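(* Let $d\geq 2$ be an integer. For Schwartz functions $f,g$ on $\mathbb R$ define $$H_\Gamma(f,g)(x)=\mathrm{p.v.}\int_{\mathbb R} f(x-t)\,g(x-t^d)\,\frac{dt}{t}.$$ Then $H_\Gamma$ extends to a bounded bilinear operator from $L^2(\mathbb R)\times L^2(\mathbb R)$ to $L^1(\mathbb R)$: there is a constant $C$ with $\|H_\Gamma(f,g)\|_{L^1}\le C\|f\|_{L^2}\|g\|_{L^2}$ for all Schwartz $f,g$.
   Context: $H_\Gamma$ is the bilinear Hilbert transform along the curve $\Gamma(t)=(t,t^d)$; p.v. denotes the principal value integral. *)

theory Defs
  imports "HOL-Analysis.Analysis"
begin

definition dR :: "(real \<Rightarrow> complex) \<Rightarrow> (real \<Rightarrow> complex)" where
  "dR h = (\<lambda>x. vector_derivative h (at x))"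

definition schwartz :: "(real \<Rightarrow> complex) \<Rightarrow> bool" where
  "schwartz f \<longleftrightarrow>
     (\<forall>k x. (dR ^^ k) f differentiable (at x)) \<and>
     (\<forall>k m. bounded (range (\<lambda>x. complex_of_real (x ^ m) * (dR ^^ k) f x)))"

definition L2norm :: "(real \<Rightarrow> complex) \<Rightarrow> real" where
  "L2norm f = sqrt (integral\<^sup>L lborel (\<lambda>x. (cmod (f x))\<^sup>2))"

definition L1norm :: "(real \<Rightarrow> complex) \<Rightarrow> real" where
  "L1norm f = integral\<^sup>L lborel (\<lambda>x. cmod (f x))"

definition H_trunc :: "nat \<Rightarrow> (real \<Rightarrow> complex) \<Rightarrow> (real \<Rightarrow> complex) \<Rightarrow> real \<Rightarrow> real \<Rightarrow> complex" where
  "H_trunc d f g x \<epsilon> =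
     (LINT t:{t. \<epsilon> \<le> \<bar>t\<bar>}|lborel. f (x - t) * g (x - t ^ d) / complex_of_real t)"

definition H_Gamma :: "nat \<Rightarrow> (real \<Rightarrow> complex) \<Rightarrow> (real \<Rightarrow> complex) \<Rightarrow> real \<Rightarrow> complex" where
  "H_Gamma d f g x = Lim (at_right 0) (H_trunc d f g x)"

end

theory Submission
  imports Defs
begin

text \<open>
  The dyadic pieces \<open>2\<^sup>-\<^sup>j \<le> |t| < 2\<^sup>1\<^sup>-\<^sup>j\<close> of the integral, after rescaling, are averages of
  \<open>F (x - L s) G (x - l s\<^sup>\<kappa>)\<close> over \<open>1 \<le> s \<le> b\<close> with \<open>|l|\<close> much smaller than \<open>|L|\<close>: for small \<open>t\<close> one takes
  \<open>F = f\<close>, \<open>G = g\<close>, \<open>\<kappa> = d\<close>, and for large \<open>t\<close> the roles are exchanged by substituting \<open>t\<^sup>d\<close> for \<open>t\<close>, which gives \<open>\<kappa> = 1/d\<close>.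
  Let \<open>E k\<close> denote averaging over dyadic intervals of length \<open>2\<^sup>-\<^sup>k\<close>, and write \<open>|L| = 2\<^sup>-\<^sup>p\<close>, \<open>|l| = 2\<^sup>-\<^sup>q\<close>. Replacing \<open>F\<close> by \<open>F - E p F\<close>
  and \<open>G\<close> by \<open>G - E q G\<close> leaves an error term \<open>Err\<close> that decays geometrically in \<open>|k - p| + |j - q|\<close> when \<open>F\<close> and \<open>G\<close> are
  martingale differences at levels \<open>k\<close> and \<open>j\<close>, so that its sum is controlled by orthogonality.
  The decay for high frequencies of \<open>G\<close> is the heart of the matter: by a double \<open>TT\<^sup>*\<close> argument it reduces to an integral of
  \<open>G\<close> along a curve whose velocity is bounded below, because \<open>s\<^sup>\<kappa>\<close> is not affine, and the mean-zero condition on \<open>G\<close>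
  makes the primitive of \<open>G\<close> small. What remains are paraproducts, which are bounded by Doob's maximal
  inequality and the Carleson embedding for the dyadic martingale.
\<close>

section \<open>Bounded Borel functions of compact support\<close>

text \<open>No Fourier transform appears: frequency is replaced by the dyadic martingale, and
  oscillation by vanishing means on short intervals. Squaring twice leaves four copies of
  \<open>G\<close> at parameters \<open>s\<close>, \<open>s1\<close>, \<open>s4\<close> and
  \<open>s3 = s1 + s4 - s\<close>; three are frozen by a change of variables, and the fourth then
  moves at a speed comparable to \<open>(s1*s4) powr (kp-1) - (s*s3) powr (kp-1)\<close> times
  \<open>a\<close>. Since \<open>s1*s4 - s*s3 = (s1 - s)*(s4 - s)\<close>, it stalls only near two
  diagonals, and these are paid for by their small measure. The expansion behind \<open>Err\<close>
  also produces a product of the two dyadic means that neither decays nor is a paraproduct; it is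
  the same for \<open>t > 0\<close> and \<open>t < 0\<close> and cancels because \<open>1/t\<close>
  is odd. The remaining differences of averages are not martingale differences, but their partial
  sums stay close to a martingale in a square-function sense. The analysis is done for
  \<open>bcs\<close> functions, so that every integral converges and integrals may be exchanged
  freely; Schwartz functions enter only at the end.\<close>

definition bcs :: "('a::euclidean_space => real) => bool" where
 "bcs f \<longleftrightarrow> f \<in> borel_measurable borel & bounded (range f) & bounded {x. f x ~= 0}"

lemma bcs_measurable: "bcs f ==> f \<in> borel_measurable borel"
 by (simp add: bcs_def)

lemma bcsI:
 fixes f :: "'a::euclidean_space => real"
 assumes "f \<in> borel_measurable borel" "\<And>x. abs (f x) <= M" "\<And>x. f x ~= 0 ==> norm x <= R"
 shows "bcs f"
 unfolding bcs_def
proof (intro conjI)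
 show "bounded (range f)" using assms(2) by (auto simp: bounded_iff intro!: exI[of _ M])
 show "bounded {x. f x ~= 0}" using assms(3) by (auto simp: bounded_iff intro!: exI[of _ R])
qed (use assms in auto)

lemma bcs_ex:
 assumes "bcs f"
 shows "\<exists>M R. 0 <= M & 0 <= R & (\<forall>x. abs (f x) <= M) & (\<forall>x. f x ~= 0 --> norm x <= R)"
proof -
 from assms obtain M where M: "\<And>x. abs (f x) <= M" by (auto simp: bcs_def bounded_iff)
 from assms obtain R where R: "\<And>x. f x ~= 0 ==> norm x <= R" by (auto simp: bcs_def bounded_iff)
 show ?thesis
  by (rule exI[of _ "max M 0"], rule exI[of _ "max R 0"]) (use M R in \<open>auto simp: le_max_iff_disj\<close>)
qed

lemma bcs_bounded: "bcs f ==> bounded (range f)"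
 by (simp add: bcs_def)

lemma bcs_integrable:
 assumes "bcs f" shows "integrable lborel f"
proof -
 obtain M R where MR: "0 <= M" "0 <= R" "\<And>x. abs (f x) <= M" "\<And>x. f x ~= 0 ==> norm x <= R"
  using bcs_ex[OF assms] by blast
 show ?thesis
 proof (rule integrableI_bounded_set[where A = "cball 0 R" and B = M])
  show "emeasure lborel (cball (0::'a) R) < \<infinity>"
   by (rule emeasure_bounded_finite) simp
 qed (use MR bcs_measurable[OF assms] in \<open>auto intro!: AE_I2\<close>)
qed

lemma bcs_mult:
 assumes "bcs f" "g \<in> borel_measurable borel" "bounded (range g)"
 shows "bcs (%x. f x*g x)"
proof -
 obtain M R where MR: "0 <= M" "0 <= R" "\<And>x. abs (f x) <= M" "\<And>x. f x ~= 0 ==> norm x <= R"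
  using bcs_ex[OF assms(1)] by blast
 obtain B where B: "\<And>x. abs (g x) <= B" using assms(3) by (auto simp: bounded_iff)
 have "abs (f x*g x) <= M*B" for x
  unfolding abs_mult by (rule mult_mono) (use MR B in auto)
 moreover have "norm x <= R" if "f x*g x ~= 0" for x using MR(4)[of x] that by simp
 ultimately show ?thesis
  by (intro bcsI[where M = "M*B" and R = R]) (use assms bcs_measurable[OF assms(1)] in auto)
qed

lemma bcs_mult': "bcs g ==> f \<in> borel_measurable borel ==> bounded (range f) ==> bcs (%x. f x*g x)"
 using bcs_mult[of g f] by (simp add: mult.commute)

lemma bcs_times: "bcs f ==> bcs g ==> bcs (%x. f x*g x)"
 by (rule bcs_mult) (auto simp: bcs_def)

lemma bcs_add:
 assumes "bcs f" "bcs g" shows "bcs (%x. f x + g x)"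
proof -
 obtain M R where MR: "0 <= M" "0 <= R" "\<And>x. abs (f x) <= M" "\<And>x. f x ~= 0 ==> norm x <= R"
  using bcs_ex[OF assms(1)] by blast
 obtain M' R' where MR': "0 <= M'" "0 <= R'" "\<And>x. abs (g x) <= M'" "\<And>x. g x ~= 0 ==> norm x <= R'"
  using bcs_ex[OF assms(2)] by blast
 have "f x + g x ~= 0 ==> norm x <= max R R'" for x
  using MR(4)[of x] MR'(4)[of x] by (cases "f x = 0") auto
 moreover have "abs (f x + g x) <= M + M'" for x
  using MR(3)[of x] MR'(3)[of x] by linarith
 ultimately show ?thesis
  using assms[THEN bcs_measurable] by (intro bcsI) auto
qed

lemma bcs_cmult: "bcs f ==> bcs (%x. c*f x)"
 by (rule bcs_mult') (auto simp: bounded_iff)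

lemma bcs_multc: "bcs f ==> bcs (%x. f x*c)"
 by (rule bcs_mult) (auto simp: bounded_iff)

lemma bcs_diff: "bcs f ==> bcs g ==> bcs (%x. f x - g x)"
 using bcs_add[of f "%x. (-1)*g x"] bcs_cmult[of g "-1"] by simp

lemma bcs_uminus: "bcs f ==> bcs (%x. - f x)"
 using bcs_cmult[of f "-1"] by simp

lemma bcs_zero [simp]: "bcs (%x. 0)"
 by (auto simp: bcs_def bounded_iff)

lemma bcs_sum: "(\<And>i. i \<in> I ==> bcs (f i)) ==> bcs (%x. \<Sum>i\<in>I. f i x)"
 by (induction I rule: infinite_finite_induct) (auto intro: bcs_add)

lemma bcs_abs:
 assumes "bcs f" shows "bcs (%x. abs (f x))"
proof -
 obtain M R where MR: "0 <= M" "0 <= R" "\<And>x. abs (f x) <= M" "\<And>x. f x ~= 0 ==> norm x <= R"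
  using bcs_ex[OF assms] by blast
 show ?thesis by (rule bcsI[where M = M and R = R]) (use MR bcs_measurable[OF assms] in auto)
qed

lemma bcs_power2: "bcs f ==> bcs (%x. (f x)\<^sup>2)"
 unfolding power2_eq_square by (rule bcs_times)

lemma bcs_max:
 assumes "bcs f" "bcs g" shows "bcs (%x. max (f x) (g x))"
proof -
 have "(%x. max (f x) (g x)) = (%x. (f x + g x + abs (f x - g x))*(1/2))"
  by (auto simp: fun_eq_iff max_def)
 then show ?thesis using assms by (simp only:) (intro bcs_multc bcs_add bcs_abs bcs_diff)
qed

lemma bcs_shift:
 fixes f :: "real => real"
 assumes "bcs f" shows "bcs (%x. f (x - c))"
proof -
 obtain M R where MR: "0 <= M" "0 <= R" "\<And>x. abs (f x) <= M" "\<And>x. f x ~= 0 ==> norm x <= R"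
  using bcs_ex[OF assms] by blast
 have [measurable]: "f \<in> borel_measurable borel" using bcs_measurable[OF assms] .
 have "norm x <= R + abs c" if "f (x - c) ~= 0" for x
  using MR(4)[OF that] by simp
 then show ?thesis
  by (intro bcsI[where M = M and R = "R + abs c"]) (use MR(3) in auto)
qed

lemma bcs_scale:
 fixes f :: "real => real"
 assumes "bcs f" "c ~= 0" shows "bcs (%x. f (c*x))"
proof -
 obtain M R where MR: "0 <= M" "0 <= R" "\<And>x. abs (f x) <= M" "\<And>x. f x ~= 0 ==> norm x <= R"
  using bcs_ex[OF assms(1)] by blast
 have [measurable]: "f \<in> borel_measurable borel" using bcs_measurable[OF assms(1)] .
 have "norm x <= R/abs c" if "f (c*x) ~= 0" for x
  using MR(4)[OF that] assms(2) by (simp add: field_simps abs_mult)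
 then show ?thesis
  by (intro bcsI[where M = M and R = "R/abs c"]) (use MR(3) in auto)
qed

lemma bcs_indicator: "bounded A ==> A \<in> sets borel ==> bcs (indicat_real A)"
 by (auto simp: bcs_def bounded_iff indicator_def intro!: exI[of _ 1])

lemma bcs_sgn:
 assumes "bcs f" shows "bcs (%x. sgn (f x))"
proof -
 obtain M R where MR: "0 <= M" "0 <= R" "\<And>x. abs (f x) <= M" "\<And>x. f x ~= 0 ==> norm x <= R"
  using bcs_ex[OF assms] by blast
 have [measurable]: "f \<in> borel_measurable borel" using bcs_measurable[OF assms] .
 have "(%x. sgn (f x)) = (%x. if f x > 0 then 1 else if f x < 0 then -1 else 0)"
  by (auto simp: sgn_if)
 then have "(%x. sgn (f x)) \<in> borel_measurable borel" by simp
 then show ?thesis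
  by (intro bcsI[where M = 1 and R = R]) (use MR in \<open>auto simp: sgn_if split: if_splits\<close>)
qed

lemma bcs_slice:
 fixes f :: "'a::euclidean_space \<times> 'b::euclidean_space => real"
 assumes "bcs f" shows "bcs (%y. f (x, y))" "bcs (%z. f (z, y))"
proof -
 obtain M R where MR: "0 <= M" "0 <= R" "\<And>x. abs (f x) <= M" "\<And>x. f x ~= 0 ==> norm x <= R"
  using bcs_ex[OF assms] by blast
 have m: "f \<in> borel_measurable (borel \<Otimes>\<^sub>M borel)"
  using bcs_measurable[OF assms] by (simp add: borel_prod)
 have "f (x, y) ~= 0 ==> norm y <= R" for y
  using MR(4)[of "(x,y)"] norm_snd_le[of y x] by linarith
 then show "bcs (%y. f (x, y))"
  by (intro bcsI[where M = M and R = R]) (use MR m in \<open>auto intro: measurable_Pair2\<close>)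
 have "f (z, y) ~= 0 ==> norm z <= R" for z
  using MR(4)[of "(z,y)"] norm_fst_le[of z y] by linarith
 then show "bcs (%z. f (z, y))"
  by (intro bcsI[where M = M and R = R]) (use MR m in \<open>auto intro: measurable_Pair1\<close>)
qed

lemma bcs_swap:
 fixes f :: "'a::euclidean_space \<times> 'b::euclidean_space => real"
 assumes "bcs f" shows "bcs (%(y, x). f (x, y))"
proof -
 obtain M R where MR: "0 <= M" "0 <= R" "\<And>x. abs (f x) <= M" "\<And>x. f x ~= 0 ==> norm x <= R"
  using bcs_ex[OF assms] by blast
 have m: "f \<in> borel_measurable (borel \<Otimes>\<^sub>M borel)"
  using bcs_measurable[OF assms] by (simp add: borel_prod)
 have "(%(y, x). f (x, y)) \<in> borel_measurable (borel \<Otimes>\<^sub>M borel)"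
  using m by measurable
 then have "(%(y, x). f (x, y)) \<in> borel_measurable borel" by (simp add: borel_prod)
 moreover have "norm (y, x) = norm (x, y)" for x :: 'a and y :: 'b
  by (simp add: norm_prod_def add.commute)
 ultimately show ?thesis
  by (intro bcsI[where M = M and R = R]) (use MR in auto)
qed

text \<open>The bounded support is used in both variables: in \<open>y\<close> it bounds the partial
  integral by that of \<open>M\<close> over a ball, in \<open>x\<close> it bounds the support of the
  result. Iterated integrals therefore never leave the class \<open>bcs\<close>.\<close>

lemma bcs_integral_snd:
 fixes f :: "'a::euclidean_space \<times> 'b::euclidean_space => real"
 assumes "bcs f" shows "bcs (%x. LBINT y. f (x, y))"
proof -
 obtain M R where MR: "0 <= M" "0 <= R" "\<And>x. abs (f x) <= M" "\<And>x. f x ~= 0 ==> norm x <= R"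
  using bcs_ex[OF assms] by blast
 have m: "f \<in> borel_measurable (borel \<Otimes>\<^sub>M lborel)"
  using bcs_measurable[OF assms] by (simp add: borel_prod[symmetric] cong: measurable_cong_sets)
 have m': "(%x. LBINT y. f (x, y)) \<in> borel_measurable borel"
  by (rule lborel.borel_measurable_lebesgue_integral) (use m in simp)
 have z: "f (x, y) = 0" if "\<not> norm x <= R" for x y
  using MR(4)[of "(x,y)"] norm_fst_le[of x y] that by linarith
 have z': "f (x, y) = 0" if "\<not> norm y <= R" for x y
  using MR(4)[of "(x,y)"] norm_snd_le[of y x] that by linarith
 have i: "integrable lborel (%y::'b. M*indicat_real (cball 0 R) y)"
  by (intro integrable_mult_right integrable_real_indicator emeasure_bounded_finite) auto
 have "abs (LBINT y. f (x, y)) <= (LBINT y. M*indicat_real (cball (0::'b) R) y)" for x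
 proof -
  have "abs (LBINT y. f (x, y)) <= (LBINT y. abs (f (x, y)))" by (rule integral_abs_bound)
  also have "... <= (LBINT y. M*indicat_real (cball (0::'b) R) y)"
   by (rule integral_mono[OF bcs_integrable[OF bcs_abs[OF bcs_slice(1)[OF assms]]] i])
    (use MR z' in \<open>auto simp: indicator_def\<close>)
  finally show ?thesis .
 qed
 moreover have "norm x <= R" if "(LBINT y. f (x, y)) ~= 0" for x
  using that z[of x] by (cases "norm x <= R") auto
 ultimately show ?thesis using m' by (intro bcsI)
qed

lemma bcs_integral_fst:
 fixes f :: "'a::euclidean_space \<times> 'b::euclidean_space => real"
 assumes "bcs f" shows "bcs (%y. LBINT x. f (x, y))"
 using bcs_integral_snd[OF bcs_swap[OF assms]] by simp

lemma bcs_Fubini: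
 fixes f :: "'a::euclidean_space \<times> 'b::euclidean_space => real"
 assumes "bcs f"
 shows "(LBINT x. LBINT y. f (x, y)) = (LBINT y. LBINT x. f (x, y))"
proof -
 have "integrable (lborel \<Otimes>\<^sub>M lborel) (%(x, y). f (x, y))"
  using bcs_integrable[OF assms] by (simp add: lborel_prod)
 from lborel_pair.Fubini_integral[OF this] show ?thesis by simp
qed

section \<open>L2 norms, duality and Minkowski's inequality\<close>

lemma integral_shift:
 fixes f :: "real => real"
 shows "(LBINT x. f (x - c)) = (LBINT x. f x)"
 using lborel_integral_real_affine[of 1 f "-c"] by simp

lemma integral_shift':
 fixes f :: "real => real"
 shows "(LBINT x. f (x + c)) = (LBINT x. f x)"
 using integral_shift[of f "-c"] by simp

definition N2 :: "('a::euclidean_space => real) => real" where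
 "N2 f = sqrt (LBINT x. (f x)\<^sup>2)"

lemma N2_nonneg [simp]: "0 <= N2 f"
 by (simp add: N2_def)

lemma N2_power2: "(N2 f)\<^sup>2 = (LBINT x. (f x)\<^sup>2)"
 by (simp add: N2_def)

lemma N2_shift: "N2 (%x::real. f (x - c)) = N2 f"
 unfolding N2_def using integral_shift[of "%x. (f x)\<^sup>2" c] by simp

lemma N2_abs: "N2 (%x. abs (f x)) = N2 f"
 by (simp add: N2_def)

lemma N2_cmult: "N2 (%x. c*f x) = abs c*N2 f"
 by (simp add: N2_def power_mult_distrib real_sqrt_mult)

lemma N2_zero [simp]: "N2 (%x. 0) = 0"
 by (simp add: N2_def)

lemma bcs_Cauchy_Schwarz:
 assumes "bcs f" "bcs g"
 shows "(LBINT x. f x*g x) <= N2 f*N2 g"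
proof -
 define a b c where "a = (LBINT x. (f x)\<^sup>2)" and "b = (LBINT x. f x*g x)"
  and "c = (LBINT x. (g x)\<^sup>2)"
 have *: "0 <= s\<^sup>2*a - 2 * s*t*b + t\<^sup>2*c" for s t :: real
 proof -
  have "0 <= (LBINT x. (s*f x - t*g x)\<^sup>2)" by (rule integral_nonneg_AE) simp
  also have "... = (LBINT x. s\<^sup>2*(f x)\<^sup>2 - 2 * s*t*(f x*g x) + t\<^sup>2*(g x)\<^sup>2)"
   by (simp add: power2_eq_square algebra_simps)
  also have "... = s\<^sup>2*a - 2 * s*t*b + t\<^sup>2*c"
   using assms[THEN bcs_power2, THEN bcs_integrable] bcs_integrable[OF bcs_times[OF assms]]
   by (simp add: a_def b_def c_def)
  finally show ?thesis .
 qed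
 have a0: "a >= 0" "c >= 0" by (auto simp: a_def c_def)
 have "b\<^sup>2 <= a*c"
 proof (cases "c = 0")
  case True
  show ?thesis
  proof (cases "b = 0")
   case False
   \<comment> \<open>For \<open>c = 0\<close> the quadratic form is affine in \<open>t\<close>; this
     value of \<open>t\<close> makes it equal to -1, so \<open>b\<close> cannot be nonzero.\<close>
   have "0 <= a - 2*((a + 1)/(2*b))*b" using *[of 1 "(a+1)/(2*b)"] True by simp
   then show ?thesis using False by simp
  qed (use a0 in simp)
 next
  case False
  then have "c > 0" using a0 by simp
  have "0 <= c\<^sup>2*a - 2*c*b*b + b\<^sup>2*c" using *[of c b] .
  then have "0 <= c*(a*c - b\<^sup>2)" by (simp add: power2_eq_square algebra_simps)
  then show ?thesis using \<open>c > 0\<close> by (simp add: zero_le_mult_iff)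
 qed
 then have "abs b <= sqrt (a*c)" by (simp add: real_le_rsqrt)
 then show ?thesis by (simp add: N2_def a_def b_def c_def real_sqrt_mult)
qed

lemma bcs_Cauchy_Schwarz_abs:
 assumes "bcs f" "bcs g"
 shows "(LBINT x. abs (f x*g x)) <= N2 f*N2 g"
 using bcs_Cauchy_Schwarz[OF bcs_abs[OF assms(1)] bcs_abs[OF assms(2)]] by (simp add: N2_abs abs_mult)

lemma bcs_CS_abs:
 assumes "bcs f" "bcs g"
 shows "abs (LBINT x. f x*g x) <= N2 f*N2 g"
 using bcs_Cauchy_Schwarz_abs[OF assms] integral_abs_bound[of lborel "%x. f x*g x"] by linarith

text \<open>Test with \<open>h = f\<close>, which is itself a \<open>bcs\<close> function. Whenever
  an operator is estimated through its adjoint, the bound comes back through this lemma.\<close>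

lemma N2_dual:
 assumes "bcs f" "\<And>h. bcs h ==> (LBINT x. f x*h x) <= C*N2 h" "0 <= C"
 shows "N2 f <= C"
proof -
 have "(N2 f)\<^sup>2 <= C*N2 f" using assms(2)[OF assms(1)] by (simp add: N2_power2 power2_eq_square[symmetric])
 then have "N2 f*(N2 f - C) <= 0" by (simp add: power2_eq_square algebra_simps)
 then show ?thesis using assms(3) N2_nonneg[of f]
  by (metis diff_gt_0_iff_gt linorder_not_le mult_pos_pos order_le_less_trans)
qed

text \<open>Test with the sign of \<open>f\<close>, which is again \<open>bcs\<close>. The bound 1
  on the test function is what the first squaring in \<open>smoothing_bound\<close> and the Carleson
  embedding in \<open>martingale_paraproduct\<close> rely on.\<close>

lemma L1_dual:
 assumes "bcs f" "\<And>h. bcs h ==> (\<And>x. abs (h x) <= 1) ==> (LBINT x. f x*h x) <= C"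
 shows "(LBINT x. abs (f x)) <= C"
proof -
 have "(LBINT x. f x * sgn (f x)) <= C"
  by (rule assms(2)[OF bcs_sgn[OF assms(1)]]) (auto simp: sgn_if)
 then show ?thesis by (simp add: mult_sgn_abs abs_sgn[symmetric] mult.commute)
qed

lemma N2_triangle:
 assumes "bcs f" "bcs g"
 shows "N2 (%x. f x + g x) <= N2 f + N2 g"
proof (rule N2_dual)
 fix h :: "'a => real" assume h: "bcs h"
 have "(LBINT x. (f x + g x)*h x) = (LBINT x. f x*h x) + (LBINT x. g x*h x)"
  using bcs_integrable[OF bcs_times[OF assms(1) h]] bcs_integrable[OF bcs_times[OF assms(2) h]]
  by (simp add: distrib_right)
 then show "(LBINT x. (f x + g x)*h x) <= (N2 f + N2 g)*N2 h"
  using bcs_Cauchy_Schwarz[OF assms(1) h] bcs_Cauchy_Schwarz[OF assms(2) h] by (simp add: distrib_right)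
qed (use assms bcs_add in auto)

lemma N2_triangle_diff:
 assumes "bcs f" "bcs g"
 shows "N2 (%x. f x - g x) <= N2 f + N2 g"
 using N2_triangle[OF assms(1) bcs_cmult[OF assms(2), of "-1"]] N2_cmult[of "-1" g] by simp

lemma N2_sum:
 assumes "\<And>i. i \<in> I ==> bcs (f i)"
 shows "N2 (%x. \<Sum>i\<in>I. f i x) <= (\<Sum>i\<in>I. N2 (f i))"
 using assms
proof (induction I rule: infinite_finite_induct)
 case (insert i I)
 have "N2 (%x. f i x + (\<Sum>i\<in>I. f i x)) <= N2 (f i) + N2 (%x. \<Sum>i\<in>I. f i x)"
  by (rule N2_triangle) (use insert in \<open>auto intro: bcs_sum\<close>)
 with insert show ?case by auto
qed auto

lemma L1_triangle:
 assumes "bcs f" "bcs g"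
 shows "(LBINT x. abs (f x + g x)) <= (LBINT x. abs (f x)) + (LBINT x. abs (g x))"
proof -
 have "(LBINT x. abs (f x + g x)) <= (LBINT x. abs (f x) + abs (g x))"
  by (rule integral_mono) (use assms in \<open>auto intro!: bcs_integrable bcs_abs bcs_add\<close>)
 then show ?thesis using assms[THEN bcs_abs, THEN bcs_integrable] by simp
qed

lemma L1_sum:
 assumes "\<And>i. i \<in> I ==> bcs (f i)"
 shows "(LBINT x. abs (\<Sum>i\<in>I. f i x)) <= (\<Sum>i\<in>I. LBINT x. abs (f i x))"
 using assms
proof (induction I rule: infinite_finite_induct)
 case (insert i I)
 have "(LBINT x. abs (f i x + (\<Sum>i\<in>I. f i x))) <= (LBINT x. abs (f i x)) + (LBINT x. abs (\<Sum>i\<in>I. f i x))"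
  by (rule L1_triangle) (use insert in \<open>auto intro: bcs_sum\<close>)
 with insert show ?case by auto
qed auto

lemma L1_integral_le:
 fixes \<Phi> :: "real \<times> real => real"
 assumes "bcs \<Phi>" "bcs \<omega>" "\<And>s. (LBINT x. abs (\<Phi> (x, s))) <= \<omega> s"
 shows "(LBINT x. abs (LBINT s. \<Phi> (x, s))) <= (LBINT s. \<omega> s)"
proof -
 have a: "bcs (%z. abs (\<Phi> z))" by (rule bcs_abs[OF assms(1)])
 have "(LBINT x. abs (LBINT s. \<Phi> (x, s))) <= (LBINT x. LBINT s. abs (\<Phi> (x, s)))"
  by (rule integral_mono)
   (auto intro!: integral_abs_bound bcs_integrable bcs_abs bcs_integral_snd[OF assms(1)] bcs_integral_snd[OF a])
 also have "... = (LBINT s. LBINT x. abs (\<Phi> (x, s)))" by (rule bcs_Fubini[OF a])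
 also have "... <= (LBINT s. \<omega> s)"
  by (rule integral_mono[OF bcs_integrable[OF bcs_integral_fst[OF a]] bcs_integrable[OF assms(2)]]) (rule assms(3))
 finally show ?thesis .
qed

text \<open>Minkowski's integral inequality, proved by duality. The majorant \<open>\<omega>\<close>
  is a separate \<open>bcs\<close> function, so measurability of the norm of the slice as a function
  of \<open>s\<close> is never an issue.\<close>

lemma N2_integral_le:
 fixes \<Phi> :: "real \<times> real => real"
 assumes "bcs \<Phi>" "bcs \<omega>" "\<And>s. N2 (%x. \<Phi> (x, s)) <= \<omega> s"
 shows "N2 (%x. LBINT s. \<Phi> (x, s)) <= (LBINT s. \<omega> s)"
proof (rule N2_dual)
 show "0 <= (LBINT s. \<omega> s)"
  by (rule integral_nonneg_AE) (use assms(3) N2_nonneg order_trans in \<open>blast intro!: AE_I2\<close>)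
 fix h :: "real => real" assume h: "bcs h"
 have m [measurable]: "h \<in> borel_measurable borel" by (rule bcs_measurable[OF h])
 have hm: "(%z::real\<times>real. h (fst z)) \<in> borel_measurable borel"
  by (rule measurable_compose[OF _ m]) (simp add: borel_measurable_continuous_onI continuous_on_fst)
 have b: "bcs (%z. \<Phi> z*h (fst z))"
  by (rule bcs_mult[OF assms(1) hm]) (use bcs_bounded[OF h] in \<open>auto simp: bounded_iff\<close>)
 have "(LBINT x. (LBINT s. \<Phi> (x, s))*h x) = (LBINT x. LBINT s. \<Phi> (x, s)*h x)"
  by simp
 also have "... = (LBINT s. LBINT x. \<Phi> (x, s)*h x)"
  using bcs_Fubini[OF b] by simp
 also have "... <= (LBINT s. \<omega> s*N2 h)"
 proof (rule integral_mono)
  show "integrable lborel (%s. LBINT x. \<Phi> (x, s)*h x)"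
   using bcs_integrable[OF bcs_integral_fst[OF b]] by simp
  show "integrable lborel (%s. \<omega> s*N2 h)" using bcs_integrable[OF assms(2)] by simp
  fix s
  have "(LBINT x. \<Phi> (x, s)*h x) <= N2 (%x. \<Phi> (x, s))*N2 h"
   by (rule bcs_Cauchy_Schwarz[OF bcs_slice(2)[OF assms(1)] h])
  then show "(LBINT x. \<Phi> (x, s)*h x) <= \<omega> s*N2 h"
   using assms(3)[of s] by (meson N2_nonneg mult_right_mono order_trans)
 qed
 finally show "(LBINT x. (LBINT s. \<Phi> (x, s))*h x) <= (LBINT s. \<omega> s)*N2 h" by simp
qed (rule bcs_integral_snd[OF assms(1)])

section \<open>Power functions and bounded Lipschitz functions\<close>

text \<open>A power is monotone in one direction or the other, so its value is at most the sum of
  the two endpoint values; applying this to \<open>x\<close> and to \<open>-x\<close> gives one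
  constant for both inequalities without a case split on the sign of \<open>x\<close> in later
  uses.\<close>

lemma powr_bounds:
 fixes x :: real
 assumes "0 < l" "l <= u"
 shows "\<exists>C>0. \<forall>s\<in>{l..u}. s powr x <= C & 1 <= C * s powr x"
proof -
 define C where "C = l powr x + u powr x + l powr (-x) + u powr (-x)"
 have p: "l powr x > 0" "u powr x > 0" "l powr (-x) > 0" "u powr (-x) > 0" using assms by auto
 have *: "s powr y <= l powr y + u powr y" if "s \<in> {l..u}" for s y
 proof (cases "y >= 0")
  case True
  then have "s powr y <= u powr y" using that assms by (intro powr_mono2) auto
  then show ?thesis by (simp add: add_increasing)
 next
  case False
  then have "s powr y <= l powr y" using that assms by (intro powr_mono2') auto
  then show ?thesis by (simp add: add_increasing2)
 qed
 have "s powr x <= C & 1 <= C * s powr x" if s: "s \<in> {l..u}" for s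
 proof
  show "s powr x <= C" using *[OF s, of x] p unfolding C_def by linarith
  have "1 = s powr (-x) * s powr x" using s assms by (simp add: powr_add[symmetric])
  also have "... <= C * s powr x"
   using *[OF s, of "-x"] p unfolding C_def by (intro mult_right_mono[OF _ powr_ge_zero]) linarith
  finally show "1 <= C * s powr x" .
 qed
 moreover have "C > 0" using p unfolding C_def by linarith
 ultimately show ?thesis by blast
qed

lemma powr_diff_bounds:
 fixes x :: real
 assumes "0 < l" "l <= u"
 shows "\<exists>C>0. \<forall>s\<in>{l..u}. \<forall>t\<in>{l..u}. abs (s powr x - t powr x) <= C*abs (s - t) &
      abs x*abs (s - t) <= C*abs (s powr x - t powr x)"
proof -
 obtain C where C: "C > 0" "\<And>s. s \<in> {l..u} ==> s powr (x-1) <= C & 1 <= C * s powr (x-1)"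
  using powr_bounds[OF assms, of "x-1"] by blast
 define D where "D = max C (abs x*C)"
 have *: "abs (s powr x - t powr x) <= D*abs (s - t) & abs x*abs (s - t) <= D*abs (s powr x - t powr x)"
  if st: "s \<in> {l..u}" "t \<in> {l..u}" "s < t" for s t
 proof -
  have "\<exists>\<xi>. s < \<xi> & \<xi> < t & t powr x - s powr x = (t - s)*(x*\<xi> powr (x - 1))"
   by (rule MVT2) (use st assms in \<open>auto intro!: derivative_eq_intros\<close>)
  then obtain \<xi> where \<xi>: "s < \<xi>" "\<xi> < t" "t powr x - s powr x = (t - s)*(x*\<xi> powr (x - 1))" by blast
  have e: "abs (s powr x - t powr x) = abs (s - t)*(abs x*\<xi> powr (x - 1))"
   using \<xi>(3) by (metis abs_minus_commute abs_mult abs_of_nonneg powr_ge_zero)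
  have c: "\<xi> powr (x-1) <= C" "1 <= C*\<xi> powr (x-1)" using C(2)[of \<xi>] \<xi> st by auto
  have "abs (s - t)*(abs x*\<xi> powr (x - 1)) <= abs (s - t)*(abs x*C)"
   by (intro mult_left_mono c) auto
  also have "... <= abs (s - t)*D" by (intro mult_left_mono) (auto simp: D_def)
  finally have 1: "abs (s powr x - t powr x) <= D*abs (s - t)" using e by (simp add: mult.commute)
  have "abs x*abs (s - t)*1 <= abs x*abs (s - t)*(C*\<xi> powr (x-1))"
   by (intro mult_left_mono c) auto
  also have "... = C*abs (s powr x - t powr x)" using e by simp
  also have "... <= D*abs (s powr x - t powr x)" by (intro mult_right_mono) (auto simp: D_def)
  finally show ?thesis using 1 by simp
 qed
 have "abs (s powr x - t powr x) <= D*abs (s - t) & abs x*abs (s - t) <= D*abs (s powr x - t powr x)"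
  if "s \<in> {l..u}" "t \<in> {l..u}" for s t
  using *[of s t] *[of t s] that by (cases s t rule: linorder_cases) (auto simp: abs_minus_commute)
 moreover have "D > 0" using C by (auto simp: D_def)
 ultimately show ?thesis by blast
qed

text \<open>Sup bound and Lipschitz bound share one constant, so that the regularity of long
  products and quotients can be followed with a single number, later a power of
  \<open>V\<close>.\<close>

definition blip :: "real => real set => (real => real) => bool" where
 "blip M Z f \<longleftrightarrow> (\<forall>s\<in>Z. abs (f s) <= M) & (\<forall>s\<in>Z. \<forall>t\<in>Z. abs (f s - f t) <= M*abs (s - t))"

lemma blipI: "(\<And>s. s \<in> Z ==> abs (f s) <= M) ==>
  (\<And>s t. s \<in> Z ==> t \<in> Z ==> abs (f s - f t) <= M*abs (s - t)) ==> blip M Z f"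
 by (simp add: blip_def)

lemma blipD: "blip M Z f ==> s \<in> Z ==> abs (f s) <= M"
 "blip M Z f ==> s \<in> Z ==> t \<in> Z ==> abs (f s - f t) <= M*abs (s - t)"
 by (auto simp: blip_def)

lemma blip_mono:
 assumes "blip M Z f" "M <= N" shows "blip N Z f"
proof (rule blipI)
 fix s t assume "s \<in> Z" "t \<in> Z"
 then show "abs (f s - f t) <= N*abs (s - t)"
  using blipD(2)[OF assms(1)] assms(2) by (meson abs_ge_zero mult_right_mono order_trans)
qed (use assms blipD in force)

lemma blip_add:
 assumes "blip M Z f" "blip N Z g" shows "blip (M + N) Z (%s. f s + g s)"
proof (rule blipI)
 fix s assume s: "s \<in> Z"
 show "abs (f s + g s) <= M + N" using blipD(1)[OF assms(1) s] blipD(1)[OF assms(2) s] by linarith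
 fix t assume t: "t \<in> Z"
 have "abs (f s + g s - (f t + g t)) <= M*abs (s - t) + N*abs (s - t)"
  using blipD(2)[OF assms(1) s t] blipD(2)[OF assms(2) s t] by linarith
 then show "abs (f s + g s - (f t + g t)) <= (M + N)*abs (s - t)" by (simp add: distrib_right)
qed

lemma blip_mult:
 assumes "blip M Z f" "blip N Z g" "0 <= M" "0 <= N" shows "blip (2*M*N) Z (%s. f s*g s)"
proof (rule blipI)
 fix s assume s: "s \<in> Z"
 have "abs (f s)*abs (g s) <= M*N"
  using blipD(1)[OF assms(1) s] blipD(1)[OF assms(2) s] assms by (intro mult_mono) auto
 also have "... <= 2*M*N" using assms by simp
 finally show "abs (f s*g s) <= 2*M*N" by (simp add: abs_mult)
 fix t assume t: "t \<in> Z"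
 have "f s*g s - f t*g t = f s*(g s - g t) + (f s - f t)*g t" by (simp add: algebra_simps)
 then have "abs (f s*g s - f t*g t) <= abs (f s)*abs (g s - g t) + abs (f s - f t)*abs (g t)"
  by (metis abs_mult abs_triangle_ineq)
 also have "... <= M*(N*abs (s - t)) + (M*abs (s - t))*N"
  using blipD(1)[OF assms(1) s] blipD(1)[OF assms(2) t] blipD(2)[OF assms(1) s t] blipD(2)[OF assms(2) s t] assms
  by (intro add_mono mult_mono) auto
 finally show "abs (f s*g s - f t*g t) <= 2*M*N*abs (s - t)" by (simp add: algebra_simps)
qed

lemma blip_inverse:
 assumes "blip M Z f" "\<And>s. s \<in> Z ==> m <= abs (f s)" "0 < m" "1/m <= N" "M/m\<^sup>2 <= N"
 shows "blip N Z (%s. 1/f s)"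
proof (rule blipI)
 fix s assume s: "s \<in> Z"
 have "abs (1/f s) <= 1/m" using assms(2)[OF s] assms(3) by (auto simp: field_simps)
 then show "abs (1/f s) <= N" using assms(4) by linarith
 fix t assume t: "t \<in> Z"
 have nz: "f s ~= 0" "f t ~= 0" using assms(2)[OF s] assms(2)[OF t] assms(3) by auto
 then have "abs (1/f s - 1/f t) = abs (f s - f t)/(abs (f s)*abs (f t))"
  by (simp add: diff_frac_eq abs_divide abs_mult abs_minus_commute)
 also have "... <= (M*abs (s - t))/(m*m)"
  using blipD(2)[OF assms(1) s t] assms(2)[OF s] assms(2)[OF t] assms(3)
  by (intro frac_le mult_mono) auto
 also have "... = M/m\<^sup>2*abs (s - t)" by (simp add: power2_eq_square)
 also have "... <= N*abs (s - t)" using assms(5) by (intro mult_right_mono) auto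
 finally show "abs (1/f s - 1/f t) <= N*abs (s - t)" .
qed

section \<open>Geometry of the curve\<close>

text \<open>The situation after rescaling the displacement of \<open>F\<close> to unit speed;
  \<open>a\<close> is the ratio \<open>l/L\<close>. One constant \<open>V\<close>, which does not
  depend on \<open>a\<close>, controls all powers. The interval \<open>{1/2..2*b}\<close> is larger
  than \<open>{1..b}\<close> so that inverse functions are differentiable at the ends of
  \<open>{1..b}\<close>. The assumption \<open>pP_low\<close> is the quantitative form of the
  curvature; it is stated on \<open>{1..b\<^sup>2}\<close> because it is applied to products of two
  parameters. The eighth power in \<open>small\<close> leaves room to absorb up to seven factors
  \<open>V\<close> and still be at most 1/4.\<close>

locale curve =
 fixes kp b a V :: real
 assumes kpos: "kp > 0" and b1: "b > 1" and a0: "a ~= 0"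
  and V4: "V >= 4" and Vb: "b <= V" and Vk: "kp <= V" and Vk': "1/kp <= V"
  and pk: "\<And>s t. s \<in> {1/2..2*b} ==> t \<in> {1/2..2*b} ==> abs (s powr kp - t powr kp) <= V*abs (s - t)"
  and pk_low: "\<And>s t. s \<in> {1/2..2*b} ==> t \<in> {1/2..2*b} ==> abs (s - t) <= V*abs (s powr kp - t powr kp)"
  and pk_ub: "\<And>s. s \<in> {1/2..2*b} ==> s powr kp <= V"
  and pP: "\<And>s t. s \<in> {1/2..2*b} ==> t \<in> {1/2..2*b} ==> abs (s powr (kp-1) - t powr (kp-1)) <= V*abs (s - t)"
  and pP_ub: "\<And>s. s \<in> {1/2..2*b} ==> s powr (kp-1) <= V"
  and pP_lb: "\<And>s. s \<in> {1/2..2*b} ==> 1 <= V * s powr (kp-1)"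
  and pP_low: "\<And>X Y. X \<in> {1..b\<^sup>2} ==> Y \<in> {1..b\<^sup>2} ==> abs (X - Y) <= V*abs (X powr (kp-1) - Y powr (kp-1))"
  and small: "abs a*V^8 <= 1"
begin

lemma V_pos: "V > 0" "V >= 1" using V4 by auto

lemma small_pow:
 assumes "n <= 7" shows "abs a*V^n <= 1/4"
proof -
 have "4*(abs a*V^n) <= V*(abs a*V^n)" using V4 by (intro mult_right_mono) auto
 also have "... = abs a*V^Suc n" by simp
 also have "... <= abs a*V^8" using V4 assms by (intro mult_left_mono power_increasing) auto
 finally show ?thesis using small by linarith
qed

lemma aV: "abs a*V <= 1/4" using small_pow[of 1] by simp

lemma a_le: "abs a <= 1/4" using small_pow[of 0] by simp

text \<open>In terms of \<open>u = x - s\<close> the second argument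
  \<open>x - a * s powr kp\<close> is \<open>u + \<theta> s\<close>. For small \<open>a\<close> this
  is a perturbation of the identity, which is why changes of variable through
  \<open>\<theta>\<close> are harmless.\<close>

definition \<theta> :: "real => real" where "\<theta> s = s - a * s powr kp"
definition \<theta>' :: "real => real" where "\<theta>' s = 1 - a*(kp * s powr (kp - 1))"

lemma \<theta>_deriv: "s > 0 ==> (\<theta> has_real_derivative \<theta>' s) (at s)"
 unfolding \<theta>_def[abs_def] \<theta>'_def by (auto intro!: derivative_eq_intros)

lemma \<theta>_near:
 assumes "s \<in> {1/2..2*b}" "t \<in> {1/2..2*b}"
 shows "abs ((\<theta> s - \<theta> t) - (s - t)) <= abs a*V*abs (s - t)" "abs ((\<theta> s - \<theta> t) - (s - t)) <= abs (s - t)/4"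
proof -
 have "abs ((\<theta> s - \<theta> t) - (s - t)) = abs a*abs (s powr kp - t powr kp)"
  unfolding \<theta>_def by (metis (no_types, opaque_lifting) abs_minus_commute abs_mult diff_diff_eq2 diff_diff_add
    add_diff_cancel_left' add.commute right_diff_distrib' diff_add_eq_diff_diff_swap add_diff_eq)
 also have "... <= abs a*(V*abs (s - t))" by (intro mult_left_mono pk assms) auto
 finally show 1: "abs ((\<theta> s - \<theta> t) - (s - t)) <= abs a*V*abs (s - t)" by (simp add: mult.assoc)
 have "abs a*V*abs (s - t) <= 1/4*abs (s - t)" by (intro mult_right_mono aV) auto
 with 1 show "abs ((\<theta> s - \<theta> t) - (s - t)) <= abs (s - t)/4" by simp
qed

lemma \<theta>_lip:
 assumes "s \<in> {1/2..2*b}" "t \<in> {1/2..2*b}"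
 shows "abs (\<theta> s - \<theta> t) <= 5/4*abs (s - t)" "3/4*abs (s - t) <= abs (\<theta> s - \<theta> t)"
 using \<theta>_near(2)[OF assms] by (auto simp: abs_if split: if_splits)

lemma \<theta>_strict:
 assumes "s \<in> {1/2..2*b}" "t \<in> {1/2..2*b}"
 shows "s < t \<longleftrightarrow> \<theta> s < \<theta> t" "s <= t \<longleftrightarrow> \<theta> s <= \<theta> t"
 using \<theta>_near(2)[OF assms] by (auto simp: abs_if split: if_splits)

lemma \<theta>'_bounds:
 assumes "s \<in> {1/2..2*b}" shows "1/2 <= \<theta>' s" "\<theta>' s <= 3/2"
proof -
 have "abs (a*(kp * s powr (kp - 1))) = abs a*(kp * s powr (kp - 1))" using kpos by (simp add: abs_mult)
 also have "... <= abs a*(V*V)" using kpos V_pos by (intro mult_left_mono mult_mono Vk pP_ub assms) auto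
 also have "... <= 1/4" using small_pow[of 2] by (simp add: power2_eq_square)
 finally show "1/2 <= \<theta>' s" "\<theta>' s <= 3/2" unfolding \<theta>'_def by linarith+
qed

lemma \<theta>'_diff:
 assumes "s \<in> {1/2..2*b}" "t \<in> {1/2..2*b}" shows "abs (\<theta>' s - \<theta>' t) <= abs a*V\<^sup>2*abs (s - t)"
proof -
 have "abs (\<theta>' s - \<theta>' t) = abs a*(kp*abs (s powr (kp - 1) - t powr (kp - 1)))"
 proof -
  have "\<theta>' s - \<theta>' t = - (a*(kp*(s powr (kp - 1) - t powr (kp - 1))))"
   by (simp add: \<theta>'_def algebra_simps)
  then show ?thesis using kpos by (simp add: abs_mult)
 qed
 also have "... <= abs a*(V*(V*abs (s - t)))"
  using kpos V_pos by (intro mult_left_mono mult_mono Vk pP assms) auto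
 finally show ?thesis by (simp add: power2_eq_square)
qed

text \<open>Written as a supremum, the inverse is defined on the whole line and monotone by
  construction, hence Borel measurable; the inserted point 1/2 keeps the set nonempty outside the
  range of \<open>\<theta>\<close>.\<close>

definition \<theta>inv :: "real => real" where
 "\<theta>inv rh = Sup (insert (1/2) {s \<in> {1/2..2*b}. \<theta> s <= rh})"

lemma \<theta>inv_mono: "mono \<theta>inv"
proof (rule monoI)
 fix rh rh' :: real assume "rh <= rh'"
 then show "\<theta>inv rh <= \<theta>inv rh'" unfolding \<theta>inv_def
  by (intro cSup_subset_mono) (auto intro!: bdd_aboveI[of _ "2*b"] simp: b1[THEN less_imp_le] intro: order_trans[OF _ b1[THEN less_imp_le]])
qed

lemma \<theta>inv_measurable [measurable]: "\<theta>inv \<in> borel_measurable borel"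
 by (rule borel_measurable_mono[OF \<theta>inv_mono])

lemma \<theta>inv_\<theta>: assumes "s \<in> {1/2..2*b}" shows "\<theta>inv (\<theta> s) = s"
 unfolding \<theta>inv_def
proof (rule cSup_eq_maximum)
 show "s \<in> insert (1/2) {t \<in> {1/2..2*b}. \<theta> t <= \<theta> s}" using assms by simp
 show "t <= s" if "t \<in> insert (1/2) {t \<in> {1/2..2*b}. \<theta> t <= \<theta> s}" for t
  using that assms \<theta>_strict(2)[of t s] by auto
qed

lemma \<theta>_cont: "continuous_on {1/2..2*b} \<theta>"
 by (auto intro!: continuous_at_imp_continuous_on DERIV_isCont[OF \<theta>_deriv])

lemma \<theta>_\<theta>inv:
 assumes "rh \<in> {\<theta> l..\<theta> u}" "l <= u" "{l..u} \<subseteq> {1/2..2*b}"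
 shows "\<theta>inv rh \<in> {l..u}" "\<theta> (\<theta>inv rh) = rh"
proof -
 have "\<exists>s. l <= s & s <= u & \<theta> s = rh"
  by (rule IVT') (use assms in \<open>auto intro: continuous_on_subset[OF \<theta>_cont]\<close>)
 then obtain s where s: "l <= s" "s <= u" "\<theta> s = rh" by blast
 moreover have "\<theta>inv rh = s" using \<theta>inv_\<theta>[of s] s assms(3) by auto
 ultimately show "\<theta>inv rh \<in> {l..u}" "\<theta> (\<theta>inv rh) = rh" by auto
qed

lemma \<theta>inv_deriv:
 assumes "s \<in> {1/2<..<2*b}"
 shows "(\<theta>inv has_real_derivative 1/\<theta>' s) (at (\<theta> s))"
proof -
 have c: "isCont \<theta>inv (\<theta> s)"
  by (rule isCont_inverse_function2[where a = "1/2" and b = "2*b"])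
   (use assms in \<open>auto intro!: \<theta>inv_\<theta> DERIV_isCont[OF \<theta>_deriv]\<close>)
 have "DERIV \<theta>inv (\<theta> s) :> inverse (\<theta>' s)"
 proof (rule DERIV_inverse_function[where a = "\<theta> (1/2)" and b = "\<theta> (2*b)"])
  show "DERIV \<theta> (\<theta>inv (\<theta> s)) :> \<theta>' s" using assms \<theta>_deriv[of s] by (subst \<theta>inv_\<theta>) auto
  show "\<theta>' s ~= 0" using \<theta>'_bounds[of s] assms by auto
  show "\<theta> (1/2) < \<theta> s" "\<theta> s < \<theta> (2*b)"
   using \<theta>_strict(1)[of "1/2" s] \<theta>_strict(1)[of s "2*b"] assms by auto
  show "\<And>y. \<theta> (1/2) < y ==> y < \<theta> (2*b) ==> \<theta> (\<theta>inv y) = y"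
   using b1 by (intro \<theta>_\<theta>inv(2)[of _ "1/2" "2*b"]) auto
 qed (rule c)
 then show ?thesis by (simp add: inverse_eq_divide)
qed

section \<open>The four parameters and the speed of the fourth argument\<close>

text \<open>Given points \<open>x\<close>, \<open>x'\<close> and parameters \<open>s\<close>,
  \<open>t\<close>, put \<open>v = x - a * s powr kp\<close>,
  \<open>alf = t powr kp - s powr kp\<close> and
  \<open>bt = \<theta> (s + (x' - x)) - \<theta> s\<close>. With \<open>v\<close>,
  \<open>alf\<close>, \<open>bt\<close> held fixed, the functions below recover \<open>t\<close> as
  \<open>s1\<close>, \<open>s + (x' - x)\<close> as \<open>s4\<close> and
  \<open>t + (x' - x)\<close> as \<open>s3\<close>. The set \<open>Dom\<close> asks that
  \<open>s\<close>, \<open>s1\<close> and \<open>s4\<close> lie in \<open>{1..b}\<close>; the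
  condition on \<open>s3\<close> is added in \<open>Dom3\<close>.\<close>

definition Dom :: "real => real => real set" where
 "Dom alf bt = {s \<in> {1..b}. s powr kp + alf \<in> {1..b powr kp} & \<theta> s + bt \<in> {\<theta> 1..\<theta> b}}"
definition s1 :: "real => real => real" where "s1 alf s = (s powr kp + alf) powr (1/kp)"
definition s4 :: "real => real => real" where "s4 bt s = \<theta>inv (\<theta> s + bt)"
definition s3 :: "real => real => real => real" where "s3 alf bt s = s1 alf s + s4 bt s - s"

lemma Dom_s: "s \<in> Dom alf bt ==> s \<in> {1..b}" "s \<in> Dom alf bt ==> s \<in> {1/2..2*b}" "s \<in> Dom alf bt ==> s > 0"
 by (auto simp: Dom_def)

lemma Dom_s1: assumes "s \<in> Dom alf bt"
 shows "s1 alf s \<in> {1..b}" "s1 alf s powr kp = s powr kp + alf"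
proof -
 have 1: "1 <= s powr kp + alf" "s powr kp + alf <= b powr kp" using assms by (auto simp: Dom_def)
 have "(s powr kp + alf) powr (1/kp) <= (b powr kp) powr (1/kp)" using 1 kpos by (intro powr_mono2) auto
 also have "... = b" using kpos b1 by (simp add: powr_powr)
 finally show "s1 alf s \<in> {1..b}" using 1 kpos by (auto simp: s1_def intro!: ge_one_powr_ge_zero)
 show "s1 alf s powr kp = s powr kp + alf" using 1 kpos by (simp add: s1_def powr_powr)
qed

lemma Dom_s4: assumes "s \<in> Dom alf bt"
 shows "s4 bt s \<in> {1..b}" "\<theta> (s4 bt s) = \<theta> s + bt"
proof -
 have "\<theta> s + bt \<in> {\<theta> 1..\<theta> b}" using assms by (simp add: Dom_def)
 from \<theta>_\<theta>inv[OF this] b1 show "s4 bt s \<in> {1..b}" "\<theta> (s4 bt s) = \<theta> s + bt" by (auto simp: s4_def)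
qed

lemma in_big: "s \<in> {1..b} ==> s \<in> {1/2..2*b}" using b1 by auto

lemma s1_lip: assumes "s \<in> Dom alf bt" "t \<in> Dom alf bt"
 shows "abs (s1 alf s - s1 alf t) <= V\<^sup>2*abs (s - t)" "abs (s - t) <= V\<^sup>2*abs (s1 alf s - s1 alf t)"
proof -
 note i = Dom_s1(1)[OF assms(1), THEN in_big] Dom_s1(1)[OF assms(2), THEN in_big]
 have e: "s1 alf s powr kp - s1 alf t powr kp = s powr kp - t powr kp"
  using Dom_s1(2)[OF assms(1)] Dom_s1(2)[OF assms(2)] by simp
 have "abs (s1 alf s - s1 alf t) <= V*abs (s powr kp - t powr kp)" using pk_low[OF i] e by simp
 also have "... <= V*(V*abs (s - t))"
  by (intro mult_left_mono pk Dom_s(2)[OF assms(1)] Dom_s(2)[OF assms(2)]) (use V_pos in auto)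
 finally show "abs (s1 alf s - s1 alf t) <= V\<^sup>2*abs (s - t)" by (simp add: power2_eq_square)
 have "abs (s - t) <= V*abs (s powr kp - t powr kp)"
  by (intro pk_low Dom_s(2)[OF assms(1)] Dom_s(2)[OF assms(2)])
 also have "... <= V*(V*abs (s1 alf s - s1 alf t))"
  using pk[OF i] e by (intro mult_left_mono) (use V_pos in auto)
 finally show "abs (s - t) <= V\<^sup>2*abs (s1 alf s - s1 alf t)" by (simp add: power2_eq_square)
qed

lemma s1_mono: assumes "s \<in> Dom alf bt" "t \<in> Dom alf bt" "s <= t" shows "s1 alf s <= s1 alf t"
proof -
 have "s powr kp <= t powr kp" using assms kpos Dom_s(3)[OF assms(1)] by (intro powr_mono2) auto
 moreover have "1 <= s powr kp + alf" using assms(1) by (auto simp: Dom_def)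
 ultimately show ?thesis unfolding s1_def using kpos by (intro powr_mono2) auto
qed

lemma s4_lip: assumes "s \<in> Dom alf bt" "t \<in> Dom alf bt"
 shows "abs (s4 bt s - s4 bt t) <= 2*abs (s - t)"
  "abs ((s4 bt s - s4 bt t) - (s - t)) <= 3*abs a*V*abs (s - t)"
proof -
 note i = Dom_s4(1)[OF assms(1), THEN in_big] Dom_s4(1)[OF assms(2), THEN in_big]
 note j = Dom_s(2)[OF assms(1)] Dom_s(2)[OF assms(2)]
 have e: "\<theta> (s4 bt s) - \<theta> (s4 bt t) = \<theta> s - \<theta> t"
  using Dom_s4(2)[OF assms(1)] Dom_s4(2)[OF assms(2)] by simp
 show 1: "abs (s4 bt s - s4 bt t) <= 2*abs (s - t)"
 proof -
  have "3/4*abs (s4 bt s - s4 bt t) <= 5/4*abs (s - t)"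
   using \<theta>_lip(2)[OF i] \<theta>_lip(1)[OF j] unfolding e by (rule order_trans)
  then have "abs (s4 bt s - s4 bt t) <= 5/3*abs (s - t)" by simp
  also have "... <= 2*abs (s - t)" by (intro mult_right_mono) auto
  finally show ?thesis .
 qed
 have "abs ((s4 bt s - s4 bt t) - (s - t)) <= abs a*V*abs (s4 bt s - s4 bt t) + abs a*V*abs (s - t)"
  using \<theta>_near(1)[OF i] \<theta>_near(1)[OF j] e by linarith
 also have "... <= abs a*V*(2*abs (s - t)) + abs a*V*abs (s - t)"
  by (intro add_mono mult_left_mono 1) (use V_pos in auto)
 finally show "abs ((s4 bt s - s4 bt t) - (s - t)) <= 3*abs a*V*abs (s - t)" by (simp add: algebra_simps)
qed

lemma s4_mono: assumes "s \<in> Dom alf bt" "t \<in> Dom alf bt" "s <= t" shows "s4 bt s <= s4 bt t"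
 unfolding s4_def using \<theta>_strict(2)[OF Dom_s(2)[OF assms(1)] Dom_s(2)[OF assms(2)]] assms(3)
 by (intro monoD[OF \<theta>inv_mono]) auto

lemma s3_lip: assumes "s \<in> Dom alf bt" "t \<in> Dom alf bt"
 shows "abs (s3 alf bt s - s3 alf bt t) <= V^3*abs (s - t)"
proof -
 have "abs (s3 alf bt s - s3 alf bt t) <= V\<^sup>2*abs (s - t) + 3*abs (s - t)"
 proof -
  have "s3 alf bt s - s3 alf bt t = (s1 alf s - s1 alf t) + (s4 bt s - s4 bt t) - (s - t)"
   by (simp add: s3_def)
  then have "abs (s3 alf bt s - s3 alf bt t) <= abs (s1 alf s - s1 alf t) + abs (s4 bt s - s4 bt t) + abs (s - t)"
   by linarith
  then show ?thesis using s1_lip(1)[OF assms] s4_lip(1)[OF assms] by (simp add: algebra_simps)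
 qed
 also have "... = (V\<^sup>2 + 3)*abs (s - t)" by (simp add: distrib_right)
 also have "... <= V^3*abs (s - t)"
 proof (rule mult_right_mono)
  have "V\<^sup>2*4 <= V\<^sup>2*V" using V4 by (intro mult_left_mono) auto
  moreover have "1 <= V\<^sup>2" using V4 by (simp add: one_le_power)
  ultimately show "V\<^sup>2 + 3 <= V^3" by (simp add: power3_eq_cube power2_eq_square)
 qed auto
 finally show ?thesis .
qed

text \<open>By \<open>s4_lip\<close> the difference \<open>s4 bt s - s\<close> varies at a rate of
  at most \<open>3*abs a*V\<close>, while \<open>s1\<close> grows at a rate of at least
  \<open>1/V\<^sup>2\<close>; smallness of \<open>a\<close> lets the latter win.\<close>

lemma s3_mono: assumes "s \<in> Dom alf bt" "t \<in> Dom alf bt" "s <= t" shows "s3 alf bt s <= s3 alf bt t"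
proof -
 have "V\<^sup>2*(3*abs a*V*abs (s - t)) = 3*(abs a*V^3)*abs (s - t)"
  by (simp add: power3_eq_cube power2_eq_square algebra_simps)
 also have "... <= 3*(1/4)*abs (s - t)" by (intro mult_right_mono mult_left_mono small_pow) auto
 also have "... <= abs (s - t)" by simp
 also have "... <= V\<^sup>2*abs (s1 alf s - s1 alf t)" by (rule s1_lip(2)[OF assms(1,2)])
 finally have "3*abs a*V*abs (s - t) <= abs (s1 alf s - s1 alf t)"
  using V_pos by (metis mult_le_cancel_left_pos zero_less_power)
 then show ?thesis using s4_lip(2)[OF assms(1,2)] s1_mono[OF assms] unfolding s3_def by linarith
qed

lemma Dom_convex: assumes "s \<in> Dom alf bt" "t \<in> Dom alf bt" "s <= r" "r <= t" shows "r \<in> Dom alf bt"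
proof -
 have st: "1 <= s" "t <= b" using assms by (auto simp: Dom_def)
 have "s powr kp <= r powr kp" "r powr kp <= t powr kp" using assms st kpos by (auto intro!: powr_mono2)
 moreover have "\<theta> s <= \<theta> r" "\<theta> r <= \<theta> t"
  using \<theta>_strict(2)[of s r] \<theta>_strict(2)[of r t] st assms by auto
 ultimately show ?thesis using assms unfolding Dom_def by auto
qed

lemma Dom_closed: "closed (Dom alf bt)"
proof -
 have c: "continuous_on {1..b} (%s. s powr kp + alf)"
  by (intro continuous_intros) auto
 have c': "continuous_on {1..b} (%s. \<theta> s + bt)"
  by (intro continuous_intros continuous_on_subset[OF \<theta>_cont]) (use b1 in auto)
 have "Dom alf bt = ({1..b} \<inter> (%s. s powr kp + alf) -` {1..b powr kp}) \<inter> ({1..b} \<inter> (%s. \<theta> s + bt) -` {\<theta> 1..\<theta> b})"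
  by (auto simp: Dom_def)
 then show ?thesis
  using continuous_closed_preimage[OF c, of "{1..b powr kp}"] continuous_closed_preimage[OF c', of "{\<theta> 1..\<theta> b}"]
  by auto
qed

definition s1' where "s1' alf s = s powr (kp-1)*(1/s1 alf s powr (kp-1))"
definition s4' where "s4' bt s = \<theta>' s*(1/\<theta>' (s4 bt s))"
definition Wd where
 "Wd alf bt s = kp*(s4 bt s powr (kp-1) * s4' bt s - s3 alf bt s powr (kp-1)*(s1' alf s + s4' bt s - 1))"
text \<open>The argument \<open>x' - a * s3 powr kp\<close> of the fourth copy of \<open>G\<close>,
  seen as a function of \<open>s\<close> while the other three arguments \<open>v\<close>,
  \<open>v - a*alf\<close>, \<open>v + bt\<close> stay put. Its derivative is
  \<open>a*Wd\<close>.\<close>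

definition W where "W v alf bt s = v + bt + a*(s4 bt s powr kp - s3 alf bt s powr kp)"

lemma s1_deriv: assumes "s \<in> Dom alf bt" shows "(s1 alf has_real_derivative s1' alf s) (at s)"
proof -
 have p: "s > 0" "s powr kp + alf > 0" using assms by (auto simp: Dom_def)
 have "((%s. (s powr kp + alf) powr (1/kp)) has_real_derivative
   (1/kp)*(s powr kp + alf) powr (1/kp - 1)*(kp * s powr (kp - 1))) (at s)"
  using p by (intro derivative_eq_intros | simp)+
 moreover have "(s powr kp + alf) powr (1/kp - 1) = 1/s1 alf s powr (kp - 1)"
 proof -
  have "1/kp - 1 = - (1/kp*(kp - 1))" using kpos by (simp add: field_simps)
  then show ?thesis unfolding s1_def powr_powr by (simp only: powr_minus_divide)
 qed
 ultimately show ?thesis using kpos unfolding s1_def[abs_def] s1'_def by (simp add: s1_def mult.commute)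
qed

lemma s4_deriv: assumes "s \<in> Dom alf bt" shows "(s4 bt has_real_derivative s4' bt s) (at s)"
proof -
 have i: "s4 bt s \<in> {1/2<..<2*b}" using Dom_s4(1)[OF assms] b1 by auto
 have "(\<theta>inv has_real_derivative 1/\<theta>' (s4 bt s)) (at (\<theta> s + bt))"
  using \<theta>inv_deriv[OF i] Dom_s4(2)[OF assms] by simp
 moreover have "((%s. \<theta> s + bt) has_real_derivative \<theta>' s) (at s)"
  using \<theta>_deriv[OF Dom_s(3)[OF assms]] by (auto intro!: derivative_eq_intros)
 ultimately have "((%s. \<theta>inv (\<theta> s + bt)) has_real_derivative 1/\<theta>' (s4 bt s)*\<theta>' s) (at s)"
  by (rule DERIV_chain2)
 then show ?thesis unfolding s4_def[abs_def] s4'_def by (simp add: mult.commute)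
qed

lemma W_deriv: assumes "s \<in> Dom alf bt" "s3 alf bt s \<in> {1..b}"
 shows "(W v alf bt has_real_derivative a*Wd alf bt s) (at s)"
proof -
 have p: "s4 bt s > 0" "s3 alf bt s > 0" using Dom_s4(1)[OF assms(1)] assms(2) by auto
 have "(s3 alf bt has_real_derivative (s1' alf s + s4' bt s - 1)) (at s)"
  unfolding s3_def[abs_def] using s1_deriv[OF assms(1)] s4_deriv[OF assms(1)] by (auto intro!: derivative_eq_intros)
 with s4_deriv[OF assms(1)] p show ?thesis
  unfolding W_def[abs_def] Wd_def
  by (auto intro!: derivative_eq_intros simp: algebra_simps)
qed

lemma blip_V_mult: "blip (V^m) Z f ==> blip (V^n) Z g ==> blip (V^(m+n+1)) Z (%s. f s*g s)"
proof -
 assume "blip (V^m) Z f" "blip (V^n) Z g"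
 then have "blip (2*V^m*V^n) Z (%s. f s*g s)" using V_pos by (intro blip_mult) auto
 moreover have "2*V^m*V^n <= V^(m+n+1)"
  using V4 mult_right_mono[of 2 V "V^m*V^n"] by (simp add: power_add)
 ultimately show ?thesis by (rule blip_mono)
qed

lemma blip_V_up: "blip (V^m) Z f ==> m <= n ==> blip (V^n) Z f"
 by (erule blip_mono) (use V_pos in \<open>auto intro: power_increasing\<close>)

lemma blip_V_add: "blip (V^m) Z f ==> blip (V^m) Z g ==> blip (V^(m+1)) Z (%s. f s + g s)"
proof -
 assume "blip (V^m) Z f" "blip (V^m) Z g"
 then have "blip (V^m + V^m) Z (%s. f s + g s)" by (rule blip_add)
 moreover have "V^m + V^m <= V^(m+1)" using V4 mult_right_mono[of 2 V "V^m"] by simp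
 ultimately show ?thesis by (rule blip_mono)
qed

lemma blip_uminus: "blip M Z f ==> blip M Z (%s. - f s)"
 by (auto simp: blip_def abs_minus_commute)

lemma blip_V_powr:
 assumes "blip (V^m) Z f" "\<And>s. s \<in> Z ==> f s \<in> {1..b}"
 shows "blip (V^(m+1)) Z (%s. f s powr (kp-1))"
proof (rule blipI)
 fix s assume s: "s \<in> Z"
 have "f s powr (kp-1) <= V" by (rule pP_ub[OF in_big[OF assms(2)[OF s]]])
 also have "V <= V^(m+1)" using V_pos by (intro self_le_power) auto
 finally show "abs (f s powr (kp-1)) <= V^(m+1)" by simp
 fix t assume t: "t \<in> Z"
 have "abs (f s powr (kp-1) - f t powr (kp-1)) <= V*abs (f s - f t)"
  by (rule pP[OF in_big[OF assms(2)[OF s]] in_big[OF assms(2)[OF t]]])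
 also have "... <= V*(V^m*abs (s - t))" by (intro mult_left_mono blipD(2)[OF assms(1) s t]) (use V_pos in auto)
 finally show "abs (f s powr (kp-1) - f t powr (kp-1)) <= V^(m+1)*abs (s - t)" by simp
qed

definition Dom3 where "Dom3 alf bt = {s \<in> Dom alf bt. s3 alf bt s \<in> {1..b}}"

lemma Dom3_Dom: "s \<in> Dom3 alf bt ==> s \<in> Dom alf bt" "s \<in> Dom3 alf bt ==> s3 alf bt s \<in> {1..b}" by (auto simp: Dom3_def)

lemma V_le_pow: "m >= 1 ==> V <= V^m" "1 <= V^m" using V_pos by (auto intro: self_le_power one_le_power)

lemma blip_path:
 fixes alf bt defines "Z \<equiv> Dom3 alf bt"
 shows "blip (V^1) Z (%s. s)" "blip (V^2) Z (s1 alf)" "blip (V^1) Z (s4 bt)" "blip (V^3) Z (s3 alf bt)"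
proof -
 have V: "V <= V^2" "V <= V^3" using V_le_pow(1)[of 2] V_le_pow(1)[of 3] by auto
 show "blip (V^1) Z (%s. s)"
 proof (rule blipI)
  fix s t assume "s \<in> Z"
  then show "abs s <= V^1" using Dom_s(1)[OF Dom3_Dom(1)] Vb by (force simp: Z_def)
  show "abs (s - t) <= V^1*abs (s - t)" using V_pos mult_right_mono[of 1 V "abs (s - t)"] by simp
 qed
 show "blip (V^2) Z (s1 alf)"
 proof (rule blipI)
  fix s assume s: "s \<in> Z"
  show "abs (s1 alf s) <= V^2" using Dom_s1(1)[OF Dom3_Dom(1)[OF s[unfolded Z_def]]] Vb V by auto
  fix t assume t: "t \<in> Z"
  show "abs (s1 alf s - s1 alf t) <= V^2*abs (s - t)"
   by (rule s1_lip(1)[OF Dom3_Dom(1)[OF s[unfolded Z_def]] Dom3_Dom(1)[OF t[unfolded Z_def]]])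
 qed
 show "blip (V^1) Z (s4 bt)"
 proof (rule blipI)
  fix s assume s: "s \<in> Z"
  then show "abs (s4 bt s) <= V^1" using Dom_s4(1)[OF Dom3_Dom(1)] Vb by (force simp: Z_def)
  fix t assume t: "t \<in> Z"
  have "abs (s4 bt s - s4 bt t) <= 2*abs (s - t)" by (rule s4_lip(1)[OF Dom3_Dom(1)[OF s[unfolded Z_def]] Dom3_Dom(1)[OF t[unfolded Z_def]]])
  also have "... <= V^1*abs (s - t)" using V4 by (intro mult_right_mono) auto
  finally show "abs (s4 bt s - s4 bt t) <= V^1*abs (s - t)" .
 qed
 show "blip (V^3) Z (s3 alf bt)"
 proof (rule blipI)
  fix s assume s: "s \<in> Z"
  show "abs (s3 alf bt s) <= V^3" using Dom3_Dom(2)[OF s[unfolded Z_def]] Vb V by auto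
  fix t assume t: "t \<in> Z"
  show "abs (s3 alf bt s - s3 alf bt t) <= V^3*abs (s - t)"
   by (rule s3_lip[OF Dom3_Dom(1)[OF s[unfolded Z_def]] Dom3_Dom(1)[OF t[unfolded Z_def]]])
 qed
qed

text \<open>The derivative \<open>\<theta>'\<close> differs from 1 by a multiple of
  \<open>a\<close>, so the smallness of \<open>a\<close> absorbs the Lipschitz constant of
  \<open>f\<close> and the result is back at the first power of \<open>V\<close>.\<close>

lemma blip_\<theta>':
 assumes "blip (V^m) Z f" "\<And>s. s \<in> Z ==> f s \<in> {1..b}" "m <= 5"
 shows "blip (V^1) Z (%s. \<theta>' (f s))"
proof (rule blipI)
 fix s assume s: "s \<in> Z"
 show "abs (\<theta>' (f s)) <= V^1" using \<theta>'_bounds[OF in_big[OF assms(2)[OF s]]] V4 by simp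
 fix t assume t: "t \<in> Z"
 have "abs (\<theta>' (f s) - \<theta>' (f t)) <= abs a*V\<^sup>2*abs (f s - f t)"
  by (rule \<theta>'_diff[OF in_big[OF assms(2)[OF s]] in_big[OF assms(2)[OF t]]])
 also have "... <= abs a*V\<^sup>2*(V^m*abs (s - t))" by (intro mult_left_mono blipD(2)[OF assms(1) s t]) auto
 also have "... = abs a*V^(2+m)*abs (s - t)" by (simp only: power_add mult.assoc)
 also have "... <= V^1*abs (s - t)"
 proof (rule mult_right_mono)
  show "abs a*V^(2+m) <= V^1" using small_pow[of "2+m"] assms(3) V4 unfolding power_one_right by linarith
 qed simp
 finally show "abs (\<theta>' (f s) - \<theta>' (f t)) <= V^1*abs (s - t)" .
qed

lemma blip_inv_\<theta>': "blip (V^2) (Dom3 alf bt) (%s. 1/\<theta>' (s4 bt s))"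
proof (rule blip_inverse[where m = "1/2" and M = V])
 show "blip V (Dom3 alf bt) (%s. \<theta>' (s4 bt s))"
  using blip_\<theta>'[OF blip_path(3)] Dom_s4(1)[OF Dom3_Dom(1)] by simp
 show "1/2 <= abs (\<theta>' (s4 bt s))" if "s \<in> Dom3 alf bt" for s
  using \<theta>'_bounds(1)[OF in_big[OF Dom_s4(1)[OF Dom3_Dom(1)[OF that]]]] by linarith
 show "1/(1/2) <= V^2" using order_trans[OF _ V_le_pow(1)[of 2], of 2] V4 by simp
 show "V/(1/2)\<^sup>2 <= V^2" using V4 by (simp add: power2_eq_square)
qed simp

lemma blip_s1': "blip (V^8) (Dom3 alf bt) (s1' alf)"
proof -
 have a: "blip (V^2) (Dom3 alf bt) (%s. s powr (kp-1))"
  using blip_V_powr[OF blip_path(1)] Dom_s(1)[OF Dom3_Dom(1)] by (simp add: numeral_eq_Suc)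
 have c: "blip (V^3) (Dom3 alf bt) (%s. s1 alf s powr (kp-1))"
  using blip_V_powr[OF blip_path(2)] Dom_s1(1)[OF Dom3_Dom(1)] by (simp add: numeral_eq_Suc)
 have "blip (V^5) (Dom3 alf bt) (%s. 1/s1 alf s powr (kp-1))"
 proof (rule blip_inverse[OF c, where m = "1/V"])
  show "1/V <= abs (s1 alf s powr (kp-1))" if "s \<in> Dom3 alf bt" for s
   using pP_lb[OF in_big[OF Dom_s1(1)[OF Dom3_Dom(1)[OF that]]]] V_pos by (simp add: field_simps)
  show "1/(1/V) <= V^5" using V_le_pow(1)[of 5] by simp
  show "V^3/(1/V)\<^sup>2 <= V^5" by (simp add: power_divide flip: power_add)
 qed (use V_pos in simp)
 from blip_V_mult[OF a this] show ?thesis by (simp add: s1'_def[abs_def])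
qed

lemma blip_s4': "blip (V^4) (Dom3 alf bt) (s4' bt)"
proof -
 have "blip (V^1) (Dom3 alf bt) (%s. \<theta>' s)"
  using blip_\<theta>'[OF blip_path(1)] Dom_s(1)[OF Dom3_Dom(1)] by simp
 from blip_V_mult[OF this blip_inv_\<theta>'] show ?thesis by (simp add: s4'_def[abs_def] numeral_eq_Suc)
qed

lemma blip_Wd: "blip (V^18) (Dom3 alf bt) (Wd alf bt)"
proof -
 have one: "blip (V^8) (Dom3 alf bt) (%s. -1)"
  using V_le_pow(2)[of 8] V_pos by (intro blipI) auto
 have a: "blip (V^2) (Dom3 alf bt) (%s. s4 bt s powr (kp-1))"
  using blip_V_powr[OF blip_path(3)] Dom_s4(1)[OF Dom3_Dom(1)] by (simp add: numeral_eq_Suc)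
 have c: "blip (V^4) (Dom3 alf bt) (%s. s3 alf bt s powr (kp-1))"
  using blip_V_powr[OF blip_path(4)] Dom3_Dom(2) by (simp add: numeral_eq_Suc)
 have d: "blip (V^10) (Dom3 alf bt) (%s. s1' alf s + s4' bt s - 1)"
  using blip_V_add[OF blip_V_add[OF blip_s1' blip_V_up[OF blip_s4']] blip_V_up[OF one]] by simp
 have e: "blip (V^15) (Dom3 alf bt) (%s. s4 bt s powr (kp-1) * s4' bt s)"
  using blip_V_up[OF blip_V_mult[OF a blip_s4'], of 15] by simp
 have f: "blip (V^15) (Dom3 alf bt) (%s. s3 alf bt s powr (kp-1)*(s1' alf s + s4' bt s - 1))"
  using blip_V_mult[OF c d] by simp
 have g: "blip (V^16) (Dom3 alf bt) (%s. s4 bt s powr (kp-1) * s4' bt s - s3 alf bt s powr (kp-1)*(s1' alf s + s4' bt s - 1))"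
  using blip_V_add[OF e blip_uminus[OF f]] by simp
 have "blip (V^1) (Dom3 alf bt) (%s. kp)" using Vk kpos V_pos by (intro blipI) auto
 from blip_V_mult[OF this g] show ?thesis by (simp add: Wd_def[abs_def])
qed

text \<open>The two Jacobians times the four weights \<open>1/s\<close>. The Jacobian of the
  substitution for \<open>t\<close> contributes a factor \<open>s1\<close>, which cancels the weight
  \<open>1/s1\<close>; hence only \<open>1/(s powr kp + alf)\<close> remains of that pair.\<close>

definition amp where
 "amp alf bt s = (1/kp)*((1/(s powr kp + alf))*((1/s)*((1/s3 alf bt s)*((1/s4 bt s)*(1/\<theta>' (s4 bt s))))))"

lemma blip_amp: "blip (V^17) (Dom3 alf bt) (amp alf bt)"
proof -
 have r: "blip (V^m) (Dom3 alf bt) (%s. 1/f s)"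
  if "blip (V^m) (Dom3 alf bt) f" "\<And>s. s \<in> Dom3 alf bt ==> 1 <= f s" for f m
 proof (rule blip_inverse[OF that(1), where m = 1])
  show "1 <= abs (f s)" if "s \<in> Dom3 alf bt" for s using \<open>\<And>s. s \<in> Dom3 alf bt ==> 1 <= f s\<close>[OF that] by linarith
 qed (use V_le_pow(2)[of m] in auto)
 have 1: "blip (V^1) (Dom3 alf bt) (%s. s powr kp + alf)"
 proof (rule blipI)
  fix s assume s: "s \<in> Dom3 alf bt"
  have "s powr kp + alf <= b powr kp" "1 <= s powr kp + alf" using Dom3_Dom(1)[OF s] by (auto simp: Dom_def)
  then show "abs (s powr kp + alf) <= V^1" using pk_ub[of b] b1 by auto
  fix t assume t: "t \<in> Dom3 alf bt"
  show "abs (s powr kp + alf - (t powr kp + alf)) <= V^1*abs (s - t)"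
   using pk[OF Dom_s(2)[OF Dom3_Dom(1)[OF s]] Dom_s(2)[OF Dom3_Dom(1)[OF t]]] by simp
 qed
 have "blip (V^1) (Dom3 alf bt) (%s. 1/kp)" using Vk' kpos V_pos by (intro blipI) auto
 moreover have "blip (V^1) (Dom3 alf bt) (%s. 1/(s powr kp + alf))"
  by (rule r[OF 1]) (auto dest!: Dom3_Dom(1) simp: Dom_def)
 moreover have "blip (V^1) (Dom3 alf bt) (%s. 1/s)"
  by (rule r[OF blip_path(1)]) (auto dest!: Dom3_Dom(1) simp: Dom_def)
 moreover have "blip (V^3) (Dom3 alf bt) (%s. 1/s3 alf bt s)"
  by (rule r[OF blip_path(4)]) (auto dest!: Dom3_Dom(2))
 moreover have "blip (V^1) (Dom3 alf bt) (%s. 1/s4 bt s)"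
  by (rule r[OF blip_path(3)]) (use Dom_s4(1)[OF Dom3_Dom(1)] in auto)
 ultimately have "blip (V^(1+(1+(1+(3+(1+2+1)+1)+1)+1)+1)) (Dom3 alf bt) (amp alf bt)"
  unfolding amp_def[abs_def] by (intro blip_V_mult blip_inv_\<theta>')
 then show ?thesis by (rule blip_V_up) simp
qed

text \<open>Up to a factor \<open>u powr P\<close>, where \<open>u = s1\<close>,
  \<open>x = s4\<close>, \<open>z = s3\<close> and \<open>P = kp - 1\<close>, the main part of
  \<open>Wd\<close> is \<open>(u*x) powr P - (z*s) powr P\<close>, and
  \<open>u*x - z*s = (u - s)*(x - s)\<close> because \<open>z = u + x - s\<close>. Curvature turns
  the difference of the bases into a difference of the powers. The rest comes from
  \<open>s4'\<close> not being 1; it is bounded by \<open>a\<close> times the same product of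
  differences and is absorbed.\<close>

lemma Wd_lower:
 assumes "s \<in> Dom3 alf bt"
 shows "abs (s1 alf s - s)*abs (s4 bt s - s) <= V^4*abs (Wd alf bt s)"
proof -
 note D = Dom3_Dom[OF assms]
 define P where "P = kp - 1"
 define u where "u = s1 alf s"
 define x where "x = s4 bt s"
 define z where "z = s3 alf bt s"
 have i: "s \<in> {1..b}" "u \<in> {1..b}" "x \<in> {1..b}" "z \<in> {1..b}"
  using Dom_s(1)[OF D(1)] Dom_s1(1)[OF D(1)] Dom_s4(1)[OF D(1)] D(2) by (auto simp: u_def x_def z_def)
 have z: "z = u + x - s" by (simp add: z_def s3_def u_def x_def)
 define A where "A = abs (u - s)*abs (x - s)"
 have A0: "A >= 0" by (simp add: A_def)
 have up: "u powr P > 0" using i by auto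
 have up': "1/u powr P >= 1/V"
  using pP_ub[OF in_big[OF i(2)]] up V_pos by (auto simp: field_simps P_def)
 have e: "Wd alf bt s/kp = (1/u powr P)*((u*x) powr P - (z * s) powr P)
   + (s4' bt s - 1)*(x powr P - z powr P)"
  using kpos up i unfolding Wd_def s1'_def
  by (simp add: u_def[symmetric] x_def[symmetric] z_def[symmetric] P_def[symmetric] powr_mult field_simps)
 have in2: "u*x \<in> {1..b\<^sup>2}" "z * s \<in> {1..b\<^sup>2}"
  using i by (auto simp: power2_eq_square intro!: mult_mono) (metis mult_mono' mult_1 zero_le_one)+
 have "A = abs (u*x - z * s)" unfolding A_def z by (simp add: abs_mult[symmetric] algebra_simps)
 also have "... <= V*abs ((u*x) powr P - (z * s) powr P)" using pP_low[OF in2] by (simp add: P_def)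
 finally have l1: "A <= V*abs ((u*x) powr P - (z * s) powr P)" .
 have "A/V*(1/V) <= abs ((u*x) powr P - (z * s) powr P)*(1/u powr P)"
  using l1 up' V_pos A0 by (intro mult_mono) (auto simp: field_simps)
 then have m1: "A/V\<^sup>2 <= abs ((1/u powr P)*((u*x) powr P - (z * s) powr P))"
  using up by (simp add: abs_mult power2_eq_square)
 have t4: "\<theta>' x >= 1/2" using \<theta>'_bounds(1)[OF in_big[OF i(3)]] .
 have "s4' bt s - 1 = (\<theta>' s - \<theta>' x)/\<theta>' x" using t4 by (simp add: s4'_def x_def[symmetric] field_simps)
 then have "abs (s4' bt s - 1) = abs (\<theta>' s - \<theta>' x)/\<theta>' x" using t4 by (simp add: abs_divide)
 also have "... <= (abs a*V\<^sup>2*abs (s - x))/(1/2)"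
  by (intro frac_le \<theta>'_diff in_big i t4) auto
 finally have q1: "abs (s4' bt s - 1) <= 2*abs a*V\<^sup>2*abs (x - s)" by (simp add: abs_minus_commute)
 have q2: "abs (x powr P - z powr P) <= V*abs (u - s)"
  using pP[OF in_big[OF i(3)] in_big[OF i(4)]] by (simp add: P_def z abs_minus_commute)
 have "abs ((s4' bt s - 1)*(x powr P - z powr P)) <= (2*abs a*V\<^sup>2*abs (x - s))*(V*abs (u - s))"
  unfolding abs_mult by (intro mult_mono q1 q2) auto
 also have "... = 2*(abs a*V^5)*A/V\<^sup>2"
  using V_pos by (simp add: A_def field_simps power_numeral_reduce)
 also have "... <= 2*(1/4)*A/V\<^sup>2"
  using small_pow[of 5] A0 by (intro divide_right_mono mult_right_mono mult_left_mono) auto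
 finally have m2: "abs ((s4' bt s - 1)*(x powr P - z powr P)) <= (A/V\<^sup>2)/2" by simp
 have tri: "X - Y <= abs (x' + y')" if "X <= abs x'" "abs y' <= Y" for X Y x' y' :: real
  using that by linarith
 have "A/V\<^sup>2/2 <= abs (Wd alf bt s/kp)" using tri[OF m1 m2] unfolding e by simp
 then have "A <= 2*V\<^sup>2*((1/kp)*abs (Wd alf bt s))" using kpos V_pos by (simp add: field_simps)
 also have "... <= 2*V\<^sup>2*(V*abs (Wd alf bt s))" using Vk' by (intro mult_left_mono mult_right_mono) auto
 also have "... = 2*(V^3*abs (Wd alf bt s))" by (simp add: power_numeral_reduce)
 also have "... <= V*(V^3*abs (Wd alf bt s))" using V4 by (intro mult_right_mono) auto
 finally show ?thesis by (simp add: A_def u_def x_def power_numeral_reduce mult.assoc)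
qed

end

text \<open>The constant \<open>V\<close> is fixed before \<open>a\<close>: it is the sum of all
  constants involved, so each single one is below it. The assumption \<open>kp ~= 1\<close> enters
  through the summand \<open>C5/abs (kp-1)\<close>, that is, through the curvature assumption
  \<open>pP_low\<close>.\<close>

lemma curve_exists:
 fixes kp b :: real
 assumes "kp > 0" "kp ~= 1" "b > 1"
 shows "\<exists>V. \<forall>a. a ~= 0 & abs a*V^8 <= 1 --> curve kp b a V"
proof -
 have I: "0 < (1/2::real)" "1/2 <= 2*b" "0 < (1::real)" "1 <= b\<^sup>2" using assms by (auto simp: one_le_power)
 obtain C1 where C1: "C1 > 0" "\<forall>s\<in>{1/2..2*b}. s powr kp <= C1 & 1 <= C1 * s powr kp"
  using powr_bounds[OF I(1,2), of kp] by blast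
 obtain C2 where C2: "C2 > 0" "\<forall>s\<in>{1/2..2*b}. s powr (kp-1) <= C2 & 1 <= C2 * s powr (kp-1)"
  using powr_bounds[OF I(1,2), of "kp-1"] by blast
 obtain C3 where C3: "C3 > 0" "\<forall>s\<in>{1/2..2*b}. \<forall>t\<in>{1/2..2*b}. abs (s powr kp - t powr kp) <= C3*abs (s - t) &
      abs kp*abs (s - t) <= C3*abs (s powr kp - t powr kp)"
  using powr_diff_bounds[OF I(1,2), of kp] by blast
 obtain C4 where C4: "C4 > 0" "\<forall>s\<in>{1/2..2*b}. \<forall>t\<in>{1/2..2*b}. abs (s powr (kp-1) - t powr (kp-1)) <= C4*abs (s - t) &
      abs (kp-1)*abs (s - t) <= C4*abs (s powr (kp-1) - t powr (kp-1))"
  using powr_diff_bounds[OF I(1,2), of "kp-1"] by blast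
 obtain C5 where C5: "C5 > 0" "\<forall>s\<in>{1..b\<^sup>2}. \<forall>t\<in>{1..b\<^sup>2}. abs (s powr (kp-1) - t powr (kp-1)) <= C5*abs (s - t) &
      abs (kp-1)*abs (s - t) <= C5*abs (s powr (kp-1) - t powr (kp-1))"
  using powr_diff_bounds[OF I(3,4), of "kp-1"] by blast
 define V where "V = 4 + b + kp + 1/kp + C1 + C2 + C3 + C4 + C3/kp + C5/abs (kp-1)"
 have p: "1/kp > 0" "C3/kp > 0" "C5/abs (kp-1) > 0" using assms C3(1) C5(1) by auto
 note ps = p C1(1) C2(1) C3(1) C4(1) C5(1) assms(1,3)
 have m: "c*x <= V*x" if "c <= V" "0 <= x" for c x using that by (rule mult_right_mono)
 have "curve kp b a V" if a: "a ~= 0" "abs a*V^8 <= 1" for a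
 proof
  show "abs (s powr kp - t powr kp) <= V*abs (s - t)" if "s \<in> {1/2..2*b}" "t \<in> {1/2..2*b}" for s t
   using C3(2) that m[of C3 "abs (s - t)"] ps by (fastforce simp: V_def)
  show "abs (s - t) <= V*abs (s powr kp - t powr kp)" if "s \<in> {1/2..2*b}" "t \<in> {1/2..2*b}" for s t
  proof -
   have "kp*abs (s - t) <= C3*abs (s powr kp - t powr kp)" using C3(2) that assms(1) by auto
   then have "abs (s - t) <= C3/kp*abs (s powr kp - t powr kp)" using assms(1) by (simp add: field_simps)
   also have "... <= V*abs (s powr kp - t powr kp)" using ps by (intro m) (auto simp: V_def)
   finally show ?thesis .
  qed
  show "abs (s powr (kp-1) - t powr (kp-1)) <= V*abs (s - t)" if "s \<in> {1/2..2*b}" "t \<in> {1/2..2*b}" for s t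
   using C4(2) that m[of C4 "abs (s - t)"] ps by (fastforce simp: V_def)
  show "s powr kp <= V" if "s \<in> {1/2..2*b}" for s
  proof -
   have "s powr kp <= C1" using C1(2) that by blast
   then show ?thesis using ps unfolding V_def by linarith
  qed
  show "s powr (kp-1) <= V" if "s \<in> {1/2..2*b}" for s
  proof -
   have "s powr (kp-1) <= C2" using C2(2) that by blast
   then show ?thesis using ps unfolding V_def by linarith
  qed
  show "1 <= V * s powr (kp-1)" if "s \<in> {1/2..2*b}" for s
  proof -
   have "1 <= C2 * s powr (kp-1)" using C2(2) that by blast
   also have "... <= V * s powr (kp-1)" using ps by (intro m) (auto simp: V_def)
   finally show ?thesis .
  qed
  show "abs (s - t) <= V*abs (s powr (kp-1) - t powr (kp-1))" if "s \<in> {1..b\<^sup>2}" "t \<in> {1..b\<^sup>2}" for s t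
  proof -
   have "abs (kp-1)*abs (s - t) <= C5*abs (s powr (kp-1) - t powr (kp-1))" using C5(2) that by auto
   then have "abs (s - t) <= C5/abs (kp-1)*abs (s powr (kp-1) - t powr (kp-1))" using assms(2) by (simp add: field_simps)
   also have "... <= V*abs (s powr (kp-1) - t powr (kp-1))" using ps by (intro m) (auto simp: V_def)
   finally show ?thesis .
  qed
 qed (use a ps assms in \<open>auto simp: V_def\<close>)
 then show ?thesis by blast
qed

section \<open>Integrals of a mean-zero function along a monotone curve\<close>

text \<open>Over \<open>m\<close> equal steps the quadratic terms add up to
  \<open>B*(z1 - z0)\<^sup>2/m\<close>, which disappears as \<open>m\<close> grows. This stands in
  for the mean value inequality where no derivative is at hand.\<close>

lemma quadratic_increment_bound:
 fixes \<Psi> :: "real => real"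
 assumes z: "z0 <= z1" and inc: "\<And>y y'. z0 <= y ==> y <= y' ==> y' <= z1 ==> abs (\<Psi> y' - \<Psi> y) <= A*(y' - y) + B*(y' - y)\<^sup>2"
  and B: "0 <= B"
 shows "abs (\<Psi> z1 - \<Psi> z0) <= A*(z1 - z0)"
proof (rule ccontr)
 define L where "L = z1 - z0"
 have L: "0 <= L" using z by (simp add: L_def)
 assume "\<not> ?thesis"
 then have gap: "A*L < abs (\<Psi> z1 - \<Psi> z0)" by (simp add: L_def)
 obtain n :: nat where n: "B*L\<^sup>2/(abs (\<Psi> z1 - \<Psi> z0) - A*L) < real n"
  using reals_Archimedean2 by blast
 define m where "m = Suc n"
 define h where "h = L/real m"
 have h: "0 <= h" "real m*h = L" using L by (auto simp: h_def m_def)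
 have "abs (\<Psi> (z0 + real i*h) - \<Psi> z0) <= real i*(A*h + B*h\<^sup>2)" if "i <= m" for i
  using that
 proof (induction i)
  case (Suc i)
  have "real (Suc i)*h <= real m*h" using Suc.prems h by (intro mult_right_mono) auto
  then have "z0 + real (Suc i)*h <= z1" using h by (simp add: L_def)
  then have "abs (\<Psi> (z0 + real (Suc i)*h) - \<Psi> (z0 + real i*h)) <= A*h + B*h\<^sup>2"
   using inc[of "z0 + real i*h" "z0 + real (Suc i)*h"] h by (simp add: algebra_simps)
  with Suc show ?case by (simp add: algebra_simps)
 qed simp
 from this[of m] have "abs (\<Psi> z1 - \<Psi> z0) <= real m*(A*h + B*h\<^sup>2)" using h by (simp add: L_def)
 also have "... = A*L + B*L\<^sup>2/real m"
 proof -
  have "real m ~= 0" by (simp add: m_def)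
  then show ?thesis by (simp add: h_def field_simps power2_eq_square)
 qed
 finally have "(abs (\<Psi> z1 - \<Psi> z0) - A*L)*real m <= B*L\<^sup>2"
  by (simp add: m_def field_simps)
 moreover have "B*L\<^sup>2 < (abs (\<Psi> z1 - \<Psi> z0) - A*L)*real n"
  using n gap by (simp add: field_simps)
 moreover have "(abs (\<Psi> z1 - \<Psi> z0) - A*L)*real n <= (abs (\<Psi> z1 - \<Psi> z0) - A*L)*real m"
  using gap by (intro mult_left_mono) (auto simp: m_def)
 ultimately show False by linarith
qed

lemma blip_continuous:
 assumes "blip M Z q" shows "continuous_on Z q"
proof -
 have "(max M 0)-lipschitz_on Z q"
 proof (rule lipschitz_onI)
  fix s t assume "s \<in> Z" "t \<in> Z"
  then have "abs (q s - q t) <= M*abs (s - t)" using blipD(2)[OF assms] by blast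
  also have "... <= max M 0*abs (s - t)" by (intro mult_right_mono) auto
  finally show "dist (q s) (q t) <= max M 0*dist s t" by (simp add: dist_real_def)
 qed simp
 then show ?thesis by (rule lipschitz_on_continuous_on)
qed

text \<open>Integration by parts with \<open>q\<close> merely Lipschitz and \<open>k\<close> merely
  bounded. With \<open>\<Phi>\<close> and \<open>\<Gamma>\<close> the primitives of \<open>k\<close>
  and \<open>k*q\<close>, the increments of \<open>\<Gamma> - q*\<Phi>\<close> consist of
  \<open>(q y' - q y)*\<Phi> y\<close>, linear in the step with constant \<open>M*D\<close>, and of
  an integral of \<open>k*(q - q y')\<close>, quadratic in the step.\<close>

lemma abel_bound_UNIV:
 fixes k q :: "real => real"
 assumes z: "z0 <= z1" and k [measurable]: "k \<in> borel_measurable borel" and kb: "\<And>s. abs (k s) <= B"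
  and q: "blip M UNIV q" "0 <= M"
  and D: "\<And>y. y \<in> {z0..z1} ==> abs (LBINT s. k s*indicator {z0..y} s) <= D"
 shows "abs (LBINT s. (k s*q s)*indicator {z0..z1} s) <= D*M*(1 + (z1 - z0))"
proof -
 have B: "0 <= B" using kb[of 0] by linarith
 have [measurable]: "q \<in> borel_measurable borel"
  using blip_continuous[OF q(1)] by (rule borel_measurable_continuous_onI)
 have qb: "abs (q s) <= M" for s using blipD(1)[OF q(1)] by simp
 have kbb: "bounded (range k)" using kb by (auto simp: bounded_iff)
 have qbb: "bounded (range (%s. k s*q s))" using kb qb B q(2)
  by (auto simp: bounded_iff abs_mult intro!: exI[of _ "B*M"] mult_mono)
 have qcb: "bounded (range (%s. k s*(q s - c)))" for c
 proof -
  have "abs (k s*(q s - c)) <= B*(M + abs c)" for s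
   unfolding abs_mult using kb[of s] qb[of s] B q(2) by (intro mult_mono) linarith+
  then show ?thesis by (auto simp: bounded_iff)
 qed
 have i1: "bcs (%s. k s*indicator A s)" and i2: "bcs (%s. (k s*q s)*indicator A s)"
  and i3: "bcs (%s. (k s*(q s - c))*indicator A s)" if "bounded A" "A \<in> sets borel" for A c
  using that kbb qbb qcb by (auto intro!: bcs_mult' bcs_indicator)
 define \<Phi> where "\<Phi> y = (LBINT s. k s*indicator {z0..y} s)" for y
 define \<Gamma> where "\<Gamma> y = (LBINT s. (k s*q s)*indicator {z0..y} s)" for y
 have D0: "0 <= D" using D[of z0] z by (meson abs_ge_zero atLeastAtMost_iff order_refl order_trans)
 have split: "indicat_real {z0..y'} s = indicator {z0..y} s + indicator {y<..y'} s"
  if "z0 <= y" "y <= y'" for y y' s using that by (auto simp: indicator_def)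
 have "abs ((\<Gamma> z1 - q z1*\<Phi> z1) - (\<Gamma> z0 - q z0*\<Phi> z0)) <= (M*D)*(z1 - z0)"
 proof (rule quadratic_increment_bound[where B = "B*M"])
  fix y y' assume y: "z0 <= y" "y <= y'" "y' <= z1"
  have e1: "\<Gamma> y' = \<Gamma> y + (LBINT s. (k s*q s)*indicator {y<..y'} s)"
   unfolding \<Gamma>_def split[OF y(1,2)] distrib_left
   by (intro Bochner_Integration.integral_add bcs_integrable i2) auto
  have e2: "\<Phi> y' = \<Phi> y + (LBINT s. k s*indicator {y<..y'} s)"
   unfolding \<Phi>_def split[OF y(1,2)] distrib_left
   by (intro Bochner_Integration.integral_add bcs_integrable i1) auto
  have e3: "(LBINT s. (k s*(q s - q y'))*indicator {y<..y'} s)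
    = (LBINT s. (k s*q s)*indicator {y<..y'} s) - q y'*(LBINT s. k s*indicator {y<..y'} s)"
  proof -
   have "(LBINT s. (k s*(q s - q y'))*indicator {y<..y'} s)
    = (LBINT s. (k s*q s)*indicator {y<..y'} s - q y'*(k s*indicator {y<..y'} s))"
    by (simp add: algebra_simps)
   also have "... = (LBINT s. (k s*q s)*indicator {y<..y'} s) - (LBINT s. q y'*(k s*indicator {y<..y'} s))"
    by (intro Bochner_Integration.integral_diff bcs_integrable i2 bcs_cmult i1) auto
   finally show ?thesis by simp
  qed
  have "abs (LBINT s. (k s*(q s - q y'))*indicator {y<..y'} s) <= (LBINT s. abs ((k s*(q s - q y'))*indicator {y<..y'} s))"
   by (rule integral_abs_bound)
  also have "... <= (LBINT s. (B*(M*(y' - y)))*indicator {y<..y'} s)"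
  proof (rule integral_mono)
   show "integrable lborel (%s. abs ((k s*(q s - q y'))*indicator {y<..y'} s))"
    by (intro bcs_integrable bcs_abs i3) auto
   show "integrable lborel (%s. (B*(M*(y' - y)))*indicat_real {y<..y'} s)"
    by (intro bcs_integrable bcs_cmult bcs_indicator) auto
   fix s
   show "abs ((k s*(q s - q y'))*indicator {y<..y'} s) <= (B*(M*(y' - y)))*indicator {y<..y'} s"
   proof (cases "s \<in> {y<..y'}")
    case True
    have "abs (q s - q y') <= M*abs (s - y')" using blipD(2)[OF q(1)] by simp
    also have "... <= M*(y' - y)" using True q(2) by (intro mult_left_mono) auto
    finally show ?thesis using True kb[of s] B by (simp add: abs_mult) (intro mult_mono, auto)
   qed simp
  qed
  also have "... = B*M*(y' - y)\<^sup>2" using y by (simp add: power2_eq_square)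
  finally have 1: "abs (LBINT s. (k s*(q s - q y'))*indicator {y<..y'} s) <= B*M*(y' - y)\<^sup>2" .
  have "abs ((q y' - q y)*\<Phi> y) <= (M*(y' - y))*D"
   unfolding abs_mult using blipD(2)[OF q(1), of y' y] D[of y] y q(2)
   by (intro mult_mono) (auto simp: \<Phi>_def)
  moreover have "(\<Gamma> y' - q y'*\<Phi> y') - (\<Gamma> y - q y*\<Phi> y) =
    (LBINT s. (k s*(q s - q y'))*indicator {y<..y'} s) - (q y' - q y)*\<Phi> y"
   unfolding e3 e1 e2 by (simp add: algebra_simps)
  ultimately show "abs ((\<Gamma> y' - q y'*\<Phi> y') - (\<Gamma> y - q y*\<Phi> y)) <= (M*D)*(y' - y) + B*M*(y' - y)\<^sup>2"
   using 1 by (simp add: mult.commute mult.left_commute)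
 qed (use z B q in auto)
 moreover have "\<Gamma> z0 = 0" "\<Phi> z0 = 0"
 proof -
  have n: "AE s in lborel. s ~= z0" by (rule AE_lborel_singleton)
  show "\<Gamma> z0 = 0" unfolding \<Gamma>_def by (rule integral_eq_zero_AE) (use n in \<open>auto elim: eventually_mono\<close>)
  show "\<Phi> z0 = 0" unfolding \<Phi>_def by (rule integral_eq_zero_AE) (use n in \<open>auto elim: eventually_mono\<close>)
 qed
 moreover have "abs (q z1*\<Phi> z1) <= M*D"
  unfolding abs_mult using qb D[of z1] z q(2) by (intro mult_mono) (auto simp: \<Phi>_def)
 ultimately have "abs (\<Gamma> z1) <= M*D + (M*D)*(z1 - z0)" by simp
 then show ?thesis by (simp add: \<Gamma>_def algebra_simps)
qed

definition clamp1 :: "real => real => real => real" where "clamp1 z0 z1 s = max z0 (min z1 s)"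

lemma clamp1: "z0 <= z1 ==> clamp1 z0 z1 s \<in> {z0..z1}" "s \<in> {z0..z1} ==> clamp1 z0 z1 s = s"
 "abs (clamp1 z0 z1 s - clamp1 z0 z1 t) <= abs (s - t)"
 by (auto simp: clamp1_def)

lemma continuous_clamp1: "continuous_on UNIV (clamp1 z0 z1)"
 unfolding clamp1_def[abs_def] by (intro continuous_intros)

text \<open>Substituting \<open>x = w s\<close> turns the primitive of \<open>G (w s)*w' s\<close>
  into an integral of \<open>G\<close> between two values of \<open>w\<close>, which
  \<open>D\<close> controls; Abel summation then brings in \<open>q\<close>. Composition with the
  clamping map extends \<open>w\<close>, \<open>w'\<close> and \<open>q\<close> from the interval to
  the line.\<close>

lemma osc_bound_pos:
 fixes G w w' q :: "real => real"
 assumes G: "bcs G" and z: "z0 <= z1"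
  and w: "\<And>s. s \<in> {z0..z1} ==> (w has_real_derivative w' s) (at s)"
  and w': "continuous_on {z0..z1} w'" "\<And>s. s \<in> {z0..z1} ==> w' s > 0"
  and q: "blip M {z0..z1} q" "0 <= M"
  and D: "\<And>c d. c \<in> w ` {z0..z1} ==> d \<in> w ` {z0..z1} ==> c <= d ==> abs (LBINT x. G x*indicator {c..d} x) <= D"
 shows "abs (LBINT s. (G (w s)*w' s*q s)*indicator {z0..z1} s) <= D*M*(1 + (z1 - z0))"
proof -
 define cl where "cl = clamp1 z0 z1"
 have cl: "cl s \<in> {z0..z1}" for s unfolding cl_def by (rule clamp1(1)[OF z])
 have cl': "s \<in> {z0..z1} ==> cl s = s" for s unfolding cl_def by (rule clamp1(2))
 have ccl: "continuous_on UNIV cl" unfolding cl_def by (rule continuous_clamp1)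
 have cw: "continuous_on {z0..z1} w" using w by (rule has_real_derivative_imp_continuous_on)
 have "continuous_on UNIV (%s. w (cl s))" "continuous_on UNIV (%s. w' (cl s))"
  by (rule continuous_on_compose2[OF cw ccl] continuous_on_compose2[OF w'(1) ccl]; use cl in auto)+
 then have [measurable]: "(%s. w (cl s)) \<in> borel_measurable borel" "(%s. w' (cl s)) \<in> borel_measurable borel"
  by (auto intro: borel_measurable_continuous_onI)
 have [measurable]: "G \<in> borel_measurable borel" by (rule bcs_measurable[OF G])
 obtain B where B: "\<And>x. abs (G x) <= B" using bcs_bounded[OF G] by (auto simp: bounded_iff)
 have B0: "0 <= B" using B[of 0] by linarith
 have "compact (w' ` {z0..z1})" by (rule compact_continuous_image[OF w'(1)]) simp
 then obtain B' where B': "\<And>s. s \<in> {z0..z1} ==> abs (w' s) <= B'"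
  using compact_imp_bounded bounded_iff by (metis imageI real_norm_def)
 define k where "k s = G (w (cl s))*w' (cl s)" for s
 have k: "k \<in> borel_measurable borel" unfolding k_def[abs_def] by measurable
 have kb: "abs (k s) <= B*B'" for s
  unfolding k_def abs_mult using B B'[OF cl] B0 by (intro mult_mono) auto
 have q': "blip M UNIV (%s. q (cl s))"
 proof (rule blipI)
  show "abs (q (cl s)) <= M" for s using blipD(1)[OF q(1) cl] .
  fix s t
  have "abs (q (cl s) - q (cl t)) <= M*abs (cl s - cl t)" using blipD(2)[OF q(1) cl cl] .
  also have "... <= M*abs (s - t)" unfolding cl_def by (intro mult_left_mono clamp1 q)
  finally show "abs (q (cl s) - q (cl t)) <= M*abs (s - t)" .
 qed
 have "abs (LBINT s. (k s*q (cl s))*indicator {z0..z1} s) <= D*M*(1 + (z1 - z0))"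
 proof (rule abel_bound_UNIV[OF z k kb q' q(2)])
  fix y assume y: "y \<in> {z0..z1}"
  have sub: "{z0..y} \<subseteq> {z0..z1}" using y by auto
  have "(LBINT s. k s*indicator {z0..y} s) = (LBINT s. G (w s)*w' s*indicator {z0..y} s)"
   by (rule Bochner_Integration.integral_cong) (use sub cl' in \<open>auto simp: k_def indicator_def\<close>)
  also have "... = (LBINT x. G x*indicator {w z0..w y} x)"
  proof (rule integral_substitution(2)[symmetric])
   have "bcs (%x. indicator {w z0..w y} x*G x)"
    by (rule bcs_mult'[OF G]) (auto simp: bounded_iff intro!: exI[of _ 1] indicator_le_1)
   from bcs_integrable[OF this] show "set_integrable lborel {w z0..w y} G"
    by (simp add: set_integrable_def)
   show "(w has_real_derivative w' x) (at x)" if "x \<in> {z0..y}" for x using w that sub by blast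
   show "continuous_on {z0..y} w'" by (rule continuous_on_subset[OF w'(1) sub])
   show "0 <= w' x" if "x \<in> {z0..y}" for x using w'(2)[of x] that sub by fastforce
   show "z0 <= y" using y by simp
  qed
  finally have e: "(LBINT s. k s*indicator {z0..y} s) = (LBINT x. G x*indicator {w z0..w y} x)" .
  have "w z0 <= w y"
  proof (rule DERIV_nonneg_imp_nondecreasing[where f = w])
   show "z0 <= y" using y by simp
   fix x assume "z0 <= x" "x <= y"
   then have "x \<in> {z0..z1}" using y by auto
   then show "\<exists>d. (w has_real_derivative d) (at x) & 0 <= d" using w w'(2) less_imp_le by blast
  qed
  then show "abs (LBINT s. k s*indicator {z0..y} s) <= D"
   unfolding e using y z by (intro D) auto
 qed
 also have "(LBINT s. (k s*q (cl s))*indicator {z0..z1} s) = (LBINT s. (G (w s)*w' s*q s)*indicator {z0..z1} s)"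
  by (rule Bochner_Integration.integral_cong) (use cl' in \<open>auto simp: k_def indicator_def\<close>)
 finally show ?thesis .
qed

lemma integral_reflect:
 fixes f :: "real => real"
 shows "(LBINT x. f (- x)) = (LBINT x. f x)"
 using lborel_integral_real_affine[of "-1" f 0] by simp

text \<open>A continuous derivative without zeros on an interval has constant sign by connectedness;
  the decreasing case is the increasing one for \<open>- w\<close> and the reflected
  \<open>G\<close>.\<close>

lemma osc_bound:
 fixes G w w' q :: "real => real"
 assumes G: "bcs G" and z: "z0 <= z1"
  and w: "\<And>s. s \<in> {z0..z1} ==> (w has_real_derivative w' s) (at s)"
  and w': "continuous_on {z0..z1} w'" "\<And>s. s \<in> {z0..z1} ==> w' s ~= 0"
  and q: "blip M {z0..z1} q" "0 <= M"
  and D: "\<And>c d. c \<in> w ` {z0..z1} ==> d \<in> w ` {z0..z1} ==> c <= d ==> abs (LBINT x. G x*indicator {c..d} x) <= D"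
 shows "abs (LBINT s. (G (w s)*w' s*q s)*indicator {z0..z1} s) <= D*M*(1 + (z1 - z0))"
proof -
 have "(\<forall>s\<in>{z0..z1}. w' s > 0) \<or> (\<forall>s\<in>{z0..z1}. w' s < 0)"
 proof (rule ccontr)
  assume "\<not> ?thesis"
  then obtain s t where st: "s \<in> {z0..z1}" "t \<in> {z0..z1}" "w' s <= 0" "0 <= w' t" by force
  have "connected (w' ` {z0..z1})" by (rule connected_continuous_image[OF w'(1)]) simp
  then have "0 \<in> w' ` {z0..z1}" using st unfolding connected_iff_interval by blast
  then show False using w'(2) by force
 qed
 then show ?thesis
 proof
  assume "\<forall>s\<in>{z0..z1}. w' s > 0"
  then show ?thesis by (intro osc_bound_pos[OF G z w w'(1) _ q D]) auto
 next
  assume neg: "\<forall>s\<in>{z0..z1}. w' s < 0"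
  have "abs (LBINT s. (G (- (- w s))*(- w' s)*q s)*indicator {z0..z1} s) <= D*M*(1 + (z1 - z0))"
  proof (rule osc_bound_pos[where G = "%x. G (- x)" and w = "%s. - w s" and w' = "%s. - w' s", OF _ z _ _ _ q])
   show "bcs (%x. G (- x))" using bcs_scale[OF G, of "-1"] by simp
   show "((%s. - w s) has_real_derivative - w' s) (at s)" if "s \<in> {z0..z1}" for s
    using w[OF that] by (auto intro!: derivative_eq_intros)
   show "continuous_on {z0..z1} (%s. - w' s)" using w'(1) by (intro continuous_intros)
   show "0 < - w' s" if "s \<in> {z0..z1}" for s using neg that by auto
   fix c d assume cd: "c \<in> (%s. - w s) ` {z0..z1}" "d \<in> (%s. - w s) ` {z0..z1}" "c <= d"
   have "(LBINT x. G (- x)*indicator {c..d} x) = (LBINT x. G (- x)*indicator {-d..-c} (- x))"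
    by (rule Bochner_Integration.integral_cong) (auto simp: indicator_def)
   also have "... = (LBINT x. G x*indicator {-d..-c} x)"
    by (rule integral_reflect[of "%x. G x*indicator {-d..-c} x"])
   finally show "abs (LBINT x. G (- x)*indicator {c..d} x) <= D"
    using cd D[of "-d" "-c"] by force
  qed
  then show ?thesis by (simp add: mult_minus_left)
 qed
qed

text \<open>The primitive vanishes at every grid point \<open>of_int z*et\<close>: it is zero far to
  the left, and each cell contributes nothing. From the last grid point before \<open>y\<close> only
  a piece of length below \<open>et\<close> is left, to which Cauchy-Schwarz applies; hence the gain
  \<open>sqrt et\<close> together with a local norm.\<close>

lemma meanzero_antiderivative:
 fixes G :: "real => real"
 assumes G: "bcs G" and et: "0 < et" and mz: "\<And>z::int. (LBINT x. G x*indicator {of_int z*et..(of_int z + 1)*et} x) = 0"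
 shows "abs (LBINT x. G x*indicator {..y} x) <= sqrt et * sqrt (LBINT x. (G x)\<^sup>2*indicator {y - et..y} x)"
proof -
 define P where "P y = (LBINT x. G x*indicator {..y} x)" for y
 have Gi: "bcs (%x. G x*indicator A x)" if "A \<in> sets borel" for A
  using that by (intro bcs_mult[OF G]) (auto simp: bounded_iff intro!: exI[of _ 1] indicator_le_1)
 have split: "P y' = P y + (LBINT x. G x*indicator {y<..y'} x)" if "y <= y'" for y y'
 proof -
  have "indicat_real {..y'} s = indicator {..y} s + indicator {y<..y'} s" for s
   using that by (auto simp: indicator_def)
  then show ?thesis unfolding P_def
   by (simp only: distrib_left) (intro Bochner_Integration.integral_add bcs_integrable Gi; simp)
 qed
 obtain M R where MR: "0 <= R" "\<And>x. abs (G x) <= M" "\<And>x. G x ~= 0 ==> norm x <= R"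
  using bcs_ex[OF G] by blast
 have step: "P ((of_int z + 1)*et) = P (of_int z*et)" for z :: int
 proof -
  have "(LBINT x. G x*indicator {of_int z*et<..(of_int z + 1)*et} x) = (LBINT x. G x*indicator {of_int z*et..(of_int z + 1)*et} x)"
  proof (rule integral_cong_AE)
   show "AE x in lborel. G x*indicator {of_int z*et<..(of_int z + 1)*et} x = G x*indicator {of_int z*et..(of_int z + 1)*et} x"
    using AE_lborel_singleton[of "of_int z*et"] by eventually_elim (auto simp: indicator_def)
  qed (use bcs_measurable[OF Gi] in auto)
  then show ?thesis using split[of "of_int z*et" "(of_int z + 1)*et"] mz[of z] et by (simp add: distrib_right)
 qed
 have Pz: "P (of_int z*et) = 0" for z :: int
 proof -
  have far: "P y = 0" if "y < - R" for y
  proof -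
   have "G x*indicator {..y} x = 0" for x using MR(3)[of x] that by (auto simp: indicator_def)
   then show ?thesis unfolding P_def by (simp only: Bochner_Integration.integral_zero)
  qed
  define z0 where "z0 = min z (\<lfloor>- R/et\<rfloor> - 1)"
  have "of_int z0*et < - R"
  proof -
   have "of_int z0 < - R/et" unfolding z0_def using of_int_floor_le[of "- R/et"] by (simp add: min_def) linarith
   then show ?thesis using et by (simp add: field_simps)
  qed
  then have base: "P (of_int z0*et) = 0" by (rule far)
  have "P (of_int (z0 + int n)*et) = 0" for n
  proof (induction n)
   case (Suc n)
   then show ?case using step[of "z0 + int n"] by (simp add: algebra_simps)
  qed (use base in simp)
  from this[of "nat (z - z0)"] show ?thesis by (simp add: z0_def)
 qed
 define z where "z = \<lfloor>y/et\<rfloor>"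
 have zy: "of_int z*et <= y" "y - et < of_int z*et"
 proof -
  have "of_int z <= y/et" "y/et < of_int z + 1" by (simp_all add: z_def)
  then show "of_int z*et <= y" "y - et < of_int z*et" using et by (simp_all add: field_simps)
 qed
 have "P y = (LBINT x. G x*indicator {of_int z*et<..y} x)"
  using split[OF zy(1)] Pz by simp
 also have "... = (LBINT x. (G x*indicator {y - et..y} x)*indicator {of_int z*et<..y} x)"
  by (rule Bochner_Integration.integral_cong) (use zy in \<open>auto simp: indicator_def\<close>)
 finally have "abs (P y) <= N2 (%x. G x*indicator {y - et..y} x)*N2 (indicat_real {of_int z*et<..y})"
  using bcs_CS_abs[OF Gi[of "{y - et..y}"] bcs_indicator[of "{of_int z*et<..y}"]] by simp
 also have "... <= N2 (%x. G x*indicator {y - et..y} x) * sqrt et"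
 proof (rule mult_left_mono)
  have "(%x. (indicat_real {of_int z*et<..y} x)\<^sup>2) = indicat_real {of_int z*et<..y}"
   by (auto simp: indicator_def)
  then show "N2 (indicat_real {of_int z*et<..y}) <= sqrt et"
   unfolding N2_def using zy by (simp add: measure_def)
 qed simp
 also have "N2 (%x. G x*indicator {y - et..y} x) = sqrt (LBINT x. (G x)\<^sup>2*indicator {y - et..y} x)"
  unfolding N2_def by (intro arg_cong[where f = sqrt] Bochner_Integration.integral_cong) (auto simp: indicator_def)
 finally show ?thesis by (simp add: P_def mult.commute)
qed

definition locsq :: "(real => real) => real => real => real" where
 "locsq G r y = (LBINT x. (G x)\<^sup>2*indicator {y - r..y + r} x)"

lemma locsq_nonneg: "0 <= locsq G r y"
 unfolding locsq_def by (rule integral_nonneg_AE) simp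

lemma meanzero_interval:
 fixes G :: "real => real"
 assumes G: "bcs G" and et: "0 < et" and mz: "\<And>z::int. (LBINT x. G x*indicator {of_int z*et..(of_int z + 1)*et} x) = 0"
  and cd: "c <= d" "c \<in> {y - r + et..y + r}" "d \<in> {y - r + et..y + r}"
 shows "abs (LBINT x. G x*indicator {c..d} x) <= 2 * sqrt et * sqrt (locsq G r y)"
proof -
 have Gi: "bcs (%x. G x*indicator A x)" and Gi2: "bcs (%x. (G x)\<^sup>2*indicator A x)" if "A \<in> sets borel" for A
  using that by (auto intro!: bcs_mult[OF G] bcs_mult[OF bcs_power2[OF G]] exI[of _ 1] indicator_le_1 simp: bounded_iff)
 have "(LBINT x. G x*indicator {c..d} x) = (LBINT x. G x*indicator {..d} x - G x*indicator {..c} x)"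
 proof (rule integral_cong_AE)
  show "AE x in lborel. G x*indicator {c..d} x = G x*indicator {..d} x - G x*indicator {..c} x"
   using AE_lborel_singleton[of c] by eventually_elim (use cd in \<open>auto simp: indicator_def\<close>)
  show "(%x. G x*indicator {..d} x - G x*indicator {..c} x) \<in> borel_measurable lborel"
   using bcs_measurable[OF bcs_diff[OF Gi[of "{..d}"] Gi[of "{..c}"]]] by simp
 qed (use bcs_measurable[OF Gi] in auto)
 also have "... = (LBINT x. G x*indicator {..d} x) - (LBINT x. G x*indicator {..c} x)"
  by (intro Bochner_Integration.integral_diff bcs_integrable Gi) auto
 finally have e: "abs (LBINT x. G x*indicator {c..d} x) <= abs (LBINT x. G x*indicator {..d} x) + abs (LBINT x. G x*indicator {..c} x)"
  by linarith
 have *: "abs (LBINT x. G x*indicator {..t} x) <= sqrt et * sqrt (locsq G r y)" if "t \<in> {y - r + et..y + r}" for t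
 proof -
  have "(LBINT x. (G x)\<^sup>2*indicator {t - et..t} x) <= locsq G r y"
   unfolding locsq_def by (intro integral_mono bcs_integrable Gi2) (use that in \<open>auto simp: indicator_def\<close>)
  then have "sqrt et * sqrt (LBINT x. (G x)\<^sup>2*indicator {t - et..t} x) <= sqrt et * sqrt (locsq G r y)"
   using et by (intro mult_left_mono) auto
  with meanzero_antiderivative[OF G et mz, of t] show ?thesis by linarith
 qed
 show ?thesis using e *[OF cd(2)] *[OF cd(3)] by linarith
qed

section \<open>Oscillation of the fourth factor\<close>

context curve
begin

text \<open>Those \<open>s\<close> for which \<open>x = v + a * s powr kp\<close> lies in the window
  at \<open>y\<close> and \<open>x' = v + bt + a * s4 powr kp\<close> in the window at
  \<open>y'\<close>, both of side \<open>rh\<close>.\<close>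

definition Box where
 "Box v alf bt y y' rh = {s \<in> Dom3 alf bt. v + a * s powr kp \<in> {y..y+rh} & v + bt + a * s4 bt s powr kp \<in> {y'..y'+rh}}"

lemma mult_mono_between:
 fixes p q r :: real
 assumes "p <= q" "q <= r" "c*p \<in> {A..B}" "c*r \<in> {A..B}" shows "c*q \<in> {A..B}"
proof (cases "c >= 0")
 case True
 then have "c*p <= c*q" "c*q <= c*r" using assms by (auto intro: mult_left_mono)
 then show ?thesis using assms by auto
next
 case False
 then have "c*r <= c*q" "c*q <= c*p" using assms by (auto intro: mult_left_mono_neg)
 then show ?thesis using assms by auto
qed

text \<open>Every defining condition confines a monotone function of \<open>s\<close> to an
  interval, so the set is convex; it is also compact. A single interval is needed because
  \<open>osc_bound\<close> is applied to it once, without control over the number of pieces.\<close>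

lemma Box_interval:
 assumes "Box v alf bt y y' rh ~= {}"
 obtains z0 z1 where "z0 <= z1" "Box v alf bt y y' rh = {z0..z1}" "1 <= z0" "z1 <= b"
proof -
 let ?Z = "Box v alf bt y y' rh"
 have conv: "r \<in> ?Z" if st: "s \<in> ?Z" "t \<in> ?Z" "s <= r" "r <= t" for s t r
 proof -
  have D: "s \<in> Dom alf bt" "t \<in> Dom alf bt" using st by (auto simp: Box_def Dom3_def)
  have r: "r \<in> Dom alf bt" by (rule Dom_convex[OF D st(3,4)])
  have "s3 alf bt r \<in> {1..b}"
   using s3_mono[OF D(1) r st(3)] s3_mono[OF r D(2) st(4)] st by (auto simp: Box_def Dom3_def)
  moreover have "a*r powr kp \<in> {y - v..y - v + rh}"
  proof (rule mult_mono_between[of "s powr kp" _ "t powr kp"])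
   show "s powr kp <= r powr kp" "r powr kp <= t powr kp"
    using st kpos Dom_s(3)[OF D(1)] by (auto intro!: powr_mono2)
  qed (use st in \<open>auto simp: Box_def\<close>)
  moreover have "a * s4 bt r powr kp \<in> {y' - v - bt..y' - v - bt + rh}"
  proof (rule mult_mono_between[of "s4 bt s powr kp" _ "s4 bt t powr kp"])
   show "s4 bt s powr kp <= s4 bt r powr kp" "s4 bt r powr kp <= s4 bt t powr kp"
    using kpos s4_mono[OF D(1) r st(3)] s4_mono[OF r D(2) st(4)] Dom_s4(1)[OF D(1)] Dom_s4(1)[OF r]
    by (auto intro!: powr_mono2)
  qed (use st in \<open>auto simp: Box_def\<close>)
  ultimately show ?thesis using r by (auto simp: Box_def Dom3_def)
 qed
 have c3: "continuous_on (Dom alf bt) (s3 alf bt)"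
  unfolding s3_def[abs_def]
  using s1_deriv s4_deriv by (intro continuous_intros continuous_at_imp_continuous_on ballI) (auto intro!: DERIV_isCont)
 have c4: "continuous_on (Dom alf bt) (s4 bt)"
  using s4_deriv by (intro continuous_at_imp_continuous_on ballI DERIV_isCont) blast
 have c1: "continuous_on (Dom alf bt) (%s. v + a * s powr kp)"
  by (intro continuous_intros) (use Dom_s(3) in force)
 have c2: "continuous_on (Dom alf bt) (%s. v + bt + a * s4 bt s powr kp)"
  by (intro continuous_intros c4) (use Dom_s4(1) in force)
 have "?Z = (Dom alf bt \<inter> s3 alf bt -` {1..b}) \<inter> (Dom alf bt \<inter> (%s. v + a * s powr kp) -` {y..y+rh})
   \<inter> (Dom alf bt \<inter> (%s. v + bt + a * s4 bt s powr kp) -` {y'..y'+rh})"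
  by (auto simp: Box_def Dom3_def)
 then have cl: "closed ?Z"
  using continuous_closed_preimage[OF c3 Dom_closed, of "{1..b}"] continuous_closed_preimage[OF c1 Dom_closed, of "{y..y+rh}"]
   continuous_closed_preimage[OF c2 Dom_closed, of "{y'..y'+rh}"] by auto
 have sub: "?Z \<subseteq> {1..b}" by (auto simp: Box_def Dom3_def Dom_def)
 have "compact ?Z" using cl sub bounded_subset[OF bounded_closed_interval] by (auto simp: compact_eq_bounded_closed)
 moreover have "connected ?Z" unfolding connected_iff_interval using conv by blast
 ultimately obtain z0 z1 where z: "?Z = {z0..z1}" using connected_compact_interval_1[of ?Z] by auto
 show ?thesis using that[of z0 z1] z assms sub by auto
qed

text \<open>The terms \<open>a*t powr kp\<close> are at most \<open>V*abs a\<close>, so all four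
  arguments of \<open>G\<close> stay within \<open>2*V*abs a\<close> of the window corners. The last
  two facts bound from below the two factors in \<open>Wd_lower\<close>: \<open>s4 - s\<close>
  equals \<open>x' - x\<close>, and \<open>alf\<close> is a difference of powers.\<close>

lemma Box_facts:
 assumes s: "s \<in> Box v alf bt y y' rh" and rh: "0 <= rh" "rh <= abs a"
 shows "abs (v - y) <= 2*V*abs a" "abs (v - a*alf - y) <= 2*V*abs a" "abs (v + bt - y') <= 2*V*abs a"
  "abs (W v alf bt s - y') <= 2*V*abs a" "abs (y - y') - rh <= abs (s4 bt s - s)" "abs alf <= V*abs (s1 alf s - s)"
proof -
 have D3: "s \<in> Dom3 alf bt" and bx: "v + a * s powr kp \<in> {y..y+rh}" "v + bt + a * s4 bt s powr kp \<in> {y'..y'+rh}"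
  using s by (auto simp: Box_def)
 note D = Dom3_Dom[OF D3]
 have pw: "abs (a*t powr kp) <= V*abs a" if "t \<in> {1..b}" for t
  using mult_left_mono[OF pk_ub[OF in_big[OF that]], of "abs a"] by (simp add: abs_mult mult.commute)
 have rV: "rh <= V*abs a" using rh V_pos mult_right_mono[of 1 V "abs a"] by simp
 have 1: "abs (p - q) <= 2*V*abs a" if "p + e \<in> {q..q+rh}" "abs e <= V*abs a" for p q e
  using that rV rh by (auto simp: abs_le_iff)
 show "abs (v - y) <= 2*V*abs a" by (rule 1[OF bx(1) pw[OF Dom_s(1)[OF D(1)]]])
 have "v - a*alf + a * s1 alf s powr kp \<in> {y..y+rh}"
  using bx(1) Dom_s1(2)[OF D(1)] by (simp add: algebra_simps)
 then show "abs (v - a*alf - y) <= 2*V*abs a" by (rule 1) (rule pw[OF Dom_s1(1)[OF D(1)]])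
 show "abs (v + bt - y') <= 2*V*abs a" by (rule 1[OF bx(2) pw[OF Dom_s4(1)[OF D(1)]]])
 have "W v alf bt s + a * s3 alf bt s powr kp \<in> {y'..y'+rh}"
  using bx(2) by (simp add: W_def algebra_simps)
 then show "abs (W v alf bt s - y') <= 2*V*abs a" by (rule 1) (rule pw[OF D(2)])
 have "s4 bt s - s = (v + bt + a * s4 bt s powr kp) - (v + a * s powr kp)"
  using Dom_s4(2)[OF D(1)] by (simp add: \<theta>_def)
 then show "abs (y - y') - rh <= abs (s4 bt s - s)" using bx by auto
 have "alf = s1 alf s powr kp - s powr kp" using Dom_s1(2)[OF D(1)] by simp
 then show "abs alf <= V*abs (s1 alf s - s)"
  using pk[OF in_big[OF Dom_s1(1)[OF D(1)]] Dom_s(2)[OF D(1)]] by simp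
qed

text \<open>The integrand is rewritten as \<open>G (W s)\<close> times the speed \<open>a*Wd\<close>
  times \<open>amp/(a*Wd)\<close>, to which \<open>osc_bound\<close> applies. The exponents add up
  as 17 from \<open>amp\<close>, 28 from \<open>1/Wd\<close> and 1 from the length of the interval;
  the power \<open>ep^10\<close> is the square of the speed bound, since inverting a Lipschitz
  function costs two powers of its lower bound.\<close>

lemma inner_osc:
 assumes G: "bcs G" and et: "0 < et" "et <= abs a"
  and mz: "\<And>z::int. (LBINT x. G x*indicator {of_int z*et..(of_int z + 1)*et} x) = 0"
  and ep: "0 < ep" "ep <= 1" and rh: "0 <= rh" "rh <= abs a" "rh <= ep"
  and y: "2*ep <= abs (y - y')" and alf: "ep^4 <= abs alf"
 shows "abs (LBINT s. (G (W v alf bt s)*amp alf bt s)*indicator (Box v alf bt y y' rh) s)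
   <= 8*V^46/(abs a*ep^10) * sqrt et * sqrt (locsq G (3*V*abs a) y')"
proof (cases "Box v alf bt y y' rh = {}")
 case True
 then show ?thesis using V_pos ep et locsq_nonneg by simp
next
 case False
 then obtain z0 z1 where z: "z0 <= z1" "Box v alf bt y y' rh = {z0..z1}" "1 <= z0" "z1 <= b"
  by (rule Box_interval)
 let ?Z = "{z0..z1}"
 have D3: "?Z \<subseteq> Dom3 alf bt" using z(2) by (auto simp: Box_def)
 have bsub: "blip M (Dom3 alf bt) f ==> blip M ?Z f" for M f using D3 by (auto simp: blip_def)
 \<comment> \<open>Lower bound for \<open>Wd\<close>: a factor \<open>ep^4/V\<close> from
   \<open>abs alf\<close>, a factor \<open>ep\<close> from the separation of the windows, and
   \<open>V^4\<close> lost in \<open>Wd_lower\<close>.\<close>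
 define m where "m = ep^5/V^5"
 have m0: "0 < m" using ep V_pos by (simp add: m_def)
 have low: "m <= abs (Wd alf bt s)" if s: "s \<in> ?Z" for s
 proof -
  note F = Box_facts[OF s[folded z(2)] rh(1,2)]
  have "ep^4/V <= abs (s1 alf s - s)" using F(6) alf V_pos by (simp add: field_simps)
  moreover have "ep <= abs (s4 bt s - s)" using F(5) y rh by linarith
  ultimately have "ep^4/V*ep <= abs (s1 alf s - s)*abs (s4 bt s - s)" using ep V_pos by (intro mult_mono) auto
  also have "... <= V^4*abs (Wd alf bt s)" using Wd_lower D3 s by blast
  finally show ?thesis using V_pos by (simp add: m_def field_simps power_numeral_reduce)
 qed
 have m1: "m <= 1"
 proof -
  have "ep^5 <= 1" using ep by (simp add: power_le_one)
  then have "ep^5 <= V^5" using V_le_pow(2)[of 5] by linarith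
  then show ?thesis using V_pos by (simp add: m_def)
 qed
 have N: "V^18/m\<^sup>2 = V^28/ep^10"
  using ep V_pos by (simp add: m_def field_simps flip: power_mult power_add)
 have bi: "blip (V^18/m\<^sup>2) ?Z (%s. 1/Wd alf bt s)"
 proof (rule blip_inverse[OF bsub[OF blip_Wd] low m0])
  have "1/m <= 1/m\<^sup>2" using m0 m1 by (simp add: field_simps power2_eq_square)
  also have "... <= V^18/m\<^sup>2" using V_le_pow(2)[of 18] by (intro divide_right_mono) auto
  finally show "1/m <= V^18/m\<^sup>2" .
 qed auto
 define M where "M = 2*(2*V^17*(V^28/ep^10))*(1/abs a)"
 have M0: "0 <= M" using V_pos ep by (simp add: M_def)
 have bq': "blip (2*V^17*(V^28/ep^10)) ?Z (%s. amp alf bt s*(1/Wd alf bt s))"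
  using bsub[OF blip_amp] bi[unfolded N] V_pos ep by (intro blip_mult) auto
 have bq: "blip M ?Z (%s. amp alf bt s*(1/Wd alf bt s)*(1/a))"
  unfolding M_def
 proof (rule blip_mult[OF bq'])
  show "blip (1/abs a) ?Z (%s. 1/a)" by (rule blipI) (auto simp: abs_divide)
 qed (use V_pos ep in auto)
 have "abs (LBINT s. (G (W v alf bt s)*(a*Wd alf bt s)*(amp alf bt s*(1/Wd alf bt s)*(1/a)))*indicator ?Z s)
  <= (2 * sqrt et * sqrt (locsq G (3*V*abs a) y'))*M*(1 + (z1 - z0))"
 proof (rule osc_bound[OF G z(1) _ _ _ bq M0])
  show "(W v alf bt has_real_derivative a*Wd alf bt s) (at s)" if "s \<in> ?Z" for s
   using W_deriv D3 that Dom3_Dom by blast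
  show "continuous_on ?Z (%s. a*Wd alf bt s)"
   by (intro continuous_intros blip_continuous[OF bsub[OF blip_Wd]])
  show "a*Wd alf bt s ~= 0" if "s \<in> ?Z" for s using low[OF that] m0 a0 by auto
  fix c d assume cd: "c \<in> W v alf bt ` ?Z" "d \<in> W v alf bt ` ?Z" "c <= d"
  have "t \<in> {y' - 3*V*abs a + et..y' + 3*V*abs a}" if "t \<in> W v alf bt ` ?Z" for t
  proof -
   have "abs (t - y') <= 2*V*abs a" 
   proof -
    obtain s where "s \<in> Box v alf bt y y' rh" "t = W v alf bt s" using \<open>t \<in> _\<close> z(2) by auto
    then show ?thesis using Box_facts(4)[OF _ rh(1,2)] by simp
   qed
   moreover have "et <= V*abs a" using et V_pos mult_right_mono[of 1 V "abs a"] by simp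
   ultimately show ?thesis using et(1) by (simp add: abs_le_iff)
  qed
  then show "abs (LBINT x. G x*indicator {c..d} x) <= 2 * sqrt et * sqrt (locsq G (3*V*abs a) y')"
   using meanzero_interval[OF G et(1) mz cd(3)] cd by blast
 qed
 also have "... <= (2 * sqrt et * sqrt (locsq G (3*V*abs a) y'))*M*V"
  using z Vb M0 et locsq_nonneg by (intro mult_left_mono) auto
 also have "... = 8*V^46/(abs a*ep^10) * sqrt et * sqrt (locsq G (3*V*abs a) y')"
  using ep a0 by (simp add: M_def field_simps flip: power_Suc power_add)
 also have "(LBINT s. (G (W v alf bt s)*(a*Wd alf bt s)*(amp alf bt s*(1/Wd alf bt s)*(1/a)))*indicator ?Z s)
   = (LBINT s. (G (W v alf bt s)*amp alf bt s)*indicator ?Z s)"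
 proof (rule Bochner_Integration.integral_cong[OF refl])
  fix s
  have "s \<in> ?Z ==> Wd alf bt s ~= 0" using low[of s] m0 by auto
  then show "(G (W v alf bt s)*(a*Wd alf bt s)*(amp alf bt s*(1/Wd alf bt s)*(1/a)))*indicator ?Z s
   = (G (W v alf bt s)*amp alf bt s)*indicator ?Z s"
   using a0 by (auto simp: indicator_def)
 qed
 finally show ?thesis by (simp add: z(2))
qed

end

section \<open>Iterated integrals in several variables\<close>

lemma bcs_prod_integral:
 fixes f :: "'a::euclidean_space \<times> 'b::euclidean_space => real"
 assumes "bcs f"
 shows "(LBINT z. f z) = (LBINT x. LBINT y. f (x, y))"
proof -
 have "integrable (lborel \<Otimes>\<^sub>M lborel) f" using bcs_integrable[OF assms] by (simp add: lborel_prod)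
 from lborel_pair.integral_fst'[OF this] show ?thesis by (simp add: lborel_prod)
qed

lemma bcs2I:
 fixes f :: "real \<times> real => real"
 assumes "f \<in> borel_measurable (borel \<Otimes>\<^sub>M borel)" "\<And>x y. abs (f (x, y)) <= M"
  "\<And>x y. f (x, y) ~= 0 ==> abs x <= R & abs y <= R"
 shows "bcs f"
proof (rule bcsI[where M = M and R = "R + R"])
 show "f \<in> borel_measurable borel" using assms(1) by (simp add: borel_prod)
 show "abs (f z) <= M" for z using assms(2) by (cases z) auto
 show "norm z <= R + R" if "f z ~= 0" for z
 proof (cases z)
  case (Pair x y)
  then show ?thesis using assms(3)[of x y] that norm_Pair_le[of x y] by simp
 qed
qed

lemma bcs3I:
 fixes f :: "real \<times> real \<times> real => real"
 assumes "f \<in> borel_measurable (borel \<Otimes>\<^sub>M (borel \<Otimes>\<^sub>M borel))" "\<And>x y z. abs (f (x, y, z)) <= M"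
  "\<And>x y z. f (x, y, z) ~= 0 ==> abs x <= R & abs y <= R & abs z <= R"
 shows "bcs f"
proof (rule bcsI[where M = M and R = "R + (R + R)"])
 show "f \<in> borel_measurable borel" using assms(1) by (simp add: borel_prod)
 show "abs (f z) <= M" for z using assms(2) by (cases z) auto
 show "norm z <= R + (R + R)" if "f z ~= 0" for z
 proof (cases z)
  case (fields x y w)
  then show ?thesis using assms(3)[of x y w] that norm_Pair_le[of x "(y, w)"] norm_Pair_le[of y w] by simp
 qed
qed

lemma bcs4I:
 fixes f :: "real \<times> real \<times> real \<times> real => real"
 assumes "f \<in> borel_measurable (borel \<Otimes>\<^sub>M (borel \<Otimes>\<^sub>M (borel \<Otimes>\<^sub>M borel)))" "\<And>x y z w. abs (f (x, y, z, w)) <= M"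
  "\<And>x y z w. f (x, y, z, w) ~= 0 ==> abs x <= R & abs y <= R & abs z <= R & abs w <= R"
 shows "bcs f"
proof (rule bcsI[where M = M and R = "R + (R + (R + R))"])
 show "f \<in> borel_measurable borel" using assms(1) by (simp add: borel_prod)
 show "abs (f z) <= M" for z using assms(2) by (cases z) auto
 show "norm z <= R + (R + (R + R))" if "f z ~= 0" for z
 proof (cases z)
  case (fields x y u w)
  then show ?thesis using assms(3)[of x y u w] that norm_Pair_le[of x "(y, u, w)"] norm_Pair_le[of y "(u, w)"] norm_Pair_le[of u w] by simp
 qed
qed

lemma bcs_assoc:
 fixes f :: "'a::euclidean_space \<times> 'b::euclidean_space \<times> 'c::euclidean_space => real"
 assumes "bcs f" shows "bcs (%((x, y), z). f (x, y, z))"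
proof -
 obtain M R where MR: "0 <= R" "\<And>x. abs (f x) <= M" "\<And>x. f x ~= 0 ==> norm x <= R"
  using bcs_ex[OF assms] by blast
 have m: "f \<in> borel_measurable (borel \<Otimes>\<^sub>M (borel \<Otimes>\<^sub>M borel))"
  using bcs_measurable[OF assms] by (simp add: borel_prod)
 have "(%z. f (fst (fst z), snd (fst z), snd z)) \<in> borel_measurable ((borel \<Otimes>\<^sub>M borel) \<Otimes>\<^sub>M borel)"
  using m by measurable
 then have "(%((x, y), z). f (x, y, z)) \<in> borel_measurable ((borel \<Otimes>\<^sub>M borel) \<Otimes>\<^sub>M borel)"
  by (simp add: case_prod_unfold)
 then have "(%((x, y), z). f (x, y, z)) \<in> borel_measurable borel" by (simp add: borel_prod)
 moreover have "norm ((x, y), z) = norm (x, y, z)" for x :: 'a and y :: 'b and z :: 'c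
  by (simp add: norm_prod_def add.assoc)
 ultimately show ?thesis using MR by (intro bcsI[where M = M and R = R]) auto
qed

lemma bcs_integral_third:
 fixes f :: "'a::euclidean_space \<times> 'b::euclidean_space \<times> 'c::euclidean_space => real"
 assumes "bcs f" shows "bcs (%(x, y). LBINT z. f (x, y, z))"
 using bcs_integral_snd[OF bcs_assoc[OF assms]] by (simp add: case_prod_unfold)

lemma bcs_swap12:
 fixes f :: "'a::euclidean_space \<times> 'b::euclidean_space \<times> 'c::euclidean_space => real"
 assumes "bcs f"
 shows "(LBINT x. LBINT y. LBINT z. f (x, y, z)) = (LBINT y. LBINT x. LBINT z. f (x, y, z))"
 using bcs_Fubini[OF bcs_integral_third[OF assms]] by simp

lemma bcs_integral4:
 fixes f :: "real \<times> real \<times> real \<times> real => real"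
 assumes "bcs f"
 shows "bcs (%(x, y, z). LBINT w. f (x, y, z, w))"
  "(LBINT x. LBINT y. LBINT z. LBINT w. f (x, y, z, w)) = (LBINT y. LBINT x. LBINT z. LBINT w. f (x, y, z, w))"
  "(LBINT x. LBINT y. LBINT z. LBINT w. f (x, y, z, w)) = (LBINT x. LBINT z. LBINT y. LBINT w. f (x, y, z, w))"
  "(LBINT x. LBINT y. LBINT z. LBINT w. f (x, y, z, w)) = (LBINT x. LBINT y. LBINT w. LBINT z. f (x, y, z, w))"
proof -
 have sl: "bcs (%z. f (x, z))" for x by (rule bcs_slice(1)[OF assms])
 have sl2: "bcs (%z. f (x, y, z))" for x y by (rule bcs_slice(1)[OF sl])
 have "bcs (%(xy, zw). f (fst xy, snd xy, zw))"
  using bcs_assoc[OF assms] by (simp add: case_prod_unfold)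
 from bcs_integral_third[OF this] show c: "bcs (%(x, y, z). LBINT w. f (x, y, z, w))"
 proof -
  assume a: "bcs (%(xa, y). LBINT z. (case (xa, y, z) of (xy, zw) => f (fst xy, snd xy, zw)))" (is "bcs ?F")
  have m: "(%(xy, z). LBINT w. f (fst xy, snd xy, z, w)) \<in> borel_measurable ((borel \<Otimes>\<^sub>M borel) \<Otimes>\<^sub>M borel)"
   using bcs_measurable[OF a] by (simp add: borel_prod)
  have m': "(%(x, y, z). ((x::real, y::real), z::real)) \<in> measurable (borel \<Otimes>\<^sub>M (borel \<Otimes>\<^sub>M borel)) ((borel \<Otimes>\<^sub>M borel) \<Otimes>\<^sub>M borel)"
   by measurable
  have m3: "(%(x, y, z). LBINT w. f (x, y, z, w)) \<in> borel_measurable (borel \<Otimes>\<^sub>M (borel \<Otimes>\<^sub>M borel))"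
   using measurable_compose[OF m' m] by (simp add: case_prod_unfold)
  obtain M R where MR: "0 <= R" "\<And>x. abs (?F x) <= M" "\<And>x. ?F x ~= 0 ==> norm x <= R"
   using bcs_ex[OF a] by blast
  show ?thesis
  proof (rule bcs3I[OF m3, where M = M and R = R])
   fix x y z :: real
   show "abs (case (x, y, z) of (x, y, z) => LBINT w. f (x, y, z, w)) <= M" using MR(2)[of "((x,y),z)"] by simp
   assume "(case (x, y, z) of (x, y, z) => LBINT w. f (x, y, z, w)) ~= 0"
   then have "norm ((x,y),z) <= R" using MR(3)[of "((x,y),z)"] by simp
   then show "abs x <= R & abs y <= R & abs z <= R"
    using norm_fst_le[of "(x,y)" z] norm_snd_le[of z "(x,y)"] norm_fst_le[of x y] norm_snd_le[of y x] by simp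
  qed
 qed
 show "(LBINT x. LBINT y. LBINT z. LBINT w. f (x, y, z, w)) = (LBINT y. LBINT x. LBINT z. LBINT w. f (x, y, z, w))"
  using bcs_swap12[OF c] by simp
 show "(LBINT x. LBINT y. LBINT z. LBINT w. f (x, y, z, w)) = (LBINT x. LBINT z. LBINT y. LBINT w. f (x, y, z, w))"
  using bcs_swap12[OF sl] by simp
 show "(LBINT x. LBINT y. LBINT z. LBINT w. f (x, y, z, w)) = (LBINT x. LBINT y. LBINT w. LBINT z. f (x, y, z, w))"
  using bcs_Fubini[OF sl2] by simp
qed

lemma bcs_int2_mono:
 fixes f g :: "real \<times> real => real"
 assumes "bcs f" "bcs g" "\<And>x y. f (x, y) <= g (x, y)"
 shows "(LBINT x. LBINT y. f (x, y)) <= (LBINT x. LBINT y. g (x, y))"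
 using assms by (intro integral_mono bcs_integrable bcs_integral_snd bcs_slice(1)) auto

lemma bcs_int3_mono:
 fixes f g :: "real \<times> real \<times> real => real"
 assumes "bcs f" "bcs g" "\<And>x y z. f (x, y, z) <= g (x, y, z)"
 shows "(LBINT x. LBINT y. LBINT z. f (x, y, z)) <= (LBINT x. LBINT y. LBINT z. g (x, y, z))"
 using bcs_int2_mono[OF bcs_integral_third[OF assms(1)] bcs_integral_third[OF assms(2)]] assms
  integral_mono[OF bcs_integrable[OF bcs_slice(1)[OF bcs_slice(1)[OF assms(1)]]] bcs_integrable[OF bcs_slice(1)[OF bcs_slice(1)[OF assms(2)]]]]
 by simp

lemma bcs_int4_mono:
 fixes f g :: "real \<times> real \<times> real \<times> real => real"
 assumes "bcs f" "bcs g" "\<And>x y z w. f (x, y, z, w) <= g (x, y, z, w)"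
 shows "(LBINT x. LBINT y. LBINT z. LBINT w. f (x, y, z, w)) <= (LBINT x. LBINT y. LBINT z. LBINT w. g (x, y, z, w))"
 using bcs_int3_mono[OF bcs_integral4(1)[OF assms(1)] bcs_integral4(1)[OF assms(2)]] assms
  integral_mono[OF bcs_integrable[OF bcs_slice(1)[OF bcs_slice(1)[OF bcs_slice(1)[OF assms(1)]]]] bcs_integrable[OF bcs_slice(1)[OF bcs_slice(1)[OF bcs_slice(1)[OF assms(2)]]]]]
 by simp

section \<open>Jacobians of the substitutions\<close>

context curve
begin

definition wt :: "real => real" where "wt s = indicator {1..b} s/s"

lemma wt_measurable [measurable]: "wt \<in> borel_measurable borel"
 unfolding wt_def[abs_def] by measurable

lemma wt_bounds: "0 <= wt s" "wt s <= indicator {1..b} s" "abs (wt s) <= 1" "wt s ~= 0 ==> s \<in> {1..b}" "wt s <= 1"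
 by (auto simp: wt_def indicator_def)

lemma \<theta>_measurable [measurable]: "\<theta> \<in> borel_measurable borel" "\<theta>' \<in> borel_measurable borel"
 unfolding \<theta>_def[abs_def] \<theta>'_def[abs_def] by measurable

text \<open>The Jacobians of \<open>p = \<theta>inv rh\<close> and, in \<open>J2\<close>, of
  \<open>p = si powr (1/kp)\<close>, cut off to the images of \<open>{1..b}\<close>. Thanks to the
  cutoff both substitutions are identities between integrals over the whole line and can be combined
  with translations.\<close>

definition J1 :: "real => real" where "J1 rh = indicator {\<theta> 1..\<theta> b} rh*(1/\<theta>' (\<theta>inv rh))"
definition J2 :: "real => real" where "J2 si = indicator {1..b powr kp} si*((1/kp) * si powr (1/kp - 1))"

lemma J_measurable [measurable]: "J1 \<in> borel_measurable borel" "J2 \<in> borel_measurable borel"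
 unfolding J1_def[abs_def] J2_def[abs_def] by measurable

lemma b_range: "{1..b} \<subseteq> {1/2..2*b}" using b1 by auto

lemma J1_bounds: "0 <= J1 rh" "J1 rh <= 2" "J1 rh ~= 0 ==> rh \<in> {\<theta> 1..\<theta> b}"
proof -
 have "1/2 <= \<theta>' (\<theta>inv rh)" if "rh \<in> {\<theta> 1..\<theta> b}"
  using \<theta>_\<theta>inv(1)[OF that _ b_range] b1 \<theta>'_bounds(1) in_big by auto
 then show "0 <= J1 rh" "J1 rh <= 2" by (auto simp: J1_def indicator_def field_simps)
 show "J1 rh ~= 0 ==> rh \<in> {\<theta> 1..\<theta> b}" by (auto simp: J1_def indicator_def)
qed

lemma J2_bounded: "\<exists>B. \<forall>si. abs (J2 si) <= B"
proof -
 have "0 < (1::real)" "1 <= b powr kp" using b1 kpos by (auto intro!: ge_one_powr_ge_zero)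
 from powr_bounds[OF this, of "1/kp - 1"] obtain C where C: "C > 0" "\<forall>s\<in>{1..b powr kp}. s powr (1/kp - 1) <= C" by blast
 have "abs (J2 si) <= (1/kp)*C" for si
 proof (cases "si \<in> {1..b powr kp}")
  case True
  then have "(1/kp) * si powr (1/kp - 1) <= (1/kp)*C" using C(2) kpos by (intro mult_left_mono) auto
  then show ?thesis using True kpos by (simp add: J2_def abs_mult)
 qed (use C kpos in \<open>auto simp: J2_def\<close>)
 then show ?thesis by blast
qed

lemma J2_support: "J2 si ~= 0 ==> si \<in> {1..b powr kp}"
 by (auto simp: J2_def indicator_def)

lemma subst_\<theta>:
 assumes \<Xi>: "bcs \<Xi>" and supp: "\<And>p. \<Xi> p ~= 0 ==> p \<in> {1..b}"
 shows "(LBINT p. \<Xi> p) = (LBINT rh. J1 rh*\<Xi> (\<theta>inv rh))"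
proof -
 have [measurable]: "\<Xi> \<in> borel_measurable borel" by (rule bcs_measurable[OF \<Xi>])
 obtain M where M: "\<And>x. abs (\<Xi> x) <= M" using bcs_bounded[OF \<Xi>] by (auto simp: bounded_iff)
 have M0: "0 <= M" using M[of 0] by linarith
 define f where "f rh = \<Xi> (\<theta>inv rh)*(1/\<theta>' (\<theta>inv rh))" for rh
 have J: "indicator {\<theta> 1..\<theta> b} rh*f rh = J1 rh*\<Xi> (\<theta>inv rh)" for rh by (simp add: f_def J1_def)
 have bJ: "bcs (%rh. J1 rh*\<Xi> (\<theta>inv rh))"
 proof (rule bcsI[where M = "2*M" and R = "max (abs (\<theta> 1)) (abs (\<theta> b))"])
  show "abs (J1 x*\<Xi> (\<theta>inv x)) <= 2*M" for x
   unfolding abs_mult using J1_bounds[of x] M by (intro mult_mono) auto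
  show "norm x <= max (abs (\<theta> 1)) (abs (\<theta> b))" if "J1 x*\<Xi> (\<theta>inv x) ~= 0" for x
   using J1_bounds(3)[of x] that by auto
 qed measurable
 have "(LBINT rh. f rh*indicator {\<theta> 1..\<theta> b} rh) = (LBINT p. f (\<theta> p)*\<theta>' p*indicator {1..b} p)"
 proof (rule integral_substitution(2))
  show "set_integrable lborel {\<theta> 1..\<theta> b} f"
   unfolding set_integrable_def real_scaleR_def J by (rule bcs_integrable[OF bJ])
  show "(\<theta> has_real_derivative \<theta>' x) (at x)" if "x \<in> {1..b}" for x using that \<theta>_deriv by auto
  show "continuous_on {1..b} \<theta>'" unfolding \<theta>'_def[abs_def] by (intro continuous_intros) auto
  show "0 <= \<theta>' x" if "x \<in> {1..b}" for x using \<theta>'_bounds(1)[OF in_big[OF that]] by linarith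
 qed (use b1 in simp)
 also have "... = (LBINT p. \<Xi> p)"
 proof (rule Bochner_Integration.integral_cong[OF refl])
  fix p
  show "f (\<theta> p)*\<theta>' p*indicator {1..b} p = \<Xi> p"
  proof (cases "p \<in> {1..b}")
   case True
   then have "\<theta>' p ~= 0" "\<theta>inv (\<theta> p) = p" using \<theta>'_bounds(1)[OF in_big[OF True]] \<theta>inv_\<theta>[OF in_big[OF True]] by auto
   then show ?thesis using True by (simp add: f_def)
  next
   case False
   then show ?thesis using supp[of p] by auto
  qed
 qed
 finally show ?thesis using J by (simp add: mult.commute)
qed

lemma subst_pow:
 assumes \<Xi>: "bcs \<Xi>" and supp: "\<And>p. \<Xi> p ~= 0 ==> p \<in> {1..b}"
 shows "(LBINT p. \<Xi> p) = (LBINT si. J2 si*\<Xi> (si powr (1/kp)))"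
proof -
 have e: "(1::real) powr (1/kp) = 1" "(b powr kp) powr (1/kp) = b" "1 <= b powr kp"
  using kpos b1 by (auto simp: powr_powr intro!: ge_one_powr_ge_zero)
 have "(LBINT x. \<Xi> x*indicator {1 powr (1/kp)..(b powr kp) powr (1/kp)} x)
   = (LBINT si. \<Xi> (si powr (1/kp))*((1/kp) * si powr (1/kp - 1))*indicator {1..b powr kp} si)"
 proof (rule integral_substitution(2))
  have "bcs (%x. indicator {1..b} x*\<Xi> x)"
   by (rule bcs_mult'[OF \<Xi>]) (auto simp: bounded_iff intro!: exI[of _ 1] indicator_le_1)
  then show "set_integrable lborel {1 powr (1/kp)..(b powr kp) powr (1/kp)} \<Xi>"
   unfolding e set_integrable_def real_scaleR_def by (rule bcs_integrable)
  show "((%si. si powr (1/kp)) has_real_derivative (1/kp)*x powr (1/kp - 1)) (at x)" if "x \<in> {1..b powr kp}" for x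
   using that by (intro derivative_eq_intros | simp)+
  show "continuous_on {1..b powr kp} (%x. (1/kp)*x powr (1/kp - 1))" by (intro continuous_intros) auto
 qed (use e kpos in auto)
 moreover have "(LBINT x. \<Xi> x*indicator {1..b} x) = (LBINT x. \<Xi> x)"
  by (rule Bochner_Integration.integral_cong) (use supp in \<open>auto simp: indicator_def\<close>)
 moreover have "(LBINT si. \<Xi> (si powr (1/kp))*((1/kp) * si powr (1/kp - 1))*indicator {1..b powr kp} si)
   = (LBINT si. J2 si*\<Xi> (si powr (1/kp)))"
  by (simp add: J2_def mult_ac)
 ultimately show ?thesis using e by simp
qed

lemma subst_\<theta>_le:
 assumes H: "bcs H" "\<And>x. 0 <= H x"
 shows "(LBINT p. indicator {1..b} p*H (c + \<theta> p)) <= 2*(LBINT x. H x)"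
proof -
 have [measurable]: "H \<in> borel_measurable borel" by (rule bcs_measurable[OF H(1)])
 obtain M R where MR: "0 <= M" "0 <= R" "\<And>x. abs (H x) <= M" "\<And>x. H x ~= 0 ==> norm x <= R" using bcs_ex[OF H(1)] by blast
 have bb: "bcs (%p. indicator {1..b} p*H (c + \<theta> p))"
  by (rule bcsI[where M = M and R = b]) (use MR in \<open>auto simp: indicator_def\<close>)
 have "(LBINT p. indicator {1..b} p*H (c + \<theta> p)) = (LBINT rh. J1 rh*(indicator {1..b} (\<theta>inv rh)*H (c + \<theta> (\<theta>inv rh))))"
  by (rule subst_\<theta>[OF bb]) (auto simp: indicator_def split: if_splits)
 also have "... <= (LBINT rh. 2*H (c + rh))"
 proof (rule integral_mono)
  have i: "bcs (%rh. H (c + rh))" using bcs_shift[OF H(1), of "-c"] by (simp add: add.commute)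
  then show i2: "integrable lborel (%rh. 2*H (c + rh))" by (intro bcs_integrable bcs_cmult)
  have *: "J1 rh*(indicator {1..b} (\<theta>inv rh)*H (c + \<theta> (\<theta>inv rh))) <= 2*H (c + rh)"
    "0 <= J1 rh*(indicator {1..b} (\<theta>inv rh)*H (c + \<theta> (\<theta>inv rh)))" for rh
  proof -
   have r: "\<theta> (\<theta>inv rh) = rh" if "J1 rh ~= 0"
    using \<theta>_\<theta>inv(2)[OF J1_bounds(3)[OF that] _ b_range] b1 by simp
   show "J1 rh*(indicator {1..b} (\<theta>inv rh)*H (c + \<theta> (\<theta>inv rh))) <= 2*H (c + rh)"
   proof (cases "J1 rh = 0")
    case False
    have "J1 rh*(indicator {1..b} (\<theta>inv rh)*H (c + \<theta> (\<theta>inv rh))) <= 2*(1*H (c + rh))"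
     unfolding r[OF False] using J1_bounds[of rh] H(2) by (intro mult_mono) (auto simp: indicator_def)
    then show ?thesis by simp
   qed (use H in simp)
   show "0 <= J1 rh*(indicator {1..b} (\<theta>inv rh)*H (c + \<theta> (\<theta>inv rh)))"
    using J1_bounds H by simp
  qed
  show "integrable lborel (%rh. J1 rh*(indicator {1..b} (\<theta>inv rh)*H (c + \<theta> (\<theta>inv rh))))"
   by (rule Bochner_Integration.integrable_bound[OF i2]) (use * H(2) in auto)
  show "J1 rh*(indicator {1..b} (\<theta>inv rh)*H (c + \<theta> (\<theta>inv rh))) <= 2*H (c + rh)" for rh by (rule *)
 qed
 also have "... = 2*(LBINT x. H x)" using integral_shift'[of H c] by (simp add: add.commute)
 finally show ?thesis .
qed

end

lemma bcs_swap_pairs: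
 fixes f :: "real \<times> real \<times> real \<times> real => real"
 assumes "bcs f"
 shows "(LBINT x. LBINT y. LBINT z. LBINT w. f (x, y, z, w)) = (LBINT z. LBINT w. LBINT x. LBINT y. f (x, y, z, w))"
proof -
 have a: "bcs (%(p, zw). f (fst p, snd p, zw))" using bcs_assoc[OF assms] by (simp add: case_prod_unfold)
 have b: "bcs (%p. LBINT zw. f (fst p, snd p, zw))" using bcs_integral_snd[OF a] by simp
 have c: "bcs (%zw. LBINT p. f (fst p, snd p, zw))" using bcs_integral_fst[OF a] by simp
 have sl: "bcs (%zw. f (x, y, zw))" for x y by (rule bcs_slice(1)[OF bcs_slice(1)[OF assms]])
 have sl': "bcs (%p. f (fst p, snd p, zw))" for zw using bcs_slice(2)[OF a, of zw] by simp
 have "(LBINT x. LBINT y. LBINT z. LBINT w. f (x, y, z, w)) = (LBINT x. LBINT y. LBINT zw. f (x, y, zw))"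
  using bcs_prod_integral[OF sl] by simp
 also have "... = (LBINT p. LBINT zw. f (fst p, snd p, zw))" using bcs_prod_integral[OF b] by simp
 also have "... = (LBINT zw. LBINT p. f (fst p, snd p, zw))" using bcs_Fubini[OF a] by simp
 also have "... = (LBINT z. LBINT w. LBINT p. f (fst p, snd p, (z, w)))" using bcs_prod_integral[OF c] by simp
 also have "... = (LBINT z. LBINT w. LBINT x. LBINT y. f (x, y, z, w))" using bcs_prod_integral[OF sl'] by simp
 finally show ?thesis .
qed

lemma bcs_rot3:
 fixes f :: "real \<times> real \<times> real => real"
 assumes "bcs f"
 shows "(LBINT x. LBINT y. LBINT z. f (x, y, z)) = (LBINT z. LBINT x. LBINT y. f (x, y, z))"
proof -
 have a: "bcs (%(p, z). f (fst p, snd p, z))" using bcs_assoc[OF assms] by (simp add: case_prod_unfold)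
 have b: "bcs (%p. LBINT z. f (fst p, snd p, z))" using bcs_integral_snd[OF a] by simp
 have sl': "bcs (%p. f (fst p, snd p, z))" for z using bcs_slice(2)[OF a, of z] by simp
 have "(LBINT x. LBINT y. LBINT z. f (x, y, z)) = (LBINT p. LBINT z. f (fst p, snd p, z))"
  using bcs_prod_integral[OF b] by simp
 also have "... = (LBINT z. LBINT p. f (fst p, snd p, z))" using bcs_Fubini[OF a] by simp
 also have "... = (LBINT z. LBINT x. LBINT y. f (x, y, z))" using bcs_prod_integral[OF sl'] by simp
 finally show ?thesis .
qed

lemma bcs_first_last:
 fixes f :: "real \<times> real \<times> real \<times> real => real"
 assumes "bcs f"
 shows "(LBINT s. LBINT x. LBINT y. LBINT z. f (s, x, y, z)) = (LBINT x. LBINT y. LBINT z. LBINT s. f (s, x, y, z))"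
  "bcs (%(x, y, z). LBINT s. f (s, x, y, z))"
proof -
 have sl: "bcs (%z. f (s, z))" for s by (rule bcs_slice(1)[OF assms])
 have sl2: "bcs (%z. f (s, x, z))" for s x by (rule bcs_slice(1)[OF sl])
 have i: "bcs (%q. LBINT s. f (s, q))" by (rule bcs_integral_fst[OF assms])
 then show "bcs (%(x, y, z). LBINT s. f (s, x, y, z))" by (simp add: case_prod_unfold)
 have i2: "bcs (%q. LBINT s. f (s, x, q))" for x by (rule bcs_slice(1)[OF i])
 have "(LBINT s. LBINT x. LBINT y. LBINT z. f (s, x, y, z)) = (LBINT s. LBINT q. f (s, q))"
  using bcs_prod_integral[OF sl] bcs_prod_integral[OF sl2] by simp
 also have "... = (LBINT q. LBINT s. f (s, q))" by (rule bcs_Fubini[OF assms])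
 also have "... = (LBINT x. LBINT y. LBINT z. LBINT s. f (s, x, y, z))"
  using bcs_prod_integral[OF i] bcs_prod_integral[OF i2] by simp
 finally show "(LBINT s. LBINT x. LBINT y. LBINT z. f (s, x, y, z)) = (LBINT x. LBINT y. LBINT z. LBINT s. f (s, x, y, z))" .
qed

section \<open>The first kernel and the square integrals over small windows\<close>

text \<open>Here \<open>et\<close> is the length on which \<open>G\<close> has mean zero and
  \<open>ep\<close> measures the gain. The near-diagonal part of the second squaring is of size
  \<open>ep^4\<close>. The far part gains \<open>sqrt et\<close> and loses \<open>ep^10\<close> by
  \<open>inner_osc\<close>, so \<open>sqrt et\<close> has to be of order \<open>ep^14\<close>: this
  is where the exponent 28 comes from.\<close>

locale smoothing = curve kp b a V for kp b a V :: real +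
 fixes G :: "real => real" and et ep :: real
 assumes G: "bcs G" and et: "0 < et" "et <= abs a*ep^28" and ep: "0 < ep" "ep <= 1"
  and mz: "\<And>z::int. (LBINT x. G x*indicator {of_int z*et..(of_int z + 1)*et} x) = 0"
begin

text \<open>The window side is small against \<open>abs a\<close>, so that a window does not disturb
  the localisation of the arguments of \<open>G\<close>, and small against \<open>ep\<close>, so
  that \<open>y' - y\<close> determines \<open>x' - x\<close> up to \<open>ep\<close>. The radius
  \<open>r\<close> below contains all arguments of \<open>G\<close> met from one window.\<close>

definition rh where "rh = abs a*ep"
definition r where "r = 3*V*abs a"

lemma rh_facts: "0 < rh" "rh <= abs a" "rh <= ep"
 using a0 ep a_le mult_left_mono[of ep 1 "abs a"] mult_right_mono[of "abs a" 1 ep] by (auto simp: rh_def)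

lemma et_le_a: "et <= abs a"
proof -
 have "abs a*ep^28 <= abs a*1" using ep by (intro mult_left_mono power_le_one) auto
 then show ?thesis using et by linarith
qed

lemma G_measurable [measurable]: "G \<in> borel_measurable borel" by (rule bcs_measurable[OF G])

text \<open>The integrand of the kernel \<open>K\<close> of the first squaring, in the variable
  \<open>s = x - u\<close> where \<open>u\<close> is the argument of \<open>F\<close>; the second
  parameter \<open>s + (x' - x)\<close> is \<open>x' - u\<close>.\<close>

definition g :: "real => real => real => real" where
 "g x x' s = wt s*wt (s + (x' - x))*(G (x - a * s powr kp)*G (x' - a*(s + (x' - x)) powr kp))"

lemma g_ex: "\<exists>M R. 0 <= M & (\<forall>x x' s. abs (g x x' s) <= M &
  (g x x' s ~= 0 --> abs x <= R & abs x' <= R & abs s <= R & s \<in> {1..b} & s + (x' - x) \<in> {1..b}))"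
proof -
 obtain M R where MR: "0 <= M" "0 <= R" "\<And>x. abs (G x) <= M" "\<And>x. G x ~= 0 ==> norm x <= R" using bcs_ex[OF G] by blast
 have pw: "abs (a*t powr kp) <= V*abs a" if "t \<in> {1..b}" for t
  using mult_left_mono[OF pk_ub[OF in_big[OF that]], of "abs a"] by (simp add: abs_mult mult.commute)
 have "abs (g x x' s) <= 1*1*(M*M)" for x x' s
  unfolding g_def abs_mult using wt_bounds MR by (intro mult_mono) auto
 moreover have "abs x <= R + V*abs a + b & abs x' <= R + V*abs a + b & abs s <= R + V*abs a + b & s \<in> {1..b} & s + (x' - x) \<in> {1..b}"
  if nz: "g x x' s ~= 0" for x x' s
 proof -
  have s: "s \<in> {1..b}" "s + (x' - x) \<in> {1..b}" using nz wt_bounds(4) by (auto simp: g_def)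
  have "abs (x - a * s powr kp) <= R" "abs (x' - a*(s + (x' - x)) powr kp) <= R"
   using nz MR(4)[of "x - a * s powr kp"] MR(4)[of "x' - a*(s + (x' - x)) powr kp"] by (auto simp: g_def)
  with pw[OF s(1)] pw[OF s(2)] have "abs x <= R + V*abs a" "abs x' <= R + V*abs a" by linarith+
  moreover have "0 <= V*abs a" using V_pos by simp
  ultimately show ?thesis using s MR(2) b1 by auto
 qed
 ultimately show ?thesis using MR(1) by (intro exI[of _ "M*M"] exI[of _ "R + V*abs a + b"]) auto
qed

lemma g_measurable: "(%(x, x', s). g x x' s) \<in> borel_measurable (borel \<Otimes>\<^sub>M (borel \<Otimes>\<^sub>M borel))"
 unfolding g_def by measurable

lemma g_bcs: "bcs (%(x, x', s). g x x' s)"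
proof -
 obtain M R where MR: "\<And>x x' s. abs (g x x' s) <= M" "\<And>x x' s. g x x' s ~= 0 ==> abs x <= R & abs x' <= R & abs s <= R"
  using g_ex by blast
 show ?thesis by (rule bcs3I[OF g_measurable, where M = M and R = R]) (use MR in auto)
qed

definition K where "K x x' = (LBINT s. g x x' s)"

lemma K_bcs: "bcs (%(x, x'). K x x')"
 using bcs_integral_third[OF g_bcs] by (simp add: K_def)

definition Ind :: "real => real => real => real => real" where
 "Ind y y' x x' = indicator {y..y+rh} x*indicator {y'..y'+rh} x'"

lemma Ind_measurable [measurable]: "(%(x, x'). Ind y y' x x') \<in> borel_measurable (borel \<Otimes>\<^sub>M borel)"
 unfolding Ind_def by measurable

lemma Ind_bounds: "0 <= Ind y y' x x'" "Ind y y' x x' <= 1" "Ind y y' x x' ~= 0 ==> x \<in> {y..y+rh} & x' \<in> {y'..y'+rh}"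
 by (auto simp: Ind_def indicator_def)

text \<open>Selects \<open>abs alf < ep^4\<close>, the region where the speed of the fourth argument
  may be too small to be of use.\<close>

definition near :: "real => real => real" where "near s t = (if abs (t powr kp - s powr kp) < ep^4 then 1 else 0)"

lemma near_measurable [measurable]: "(%(s, t). near s t) \<in> borel_measurable (borel \<Otimes>\<^sub>M borel)"
 unfolding near_def by measurable

lemma near_sym: "near s t = near t s" by (simp add: near_def abs_minus_commute)

definition Th where "Th y y' x x' s t = Ind y y' x x'*(g x x' s*g x x' t)"

lemma Th_bcs:
 assumes [measurable]: "(%(s, t). c s t) \<in> borel_measurable (borel \<Otimes>\<^sub>M borel)" and c: "\<And>s t. abs (c s t) <= 1"
 shows "bcs (%(x, x', s, t). c s t*Th y y' x x' s t)"
proof -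
 obtain M R where MR: "0 <= M" "\<And>x x' s. abs (g x x' s) <= M" "\<And>x x' s. g x x' s ~= 0 ==> abs x <= R & abs x' <= R & abs s <= R"
  using g_ex by blast
 have [measurable]: "(%(x, x', s). g x x' s) \<in> borel_measurable (borel \<Otimes>\<^sub>M (borel \<Otimes>\<^sub>M borel))" by (rule g_measurable)
 have m: "(%(x, x', s, t). c s t*Th y y' x x' s t) \<in> borel_measurable (borel \<Otimes>\<^sub>M (borel \<Otimes>\<^sub>M (borel \<Otimes>\<^sub>M borel)))"
  unfolding Th_def Ind_def g_def by measurable
 have "abs (c s t*Th y y' x x' s t) <= 1*(1*(M*M))" for x x' s t
  unfolding Th_def abs_mult using MR Ind_bounds[of y y' x x'] c by (intro mult_mono) auto
 moreover have "abs x <= R & abs x' <= R & abs s <= R & abs t <= R" if "c s t*Th y y' x x' s t ~= 0" for x x' s t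
  using that MR(3)[of x x' s] MR(3)[of x x' t] by (auto simp: Th_def)
 ultimately show ?thesis by (intro bcs4I[OF m, where M = "1*(1*(M*M))" and R = R]) auto
qed

lemma J_expand:
 "(LBINT x. LBINT x'. Ind y y' x x'*(K x x')\<^sup>2)
  = (LBINT x. LBINT x'. LBINT s. LBINT t. near s t*Th y y' x x' s t)
  + (LBINT x. LBINT x'. LBINT s. LBINT t. (1 - near s t)*Th y y' x x' s t)"
proof -
 have n: "bcs (%(x, x', s, t). near s t*Th y y' x x' s t)"
  by (rule Th_bcs) (measurable, auto simp: near_def)
 have f: "bcs (%(x, x', s, t). (1 - near s t)*Th y y' x x' s t)"
  by (rule Th_bcs) (measurable, auto simp: near_def)
 have o: "bcs (%(x, x', s, t). 1*Th y y' x x' s t)"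
  by (rule Th_bcs) (simp_all add: case_prod_unfold)
 have 1: "Ind y y' x x'*(K x x')\<^sup>2 = (LBINT s. LBINT t. 1*Th y y' x x' s t)" for x x'
  by (simp add: Th_def K_def power2_eq_square)
 have 2: "(LBINT x. LBINT x'. LBINT s. LBINT t. h (x, x', s, t)) = (LBINT z. h z)"
  if h: "bcs h" for h :: "real \<times> real \<times> real \<times> real => real"
  using bcs_prod_integral[OF h] bcs_prod_integral[OF bcs_slice(1)[OF h]]
   bcs_prod_integral[OF bcs_slice(1)[OF bcs_slice(1)[OF h]]] by simp
 have "(LBINT z. (case z of (x, x', s, t) => 1*Th y y' x x' s t))
   = (LBINT z. (case z of (x, x', s, t) => near s t*Th y y' x x' s t) + (case z of (x, x', s, t) => (1 - near s t)*Th y y' x x' s t))"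
  by (rule Bochner_Integration.integral_cong) (auto simp: algebra_simps)
 also have "... = (LBINT z. (case z of (x, x', s, t) => near s t*Th y y' x x' s t)) + (LBINT z. (case z of (x, x', s, t) => (1 - near s t)*Th y y' x x' s t))"
  by (intro Bochner_Integration.integral_add bcs_integrable n f)
 finally show ?thesis using 2[OF n] 2[OF f] 2[OF o] 1 by simp
qed

text \<open>Majorant for the near part: \<open>2*abs (p*q) <= p\<^sup>2 + q\<^sup>2\<close> splits
  the product of four values of \<open>G\<close> into two products of two squares, and
  \<open>Ad\<close> is one of them; the other arises by exchanging \<open>s\<close> and
  \<open>t\<close>.\<close>

definition Ad where
 "Ad y y' x x' s t = Ind y y' x x'*(indicator {1..b} s*indicator {1..b} t*indicator {1..b} (t + (x' - x)) *
   ((G (x - a * s powr kp))\<^sup>2*(G (x' - a*(t + (x' - x)) powr kp))\<^sup>2))"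

lemma Ad_bcs: "bcs (%(x, x', s, t). near s t*Ad y y' x x' s t)" "bcs (%(x, x', s, t). near s t*Ad y y' x x' t s)"
proof -
 obtain M where M: "0 <= M" "\<And>x. abs (G x) <= M" using bcs_ex[OF G] by blast
 have GM: "(G x)\<^sup>2 <= M\<^sup>2" for x using M(2)[of x] by (metis abs_ge_zero power2_abs power_mono)
 define R where "R = abs y + abs y' + rh + b"
 have B: "abs (near s t*Ad y y' x x' u v) <= 1*(1*(1*1*1*(M\<^sup>2*M\<^sup>2)))" for x x' s t u v
  unfolding Ad_def abs_mult using Ind_bounds[of y y' x x'] M GM
  by (intro mult_mono) (auto simp: near_def indicator_def)
 have S: "abs x <= R & abs x' <= R & abs u <= R & abs v <= R" if "near s t*Ad y y' x x' u v ~= 0" for x x' s t u v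
  using that rh_facts b1 Ind_bounds(3)[of y y' x x'] by (auto simp: Ad_def R_def indicator_def split: if_splits)
 have m1: "(%(x, x', s, t). near s t*Ad y y' x x' s t) \<in> borel_measurable (borel \<Otimes>\<^sub>M (borel \<Otimes>\<^sub>M (borel \<Otimes>\<^sub>M borel)))"
  unfolding Ad_def Ind_def near_def by measurable
 have m2: "(%(x, x', s, t). near s t*Ad y y' x x' t s) \<in> borel_measurable (borel \<Otimes>\<^sub>M (borel \<Otimes>\<^sub>M (borel \<Otimes>\<^sub>M borel)))"
  unfolding Ad_def Ind_def near_def by measurable
 show "bcs (%(x, x', s, t). near s t*Ad y y' x x' s t)"
  by (rule bcs4I[OF m1, where M = "1*(1*(1*1*1*(M\<^sup>2*M\<^sup>2)))" and R = R]) (use B S in auto)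
 show "bcs (%(x, x', s, t). near s t*Ad y y' x x' t s)"
 proof (rule bcs4I[OF m2, where M = "1*(1*(1*1*1*(M\<^sup>2*M\<^sup>2)))" and R = R])
  fix x x' s t
  show "abs (case (x, x', s, t) of (x, x', s, t) => near s t*Ad y y' x x' t s) <= 1*(1*(1*1*1*(M\<^sup>2*M\<^sup>2)))"
   using B[of s t x x' t s] by simp
  show "abs x <= R & abs x' <= R & abs s <= R & abs t <= R"
   if "(case (x, x', s, t) of (x, x', s, t) => near s t*Ad y y' x x' t s) ~= 0"
   using S[of s t x x' t s] that by simp
 qed
qed

lemma pow_le_r: "t \<in> {1..b} ==> abs (a*t powr kp) + rh <= r"
proof -
 assume t: "t \<in> {1..b}"
 have "abs (a*t powr kp) <= V*abs a"
  using mult_left_mono[OF pk_ub[OF in_big[OF t]], of "abs a"] by (simp add: abs_mult mult.commute)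
 moreover have "rh <= V*abs a" using rh_facts V_pos mult_right_mono[of 1 V "abs a"] by simp
 moreover have "0 <= V*abs a" using V_pos by simp
 ultimately show ?thesis unfolding r_def by linarith
qed

lemma locsq_bcs: "bcs (%x. (G x)\<^sup>2*indicator {c - r..c + r} x)"
 by (rule bcs_mult[OF bcs_power2[OF G]]) (auto simp: bounded_iff intro!: exI[of _ 1] indicator_le_1)

text \<open>For fixed \<open>s\<close> and \<open>t\<close>, integrating over \<open>x'\<close> and
  then over \<open>x\<close> turns the two squares into the two local norms, up to the Jacobian of
  \<open>\<theta>\<close>. What remains is the measure of the pairs \<open>(s, t)\<close>, and
  \<open>pk_low\<close> confines \<open>t\<close> to distance \<open>V*ep^4\<close> from
  \<open>s\<close>.\<close>

lemma J_near:
 "(LBINT x. LBINT x'. LBINT s. LBINT t. near s t*Th y y' x x' s t)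
  <= 4*V\<^sup>2*ep^4*locsq G r y*locsq G r y'"
proof -
 have n: "bcs (%(x, x', s, t). near s t*Th y y' x x' s t)"
  by (rule Th_bcs) (measurable, auto simp: near_def)
 define I1 where "I1 = (LBINT x. LBINT x'. LBINT s. LBINT t. near s t*Ad y y' x x' s t)"
 have I2: "(LBINT x. LBINT x'. LBINT s. LBINT t. near s t*Ad y y' x x' t s) = I1"
  using bcs_integral4(4)[OF Ad_bcs(2)[of y y']] by (simp add: I1_def near_sym)
 have pt: "near s t*Th y y' x x' s t <= (1/2)*(near s t*Ad y y' x x' s t) + (1/2)*(near s t*Ad y y' x x' t s)" for x x' s t
 proof -
  define G1 where "G1 = G (x - a * s powr kp)"
  define G2 where "G2 = G (x' - a*(s + (x' - x)) powr kp)"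
  define G3 where "G3 = G (x - a*t powr kp)"
  define G4 where "G4 = G (x' - a*(t + (x' - x)) powr kp)"
  define Q where "Q = (1/2)*(G1\<^sup>2*G4\<^sup>2) + (1/2)*(G3\<^sup>2*G2\<^sup>2)"
  have q: "abs (G1*G2*(G3*G4)) <= Q"
  proof -
   have "2*abs (G1*G4)*abs (G3*G2) <= (abs (G1*G4))\<^sup>2 + (abs (G3*G2))\<^sup>2" by (rule sum_squares_bound)
   then show ?thesis by (simp add: Q_def abs_mult power_mult_distrib mult_ac)
  qed
  define ww where "ww = wt s*wt (s + (x' - x))*(wt t*wt (t + (x' - x)))"
  define ii where "ii = indicat_real {1..b} s*indicator {1..b} (s + (x' - x))*(indicator {1..b} t*indicator {1..b} (t + (x' - x)))"
  have ww: "0 <= ww" "ww <= ii" unfolding ww_def ii_def using wt_bounds by (auto intro!: mult_mono mult_nonneg_nonneg)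
  have "g x x' s*g x x' t = ww*(G1*G2*(G3*G4))"
   unfolding g_def ww_def G1_def G2_def G3_def G4_def by (simp add: mult_ac)
  also have "... <= ww*Q" using q ww by (intro mult_left_mono) auto
  also have "... <= ii*Q" using q ww by (intro mult_right_mono) auto
  finally have gg: "g x x' s*g x x' t <= ii*Q" .
  have "near s t*Th y y' x x' s t <= near s t*(Ind y y' x x'*(ii*Q))"
   unfolding Th_def using gg Ind_bounds(1) by (intro mult_left_mono) (auto simp: near_def)
  also have "... <= near s t*((1/2)*Ad y y' x x' s t + (1/2)*Ad y y' x x' t s)"
  proof (rule mult_left_mono)
   have "ii*Q <= (1/2)*(indicator {1..b} s*indicator {1..b} t*indicator {1..b} (t + (x' - x))*(G1\<^sup>2*G4\<^sup>2))
     + (1/2)*(indicator {1..b} t*indicator {1..b} s*indicator {1..b} (s + (x' - x))*(G3\<^sup>2*G2\<^sup>2))"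
    unfolding Q_def ii_def by (auto simp: indicator_def)
   then have "Ind y y' x x'*(ii*Q) <= Ind y y' x x'*((1/2)*(indicator {1..b} s*indicator {1..b} t*indicator {1..b} (t + (x' - x))*(G1\<^sup>2*G4\<^sup>2))
     + (1/2)*(indicator {1..b} t*indicator {1..b} s*indicator {1..b} (s + (x' - x))*(G3\<^sup>2*G2\<^sup>2)))"
    by (intro mult_left_mono Ind_bounds)
   also have "... = (1/2)*Ad y y' x x' s t + (1/2)*Ad y y' x x' t s"
    unfolding Ad_def G1_def G2_def G3_def G4_def by (simp add: algebra_simps)
   finally show "Ind y y' x x'*(ii*Q) <= (1/2)*Ad y y' x x' s t + (1/2)*Ad y y' x x' t s" .
  qed (simp add: near_def)
  finally show ?thesis by (simp add: algebra_simps)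
 qed
 have hb: "bcs (%z. (1/2)*(case z of (x, x', s, t) => near s t*Ad y y' x x' s t) + (1/2)*(case z of (x, x', s, t) => near s t*Ad y y' x x' t s))"
  by (intro bcs_add bcs_cmult Ad_bcs)
 have "(LBINT x. LBINT x'. LBINT s. LBINT t. near s t*Th y y' x x' s t)
  <= (LBINT x. LBINT x'. LBINT s. LBINT t. (1/2)*(near s t*Ad y y' x x' s t) + (1/2)*(near s t*Ad y y' x x' t s))"
  using bcs_int4_mono[OF n hb] pt by simp
 also have "... = (1/2)*I1 + (1/2)*I1"
 proof -
  have 2: "(LBINT x. LBINT x'. LBINT s. LBINT t. h (x, x', s, t)) = (LBINT z. h z)"
   if h: "bcs h" for h :: "real \<times> real \<times> real \<times> real => real"
   using bcs_prod_integral[OF h] bcs_prod_integral[OF bcs_slice(1)[OF h]]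
    bcs_prod_integral[OF bcs_slice(1)[OF bcs_slice(1)[OF h]]] by simp
  have "(LBINT z. (1/2)*(case z of (x, x', s, t) => near s t*Ad y y' x x' s t) + (1/2)*(case z of (x, x', s, t) => near s t*Ad y y' x x' t s))
   = (1/2)*(LBINT z. (case z of (x, x', s, t) => near s t*Ad y y' x x' s t)) + (1/2)*(LBINT z. (case z of (x, x', s, t) => near s t*Ad y y' x x' t s))"
   by (subst Bochner_Integration.integral_add) (intro bcs_integrable bcs_cmult Ad_bcs, intro bcs_integrable bcs_cmult Ad_bcs, simp)
  then show ?thesis using 2[OF hb] 2[OF Ad_bcs(1)[of y y']] 2[OF Ad_bcs(2)[of y y']] I2 by (simp add: I1_def)
 qed
 also have "... = I1" by simp
 also have "I1 = (LBINT s. LBINT t. LBINT x. LBINT x'. near s t*Ad y y' x x' s t)"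
  unfolding I1_def using bcs_swap_pairs[OF Ad_bcs(1)[of y y']] by simp
 also have "... <= (LBINT s. LBINT t. (2*locsq G r y*locsq G r y')*(indicator {1..b} s*indicator {s - V*ep^4..s + V*ep^4} t))"
 proof -
  have inner: "(LBINT x. LBINT x'. near s t*Ad y y' x x' s t) <=
    (2*locsq G r y*locsq G r y')*(indicator {1..b} s*indicator {s - V*ep^4..s + V*ep^4} t)" for s t
  proof (cases "near s t = 1 & s \<in> {1..b} & t \<in> {1..b}")
   case False
   then have "near s t*Ad y y' x x' s t = 0" for x x' by (auto simp: near_def Ad_def)
   then have z: "(LBINT x. LBINT x'. near s t*Ad y y' x x' s t) = 0"
    by (simp only: Bochner_Integration.integral_zero)
   show ?thesis unfolding z using locsq_nonneg[of G r] by (intro mult_nonneg_nonneg) auto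
  next
   case True
   then have st: "s \<in> {1..b}" "t \<in> {1..b}" "abs (t powr kp - s powr kp) < ep^4" by (auto simp: near_def split: if_splits)
   have "abs (t - s) <= V*abs (t powr kp - s powr kp)" by (rule pk_low[OF in_big[OF st(2)] in_big[OF st(1)]])
   also have "... <= V*ep^4" using st(3) V_pos by (intro mult_left_mono) auto
   finally have ts: "t \<in> {s - V*ep^4..s + V*ep^4}" by auto
   have inn: "(LBINT x'. Ad y y' x x' s t) <= (2*locsq G r y')*((G (x - a * s powr kp))\<^sup>2*indicator {y - r..y + r} (x - a * s powr kp))" for x
   proof (cases "x \<in> {y..y+rh}")
    case False
    then have "Ad y y' x x' s t = 0" for x' by (auto simp: Ad_def Ind_def)
    then have "(LBINT x'. Ad y y' x x' s t) = 0" by (simp only: Bochner_Integration.integral_zero)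
    then show ?thesis using locsq_nonneg[of G r y'] by simp
   next
    case True
    have xr: "x - a * s powr kp \<in> {y - r..y + r}" using pow_le_r[OF st(1)] True rh_facts by auto
    define H where "H x = (G x)\<^sup>2*indicator {y' - r..y' + r} x" for x
    have Hb: "bcs H" unfolding H_def[abs_def] by (rule locsq_bcs)
    \<comment> \<open>With \<open>p = t + (x' - x)\<close> the last argument
      \<open>x' - a*p powr kp\<close> becomes \<open>(x - t) + \<theta> p\<close>, so that
      \<open>subst_\<theta>_le\<close> applies.\<close>
    have "(LBINT x'. Ad y y' x x' s t) = (LBINT p. Ad y y' x (p + (x - t)) s t)"
     using integral_shift'[of "%x'. Ad y y' x x' s t" "x - t"] by simp
    also have "... <= (LBINT p. (G (x - a * s powr kp))\<^sup>2*(indicator {1..b} p*H ((x - t) + \<theta> p)))"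
    proof (rule integral_mono)
     have [measurable]: "H \<in> borel_measurable borel" by (rule bcs_measurable[OF Hb])
     obtain M where M: "\<And>x. abs (H x) <= M" using bcs_ex[OF Hb] by blast
     have "bcs (%p. indicator {1..b} p*H ((x - t) + \<theta> p))"
      by (rule bcs_mult[OF bcs_indicator]) (use M in \<open>auto simp: bounded_iff\<close>)
     then show i: "integrable lborel (%p. (G (x - a * s powr kp))\<^sup>2*(indicator {1..b} p*H ((x - t) + \<theta> p)))"
      by (intro bcs_integrable bcs_cmult)
     have le: "Ad y y' x (p + (x - t)) s t <= (G (x - a * s powr kp))\<^sup>2*(indicator {1..b} p*H ((x - t) + \<theta> p))" for p
     proof (cases "p \<in> {1..b} & p + (x - t) \<in> {y'..y'+rh}")
      case True
      have e: "p + (x - t) - a*p powr kp = (x - t) + \<theta> p" by (simp add: \<theta>_def)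
      have "(x - t) + \<theta> p \<in> {y' - r..y' + r}"
       using pow_le_r[of p] True rh_facts unfolding e[symmetric] by auto
      then have H: "H ((x - t) + \<theta> p) = (G ((x - t) + \<theta> p))\<^sup>2" by (simp add: H_def)
      have e2: "t + (p + (x - t) - x) = p" by simp
      show ?thesis unfolding Ad_def e2 e H using True Ind_bounds(2)[of y y' x "p + (x - t)"] Ind_bounds(1)[of y y' x "p + (x - t)"] st
       by (auto simp: mult_left_le_one_le)
     next
      case False
      then have "Ad y y' x (p + (x - t)) s t = 0" by (auto simp: Ad_def Ind_def)
      then show ?thesis by (simp add: H_def)
     qed
     have nn: "0 <= Ad y y' x (p + (x - t)) s t" for p using Ind_bounds(1) by (simp add: Ad_def)
     have [measurable]: "(%p. Ad y y' x (p + (x - t)) s t) \<in> borel_measurable borel" unfolding Ad_def Ind_def by measurable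
     show "integrable lborel (%p. Ad y y' x (p + (x - t)) s t)"
     proof (rule Bochner_Integration.integrable_bound[OF i])
      show "AE p in lborel. norm (Ad y y' x (p + (x - t)) s t) <= norm ((G (x - a * s powr kp))\<^sup>2*(indicator {1..b} p*H ((x - t) + \<theta> p)))"
      proof (rule AE_I2)
       fix p
       show "norm (Ad y y' x (p + (x - t)) s t) <= norm ((G (x - a * s powr kp))\<^sup>2*(indicator {1..b} p*H ((x - t) + \<theta> p)))"
        unfolding real_norm_def abs_of_nonneg[OF nn[of p]] abs_of_nonneg[OF order_trans[OF nn[of p] le[of p]]] by (rule le)
      qed
     qed simp
     show "Ad y y' x (p + (x - t)) s t <= (G (x - a * s powr kp))\<^sup>2*(indicator {1..b} p*H ((x - t) + \<theta> p))" for p by (rule le)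
    qed
    also have "... = (G (x - a * s powr kp))\<^sup>2*(LBINT p. indicator {1..b} p*H ((x - t) + \<theta> p))" by simp
    also have "... <= (G (x - a * s powr kp))\<^sup>2*(2*(LBINT x. H x))"
     by (intro mult_left_mono subst_\<theta>_le[OF Hb]) (auto simp: H_def)
    also have "(LBINT x. H x) = locsq G r y'" by (simp add: H_def locsq_def)
    finally show ?thesis using xr by (simp add: mult_ac)
   qed
   have nearA: "near s t*Ad y y' x x' s t = Ad y y' x x' s t" for x x' using True by simp
   have sb: "bcs (%(x, x'). Ad y y' x x' s t)"
    using bcs_slice(2)[of "%((x, x'), (s, t)). near s t*Ad y y' x x' s t" "(s, t)"] bcs_assoc[OF Ad_bcs(1)[of y y']]
    by (simp add: case_prod_unfold nearA)
   have sb': "bcs (%x. LBINT x'. Ad y y' x x' s t)" using bcs_integral_snd[OF sb] by simp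
   have "(LBINT x. LBINT x'. near s t*Ad y y' x x' s t) = (LBINT x. LBINT x'. Ad y y' x x' s t)"
    by (simp only: nearA)
   also have "... <= (LBINT x. (2*locsq G r y')*((G (x - a * s powr kp))\<^sup>2*indicator {y - r..y + r} (x - a * s powr kp)))"
    by (intro integral_mono inn bcs_integrable sb' bcs_cmult bcs_shift[OF locsq_bcs])
   also have "... = (2*locsq G r y')*(LBINT x. ((G (x - a * s powr kp))\<^sup>2*indicator {y - r..y + r} (x - a * s powr kp)))" by simp
   also have "(LBINT x. ((G (x - a * s powr kp))\<^sup>2*indicator {y - r..y + r} (x - a * s powr kp))) = locsq G r y"
    unfolding locsq_def by (rule integral_shift[of "%x. (G x)\<^sup>2*indicator {y - r..y + r} x"])
   finally show ?thesis using ts st by (simp add: mult_ac)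
  qed
  have m: "(%(s, t). (2*locsq G r y*locsq G r y')*(indicat_real {1..b} s*indicator {s - V*ep^4..s + V*ep^4} t)) \<in> borel_measurable (borel \<Otimes>\<^sub>M borel)"
  proof -
   have "(%(s, t). (2*locsq G r y*locsq G r y')*(indicat_real {1..b} s*(if s - V*ep^4 <= t & t <= s + V*ep^4 then 1 else 0))) \<in> borel_measurable (borel \<Otimes>\<^sub>M borel)"
    by measurable
   then show ?thesis by (simp add: indicator_def)
  qed
  have hb: "bcs (%(s, t). (2*locsq G r y*locsq G r y')*(indicat_real {1..b} s*indicator {s - V*ep^4..s + V*ep^4} t))"
   by (rule bcs2I[OF m, where M = "abs (2*locsq G r y*locsq G r y')" and R = "b + V*ep^4"])
    (use V_pos ep in \<open>auto simp: indicator_def abs_mult split: if_splits\<close>)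
  have ab: "bcs (%(s, t). LBINT x. LBINT x'. near s t*Ad y y' x x' s t)"
  proof -
   have a: "bcs (%(p, zw). (case (fst p, snd p, zw) of (x, x', s, t) => near s t*Ad y y' x x' s t))"
    using bcs_assoc[OF Ad_bcs(1)[of y y']] by (simp add: case_prod_unfold)
   have bz: "bcs (%zw. LBINT p. (case (fst p, snd p, zw) of (x, x', s, t) => near s t*Ad y y' x x' s t))"
    using bcs_integral_fst[OF a] by simp
   have "(LBINT p. (case (fst p, snd p, zw) of (x, x', s, t) => near s t*Ad y y' x x' s t))
    = (case zw of (s, t) => LBINT x. LBINT x'. near s t*Ad y y' x x' s t)" for zw
    using bcs_prod_integral[OF bcs_slice(2)[OF a, of zw, simplified]] by (simp add: case_prod_unfold)
   then have eq: "(%zw. LBINT p. (case (fst p, snd p, zw) of (x, x', s, t) => near s t*Ad y y' x x' s t))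
    = (%(s, t). LBINT x. LBINT x'. near s t*Ad y y' x x' s t)" by (rule ext)
   show ?thesis using bz unfolding eq .
  qed
  show ?thesis using bcs_int2_mono[OF ab hb] inner by simp
 qed
 also have "... = (2*locsq G r y*locsq G r y')*((b - 1)*(2*(V*ep^4)))"
  using V_pos ep b1 by simp
 also have "... <= (2*locsq G r y*locsq G r y')*(V*(2*(V*ep^4)))"
  using Vb V_pos ep locsq_nonneg[of G r] by (intro mult_left_mono mult_right_mono) auto
 also have "... = 4*V\<^sup>2*ep^4*locsq G r y*locsq G r y'" by (simp add: power2_eq_square)
 finally show ?thesis .
qed

end

section \<open>The far part of the square integrals\<close>

context smoothing
begin

text \<open>The far integrand in the variables \<open>(s, v, bt, alf)\<close>, including both
  Jacobians. Outside the domain of the change of variables \<open>\<theta>inv\<close> and the root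
  take arbitrary values, but there the cutoffs in \<open>J1\<close>, \<open>J2\<close> or
  \<open>wt\<close> make the product zero.\<close>

definition Tf where
 "Tf y y' s v bt alf = J1 (bt + \<theta> s)*(J2 (alf + s powr kp) *
   ((1 - near s ((alf + s powr kp) powr (1/kp))) *
    Th y y' (v + a * s powr kp) (\<theta>inv (bt + \<theta> s) + (v + a * s powr kp - s)) s ((alf + s powr kp) powr (1/kp))))"

lemma Tf_measurable: "(%(s, v, bt, alf). Tf y y' s v bt alf) \<in> borel_measurable (borel \<Otimes>\<^sub>M (borel \<Otimes>\<^sub>M (borel \<Otimes>\<^sub>M borel)))"
 unfolding Tf_def Th_def Ind_def near_def g_def by measurable

lemma Tf_bcs: "bcs (%(s, v, bt, alf). Tf y y' s v bt alf)"
proof -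
 obtain M R where MR: "0 <= M" "\<And>x x' s. abs (g x x' s) <= M" "\<And>x x' s. g x x' s ~= 0 ==> abs x <= R & abs x' <= R & abs s <= R & s \<in> {1..b} & s + (x' - x) \<in> {1..b}"
  using g_ex by metis
 obtain B where B: "\<And>si. abs (J2 si) <= B" using J2_bounded by blast
 have B0: "0 <= B" using B[of 0] by linarith
 define C where "C = max (abs (\<theta> 1)) (abs (\<theta> b))"
 define R' where "R' = R + V + C + b + V"
 show ?thesis
 proof (rule bcs4I[OF Tf_measurable, where M = "2*(B*(1*(1*(M*M))))" and R = R'])
  fix s v bt alf
  have "abs (Tf y y' s v bt alf) <= 2*(B*(1*(1*(M*M))))"
   unfolding Tf_def Th_def abs_mult using MR(1,2) J1_bounds B B0 Ind_bounds
   by (intro mult_mono) (auto simp: near_def)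
  then show "abs (case (s, v, bt, alf) of (s, v, bt, alf) => Tf y y' s v bt alf) <= 2*(B*(1*(1*(M*M))))" by simp
  assume "(case (s, v, bt, alf) of (s, v, bt, alf) => Tf y y' s v bt alf) ~= 0"
  then have nz: "J1 (bt + \<theta> s) ~= 0" "J2 (alf + s powr kp) ~= 0"
   "g (v + a * s powr kp) (\<theta>inv (bt + \<theta> s) + (v + a * s powr kp - s)) s ~= 0"
   by (auto simp: Tf_def Th_def)
  note h = MR(3)[OF nz(3)]
  have s: "s \<in> {1..b}" using h by blast
  have sk: "abs (s powr kp) <= V" using pk_ub[OF in_big[OF s]] by simp
  have "abs (a * s powr kp) <= 1*V" unfolding abs_mult using a_le sk by (intro mult_mono) auto
  then have v: "abs v <= R + V" using h by linarith
  have "\<theta> 1 <= \<theta> s" "\<theta> s <= \<theta> b" using \<theta>_strict(2)[of 1 s] \<theta>_strict(2)[of s b] s b1 by auto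
  then have be: "abs bt <= C + b"
  proof -
   have "bt + \<theta> s \<in> {\<theta> 1..\<theta> b}" by (rule J1_bounds(3)[OF nz(1)])
   then have "abs bt <= \<theta> b - \<theta> 1" using \<open>\<theta> 1 <= \<theta> s\<close> \<open>\<theta> s <= \<theta> b\<close> by auto
   also have "... <= C + b"
    using \<theta>_lip(1)[of b 1] b1 unfolding C_def by (auto simp: abs_if max_def split: if_splits)
   finally show ?thesis .
  qed
  have "b powr kp <= V" using pk_ub[of b] b1 by simp
  moreover have "1 <= alf + s powr kp" "alf + s powr kp <= b powr kp" using J2_support[OF nz(2)] by auto
  ultimately have al: "abs alf <= V + V" using sk powr_ge_zero[of s kp] V_pos by linarith
  have C0: "0 <= C" by (simp add: C_def)
  have R0: "0 <= R" using h by linarith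
  show "abs s <= R' & abs v <= R' & abs bt <= R' & abs alf <= R'"
   using h v be al C0 R0 V_pos b1 unfolding R'_def by (intro conjI) linarith+
 qed
qed

text \<open>For each \<open>s\<close>, a translation trades \<open>x\<close> for \<open>v\<close>,
  the map \<open>\<theta>\<close> trades \<open>x'\<close> for \<open>bt\<close>, and the power
  trades \<open>t\<close> for \<open>alf\<close>. At the end the integral over \<open>s\<close>, so
  far outermost, is moved inside, because the oscillation is in \<open>s\<close> while three copies
  of \<open>G\<close> no longer depend on it.\<close>

lemma J_far_change:
 "(LBINT x. LBINT x'. LBINT s. LBINT t. (1 - near s t)*Th y y' x x' s t)
  = (LBINT v. LBINT bt. LBINT alf. LBINT s. Tf y y' s v bt alf)"
proof -
 define F where "F x x' s t = (1 - near s t)*Th y y' x x' s t" for x x' s t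
 have f: "bcs (%(x, x', s, t). F x x' s t)"
  unfolding F_def by (rule Th_bcs) (measurable, auto simp: near_def)
 have supp: "F x x' s t ~= 0 ==> t \<in> {1..b} & s + (x' - x) \<in> {1..b}" for x x' s t
  using wt_bounds(4) by (auto simp: F_def Th_def g_def)
 have sl: "bcs (%t. F x x' s t)" for x x' s
  using bcs_slice(1)[OF bcs_slice(1)[OF bcs_slice(1)[OF f]]] by simp
 have sl2: "bcs (%x'. LBINT t. F x x' s t)" for x s
 proof -
  have "bcs (%(x, x', s). LBINT t. F x x' s t)" using bcs_integral4(1)[OF f] by simp
  then have "bcs (%(x', s). LBINT t. F x x' s t)" using bcs_slice(1)[of "%(x, x', s). LBINT t. F x x' s t" x] by simp
  from bcs_slice(2)[OF this, of s] show ?thesis by simp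
 qed
 have "(LBINT x. LBINT x'. LBINT s. LBINT t. F x x' s t) = (LBINT s. LBINT x. LBINT x'. LBINT t. F x x' s t)"
  using bcs_rot3[OF bcs_integral4(1)[OF f]] by simp
 also have "... = (LBINT s. LBINT v. LBINT bt. LBINT alf. Tf y y' s v bt alf)"
 proof (rule Bochner_Integration.integral_cong[OF refl])
  fix s
  have "(LBINT x. LBINT x'. LBINT t. F x x' s t) = (LBINT v. LBINT x'. LBINT t. F (v + a * s powr kp) x' s t)"
   using integral_shift'[of "%x. LBINT x'. LBINT t. F x x' s t" "a * s powr kp"] by simp
  also have "... = (LBINT v. LBINT bt. LBINT alf. Tf y y' s v bt alf)"
  proof (rule Bochner_Integration.integral_cong[OF refl])
   fix v
   define x where "x = v + a * s powr kp"
   define \<Xi> where "\<Xi> p = (LBINT t. F x (p + (x - s)) s t)" for p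
   have \<Xi>b: "bcs \<Xi>"
   proof -
    have eq: "p + (x - s) = p - (s - x)" for p by simp
    show ?thesis unfolding \<Xi>_def[abs_def] eq by (rule bcs_shift[OF sl2])
   qed
   have \<Xi>s: "p \<in> {1..b}" if "\<Xi> p ~= 0" for p
   proof (rule ccontr)
    assume "p \<notin> {1..b}"
    then have "F x (p + (x - s)) s t = 0" for t using supp[of x "p + (x - s)" s t] by auto
    then show False using that by (simp add: \<Xi>_def)
   qed
   have "(LBINT x'. LBINT t. F x x' s t) = (LBINT p. \<Xi> p)"
    unfolding \<Xi>_def using integral_shift'[of "%x'. LBINT t. F x x' s t" "x - s"] by simp
   also have "... = (LBINT rh. J1 rh*\<Xi> (\<theta>inv rh))" by (rule subst_\<theta>[OF \<Xi>b \<Xi>s])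
   also have "... = (LBINT bt. J1 (bt + \<theta> s)*\<Xi> (\<theta>inv (bt + \<theta> s)))"
    using integral_shift'[of "%rh. J1 rh*\<Xi> (\<theta>inv rh)" "\<theta> s"] by simp
   also have "... = (LBINT bt. LBINT alf. Tf y y' s v bt alf)"
   proof (rule Bochner_Integration.integral_cong[OF refl])
    fix bt
    define x' where "x' = \<theta>inv (bt + \<theta> s) + (x - s)"
    have "\<Xi> (\<theta>inv (bt + \<theta> s)) = (LBINT t. F x x' s t)" by (simp add: \<Xi>_def x'_def)
    also have "... = (LBINT si. J2 si*F x x' s (si powr (1/kp)))"
     by (rule subst_pow[OF sl]) (use supp in blast)
    also have "... = (LBINT alf. J2 (alf + s powr kp)*F x x' s ((alf + s powr kp) powr (1/kp)))"
     using integral_shift'[of "%si. J2 si*F x x' s (si powr (1/kp))" "s powr kp"] by simp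
    finally show "J1 (bt + \<theta> s)*\<Xi> (\<theta>inv (bt + \<theta> s)) = (LBINT alf. Tf y y' s v bt alf)"
     unfolding Tf_def F_def x'_def x_def by simp
   qed
   finally show "(LBINT x'. LBINT t. F (v + a * s powr kp) x' s t) = (LBINT bt. LBINT alf. Tf y y' s v bt alf)"
    by (simp add: x_def)
  qed
  finally show "(LBINT x. LBINT x'. LBINT t. F x x' s t) = (LBINT v. LBINT bt. LBINT alf. Tf y y' s v bt alf)" .
 qed
 also have "... = (LBINT v. LBINT bt. LBINT alf. LBINT s. Tf y y' s v bt alf)"
  using bcs_first_last(1)[OF Tf_bcs[of y y']] by simp
 finally show ?thesis by (simp add: F_def)
qed

text \<open>Once the variables are changed, the factors split into a part independent of
  \<open>s\<close> and the oscillating part treated by \<open>inner_osc\<close>; the requirement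
  that \<open>s3\<close> be in \<open>{1..b}\<close> comes from the fourth weight and becomes part
  of \<open>Box\<close>.\<close>

lemma Tf_eq:
 "Tf y y' s v bt alf = (G v * G (v - a*alf)*G (v + bt)*(if ep^4 <= abs alf then 1 else 0)) *
   ((G (W v alf bt s)*amp alf bt s)*indicator (Box v alf bt y y' rh) s)"
proof (cases "s \<in> Dom alf bt")
 case False
 have "J1 (bt + \<theta> s) = 0 \<or> J2 (alf + s powr kp) = 0 \<or> wt s = 0"
  using False J1_bounds(3)[of "bt + \<theta> s"] J2_support[of "alf + s powr kp"] wt_bounds(4)[of s]
  by (auto simp: Dom_def add.commute)
 then have "Tf y y' s v bt alf = 0" by (auto simp: Tf_def Th_def g_def)
 moreover have "s \<notin> Box v alf bt y y' rh" using False by (auto simp: Box_def Dom3_def)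
 ultimately show ?thesis by simp
next
 case True
 define x where "x = v + a * s powr kp"
 define x' where "x' = v + bt + a * s4 bt s powr kp"
 have s4e: "\<theta>inv (bt + \<theta> s) = s4 bt s" by (simp add: s4_def add.commute)
 have s1e: "(alf + s powr kp) powr (1/kp) = s1 alf s" by (simp add: s1_def add.commute)
 have x'e: "s4 bt s + (x - s) = x'" using Dom_s4(2)[OF True] by (simp add: \<theta>_def x_def x'_def)
 have e4: "s + (x' - x) = s4 bt s" using x'e by simp
 have e3: "s1 alf s + (x' - x) = s3 alf bt s" using x'e by (simp add: s3_def)
 have v1: "x - a * s powr kp = v" by (simp add: x_def)
 have v2: "x - a * s1 alf s powr kp = v - a*alf" using Dom_s1(2)[OF True] by (simp add: x_def algebra_simps)
 have v3: "x' - a * s4 bt s powr kp = v + bt" by (simp add: x'_def)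
 have v4: "x' - a * s3 alf bt s powr kp = W v alf bt s" by (simp add: x'_def W_def algebra_simps)
 have nr: "1 - near s (s1 alf s) = (if ep^4 <= abs alf then 1 else 0)"
  using Dom_s1(2)[OF True] by (simp add: near_def)
 have j1: "J1 (bt + \<theta> s) = 1/\<theta>' (s4 bt s)"
  using True by (simp add: J1_def s4e Dom_def add.commute)
 have s1pos: "s1 alf s > 0" "s powr kp + alf > 0" using Dom_s1(1)[OF True] True by (auto simp: Dom_def)
 have j2: "J2 (alf + s powr kp) = (1/kp)*(s1 alf s*(1/(s powr kp + alf)))"
 proof -
  have "(s powr kp + alf) powr (1/kp - 1) = s1 alf s*(1/(s powr kp + alf))"
   using s1pos by (simp add: powr_diff s1_def)
  then show ?thesis using True by (simp add: J2_def Dom_def add.commute)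
 qed
 have w: "wt s = 1/s" "wt (s4 bt s) = 1/s4 bt s" "wt (s1 alf s) = 1/s1 alf s"
  using Dom_s(1)[OF True] Dom_s4(1)[OF True] Dom_s1(1)[OF True] by (auto simp: wt_def)
 have w3: "wt (s3 alf bt s) = indicator {1..b} (s3 alf bt s)*(1/s3 alf bt s)" by (simp add: wt_def)
 have bx: "indicat_real (Box v alf bt y y' rh) s = Ind y y' x x'*indicator {1..b} (s3 alf bt s)"
  using True by (auto simp: Box_def Dom3_def Ind_def x_def x'_def indicator_def)
 have "Tf y y' s v bt alf = (1/\<theta>' (s4 bt s))*(((1/kp)*(s1 alf s*(1/(s powr kp + alf)))) *
   ((if ep^4 <= abs alf then 1 else 0)*(Ind y y' x x' *
    ((1/s)*(1/s4 bt s)*(G v * G (v + bt))*((1/s1 alf s)*(indicator {1..b} (s3 alf bt s)*(1/s3 alf bt s))*(G (v - a*alf)*G (W v alf bt s)))))))"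
  unfolding Tf_def Th_def s4e s1e x_def[symmetric] x'e nr j1 j2 g_def e4 e3 v1 v2 v3 v4 w w3 by simp
 also have "... = (G v * G (v - a*alf)*G (v + bt)*(if ep^4 <= abs alf then 1 else 0)) *
   ((G (W v alf bt s)*amp alf bt s)*indicator (Box v alf bt y y' rh) s)"
  unfolding bx amp_def using s1pos(1) by (simp add: divide_simps)
 finally show ?thesis .
qed

definition H where "H c v = abs (G v)*indicator {c - r..c + r} v"

lemma H_bcs: "bcs (H c)"
 unfolding H_def[abs_def] by (rule bcs_mult[OF bcs_abs[OF G]]) (auto simp: bounded_iff intro!: exI[of _ 1] indicator_le_1)

lemma H_nonneg: "0 <= H c v" by (simp add: H_def)

lemma H_int: "(LBINT v. H c v) <= sqrt (2*r) * sqrt (locsq G r c)"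
proof -
 have r0: "0 <= r" using V_pos by (simp add: r_def)
 have "(LBINT v. H c v) = (LBINT v. H c v * indicator {c - r..c + r} v)"
  by (rule Bochner_Integration.integral_cong) (auto simp: H_def indicator_def)
 also have "... <= N2 (H c)*N2 (indicat_real {c - r..c + r})"
  by (rule bcs_Cauchy_Schwarz[OF H_bcs bcs_indicator]) auto
 also have "N2 (H c) = sqrt (locsq G r c)"
  unfolding N2_def locsq_def H_def by (intro arg_cong[where f = sqrt] Bochner_Integration.integral_cong) (auto simp: indicator_def)
 also have "N2 (indicat_real {c - r..c + r}) = sqrt (2*r)"
 proof -
  have "(%x. (indicat_real {c - r..c + r} x)\<^sup>2) = indicat_real {c - r..c + r}" by (auto simp: indicator_def)
  then show ?thesis unfolding N2_def using r0 by (simp add: measure_def)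
 qed
 finally show ?thesis by (simp add: mult.commute)
qed

text \<open>The \<open>s\<close>-integral is bounded by \<open>inner_osc\<close>; the other three
  copies of \<open>G\<close> give local L1 norms, each at most \<open>sqrt (2*r)\<close> times a
  local L2 norm, and integrating in \<open>alf\<close> costs \<open>1/abs a\<close>. The powers of
  \<open>a\<close> cancel, \<open>(abs a)\<^sup>2\<close> in the denominator against
  \<open>sqrt et\<close> and \<open>sqrt (2*r)\<close> cubed, and \<open>ep^14/ep^10\<close> leaves
  \<open>ep^4\<close>, in balance with \<open>J_near\<close>.\<close>

lemma J_far:
 assumes y: "2*ep <= abs (y - y')"
 shows "(LBINT x. LBINT x'. LBINT s. LBINT t. (1 - near s t)*Th y y' x x' s t)
   <= 128*V^48*ep^4*locsq G r y*locsq G r y'"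
proof -
 define D where "D = 8*V^46/(abs a*ep^10) * sqrt et * sqrt (locsq G r y')"
 have D0: "0 <= D" using V_pos ep et locsq_nonneg[of G r y'] by (simp add: D_def)
 have inner: "(LBINT s. Tf y y' s v bt alf) <= D*(H y v * H y' (v + bt)*H y (v - a*alf))" for v bt alf
 proof -
  define c where "c = G v * G (v - a*alf)*G (v + bt)*(if ep^4 <= abs alf then 1 else 0)"
  have e: "(LBINT s. Tf y y' s v bt alf) = c*(LBINT s. (G (W v alf bt s)*amp alf bt s)*indicator (Box v alf bt y y' rh) s)"
   unfolding Tf_eq c_def[symmetric] by simp
  show ?thesis
  proof (cases "Box v alf bt y y' rh = {} \<or> \<not> ep^4 <= abs alf")
   case True
   then have z: "c*(LBINT s. (G (W v alf bt s)*amp alf bt s)*indicator (Box v alf bt y y' rh) s) = 0"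
    by (auto simp: c_def)
   show ?thesis unfolding e z using D0 by (intro mult_nonneg_nonneg H_nonneg)
  next
   case False
   then obtain s where s: "s \<in> Box v alf bt y y' rh" and al: "ep^4 <= abs alf" by auto
   have rh': "0 <= rh" using rh_facts by simp
   have "2*V*abs a <= r" using V_pos by (simp add: r_def mult_right_mono)
   then have in_r: "v \<in> {y - r..y + r}" "v - a*alf \<in> {y - r..y + r}" "v + bt \<in> {y' - r..y' + r}"
    using Box_facts(1-3)[OF s rh' rh_facts(2)] by (auto simp: abs_le_iff)
   have "abs (LBINT s. (G (W v alf bt s)*amp alf bt s)*indicator (Box v alf bt y y' rh) s) <= D"
    unfolding D_def r_def by (rule inner_osc[OF G et(1) et_le_a mz ep rh' rh_facts(2,3) y al])
   then have le: "abs c*abs (LBINT s. (G (W v alf bt s)*amp alf bt s)*indicator (Box v alf bt y y' rh) s) <= abs c*D"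
    by (intro mult_left_mono) auto
   have c: "abs c = H y v * H y' (v + bt)*H y (v - a*alf)"
    using al in_r by (simp add: c_def H_def abs_mult mult_ac)
   have "c*I <= abs c*abs I" for I by (metis abs_ge_self abs_mult)
   from order_trans[OF this le] show ?thesis unfolding e c by (simp only: mult.commute)
  qed
 qed
 have [measurable]: "H c \<in> borel_measurable borel" for c by (rule bcs_measurable[OF H_bcs])
 have hb: "bcs (%(v, bt, alf). D*(H y v * H y' (v + bt)*H y (v - a*alf)))"
 proof -
  obtain M R where MR: "0 <= M" "0 <= R" "\<And>x. abs (H y x) <= M" "\<And>x. H y x ~= 0 ==> norm x <= R" using bcs_ex[OF H_bcs] by blast
  obtain M' R' where MR': "0 <= M'" "0 <= R'" "\<And>x. abs (H y' x) <= M'" "\<And>x. H y' x ~= 0 ==> norm x <= R'" using bcs_ex[OF H_bcs] by blast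
  have m: "(%(v, bt, alf). D*(H y v * H y' (v + bt)*H y (v - a*alf))) \<in> borel_measurable (borel \<Otimes>\<^sub>M (borel \<Otimes>\<^sub>M borel))"
   by measurable
  show ?thesis
  proof (rule bcs3I[OF m, where M = "D*(M*M'*M)" and R = "R + R' + 2*R/abs a"])
   fix v bt alf
   have "abs (D*(H y v * H y' (v + bt)*H y (v - a*alf))) <= D*(M*M'*M)"
    unfolding abs_mult using D0 MR MR' by (intro mult_mono) auto
   then show "abs (case (v, bt, alf) of (v, bt, alf) => D*(H y v * H y' (v + bt)*H y (v - a*alf))) <= D*(M*M'*M)" by simp
   assume "(case (v, bt, alf) of (v, bt, alf) => D*(H y v * H y' (v + bt)*H y (v - a*alf))) ~= 0"
   then have "abs v <= R" "abs (v + bt) <= R'" "abs (v - a*alf) <= R"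
    using MR(4)[of v] MR'(4)[of "v + bt"] MR(4)[of "v - a*alf"] by auto
   moreover have "abs a*abs alf <= 2*R" using calculation by (simp add: abs_mult[symmetric])
   then have "abs alf <= 2*R/abs a" using a0 by (simp add: field_simps)
   moreover have "0 <= 2*R/abs a" using MR by simp
   ultimately show "abs v <= R + R' + 2*R/abs a & abs bt <= R + R' + 2*R/abs a & abs alf <= R + R' + 2*R/abs a"
    using MR(2) MR'(2) by (intro conjI) linarith+
  qed
 qed
 have "(LBINT x. LBINT x'. LBINT s. LBINT t. (1 - near s t)*Th y y' x x' s t)
   <= (LBINT v. LBINT bt. LBINT alf. D*(H y v * H y' (v + bt)*H y (v - a*alf)))"
  unfolding J_far_change using bcs_int3_mono[OF bcs_first_last(2)[OF Tf_bcs[of y y']] hb] inner by simp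
 also have "... = D*(1/abs a)*((LBINT v. H y v)*(LBINT v. H y' v)*(LBINT v. H y v))"
 proof -
  have 1: "(LBINT alf. H y (v - a*alf)) = (1/abs a)*(LBINT v. H y v)" for v
   using lborel_integral_real_affine[of "-a" "H y" v] a0 by (simp add: field_simps)
  have 2: "(LBINT bt. H y' (v + bt)) = (LBINT v. H y' v)" for v
   using integral_shift'[of "H y'" v] by (simp add: add.commute)
  have "(LBINT v. LBINT bt. LBINT alf. D*(H y v * H y' (v + bt)*H y (v - a*alf)))
    = (LBINT v. D*(H y v * (LBINT bt. H y' (v + bt))*(LBINT alf. H y (v - a*alf))))"
   by simp
  then show ?thesis unfolding 1 2 by simp
 qed
 also have "... <= D*(1/abs a)*((sqrt (2*r) * sqrt (locsq G r y))*(sqrt (2*r) * sqrt (locsq G r y'))*(sqrt (2*r) * sqrt (locsq G r y)))"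
  using D0 V_pos locsq_nonneg[of G r]
  by (intro mult_left_mono mult_mono H_int mult_nonneg_nonneg) (auto intro!: integral_nonneg_AE simp: H_nonneg r_def)
 also have "... = 8*V^46/((abs a)\<^sup>2*ep^10)*(sqrt et*(sqrt (2*r) * sqrt (2*r) * sqrt (2*r))) *
   ((sqrt (locsq G r y) * sqrt (locsq G r y))*(sqrt (locsq G r y') * sqrt (locsq G r y')))"
 proof -
  have alg: "(A/(p*E)*q*Y')*(1/p)*((w*Y)*(w*Y')*(w*Y)) = A/(p\<^sup>2*E)*(q*(w*w*w))*((Y*Y)*(Y'*Y'))"
   for A p E q Y Y' w :: real by (simp add: power2_eq_square mult_ac)
  show ?thesis unfolding D_def by (rule alg)
 qed
 also have "... = 8*V^46/((abs a)\<^sup>2*ep^10)*(sqrt et*(sqrt (2*r) * sqrt (2*r) * sqrt (2*r)))*(locsq G r y*locsq G r y')"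
  using locsq_nonneg[of G r] by simp
 also have "... <= 8*V^46/((abs a)\<^sup>2*ep^10)*(ep^14*(16*V\<^sup>2*(abs a)\<^sup>2))*(locsq G r y*locsq G r y')"
 proof -
  have "sqrt et <= sqrt (abs a*ep^28)" using et by simp
  also have "... = sqrt (abs a)*ep^14"
  proof -
   have "sqrt (ep^28) = ep^14" by (rule real_sqrt_unique) (use ep in \<open>simp_all flip: power_mult\<close>)
   then show ?thesis by (simp only: real_sqrt_mult)
  qed
  finally have s1: "sqrt et <= sqrt (abs a)*ep^14" .
  have ww: "sqrt (2*r) * sqrt (2*r) = 6*V*abs a" using V_pos by (simp add: r_def)
  have w: "sqrt (2*r) = sqrt (6*V) * sqrt (abs a)" by (simp add: r_def real_sqrt_mult[symmetric])
  have s2: "sqrt (2*r) * sqrt (2*r) * sqrt (2*r) = (6*V*abs a)*(sqrt (6*V) * sqrt (abs a))"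
   unfolding ww using w by simp
  have "sqrt (6*V) <= sqrt ((5/2*V)\<^sup>2)"
  proof (rule real_sqrt_le_mono)
   have "6*V <= (5/2*5/2)*(V*1)" using V_pos by simp
   also have "... <= (5/2*5/2)*(V*V)" using V_pos by (intro mult_left_mono) auto
   finally show "6*V <= (5/2*V)\<^sup>2" by (simp add: power2_eq_square)
  qed
  then have s3: "sqrt (6*V) <= 5/2*V" using V_pos by simp
  have "sqrt et*(sqrt (2*r) * sqrt (2*r) * sqrt (2*r)) <= (sqrt (abs a)*ep^14)*((6*V*abs a)*((5/2*V) * sqrt (abs a)))"
   unfolding s2 using s1 s3 V_pos et ep by (intro mult_mono mult_nonneg_nonneg) auto
  also have "... = ep^14*(15*V\<^sup>2*(abs a)\<^sup>2)"
  proof -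
   have alg: "(u*E)*((6*W'*A)*((5/2*W')*u)) = E*(15*(W'*W')*A*(u*u))" for u E W' A :: real
    by (simp add: algebra_simps)
   show ?thesis unfolding alg by (simp add: power2_eq_square)
  qed
  also have "... <= ep^14*(16*V\<^sup>2*(abs a)\<^sup>2)" using ep by (intro mult_left_mono mult_right_mono) auto
  finally have "sqrt et*(sqrt (2*r) * sqrt (2*r) * sqrt (2*r)) <= ep^14*(16*V\<^sup>2*(abs a)\<^sup>2)" .
  then show ?thesis using V_pos ep locsq_nonneg[of G r] by (intro mult_right_mono mult_left_mono) auto
 qed
 also have "... = 128*V^48*ep^4*locsq G r y*locsq G r y'"
 proof -
  have e: "V^48 = V^46*V\<^sup>2" "ep^14 = ep^10*ep^4" by (simp_all flip: power_add)
  have alg: "8*A/(p\<^sup>2*E)*((E*F)*(16*B*p\<^sup>2))*(X*Y) = 128*(A*B)*F*X*Y"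
   if "p ~= 0" "E ~= 0" for A B E F X Y p :: real using that by (simp add: field_simps)
  show ?thesis unfolding e by (rule alg) (use a0 ep in auto)
 qed
 finally show ?thesis .
qed

text \<open>The sum of the constants 4 and 128 is rounded up to the square 144, since a square root
  is taken next.\<close>

lemma J_bound:
 assumes y: "2*ep <= abs (y - y')"
 shows "(LBINT x. LBINT x'. Ind y y' x x'*(K x x')\<^sup>2) <= 144*V^48*ep^4*locsq G r y*locsq G r y'"
proof -
 define X where "X = ep^4*locsq G r y*locsq G r y'"
 have X0: "0 <= X" using ep locsq_nonneg[of G r] by (simp add: X_def)
 have "V\<^sup>2 <= V^48" by (rule power_increasing) (use V_pos in auto)
 then have "V\<^sup>2*X <= V^48*X" by (rule mult_right_mono[OF _ X0])
 moreover have "0 <= V^48*X" using X0 V_pos by simp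
 moreover have "(LBINT x. LBINT x'. LBINT s. LBINT t. near s t*Th y y' x x' s t) <= 4*(V\<^sup>2*X)"
  using J_near[of y y'] by (simp only: X_def mult.assoc)
 moreover have "(LBINT x. LBINT x'. LBINT s. LBINT t. (1 - near s t)*Th y y' x x' s t) <= 128*(V^48*X)"
  using J_far[OF y] by (simp only: X_def mult.assoc)
 ultimately have "(LBINT x. LBINT x'. Ind y y' x x'*(K x x')\<^sup>2) <= 144*(V^48*X)"
  using J_expand[of y y'] by linarith
 then show ?thesis by (simp only: X_def mult.assoc)
qed

end

section \<open>From the kernel to the smoothing estimate\<close>

lemma bcs_first_last3:
 fixes f :: "real \<times> real \<times> real => real"
 assumes "bcs f"
 shows "(LBINT x. LBINT y. LBINT z. f (x, y, z)) = (LBINT y. LBINT z. LBINT x. f (x, y, z))"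
  "bcs (%(y, z). LBINT x. f (x, y, z))"
proof -
 have i: "bcs (%q. LBINT x. f (x, q))" by (rule bcs_integral_fst[OF assms])
 then show "bcs (%(y, z). LBINT x. f (x, y, z))" by (simp add: case_prod_unfold)
 have "(LBINT x. LBINT y. LBINT z. f (x, y, z)) = (LBINT x. LBINT q. f (x, q))"
  using bcs_prod_integral[OF bcs_slice(1)[OF assms]] by simp
 also have "... = (LBINT q. LBINT x. f (x, q))" by (rule bcs_Fubini[OF assms])
 also have "... = (LBINT y. LBINT z. LBINT x. f (x, y, z))" using bcs_prod_integral[OF i] by simp
 finally show "(LBINT x. LBINT y. LBINT z. f (x, y, z)) = (LBINT y. LBINT z. LBINT x. f (x, y, z))" .
qed

lemma integral_sub_reflect:
 fixes f :: "real => real"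
 shows "(LBINT s. f s) = (LBINT u. f (x - u))"
 using lborel_integral_real_affine[of "-1" f x] by simp

context smoothing
begin

lemma K_support: "K x x' ~= 0 ==> abs (x' - x) <= b"
proof (rule ccontr)
 assume k: "K x x' ~= 0" and n: "\<not> abs (x' - x) <= b"
 have "g x x' s = 0" for s
 proof (rule ccontr)
  assume "g x x' s ~= 0"
  then have "s \<in> {1..b}" "s + (x' - x) \<in> {1..b}" using wt_bounds(4) by (auto simp: g_def)
  then show False using n by auto
 qed
 then show False using k by (simp add: K_def)
qed

lemma K_abs_bcs: "bcs (%(x, x'). abs (K x x'))"
 using bcs_abs[OF K_bcs] by (simp add: case_prod_unfold)

text \<open>No cancellation is used: for a fixed displacement \<open>\<tau> = x' - x\<close> and
  fixed \<open>s\<close>, Cauchy-Schwarz in \<open>x\<close> gives the square of the norm of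
  \<open>G\<close>, and the strip of displacements has width \<open>6*ep\<close>.\<close>

lemma K_near:
 "(LBINT x. LBINT x'. indicator {-3*ep..3*ep} (x' - x)*abs (K x x')) <= 6*V*ep*(N2 G)\<^sup>2"
proof -
 obtain M R where MR: "0 <= M" "\<And>x x' s. abs (g x x' s) <= M" "\<And>x x' s. g x x' s ~= 0 ==> abs x <= R & abs x' <= R & abs s <= R"
  using g_ex by blast
 define f where "f x \<tau> s = indicat_real {-3*ep..3*ep} \<tau>*abs (g x (x + \<tau>) s)" for x \<tau> s
 have fm: "(%(x, \<tau>, s). f x \<tau> s) \<in> borel_measurable (borel \<Otimes>\<^sub>M (borel \<Otimes>\<^sub>M borel))"
  unfolding f_def g_def by measurable
 have fb: "bcs (%(x, \<tau>, s). f x \<tau> s)"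
 proof (rule bcs3I[OF fm, where M = M and R = "R + R"])
  fix x \<tau> s
  show "abs (case (x, \<tau>, s) of (x, \<tau>, s) => f x \<tau> s) <= M" using MR(1,2) by (auto simp: f_def indicator_def)
  assume "(case (x, \<tau>, s) of (x, \<tau>, s) => f x \<tau> s) ~= 0"
  then have "abs x <= R & abs (x + \<tau>) <= R & abs s <= R" using MR(3) by (auto simp: f_def)
  then show "abs x <= R + R & abs \<tau> <= R + R & abs s <= R + R" by linarith
 qed
 have gs: "bcs (%s. g x x' s)" for x x' using bcs_slice(1)[OF bcs_slice(1)[OF g_bcs]] by simp
 have "(LBINT x. LBINT x'. indicator {-3*ep..3*ep} (x' - x)*abs (K x x'))
   = (LBINT x. LBINT \<tau>. indicator {-3*ep..3*ep} \<tau>*abs (K x (x + \<tau>)))"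
 proof (rule Bochner_Integration.integral_cong[OF refl])
  fix x
  show "(LBINT x'. indicator {-3*ep..3*ep} (x' - x)*abs (K x x')) = (LBINT \<tau>. indicator {-3*ep..3*ep} \<tau>*abs (K x (x + \<tau>)))"
   using integral_shift'[of "%x'. indicator {-3*ep..3*ep} (x' - x)*abs (K x x')" x] by (simp add: add.commute)
 qed
 also have "... <= (LBINT x. LBINT \<tau>. LBINT s. f x \<tau> s)"
 proof -
  have Km: "(%(x, x'). K x x') \<in> borel_measurable (borel \<Otimes>\<^sub>M borel)"
   using bcs_measurable[OF K_bcs] by (simp add: borel_prod)
  obtain MK RK where MK: "0 <= MK" "\<And>z. abs (case z of (x, x') => K x x') <= MK" "\<And>z. (case z of (x, x') => K x x') ~= 0 ==> norm z <= RK"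
   using bcs_ex[OF K_bcs] by blast
  have m: "(%(x, \<tau>). indicat_real {-3*ep..3*ep} \<tau>*abs (K x (x + \<tau>))) \<in> borel_measurable (borel \<Otimes>\<^sub>M borel)"
  proof -
   have "(%z. (fst z, fst z + snd z)) \<in> measurable (borel \<Otimes>\<^sub>M borel) (borel \<Otimes>\<^sub>M (borel :: real measure))" by measurable
   from measurable_compose[OF this Km] have [measurable]: "(%z. K (fst z) (fst z + snd z)) \<in> borel_measurable (borel \<Otimes>\<^sub>M borel)" by simp
   show ?thesis unfolding case_prod_unfold by measurable
  qed
  have b: "bcs (%(x, \<tau>). indicat_real {-3*ep..3*ep} \<tau>*abs (K x (x + \<tau>)))"
  proof (rule bcs2I[OF m, where M = MK and R = "RK + RK"])
   fix x \<tau>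
   show "abs (case (x, \<tau>) of (x, \<tau>) => indicat_real {-3*ep..3*ep} \<tau>*abs (K x (x + \<tau>))) <= MK"
    using MK(1) MK(2)[of "(x, x + \<tau>)"] by (auto simp: indicator_def)
   assume "(case (x, \<tau>) of (x, \<tau>) => indicat_real {-3*ep..3*ep} \<tau>*abs (K x (x + \<tau>))) ~= 0"
   then have "norm (x, x + \<tau>) <= RK" using MK(3)[of "(x, x + \<tau>)"] by auto
   then show "abs x <= RK + RK & abs \<tau> <= RK + RK"
    using norm_fst_le[of x "x + \<tau>"] norm_snd_le[of "x + \<tau>" x] by auto
  qed
  have "indicat_real {-3*ep..3*ep} \<tau>*abs (K x (x + \<tau>)) <= (LBINT s. f x \<tau> s)" for x \<tau>
  proof -
   have "abs (K x (x + \<tau>)) <= (LBINT s. abs (g x (x + \<tau>) s))" unfolding K_def by (rule integral_abs_bound)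
   then show ?thesis unfolding f_def by (simp add: mult_left_mono)
  qed
  then show ?thesis using bcs_int2_mono[OF b bcs_integral_third[OF fb]] by simp
 qed
 also have "... = (LBINT \<tau>. LBINT s. LBINT x. f x \<tau> s)" using bcs_first_last3(1)[OF fb] by simp
 also have "... <= (LBINT \<tau>. LBINT s. (N2 G)\<^sup>2*(indicator {-3*ep..3*ep} \<tau>*indicator {1..b} s))"
 proof -
  have m: "(%(\<tau>, s). (N2 G)\<^sup>2*(indicat_real {-3*ep..3*ep} \<tau>*indicat_real {1..b} s)) \<in> borel_measurable (borel \<Otimes>\<^sub>M borel)"
   by measurable
  have b: "bcs (%(\<tau>, s). (N2 G)\<^sup>2*(indicat_real {-3*ep..3*ep} \<tau>*indicat_real {1..b} s))"
   by (rule bcs2I[OF m, where M = "(N2 G)\<^sup>2" and R = "3*ep + b"]) (use ep b1 in \<open>auto simp: indicator_def split: if_splits\<close>)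
  have "(LBINT x. f x \<tau> s) <= (N2 G)\<^sup>2*(indicator {-3*ep..3*ep} \<tau>*indicator {1..b} s)" for \<tau> s
  proof -
   define c where "c = a*(s + \<tau>) powr kp - \<tau>"
   have le: "f x \<tau> s <= (indicator {-3*ep..3*ep} \<tau>*indicator {1..b} s)*abs (G (x - a * s powr kp)*G (x - c))" for x
   proof -
    have e: "x + \<tau> - a*(s + (x + \<tau> - x)) powr kp = x - c" by (simp add: c_def)
    have "abs (g x (x + \<tau>) s) = wt s*wt (s + (x + \<tau> - x))*abs (G (x - a * s powr kp)*G (x - c))"
     unfolding g_def e abs_mult using wt_bounds(1) by simp
    also have "... <= indicator {1..b} s*1*abs (G (x - a * s powr kp)*G (x - c))"
     using wt_bounds by (intro mult_right_mono mult_mono) auto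
    finally have "abs (g x (x + \<tau>) s) <= indicator {1..b} s*abs (G (x - a * s powr kp)*G (x - c))" by simp
    then show ?thesis unfolding f_def mult.assoc by (intro mult_left_mono) auto
   qed
   have b1: "bcs (%x. G (x - a * s powr kp))" "bcs (%x. G (x - c))" by (rule bcs_shift[OF G])+
   have fs: "bcs (%x. f x \<tau> s)" using bcs_slice(2)[OF fb, of "(\<tau>, s)"] by simp
   have "(LBINT x. f x \<tau> s) <= (LBINT x. (indicator {-3*ep..3*ep} \<tau>*indicator {1..b} s)*abs (G (x - a * s powr kp)*G (x - c)))"
    by (intro integral_mono le bcs_integrable bcs_cmult bcs_abs bcs_times b1 fs)
   also have "... = (indicator {-3*ep..3*ep} \<tau>*indicator {1..b} s)*(LBINT x. abs (G (x - a * s powr kp)*G (x - c)))" by simp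
   also have "... <= (indicator {-3*ep..3*ep} \<tau>*indicator {1..b} s)*(N2 G*N2 G)"
    using bcs_Cauchy_Schwarz_abs[OF b1] by (intro mult_left_mono) (auto simp: N2_shift)
   finally show ?thesis by (simp add: power2_eq_square mult.commute)
  qed
  then show ?thesis using bcs_int2_mono[OF bcs_first_last3(2)[OF fb] b] by simp
 qed
 also have "... = (N2 G)\<^sup>2*(6*ep*(b - 1))" using ep b1 by simp
 also have "... <= (N2 G)\<^sup>2*(6*ep*V)" using ep Vb by (intro mult_left_mono) auto
 finally show ?thesis by (simp add: mult_ac)
qed

lemma locsq_fun:
 "bcs (%y. locsq G r y)" "(LBINT y. locsq G r y) = 2*r*(N2 G)\<^sup>2"
proof -
 have r0: "0 <= r" using V_pos by (simp add: r_def)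
 obtain M R where MR: "0 <= M" "0 <= R" "\<And>x. abs (G x) <= M" "\<And>x. G x ~= 0 ==> norm x <= R" using bcs_ex[OF G] by blast
 define f where "f y x = (G x)\<^sup>2*(if y - r <= x & x <= y + r then 1 else 0)" for y x
 have m: "(%(y, x). f y x) \<in> borel_measurable (borel \<Otimes>\<^sub>M borel)" unfolding f_def by measurable
 have fb: "bcs (%(y, x). f y x)"
 proof (rule bcs2I[OF m, where M = "M\<^sup>2" and R = "R + r"])
  fix y x
  show "abs (case (y, x) of (y, x) => f y x) <= M\<^sup>2"
   using MR(3)[of x] MR(1) power_mono[of "abs (G x)" M 2] by (auto simp: f_def)
  assume "(case (y, x) of (y, x) => f y x) ~= 0"
  then show "abs y <= R + r & abs x <= R + r" using MR(4)[of x] r0 by (auto simp: f_def split: if_splits)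
 qed
 have e: "locsq G r y = (LBINT x. f y x)" for y
  unfolding locsq_def f_def by (intro Bochner_Integration.integral_cong) (auto simp: indicator_def)
 show "bcs (%y. locsq G r y)" unfolding e using bcs_integral_snd[OF fb] by simp
 have "(LBINT y. locsq G r y) = (LBINT x. LBINT y. f y x)"
  unfolding e using bcs_Fubini[OF fb] by simp
 also have "... = (LBINT x. (2*r)*(G x)\<^sup>2)"
 proof (rule Bochner_Integration.integral_cong[OF refl])
  fix x
  have "(LBINT y. f y x) = (LBINT y. (G x)\<^sup>2*indicator {x - r..x + r} y)"
   unfolding f_def by (intro Bochner_Integration.integral_cong) (auto simp: indicator_def)
  then show "(LBINT y. f y x) = (2*r)*(G x)\<^sup>2" using r0 by simp
 qed
 also have "... = 2*r*(N2 G)\<^sup>2" by (simp add: N2_power2)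
 finally show "(LBINT y. locsq G r y) = 2*r*(N2 G)\<^sup>2" .
qed

lemma Ind_integral: "(LBINT y. LBINT y'. Ind y y' x x') = rh\<^sup>2"
proof -
 have i: "(LBINT y. indicat_real {y..y+rh} x) = rh" for x
 proof -
  have "(LBINT y. indicat_real {y..y+rh} x) = (LBINT y. indicat_real {x-rh..x} y)"
   by (intro Bochner_Integration.integral_cong) (auto simp: indicator_def)
  then show ?thesis using rh_facts by simp
 qed
 show ?thesis unfolding Ind_def by (simp add: i power2_eq_square)
qed

lemma Ind_bcs: "bcs (%(x, x'). Ind y y' x x')"
 by (rule bcs2I[OF Ind_measurable, where M = 1 and R = "abs y + abs y' + rh"])
  (use rh_facts in \<open>auto simp: Ind_def indicator_def split: if_splits\<close>)

lemma Ind_integral': "(LBINT x. LBINT x'. Ind y y' x x') = rh\<^sup>2"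
 unfolding Ind_def using rh_facts by (simp add: power2_eq_square)

text \<open>Cauchy-Schwarz on a window of area \<open>rh\<^sup>2\<close> passes from the square
  integral of \<open>K\<close> to its L1 norm. The geometric mean of the two local norms is replaced
  by their arithmetic mean so that the result is linear and can be integrated over \<open>y\<close>
  and \<open>y'\<close>.\<close>

lemma K_box:
 assumes "2*ep <= abs (y - y')"
 shows "(LBINT x. LBINT x'. Ind y y' x x'*abs (K x x')) <= 6*rh*V^24*ep\<^sup>2*(locsq G r y + locsq G r y')"
proof -
 define L L' where "L = locsq G r y" and "L' = locsq G r y'"
 have L0: "0 <= L" "0 <= L'" by (auto simp: L_def L'_def locsq_nonneg)
 have f: "bcs (%z. case z of (x, x') => Ind y y' x x'*abs (K x x'))"
  using bcs_times[OF Ind_bcs K_abs_bcs] by (simp add: case_prod_unfold)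
 have sq: "(Ind y y' x x')\<^sup>2 = Ind y y' x x'" for x x' by (auto simp: Ind_def indicator_def)
 have "(LBINT x. LBINT x'. Ind y y' x x'*abs (K x x')) = (LBINT z. (case z of (x, x') => Ind y y' x x'*abs (K x x')))"
  using bcs_prod_integral[OF f] by simp
 also have "... = (LBINT z. (case z of (x, x') => Ind y y' x x'*abs (K x x'))*(case z of (x, x') => Ind y y' x x'))"
  by (intro Bochner_Integration.integral_cong) (auto simp: Ind_def indicator_def)
 also have "... <= N2 (%z. case z of (x, x') => Ind y y' x x'*abs (K x x'))*N2 (%(x, x'). Ind y y' x x')"
  by (rule bcs_Cauchy_Schwarz[OF f Ind_bcs])
 also have "N2 (%(x, x'). Ind y y' x x') = rh"
 proof -
  have "(N2 (%(x, x'). Ind y y' x x'))\<^sup>2 = (LBINT z. (case z of (x, x') => Ind y y' x x'))"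
   unfolding N2_power2 by (intro Bochner_Integration.integral_cong) (auto simp: sq)
  also have "... = rh\<^sup>2" using bcs_prod_integral[OF Ind_bcs] Ind_integral' by simp
  finally show ?thesis using rh_facts(1) by (simp add: power2_eq_iff_nonneg)
 qed
 also have "N2 (%z. case z of (x, x') => Ind y y' x x'*abs (K x x')) <= 12*V^24*ep\<^sup>2*((L + L')/2)"
 proof -
  have kb: "bcs (%z. case z of (x, x') => Ind y y' x x'*(K x x')\<^sup>2)"
   using bcs_times[OF Ind_bcs bcs_power2[OF K_bcs]] by (simp add: case_prod_unfold)
  have "(N2 (%z. case z of (x, x') => Ind y y' x x'*abs (K x x')))\<^sup>2 = (LBINT z. (case z of (x, x') => Ind y y' x x'*(K x x')\<^sup>2))"
   unfolding N2_power2 by (intro Bochner_Integration.integral_cong) (auto simp: power_mult_distrib sq)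
  also have "... = (LBINT x. LBINT x'. Ind y y' x x'*(K x x')\<^sup>2)" using bcs_prod_integral[OF kb] by simp
  also have "... <= 144*V^48*ep^4*L*L'" using J_bound[OF assms] by (simp add: L_def L'_def)
  also have "... = (12*V^24*ep\<^sup>2)\<^sup>2*(L*L')"
   by (simp add: power_mult_distrib flip: power_mult)
  also have "... <= (12*V^24*ep\<^sup>2)\<^sup>2*((L + L')/2)\<^sup>2"
  proof (rule mult_left_mono)
   have "0 <= (L - L')\<^sup>2" by simp
   then show "L*L' <= ((L + L')/2)\<^sup>2" by (simp add: power2_eq_square field_simps)
  qed simp
  also have "... = (12*V^24*ep\<^sup>2*((L + L')/2))\<^sup>2" by (simp only: power_mult_distrib)
  finally show ?thesis by (rule power2_le_imp_le) (use V_pos L0 in auto)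
 qed
 finally show ?thesis using rh_facts(1) by (simp add: L_def L'_def mult_ac)
qed

text \<open>Averaging over all window positions covers the plane with multiplicity
  \<open>rh\<^sup>2\<close>. As \<open>K\<close> lives on \<open>abs (x' - x) <= b\<close>, only
  \<open>y'\<close> within \<open>V + 1\<close> of \<open>y\<close> matters, and integrating a local
  norm over \<open>y\<close> produces \<open>2*r\<close> times the global one. Since
  \<open>r*ep\<close> is a multiple of \<open>rh\<close>, the factor \<open>rh\<^sup>2\<close>
  cancels and one power of \<open>ep\<close> remains.\<close>

lemma K_far:
 "(LBINT x. LBINT x'. (1 - indicator {-3*ep..3*ep} (x' - x))*abs (K x x')) <= 288*V^26*ep*(N2 G)\<^sup>2"
proof -
 define Q where "Q x x' = (1 - indicat_real {-3*ep..3*ep} (x' - x))*abs (K x x')" for x x'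
 have Q0: "0 <= Q x x'" "Q x x' <= abs (K x x')" for x x' by (auto simp: Q_def indicator_def)
 have Km [measurable]: "(%(x, x'). abs (K x x')) \<in> borel_measurable (borel \<Otimes>\<^sub>M borel)"
  using bcs_measurable[OF K_abs_bcs] by (simp add: borel_prod)
 have Qm [measurable]: "(%(x, x'). Q x x') \<in> borel_measurable (borel \<Otimes>\<^sub>M borel)"
  unfolding Q_def by measurable
 obtain M R where MR: "0 <= M" "0 <= R" "\<And>z. abs (case z of (x, x') => abs (K x x')) <= M" "\<And>z. (case z of (x, x') => abs (K x x')) ~= 0 ==> norm z <= R"
  using bcs_ex[OF K_abs_bcs] by blast
 have QM: "abs (Q x x') <= M" for x x' using MR(3)[of "(x, x')"] Q0[of x x'] by simp
 have QR: "abs x <= R & abs x' <= R" if "Q x x' ~= 0" for x x'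
 proof -
  have "K x x' ~= 0" using that by (auto simp: Q_def)
  then have "norm (x, x') <= R" using MR(4)[of "(x, x')"] by simp
  then show ?thesis using norm_fst_le[of x x'] norm_snd_le[of x' x] by auto
 qed
 have Qb: "bcs (%(x, x'). Q x x')"
  by (rule bcs2I[OF Qm, where M = M and R = R]) (use QM QR in auto)
 have fm: "(%(x, x', y, y'). Ind y y' x x'*Q x x') \<in> borel_measurable (borel \<Otimes>\<^sub>M (borel \<Otimes>\<^sub>M (borel \<Otimes>\<^sub>M borel)))"
 proof -
  have 1: "(%z. (fst z, fst (snd z))) \<in> measurable (borel \<Otimes>\<^sub>M (borel \<Otimes>\<^sub>M (borel \<Otimes>\<^sub>M borel))) (borel \<Otimes>\<^sub>M (borel :: real measure))" by measurable
  from measurable_compose[OF 1 Qm] have [measurable]: "(%z. Q (fst z) (fst (snd z))) \<in> borel_measurable (borel \<Otimes>\<^sub>M (borel \<Otimes>\<^sub>M (borel \<Otimes>\<^sub>M borel)))" by simp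
  have "(%z. (if fst (snd (snd z)) <= fst z & fst z <= fst (snd (snd z)) + rh then 1 else 0) *
    (if snd (snd (snd z)) <= fst (snd z) & fst (snd z) <= snd (snd (snd z)) + rh then 1 else 0)*Q (fst z) (fst (snd z))) \<in> borel_measurable (borel \<Otimes>\<^sub>M (borel \<Otimes>\<^sub>M (borel \<Otimes>\<^sub>M borel)))"
   by measurable
  then show ?thesis by (simp add: Ind_def indicator_def case_prod_unfold)
 qed
 have fb: "bcs (%(x, x', y, y'). Ind y y' x x'*Q x x')"
 proof (rule bcs4I[OF fm, where M = M and R = "R + rh"])
  fix x x' y y'
  have "abs (Ind y y' x x'*Q x x') <= 1*M" unfolding abs_mult using Ind_bounds[of y y' x x'] QM MR(1) by (intro mult_mono) auto
  then show "abs (case (x, x', y, y') of (x, x', y, y') => Ind y y' x x'*Q x x') <= M" by simp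
  assume "(case (x, x', y, y') of (x, x', y, y') => Ind y y' x x'*Q x x') ~= 0"
  then have "abs x <= R & abs x' <= R" "x \<in> {y..y+rh} & x' \<in> {y'..y'+rh}" using QR[of x x'] Ind_bounds(3)[of y y' x x'] by auto
  then show "abs x <= R + rh & abs x' <= R + rh & abs y <= R + rh & abs y' <= R + rh" using rh_facts(1) by auto
 qed
 define A where "A = 6*rh*V^24*ep\<^sup>2"
 have A0: "0 <= A" using rh_facts(1) V_pos by (simp add: A_def)
 have inner: "(LBINT x. LBINT x'. Ind y y' x x'*Q x x') <= A*(indicator {-(V+1)..V+1} (y' - y)*(locsq G r y + locsq G r y'))" for y y'
 proof (cases "2*ep <= abs (y - y') & abs (y' - y) <= V + 1")
  case True
  have sub: "bcs (%z. case z of (x, x') => Ind y y' x x'*abs (K x x'))" "bcs (%z. case z of (x, x') => Ind y y' x x'*Q x x')"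
   using bcs_times[OF Ind_bcs K_abs_bcs] bcs_times[OF Ind_bcs Qb] by (simp_all add: case_prod_unfold)
  have "(LBINT x. LBINT x'. Ind y y' x x'*Q x x') <= (LBINT x. LBINT x'. Ind y y' x x'*abs (K x x'))"
   using bcs_int2_mono[OF sub(2,1)] Q0 Ind_bounds(1) by (simp add: mult_left_mono)
  also have "... <= A*(locsq G r y + locsq G r y')" unfolding A_def by (rule K_box) (use True in simp)
  finally show ?thesis using True by (simp add: abs_le_iff)
 next
  case False
  \<comment> \<open>From \<open>abs (x' - x) > 3*ep\<close> and \<open>rh <= ep\<close> the window
    corners are at least \<open>2*ep\<close> apart; this is why the strip was cut at
    \<open>3*ep\<close>.\<close>
  have "Ind y y' x x'*Q x x' = 0" for x x'
  proof (rule ccontr)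
   assume nz: "Ind y y' x x'*Q x x' ~= 0"
   then have i: "x \<in> {y..y+rh}" "x' \<in> {y'..y'+rh}" using Ind_bounds(3)[of y y' x x'] by auto
   have "K x x' ~= 0" "\<not> abs (x' - x) <= 3*ep" using nz by (auto simp: Q_def indicator_def abs_le_iff split: if_splits)
   then have "abs (x' - x) <= b" "3*ep < abs (x' - x)" using K_support by auto
   then have "2*ep <= abs (y - y')" "abs (y' - y) <= V + 1" using i rh_facts Vb ep by auto
   then show False using False by simp
  qed
  then have z: "(LBINT x. LBINT x'. Ind y y' x x'*Q x x') = 0" by (simp only: Bochner_Integration.integral_zero)
  show ?thesis unfolding z using A0 locsq_nonneg[of G r] by (intro mult_nonneg_nonneg) auto
 qed
 have Lm [measurable]: "(%y. locsq G r y) \<in> borel_measurable borel" by (rule bcs_measurable[OF locsq_fun(1)])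
 obtain Mq Rq where Mq: "0 <= Mq" "0 <= Rq" "\<And>y. abs (locsq G r y) <= Mq" "\<And>y. locsq G r y ~= 0 ==> norm y <= Rq"
  using bcs_ex[OF locsq_fun(1)] by blast
 have lb: "bcs (%(y, y'). indicat_real {-(V+1)..V+1} (y' - y)*locsq G r y)" "bcs (%(y, y'). indicat_real {-(V+1)..V+1} (y' - y)*locsq G r y')"
 proof -
  have m1: "(%(y, y'). indicat_real {-(V+1)..V+1} (y' - y)*locsq G r y) \<in> borel_measurable (borel \<Otimes>\<^sub>M borel)" by measurable
  have m2: "(%(y, y'). indicat_real {-(V+1)..V+1} (y' - y)*locsq G r y') \<in> borel_measurable (borel \<Otimes>\<^sub>M borel)" by measurable
  show "bcs (%(y, y'). indicat_real {-(V+1)..V+1} (y' - y)*locsq G r y)"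
  proof (rule bcs2I[OF m1, where M = Mq and R = "Rq + (V + 1)"])
   fix y y'
   show "abs (case (y, y') of (y, y') => indicat_real {-(V+1)..V+1} (y' - y)*locsq G r y) <= Mq" using Mq(1) Mq(3)[of y] by (auto simp: indicator_def)
   assume "(case (y, y') of (y, y') => indicat_real {-(V+1)..V+1} (y' - y)*locsq G r y) ~= 0"
   then have "abs y <= Rq" "abs (y' - y) <= V + 1" using Mq(4)[of y] by (auto simp: indicator_def split: if_splits)
   then show "abs y <= Rq + (V + 1) & abs y' <= Rq + (V + 1)" using V_pos by linarith
  qed
  show "bcs (%(y, y'). indicat_real {-(V+1)..V+1} (y' - y)*locsq G r y')"
  proof (rule bcs2I[OF m2, where M = Mq and R = "Rq + (V + 1)"])
   fix y y'
   show "abs (case (y, y') of (y, y') => indicat_real {-(V+1)..V+1} (y' - y)*locsq G r y') <= Mq" using Mq(1) Mq(3)[of y'] by (auto simp: indicator_def)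
   assume "(case (y, y') of (y, y') => indicat_real {-(V+1)..V+1} (y' - y)*locsq G r y') ~= 0"
   then have "abs y' <= Rq" "abs (y' - y) <= V + 1" using Mq(4)[of y'] by (auto simp: indicator_def split: if_splits)
   then show "abs y <= Rq + (V + 1) & abs y' <= Rq + (V + 1)" using V_pos by linarith
  qed
 qed
 have sumb: "bcs (%z. A*((case z of (y, y') => indicat_real {-(V+1)..V+1} (y' - y)*locsq G r y) + (case z of (y, y') => indicat_real {-(V+1)..V+1} (y' - y)*locsq G r y')))"
  by (intro bcs_cmult bcs_add lb)
 have swapb: "bcs (%(y, y'). LBINT x. LBINT x'. Ind y y' x x'*Q x x')"
 proof -
  have a: "bcs (%(p, zw). (case (fst p, snd p, zw) of (x, x', y, y') => Ind y y' x x'*Q x x'))"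
   using bcs_assoc[OF fb] by (simp add: case_prod_unfold)
  have bz: "bcs (%zw. LBINT p. (case (fst p, snd p, zw) of (x, x', y, y') => Ind y y' x x'*Q x x'))"
   using bcs_integral_fst[OF a] by simp
  have "(LBINT p. (case (fst p, snd p, zw) of (x, x', y, y') => Ind y y' x x'*Q x x'))
   = (case zw of (y, y') => LBINT x. LBINT x'. Ind y y' x x'*Q x x')" for zw
   using bcs_prod_integral[OF bcs_slice(2)[OF a, of zw, simplified]] by (simp add: case_prod_unfold)
  then have eq: "(%zw. LBINT p. (case (fst p, snd p, zw) of (x, x', y, y') => Ind y y' x x'*Q x x'))
    = (%(y, y'). LBINT x. LBINT x'. Ind y y' x x'*Q x x')" by (rule ext)
  show ?thesis using bz unfolding eq .
 qed
 have "rh\<^sup>2*(LBINT x. LBINT x'. Q x x') = (LBINT x. LBINT x'. LBINT y. LBINT y'. Ind y y' x x'*Q x x')"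
  using Ind_integral by simp
 also have "... = (LBINT y. LBINT y'. LBINT x. LBINT x'. Ind y y' x x'*Q x x')"
  using bcs_swap_pairs[OF fb] by simp
 also have "... <= (LBINT y. LBINT y'. A*(indicator {-(V+1)..V+1} (y' - y)*locsq G r y + indicator {-(V+1)..V+1} (y' - y)*locsq G r y'))"
  using bcs_int2_mono[OF swapb sumb] inner by (simp add: distrib_left)
 also have "... = A*((LBINT y. LBINT y'. indicator {-(V+1)..V+1} (y' - y)*locsq G r y) + (LBINT y. LBINT y'. indicator {-(V+1)..V+1} (y' - y)*locsq G r y'))"
  using bcs_prod_integral[OF sumb] unfolding Bochner_Integration.integral_mult_right_zero
   Bochner_Integration.integral_add[OF bcs_integrable[OF lb(1)] bcs_integrable[OF lb(2)]]
   bcs_prod_integral[OF lb(1)] bcs_prod_integral[OF lb(2)] prod.case by (rule sym)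
 also have "... = A*(2*(V + 1)*(2*r*(N2 G)\<^sup>2) + 2*(V + 1)*(2*r*(N2 G)\<^sup>2))"
 proof -
  have s: "(LBINT y'. indicat_real {-(V+1)..V+1} (y' - y)) = 2*(V + 1)" for y
   using integral_shift[of "indicat_real {-(V+1)..V+1}" y] V_pos by simp
  have s': "(LBINT y. indicat_real {-(V+1)..V+1} (y' - y)) = 2*(V + 1)" for y'
   using integral_sub_reflect[of "indicat_real {-(V+1)..V+1}" y'] V_pos by simp
  have 1: "(LBINT y. LBINT y'. indicator {-(V+1)..V+1} (y' - y)*locsq G r y) = 2*(V + 1)*(2*r*(N2 G)\<^sup>2)"
   using s locsq_fun(2) by simp
  have "(LBINT y. LBINT y'. indicator {-(V+1)..V+1} (y' - y)*locsq G r y') = (LBINT y'. LBINT y. indicator {-(V+1)..V+1} (y' - y)*locsq G r y')"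
   using bcs_Fubini[OF lb(2)] by simp
  also have "... = 2*(V + 1)*(2*r*(N2 G)\<^sup>2)" using s' locsq_fun(2) by simp
  finally show ?thesis using 1 by simp
 qed
 finally have main: "rh\<^sup>2*(LBINT x. LBINT x'. Q x x') <= A*(8*(V + 1)*r*(N2 G)\<^sup>2)" by (simp add: algebra_simps)
 have "A*(8*(V + 1)*r*(N2 G)\<^sup>2) = rh\<^sup>2*(144*((V + 1)*V^25)*ep*(N2 G)\<^sup>2)"
 proof -
  have V25: "V^25 = V^24*V" by (simp flip: power_Suc2)
  show ?thesis unfolding A_def r_def rh_def V25 by (simp add: power2_eq_square)
 qed
 also have "... <= rh\<^sup>2*(144*(2*V^26)*ep*(N2 G)\<^sup>2)"
 proof -
  have "(V + 1)*V^25 <= (2*V)*V^25" using V_pos by (intro mult_right_mono) auto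
  also have "... = 2*V^26" by (simp flip: power_Suc)
  finally show ?thesis using ep by (intro mult_left_mono mult_right_mono) auto
 qed
 finally have "rh\<^sup>2*(LBINT x. LBINT x'. Q x x') <= rh\<^sup>2*(288*V^26*ep*(N2 G)\<^sup>2)" using main by simp
 then show ?thesis using rh_facts(1) by (simp add: Q_def)
qed

lemma K_total: "(LBINT x. LBINT x'. abs (K x x')) <= 300*V^26*ep*(N2 G)\<^sup>2"
proof -
 have Km [measurable]: "(%(x, x'). abs (K x x')) \<in> borel_measurable (borel \<Otimes>\<^sub>M borel)"
  using bcs_measurable[OF K_abs_bcs] by (simp add: borel_prod)
 obtain c where c: "c = (%z::real\<times>real. indicat_real {-3*ep..3*ep} (snd z - fst z))" by blast
 have cm: "c \<in> borel_measurable borel"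
 proof -
  have "c \<in> borel_measurable (borel \<Otimes>\<^sub>M borel)" unfolding c by measurable
  then show ?thesis by (simp add: borel_prod)
 qed
 have cb: "bounded (range c)" "bounded (range (%z. 1 - c z))" by (auto simp: c bounded_iff indicator_def intro!: exI[of _ 1])
 have i1: "bcs (%z. c z*(case z of (x, x') => abs (K x x')))" by (rule bcs_mult'[OF K_abs_bcs cm cb(1)])
 have i2: "bcs (%z. (1 - c z)*(case z of (x, x') => abs (K x x')))" by (rule bcs_mult'[OF K_abs_bcs _ cb(2)]) (use cm in simp)
 have "(LBINT z. (case z of (x, x') => abs (K x x'))) = (LBINT z. c z*(case z of (x, x') => abs (K x x')) + (1 - c z)*(case z of (x, x') => abs (K x x')))"
  by (simp add: algebra_simps)
 also have "... = (LBINT z. c z*(case z of (x, x') => abs (K x x'))) + (LBINT z. (1 - c z)*(case z of (x, x') => abs (K x x')))"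
  by (intro Bochner_Integration.integral_add bcs_integrable i1 i2)
 also have "... <= 6*V*ep*(N2 G)\<^sup>2 + 288*V^26*ep*(N2 G)\<^sup>2"
  using bcs_prod_integral[OF i1] bcs_prod_integral[OF i2] K_near K_far by (simp add: c)
 also have "... = (6*V + 288*V^26)*(ep*(N2 G)\<^sup>2)" by (simp add: algebra_simps)
 also have "... <= (300*V^26)*(ep*(N2 G)\<^sup>2)"
 proof (rule mult_right_mono)
  have "V <= V^26" by (rule V_le_pow) simp
  moreover have "0 <= V^26" using V_pos by simp
  ultimately show "6*V + 288*V^26 <= 300*V^26" by linarith
 qed (use ep in simp)
 finally show ?thesis using bcs_prod_integral[OF K_abs_bcs] by (simp add: mult.assoc)
qed

text \<open>Dualizing with a bounded \<open>h\<close> and integrating over \<open>u = x - s\<close>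
  isolates \<open>F\<close>; Cauchy-Schwarz in \<open>u\<close> leaves the norm of
  \<open>\<Psi>\<close>, whose square is the form with kernel \<open>K\<close> evaluated at
  \<open>h\<close>. As \<open>abs (h x) <= 1\<close>, that form is at most the L1 norm of
  \<open>K\<close>, and the estimate holds for arbitrary \<open>F\<close>.\<close>

lemma smoothing_bound:
 assumes F: "bcs F"
 shows "(LBINT x. abs (LBINT s. wt s*F (x - s)*G (x - a * s powr kp))) <= sqrt (300*V^26*ep)*N2 F*N2 G"
proof -
 have [measurable]: "F \<in> borel_measurable borel" by (rule bcs_measurable[OF F])
 obtain M R where MR: "0 <= M" "0 <= R" "\<And>x. abs (G x) <= M" "\<And>x. G x ~= 0 ==> norm x <= R" using bcs_ex[OF G] by blast
 obtain MF where MF: "0 <= MF" "\<And>x. abs (F x) <= MF" using bcs_ex[OF F] by blast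
 define k where "k x u = wt (x - u)*G (x - a*(x - u) powr kp)" for x u
 have kM: "abs (k x u) <= M" for x u
  using mult_mono[of "abs (wt (x - u))" 1 "abs (G (x - a*(x - u) powr kp))" M] wt_bounds(3) MR by (simp add: k_def abs_mult)
 have kR: "abs x <= R + V + b & abs u <= R + V + b" if "k x u ~= 0" for x u
 proof -
  have s: "x - u \<in> {1..b}" using that wt_bounds(4) by (auto simp: k_def)
  have "abs (x - a*(x - u) powr kp) <= R" using that MR(4)[of "x - a*(x - u) powr kp"] by (auto simp: k_def)
  moreover have "abs (a*(x - u) powr kp) <= 1*V"
   unfolding abs_mult using a_le pk_ub[OF in_big[OF s]] by (intro mult_mono) auto
  ultimately have "abs x <= R + V" by linarith
  then show ?thesis using s b1 by auto
 qed
 have S_bcs: "bcs (%x. LBINT s. wt s*F (x - s)*G (x - a * s powr kp))"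
 proof -
  have m: "(%(x, s). wt s*F (x - s)*G (x - a * s powr kp)) \<in> borel_measurable (borel \<Otimes>\<^sub>M borel)" by measurable
  have "bcs (%(x, s). wt s*F (x - s)*G (x - a * s powr kp))"
  proof (rule bcs2I[OF m, where M = "1*MF*M" and R = "R + V + b"])
   fix x s
   have "abs (wt s*F (x - s)*G (x - a * s powr kp)) <= 1*MF*M" unfolding abs_mult
    using wt_bounds(3) MF MR by (intro mult_mono) auto
   then show "abs (case (x, s) of (x, s) => wt s*F (x - s)*G (x - a * s powr kp)) <= 1*MF*M" by simp
   assume "(case (x, s) of (x, s) => wt s*F (x - s)*G (x - a * s powr kp)) ~= 0"
   then have "k x (x - s) ~= 0" "s \<in> {1..b}" using wt_bounds(4) by (auto simp: k_def)
   then show "abs x <= R + V + b & abs s <= R + V + b" using kR[of x "x - s"] V_pos MR(2) by auto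
  qed
  from bcs_integral_snd[OF this] show ?thesis by simp
 qed
 show ?thesis
 proof (rule L1_dual[OF S_bcs])
  fix h :: "real => real" assume h: "bcs h" and h1: "\<And>x. abs (h x) <= 1"
  have [measurable]: "h \<in> borel_measurable borel" by (rule bcs_measurable[OF h])
  define \<Psi> where "\<Psi> u = (LBINT x. k x u*h x)" for u
  have khb: "bcs (%(x, u). k x u*h x)"
  proof -
   have m: "(%(x, u). k x u*h x) \<in> borel_measurable (borel \<Otimes>\<^sub>M borel)" unfolding k_def by measurable
   show ?thesis
   proof (rule bcs2I[OF m, where M = "M*1" and R = "R + V + b"])
    fix x u
    have "abs (k x u*h x) <= M*1" unfolding abs_mult using kM h1 MR(1) by (intro mult_mono) auto
    then show "abs (case (x, u) of (x, u) => k x u*h x) <= M*1" by simp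
    assume "(case (x, u) of (x, u) => k x u*h x) ~= 0"
    then show "abs x <= R + V + b & abs u <= R + V + b" using kR[of x u] by simp
   qed
  qed
  have \<Psi>b: "bcs \<Psi>" unfolding \<Psi>_def[abs_def] using bcs_integral_fst[OF khb] by simp
  have kFb: "bcs (%(x, u). k x u*h x*F u)"
  proof -
   have m: "(%z::real\<times>real. F (snd z)) \<in> borel_measurable borel"
   proof -
    have "(%z::real\<times>real. F (snd z)) \<in> borel_measurable (borel \<Otimes>\<^sub>M borel)" by measurable
    then show ?thesis by (simp add: borel_prod)
   qed
   have "bcs (%z. (case z of (x, u) => k x u*h x)*F (snd z))"
    by (rule bcs_mult[OF khb m]) (use MF in \<open>auto simp: bounded_iff\<close>)
   then show ?thesis by (simp add: case_prod_unfold)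
  qed
  have "(LBINT x. (LBINT s. wt s*F (x - s)*G (x - a * s powr kp))*h x) = (LBINT x. LBINT u. k x u*h x*F u)"
  proof (rule Bochner_Integration.integral_cong[OF refl])
   fix x
   have "(LBINT s. wt s*F (x - s)*G (x - a * s powr kp)) = (LBINT u. wt (x - u)*F (x - (x - u))*G (x - a*(x - u) powr kp))"
    by (rule integral_sub_reflect)
   then have "(LBINT s. wt s*F (x - s)*G (x - a * s powr kp))*h x = (LBINT u. (wt (x - u)*F u*G (x - a*(x - u) powr kp))*h x)" by simp
   also have "... = (LBINT u. k x u*h x*F u)" by (intro Bochner_Integration.integral_cong) (auto simp: k_def)
   finally show "(LBINT s. wt s*F (x - s)*G (x - a * s powr kp))*h x = (LBINT u. k x u*h x*F u)" .
  qed
  also have "... = (LBINT u. LBINT x. k x u*h x*F u)" using bcs_Fubini[OF kFb] by simp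
  also have "... = (LBINT u. \<Psi> u*F u)" by (simp add: \<Psi>_def)
  also have "... <= N2 \<Psi>*N2 F" by (rule bcs_Cauchy_Schwarz[OF \<Psi>b F])
  also have "... <= (sqrt (300*V^26*ep)*N2 G)*N2 F"
  proof (rule mult_right_mono)
   have m3: "(%(u, x, x'). (k x u*h x)*(k x' u*h x')) \<in> borel_measurable (borel \<Otimes>\<^sub>M (borel \<Otimes>\<^sub>M borel))" unfolding k_def by measurable
   have b3: "bcs (%(u, x, x'). (k x u*h x)*(k x' u*h x'))"
   proof (rule bcs3I[OF m3, where M = "(M*1)*(M*1)" and R = "R + V + b"])
    fix u x x'
    have "abs ((k x u*h x)*(k x' u*h x')) <= (M*1)*(M*1)" unfolding abs_mult using kM h1 MR(1) by (intro mult_mono) auto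
    then show "abs (case (u, x, x') of (u, x, x') => (k x u*h x)*(k x' u*h x')) <= (M*1)*(M*1)" by simp
    assume "(case (u, x, x') of (u, x, x') => (k x u*h x)*(k x' u*h x')) ~= 0"
    then show "abs u <= R + V + b & abs x <= R + V + b & abs x' <= R + V + b" using kR[of x u] kR[of x' u] by auto
   qed
   have Ke: "(LBINT u. (k x u*h x)*(k x' u*h x')) = h x*h x'*K x x'" for x x'
   proof -
    have "(LBINT u. (k x u*h x)*(k x' u*h x')) = h x*h x'*(LBINT u. k x u*k x' u)"
     by (simp add: mult_ac flip: Bochner_Integration.integral_mult_right_zero)
    also have "(LBINT u. k x u*k x' u) = (LBINT s. k x (x - s)*k x' (x - s))" by (rule integral_sub_reflect)
    also have "... = K x x'" unfolding K_def
    proof (rule Bochner_Integration.integral_cong[OF refl])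
     fix s
     have e: "x' - (x - s) = s + (x' - x)" by simp
     show "k x (x - s)*k x' (x - s) = g x x' s" unfolding k_def g_def e by simp
    qed
    finally show ?thesis .
   qed
   have "(N2 \<Psi>)\<^sup>2 = (LBINT u. LBINT x. LBINT x'. (k x u*h x)*(k x' u*h x'))"
   proof -
    have "(N2 \<Psi>)\<^sup>2 = (LBINT u. \<Psi> u*\<Psi> u)" unfolding N2_power2 by (simp add: power2_eq_square)
    then show ?thesis unfolding \<Psi>_def by simp
   qed
   also have "... = (LBINT x. LBINT x'. LBINT u. (k x u*h x)*(k x' u*h x'))"
    using bcs_first_last3(1)[OF b3] by simp
   also have "... = (LBINT x. LBINT x'. h x*h x'*K x x')" unfolding Ke ..
   also have "... <= (LBINT x. LBINT x'. abs (K x x'))"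
   proof -
    have b: "bcs (%(x, x'). h x*h x'*K x x')" using bcs_first_last3(2)[OF b3] by (simp add: Ke)
    have "h x*h x'*K x x' <= abs (K x x')" for x x'
    proof -
     have "abs (h x)*abs (h x') <= 1*1" using h1 by (intro mult_mono) auto
     then have "abs (h x*h x'*K x x') <= 1*abs (K x x')" unfolding abs_mult by (intro mult_right_mono) auto
     then show ?thesis by simp
    qed
    then show ?thesis using bcs_int2_mono[OF b K_abs_bcs] by simp
   qed
   also have "... <= 300*V^26*ep*(N2 G)\<^sup>2" by (rule K_total)
   also have "... = (sqrt (300*V^26*ep)*N2 G)\<^sup>2" using V_pos ep by (simp add: power_mult_distrib)
   finally show "N2 \<Psi> <= sqrt (300*V^26*ep)*N2 G" by (rule power2_le_imp_le) (use V_pos ep in simp)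
  qed simp
  finally show "(LBINT x. (LBINT s. wt s*F (x - s)*G (x - a * s powr kp))*h x) <= sqrt (300*V^26*ep)*N2 F*N2 G"
   by (simp add: mult_ac)
 qed
qed

end

section \<open>Rescaled averages along the curve\<close>

definition wgt :: "real => real => real" where "wgt b s = indicator {1..b} s/s"

definition Sop :: "real => real => real => real => (real => real) => (real => real) => real => real" where
 "Sop b kp L l F G x = (LBINT s. wgt b s*(F (x - L * s)*G (x - l * s powr kp)))"

lemma integral_scale:
 fixes f :: "real => real"
 assumes "c ~= 0"
 shows "(LBINT x. f (c*x)) = (1/abs c)*(LBINT x. f x)"
 using lborel_integral_real_affine[of c f 0] assms by simp

lemma N2_scale:
 fixes f :: "real => real"
 assumes "c ~= 0"
 shows "N2 (%x. f (c*x)) = N2 f/sqrt (abs c)"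
 unfolding N2_def using integral_scale[OF assms, of "%x. (f x)\<^sup>2"] by (simp add: real_sqrt_divide)

definition meanzero :: "real => (real => real) => bool" where
 "meanzero et G \<longleftrightarrow> (\<forall>z::int. (LBINT x. G x*indicator {of_int z*et..(of_int z + 1)*et} x) = 0)"

lemma meanzero_scale:
 assumes "meanzero et G" "L ~= 0" "0 < et"
 shows "meanzero (et/abs L) (%x. G (L*x))"
 unfolding meanzero_def
proof
 fix z :: int
 \<comment> \<open>A negative \<open>L\<close> reverses the grid, sending the cell from
   \<open>z\<close> to \<open>z + 1\<close> to the one from \<open>- z - 1\<close> to
   \<open>- z\<close>.\<close>
 define z' where "z' = (if L > 0 then z else - z - 1)"
 have "(LBINT x. G (L*x)*indicator {of_int z*(et/abs L)..(of_int z + 1)*(et/abs L)} x)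
   = (LBINT x. G (L*x)*indicator {of_int z'*et..(of_int z' + 1)*et} (L*x))"
  by (intro Bochner_Integration.integral_cong) (use assms(2) in \<open>auto simp: z'_def indicator_def field_simps\<close>)
 also have "... = (1/abs L)*(LBINT x. G x*indicator {of_int z'*et..(of_int z' + 1)*et} x)"
  by (rule integral_scale[OF assms(2)])
 also have "... = 0" using assms(1) by (simp add: meanzero_def)
 finally show "(LBINT x. G (L*x)*indicator {of_int z*(et/abs L)..(of_int z + 1)*(et/abs L)} x) = 0" .
qed

text \<open>The substitution of \<open>L*x\<close> for \<open>x\<close> normalises the displacement
  of \<open>F\<close>: it replaces \<open>l\<close> by \<open>a = l/L\<close> and \<open>et\<close>
  by \<open>et/abs L\<close>, and all norms scale consistently. The threshold
  \<open>c = 1/V^8\<close> is the smallness assumption of the locale.\<close>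

theorem smoothing_general:
 fixes kp b :: real
 assumes "kp > 0" "kp ~= 1" "b > 1"
 shows "\<exists>C>0. \<exists>c>0. \<forall>L l et ep F G. L ~= 0 --> l ~= 0 --> abs l <= c*abs L --> 0 < ep --> ep <= 1 -->
   0 < et --> et <= abs l*ep^28 --> bcs F --> bcs G --> meanzero et G -->
   (LBINT x. abs (Sop b kp L l F G x)) <= C * sqrt ep*N2 F*N2 G"
proof -
 obtain V where V: "\<And>a. a ~= 0 ==> abs a*V^8 <= 1 ==> curve kp b a V"
  using curve_exists[OF assms] by blast
 have V4: "V >= 4"
 proof -
  have p: "0 < 1 + V^8" by (rule add_pos_nonneg) simp_all
  \<comment> \<open>Any admissible \<open>a\<close> would do; this one only provides an instance of
    the locale from which \<open>V >= 4\<close> can be read off.\<close>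
  have "abs (1/(1 + V^8))*V^8 = V^8/(1 + V^8)" using p by (simp add: abs_of_pos)
  also have "... <= 1" using p by (subst divide_le_eq_1_pos) auto
  finally have "curve kp b (1/(1 + V^8)) V" using p by (intro V) auto
  then show ?thesis by (rule curve.V4)
 qed
 define C where "C = sqrt (300*V^26)"
 define c where "c = 1/V^8"
 have "(LBINT x. abs (Sop b kp L l F G x)) <= C * sqrt ep*N2 F*N2 G"
  if h: "L ~= 0" "l ~= 0" "abs l <= c*abs L" "0 < ep" "ep <= 1" "0 < et" "et <= abs l*ep^28" "bcs F" "bcs G" "meanzero et G"
  for L l et ep F G
 proof -
  define a where "a = l/L"
  have a0: "a ~= 0" using h by (simp add: a_def)
  have "abs a <= 1/V^8" using h by (simp add: a_def c_def abs_divide field_simps)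
  then have aV: "abs a*V^8 <= 1" using V4 by (simp add: field_simps)
  interpret curve kp b a V by (rule V[OF a0 aV])
  have sm: "smoothing kp b a V (%x. G (L*x)) (et/abs L) ep"
  proof
   show "bcs (%x. G (L*x))" by (rule bcs_scale[OF h(9,1)])
   show "0 < et/abs L" using h by simp
   show "et/abs L <= abs a*ep^28" using h by (simp add: a_def abs_divide field_simps)
   show "(LBINT x. G (L*x)*indicator {of_int z*(et/abs L)..(of_int z + 1)*(et/abs L)} x) = 0" for z
    using meanzero_scale[OF h(10,1,6)] by (simp add: meanzero_def)
  qed (use h in auto)
  have "(LBINT x. abs (LBINT s. wt s*F (L*(x - s))*G (L*(x - a * s powr kp))))
   <= sqrt (300*V^26*ep)*N2 (%x. F (L*x))*N2 (%x. G (L*x))"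
   by (rule smoothing.smoothing_bound[OF sm bcs_scale[OF h(8,1)]])
  also have "(%x. abs (LBINT s. wt s*F (L*(x - s))*G (L*(x - a * s powr kp)))) = (%x. abs (Sop b kp L l F G (L*x)))"
  proof
   fix x
   have "wt s*F (L*(x - s))*G (L*(x - a * s powr kp)) = wgt b s*(F (L*x - L * s)*G (L*x - l * s powr kp))" for s
    using h(1) by (simp add: wt_def wgt_def a_def right_diff_distrib)
   then show "abs (LBINT s. wt s*F (L*(x - s))*G (L*(x - a * s powr kp))) = abs (Sop b kp L l F G (L*x))"
    by (simp add: Sop_def)
  qed
  also have "(LBINT x. abs (Sop b kp L l F G (L*x))) = (1/abs L)*(LBINT x. abs (Sop b kp L l F G x))"
   by (rule integral_scale[OF h(1)])
  also have "sqrt (300*V^26*ep)*N2 (%x. F (L*x))*N2 (%x. G (L*x)) = (1/abs L)*(C * sqrt ep*N2 F*N2 G)"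
   unfolding N2_scale[OF h(1)] C_def by (simp add: real_sqrt_mult)
  finally show ?thesis using h(1) by (simp add: field_simps)
 qed
 moreover have "C > 0" "c > 0" using V4 by (auto simp: C_def c_def)
 ultimately show ?thesis by blast
qed

section \<open>Dyadic martingales\<close>

definition same :: "int => real => real => bool" where
 "same k x y \<longleftrightarrow> \<lfloor>2 powr of_int k*x\<rfloor> = \<lfloor>2 powr of_int k*y\<rfloor>"

definition ker :: "int => real => real => real" where
 "ker k x y = (if same k x y then 2 powr of_int k else 0)"

text \<open>Conditional expectation on the dyadic intervals of length \<open>2 powr (- k)\<close>.
  The form with a symmetric kernel makes self-adjointness a case of Fubini's theorem and needs no
  sigma-algebras.\<close>

definition E :: "int => (real => real) => real => real" where
 "E k f x = (LBINT y. ker k x y*f y)"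

lemma same_refl [simp]: "same k x x" by (simp add: same_def)
lemma same_sym: "same k x y ==> same k y x" by (simp add: same_def)
lemma same_trans: "same k x y ==> same k y z ==> same k x z" by (simp add: same_def)

lemma same_dist: assumes "same k x y" shows "abs (x - y) <= 2 powr (- of_int k)"
proof -
 have "abs (2 powr of_int k*x - 2 powr of_int k*y) <= 1"
  using assms floor_correct[of "2 powr of_int k*x"] floor_correct[of "2 powr of_int k*y"]
  unfolding same_def by linarith
 then have "2 powr of_int k*abs (x - y) <= 1" by (simp add: abs_mult flip: right_diff_distrib)
 then show ?thesis by (simp add: powr_minus field_simps)
qed

lemma same_coarser: assumes "same k x y" "j <= k" shows "same j x y"
proof -
 define n where "n = (2::int)^nat (k - j)"
 have n: "real_of_int n = 2 powr of_int (k - j)" using assms(2) by (simp add: n_def powr_realpow[symmetric])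
 have "2 powr of_int j*x = (2 powr of_int k*x)/real_of_int n" for x :: real
  unfolding n by (simp add: powr_diff)
 then have "\<lfloor>2 powr of_int j*x\<rfloor> = \<lfloor>2 powr of_int k*x\<rfloor> div n" for x :: real
  using floor_divide_real_eq_div[of n "2 powr of_int k*x"] by (simp add: n_def)
 then show ?thesis using assms(1) by (simp add: same_def)
qed

lemma same_measurable [measurable]: "Measurable.pred (borel \<Otimes>\<^sub>M borel) (%z. same k (fst z) (snd z))"
 unfolding same_def by measurable

lemma ker_measurable [measurable]: "(%(x, y). ker k x y) \<in> borel_measurable (borel \<Otimes>\<^sub>M borel)"
proof -
 have "(%z. if same k (fst z) (snd z) then 2 powr of_int k else 0 :: real) \<in> borel_measurable (borel \<Otimes>\<^sub>M borel)"
  by measurable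
 then show ?thesis by (simp add: ker_def case_prod_unfold)
qed

lemma ker_sym: "ker k x y = ker k y x" by (simp add: ker_def same_def)

lemma ker_nonneg: "0 <= ker k x y" by (simp add: ker_def)

lemma ker_bound: "abs (ker k x y) <= 2 powr of_int k" by (simp add: ker_def)

lemma ker_support: "ker k x y ~= 0 ==> abs (x - y) <= 2 powr (- of_int k)"
 using same_dist[of k x y] by (auto simp: ker_def split: if_splits)

lemma same_interval: "same k x y \<longleftrightarrow> y \<in> {of_int \<lfloor>2 powr of_int k*x\<rfloor>*2 powr (- of_int k)..<(of_int \<lfloor>2 powr of_int k*x\<rfloor> + 1)*2 powr (- of_int k)}"
proof -
 have "same k x y \<longleftrightarrow> of_int \<lfloor>2 powr of_int k*x\<rfloor> <= 2 powr of_int k*y & 2 powr of_int k*y < of_int \<lfloor>2 powr of_int k*x\<rfloor> + 1"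
  unfolding same_def by (metis floor_eq_iff)
 then show ?thesis by (auto simp: powr_minus field_simps)
qed

lemma ker_bcs: "bcs (ker k x)"
 by (rule bcsI[where M = "2 powr of_int k" and R = "abs x + 2 powr (- of_int k)"])
  (use ker_bound ker_support[of k x] in \<open>force+\<close>)

lemma ker_integral: "(LBINT y. ker k x y) = 1"
proof -
 define n where "n = of_int \<lfloor>2 powr of_int k*x\<rfloor>*(2::real) powr (- of_int k)"
 have "ker k x y = 2 powr of_int k*indicator {n..<n + 2 powr (- of_int k)} y" for y
  using same_interval[of k x y] by (auto simp: ker_def n_def indicator_def algebra_simps)
 then show ?thesis by (simp add: powr_minus)
qed

lemma E_kernel_bcs:
 assumes "bcs f" shows "bcs (%(x, y). ker k x y*f y)"
proof -
 obtain M R where MR: "0 <= M" "0 <= R" "\<And>x. abs (f x) <= M" "\<And>x. f x ~= 0 ==> norm x <= R" using bcs_ex[OF assms] by blast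
 have [measurable]: "f \<in> borel_measurable borel" by (rule bcs_measurable[OF assms])
 have m: "(%(x, y). ker k x y*f y) \<in> borel_measurable (borel \<Otimes>\<^sub>M borel)" by measurable
 show ?thesis
 proof (rule bcs2I[OF m, where M = "2 powr of_int k*M" and R = "R + 2 powr (- of_int k)"])
  fix x y
  show "abs (case (x, y) of (x, y) => ker k x y*f y) <= 2 powr of_int k*M"
   using mult_mono[OF ker_bound[of k x y] MR(3)[of y]] by (simp add: abs_mult)
  assume "(case (x, y) of (x, y) => ker k x y*f y) ~= 0"
  then have "abs y <= R" "abs (x - y) <= 2 powr (- of_int k)" using MR(4)[of y] ker_support[of k x y] by auto
  then show "abs x <= R + 2 powr (- of_int k) & abs y <= R + 2 powr (- of_int k)" by (auto simp: abs_if split: if_splits)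
 qed
qed

lemma E_bcs: "bcs f ==> bcs (E k f)"
 using bcs_integral_snd[OF E_kernel_bcs, of f k] by (simp add: E_def[abs_def])

lemma E_int: "bcs f ==> integrable lborel (%y. ker k x y*f y)"
 using bcs_integrable[OF bcs_slice(1)[OF E_kernel_bcs]] by simp

lemma E_selfadj:
 assumes "bcs f" "bcs g"
 shows "(LBINT x. E k f x*g x) = (LBINT x. f x*E k g x)"
proof -
 have [measurable]: "g \<in> borel_measurable borel" by (rule bcs_measurable[OF assms(2)])
 have m: "(%z::real\<times>real. g (fst z)) \<in> borel_measurable borel"
 proof -
  have "(%z::real\<times>real. g (fst z)) \<in> borel_measurable (borel \<Otimes>\<^sub>M borel)" by measurable
  then show ?thesis by (simp add: borel_prod)
 qed
 have "bcs (%z. (case z of (x, y) => ker k x y*f y)*g (fst z))"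
  by (rule bcs_mult[OF E_kernel_bcs[OF assms(1)] m]) (use bcs_bounded[OF assms(2)] in \<open>auto simp: bounded_iff\<close>)
 from bcs_Fubini[OF this] have "(LBINT x. LBINT y. ker k x y*f y*g x) = (LBINT y. LBINT x. ker k x y*f y*g x)" by simp
 moreover have "(LBINT x. ker k x y*f y*g x) = f y*E k g y" for y
 proof -
  have eq: "ker k x y*f y*g x = f y*(ker k y x*g x)" for x using ker_sym[of k x y] by simp
  show ?thesis unfolding eq E_def by (rule Bochner_Integration.integral_mult_right_zero)
 qed
 ultimately show ?thesis by (simp add: E_def)
qed

lemma E_same: assumes "same k x y" shows "E k f x = E k f y"
proof -
 have "ker k x z = ker k y z" for z using assms by (simp add: ker_def same_def)
 then show ?thesis by (simp add: E_def)
qed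

lemma E_mult_const:
 assumes "\<And>x y. same k x y ==> u x = u y"
 shows "E k (%x. u x*f x) x = u x*E k f x"
proof -
 have eq: "ker k x y*(u y*f y) = u x*(ker k x y*f y)" for y using assms[of x y] by (simp add: ker_def)
 show ?thesis unfolding E_def eq by (rule Bochner_Integration.integral_mult_right_zero)
qed

lemma E_of_const:
 assumes "\<And>x y. same k x y ==> u x = u y" shows "E k u = u"
proof
 fix x
 have "E k (%x. u x*1) x = u x*E k (%x. 1) x" by (rule E_mult_const) (use assms in blast)
 then show "E k u x = u x" using ker_integral[of k x] by (simp add: E_def)
qed

lemma E_E_fine: "j <= k ==> E k (E j f) = E j f"
 by (rule E_of_const) (metis E_same same_coarser)

text \<open>The inner average is moved onto the kernel \<open>ker j x\<close> by self-adjointness;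
  that kernel is constant on the finer cells and hence is its own average.\<close>

lemma E_E_coarse:
 assumes "bcs f" "j <= k" shows "E j (E k f) = E j f"
proof
 fix x
 have "E j (E k f) x = (LBINT y. E k f y*ker j x y)" by (simp add: E_def[of j] mult.commute)
 also have "... = (LBINT y. f y*E k (ker j x) y)" by (rule E_selfadj[OF assms(1) ker_bcs])
 also have "E k (ker j x) = ker j x"
 proof (rule E_of_const)
  fix y z assume "same k y z"
  then have "same j y z" using assms(2) same_coarser by blast
  then show "ker j x y = ker j x z" unfolding ker_def by (metis same_sym same_trans)
 qed
 also have "(LBINT y. f y*ker j x y) = E j f x" by (simp add: E_def mult.commute)
 finally show "E j (E k f) x = E j f x" .
qed

lemma E_idem: "E k (E k f) = E k f" by (rule E_E_fine) simp

lemma E_add: "bcs f ==> bcs g ==> E k (%x. f x + g x) x = E k f x + E k g x"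
 unfolding E_def distrib_left by (intro Bochner_Integration.integral_add E_int)

lemma E_diff: "bcs f ==> bcs g ==> E k (%x. f x - g x) x = E k f x - E k g x"
 unfolding E_def right_diff_distrib by (intro Bochner_Integration.integral_diff E_int)

lemma E_zero [simp]: "E k (%x. 0) x = 0" by (simp add: E_def)

lemma E_sum: "(\<And>i. i \<in> I ==> bcs (f i)) ==> E k (%x. \<Sum>i\<in>I. f i x) x = (\<Sum>i\<in>I. E k (f i) x)"
proof (induction I rule: infinite_finite_induct)
 case (insert i I)
 then show ?case using E_add[of "f i" "%x. \<Sum>i\<in>I. f i x" k x] bcs_sum[of I f] by auto
qed auto

lemma E_nonneg: "(\<And>x. 0 <= f x) ==> 0 <= E k f x"
 unfolding E_def by (intro integral_nonneg_AE AE_I2 mult_nonneg_nonneg ker_nonneg)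

lemma E_abs: "abs (E k f x) <= E k (%x. abs (f x)) x"
proof -
 have "abs (E k f x) <= (LBINT y. abs (ker k x y*f y))" unfolding E_def by (rule integral_abs_bound)
 then show ?thesis using ker_nonneg by (simp add: E_def abs_mult)
qed

lemma E_bounded: assumes "bcs f" "\<And>x. abs (f x) <= M" shows "abs (E k f x) <= M"
proof -
 have "abs (E k f x) <= (LBINT y. ker k x y*abs (f y))" using E_abs[of k f x] by (simp add: E_def)
 also have "... <= (LBINT y. ker k x y*M)"
  using E_int[OF bcs_abs[OF assms(1)]] bcs_integrable[OF bcs_multc[OF ker_bcs]]
  by (intro integral_mono mult_left_mono ker_nonneg assms) auto
 also have "... = M" using ker_integral[of k x] by simp
 finally show ?thesis .
qed

lemma E_integral: "bcs f ==> (LBINT x. E k f x*E j g x) = (LBINT x. f x*E j g x)"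
 if "j <= k" "bcs g"
 using E_selfadj[of f "E j g" k] E_bcs[OF that(2)] E_E_fine[OF that(1)] by metis

lemma N2_E_sq: "bcs f ==> (N2 (E k f))\<^sup>2 = (LBINT x. f x*E k f x)"
 unfolding N2_power2 using E_integral[of k k f f] by (simp add: power2_eq_square)

lemma N2_E: assumes "bcs f" shows "N2 (E k f) <= N2 f"
proof -
 have "(N2 (E k f))\<^sup>2 <= N2 f*N2 (E k f)"
  unfolding N2_E_sq[OF assms] by (rule bcs_Cauchy_Schwarz[OF assms E_bcs[OF assms]])
 then have "N2 (E k f)*(N2 (E k f) - N2 f) <= 0" by (simp add: power2_eq_square algebra_simps)
 then show ?thesis using N2_nonneg[of "E k f"] N2_nonneg[of f]
  by (metis diff_gt_0_iff_gt linorder_not_le mult_pos_pos order_le_less_trans)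
qed

lemma pythagoras:
 assumes "bcs f" "j <= k"
 shows "(N2 (%x. E k f x - E j f x))\<^sup>2 = (N2 (E k f))\<^sup>2 - (N2 (E j f))\<^sup>2"
proof -
 note b = E_bcs[OF assms(1), of k] E_bcs[OF assms(1), of j]
 have e1: "(LBINT x. E k f x*E j f x) = (LBINT x. f x*E j f x)"
  by (rule E_integral[OF assms(2,1,1)])
 have "(N2 (%x. E k f x - E j f x))\<^sup>2 = (LBINT x. (E k f x)\<^sup>2 - 2*(E k f x*E j f x) + (E j f x)\<^sup>2)"
  unfolding N2_power2 by (simp add: power2_eq_square algebra_simps)
 also have "... = (N2 (E k f))\<^sup>2 - 2*(LBINT x. E k f x*E j f x) + (N2 (E j f))\<^sup>2"
  using b[THEN bcs_power2, THEN bcs_integrable] bcs_integrable[OF bcs_times[OF b]] by (simp add: N2_power2)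
 finally show ?thesis unfolding e1 N2_E_sq[OF assms(1), of j, symmetric] by simp
qed

text \<open>A Bernstein inequality: averages over intervals of length \<open>2 powr (- k)\<close>
  are pointwise at most \<open>2 powr k\<close> times the L1 norm, and pairing with \<open>f\<close>
  gives the L2 bound. It makes the coarse end of the martingale vanish in the limit.\<close>

lemma N2_E_small:
 assumes "bcs f" shows "(N2 (E k f))\<^sup>2 <= 2 powr of_int k*(LBINT x. abs (f x))\<^sup>2"
proof -
 define I where "I = (LBINT x. abs (f x))"
 have pt: "abs (E k f x) <= 2 powr of_int k*I" for x
 proof -
  have "abs (E k f x) <= (LBINT y. ker k x y*abs (f y))" using E_abs[of k f x] by (simp add: E_def)
  also have "... <= (LBINT y. 2 powr of_int k*abs (f y))"
   using E_int[OF bcs_abs[OF assms]] bcs_integrable[OF bcs_cmult[OF bcs_abs[OF assms]]]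
   by (intro integral_mono mult_right_mono) (auto simp: ker_def)
  finally show ?thesis by (simp add: I_def)
 qed
 have "(N2 (E k f))\<^sup>2 = (LBINT x. f x*E k f x)" by (rule N2_E_sq[OF assms])
 also have "... <= (LBINT x. (2 powr of_int k*I)*abs (f x))"
 proof (rule integral_mono)
  show "integrable lborel (%x. f x*E k f x)" by (intro bcs_integrable bcs_times assms E_bcs)
  show "integrable lborel (%x. (2 powr of_int k*I)*abs (f x))" by (rule bcs_integrable[OF bcs_cmult[OF bcs_abs[OF assms]]])
  fix x
  have "f x*E k f x <= abs (f x)*abs (E k f x)" by (metis abs_ge_self abs_mult)
  also have "... <= abs (f x)*(2 powr of_int k*I)" by (intro mult_left_mono pt) simp
  finally show "f x*E k f x <= (2 powr of_int k*I)*abs (f x)" by (simp add: mult.commute)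
 qed
 also have "... = 2 powr of_int k*I\<^sup>2" by (simp add: I_def power2_eq_square)
 finally show ?thesis by (simp add: I_def)
qed

text \<open>Links the martingale to the smoothing estimate: the cells of \<open>same\<close> are
  half open, those of \<open>meanzero\<close> closed, and they differ by a null set.\<close>

lemma meanzero_E:
 assumes "bcs G" "\<And>x. E k G x = 0" shows "meanzero (2 powr (- of_int k)) G"
 unfolding meanzero_def
proof
 fix z :: int
 define x where "x = of_int z*(2::real) powr (- of_int k)"
 have "2 powr of_int k*x = of_int z" by (simp add: x_def powr_minus field_simps)
 then have fl: "\<lfloor>2 powr of_int k*x\<rfloor> = z" by simp
 have "(LBINT y. G y*indicator {of_int z*2 powr (- of_int k)..(of_int z + 1)*2 powr (- of_int k)} y)
   = (LBINT y. 2 powr (- of_int k)*(ker k x y*G y))"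
 proof (rule integral_cong_AE)
  show "AE y in lborel. G y*indicator {of_int z*2 powr (- of_int k)..(of_int z + 1)*2 powr (- of_int k)} y = 2 powr (- of_int k)*(ker k x y*G y)"
   using AE_lborel_singleton[of "(of_int z + 1)*2 powr (- of_int k)"]
  proof eventually_elim
   case (elim y)
   have "same k x y \<longleftrightarrow> y \<in> {of_int z*2 powr (- of_int k)..<(of_int z + 1)*2 powr (- of_int k)}"
    using same_interval[of k x y] fl by simp
   then show ?case using elim by (auto simp: ker_def indicator_def powr_minus)
  qed
  have [measurable]: "G \<in> borel_measurable borel" by (rule bcs_measurable[OF assms(1)])
  show "(%y. G y*indicator {of_int z*2 powr (- of_int k)..(of_int z + 1)*2 powr (- of_int k)} y) \<in> borel_measurable lborel" by simp
  show "(%y. 2 powr (- of_int k)*(ker k x y*G y)) \<in> borel_measurable lborel" by simp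
 qed
 also have "... = 0" using assms(2)[of x] by (simp add: E_def)
 finally show "(LBINT y. G y*indicator {of_int z*2 powr (- of_int k)..(of_int z + 1)*2 powr (- of_int k)} y) = 0" .
qed

section \<open>Translations and dyadic averages\<close>

lemma N2_mono:
 assumes "bcs f" "bcs g" "\<And>x. abs (f x) <= abs (g x)"
 shows "N2 f <= N2 g"
 unfolding N2_def
proof (intro real_sqrt_le_mono integral_mono bcs_integrable bcs_power2 assms)
 show "(f x)\<^sup>2 <= (g x)\<^sup>2" for x using assms(3)[of x] by (simp add: abs_le_square_iff)
qed

lemma N2_nonneg_le: "N2 f <= B ==> 0 <= B" using N2_nonneg[of f] by linarith

text \<open>Within one cell the points carried out by the shift form a set of measure at most
  \<open>abs y\<close>, and \<open>H\<close> is constant there. To exploit this, \<open>H\<close> is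
  written as its own average and the integral of the exit indicator is taken for each cell.\<close>

lemma cross_cell:
 assumes H: "bcs H" "\<And>x. 0 <= H x" and c: "\<And>x y. same k x y ==> H x = H y"
 shows "(LBINT x. (if same k x (x - y) then 0 else 1)*H x) <= abs y*2 powr of_int k*(LBINT x. H x)"
proof -
 define d where "d x = (if same k x (x - y) then 0 else 1 :: real)" for x
 have [measurable]: "H \<in> borel_measurable borel" by (rule bcs_measurable[OF H(1)])
 have dm [measurable]: "d \<in> borel_measurable borel"
 proof -
  have "(%x. (x, x - y)) \<in> measurable borel (borel \<Otimes>\<^sub>M borel)" by measurable
  from measurable_compose[OF this same_measurable[of k]] have "Measurable.pred borel (%x. same k x (x - y))" by simp
  then show ?thesis unfolding d_def[abs_def] by measurable
 qed
 have dm2: "(%z::real\<times>real. d (fst z)) \<in> borel_measurable borel"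
 proof -
  have "(%z::real\<times>real. d (fst z)) \<in> borel_measurable (borel \<Otimes>\<^sub>M borel)" by measurable
  then show ?thesis by (simp add: borel_prod)
 qed
 have b: "bcs (%z. d (fst z)*(case z of (x, z) => ker k x z*H z))"
  by (rule bcs_mult'[OF E_kernel_bcs[OF H(1)] dm2]) (auto simp: bounded_iff d_def intro!: exI[of _ 1])
 have inner: "(LBINT x. d x*ker k x z) <= abs y*2 powr of_int k" for z
 proof -
  define n where "n = of_int \<lfloor>2 powr of_int k*z\<rfloor>*(2::real) powr (- of_int k)"
  define e where "e = (2::real) powr (- of_int k)"
  have sm: "same k z x \<longleftrightarrow> x \<in> {n..<n + e}" for x
   using same_interval[of k z x] by (simp add: n_def e_def algebra_simps)
  define A where "A = (if y >= 0 then {n..n+y} else {n+e+y..n+e})"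
  have le: "d x*ker k x z <= 2 powr of_int k*indicator A x" for x
  proof (cases "ker k x z = 0 \<or> d x = 0")
   case False
   then have s: "same k x z" "\<not> same k x (x - y)" by (auto simp: ker_def d_def split: if_splits)
   have 1: "x \<in> {n..<n+e}" using sm same_sym[OF s(1)] by blast
   have "\<not> same k z (x - y)" using s same_trans by blast
   then have 2: "x - y \<notin> {n..<n+e}" using sm by blast
   have "x \<in> A" using 1 2 by (auto simp: A_def)
   then show ?thesis by (simp add: d_def ker_def)
  qed auto
  have Ab: "bcs (%x. 2 powr of_int k*indicat_real A x)"
   by (intro bcs_cmult bcs_indicator) (auto simp: A_def)
  have i: "integrable lborel (%x. d x*ker k x z)"
  proof (rule Bochner_Integration.integrable_bound[OF bcs_integrable[OF Ab]])
   have "(%x. d x*ker k z x) \<in> borel_measurable lborel" by simp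
   then show "(%x. d x*ker k x z) \<in> borel_measurable lborel" using ker_sym[of k _ z] by simp
   show "AE x in lborel. norm (d x*ker k x z) <= norm (2 powr of_int k*indicat_real A x)"
   proof (rule AE_I2)
    fix x
    have "0 <= d x*ker k x z" using ker_nonneg by (simp add: d_def)
    then show "norm (d x*ker k x z) <= norm (2 powr of_int k*indicat_real A x)" using le[of x] by simp
   qed
  qed
  have "(LBINT x. d x*ker k x z) <= (LBINT x. 2 powr of_int k*indicat_real A x)"
   by (rule integral_mono[OF i bcs_integrable[OF Ab] le])
  also have "... = abs y*2 powr of_int k" by (simp add: A_def)
  finally show ?thesis .
 qed
 have "(LBINT x. d x*H x) = (LBINT x. d x*E k H x)" using E_of_const[of k H] c by simp
 also have "... = (LBINT x. LBINT z. d x*(ker k x z*H z))" by (simp add: E_def)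
 also have "... = (LBINT z. LBINT x. d x*(ker k x z*H z))" using bcs_Fubini[OF b] by simp
 also have "... <= (LBINT z. (abs y*2 powr of_int k)*H z)"
 proof (rule integral_mono)
  show "integrable lborel (%z. LBINT x. d x*(ker k x z*H z))" using bcs_integrable[OF bcs_integral_fst[OF b]] by simp
  show "integrable lborel (%z. (abs y*2 powr of_int k)*H z)" by (intro bcs_integrable bcs_cmult H)
  fix z
  have "(LBINT x. d x*(ker k x z*H z)) = (LBINT x. d x*ker k x z)*H z" by (simp add: mult.assoc[symmetric])
  also have "... <= (abs y*2 powr of_int k)*H z" by (rule mult_right_mono[OF inner H(2)])
  finally show "(LBINT x. d x*(ker k x z*H z)) <= (abs y*2 powr of_int k)*H z" .
 qed
 finally show ?thesis by (simp add: d_def)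
qed

text \<open>A step function changes under translation only at points that leave their cell; there
  the difference is bounded by the two values, and \<open>cross_cell\<close> applies to each, with
  the opposite shift for one of them.\<close>

lemma shift_step:
 assumes F: "bcs F" "E k F = F"
 shows "N2 (%x. F (x - y) - F x) <= 2 * sqrt (abs y*2 powr of_int k)*N2 F"
proof -
 have [measurable]: "F \<in> borel_measurable borel" by (rule bcs_measurable[OF F(1)])
 define d where "d y x = (if same k x (x - y) then 0 else 1 :: real)" for y x
 have dm [measurable]: "d y \<in> borel_measurable borel" for y
 proof -
  have "(%x. (x, x - y)) \<in> measurable borel (borel \<Otimes>\<^sub>M borel)" by measurable
  from measurable_compose[OF this same_measurable[of k]] have "Measurable.pred borel (%x. same k x (x - y))" by simp
  then show ?thesis unfolding d_def[abs_def] by measurable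
 qed
 have db: "bounded (range (d y))" for y by (auto simp: bounded_iff d_def intro!: exI[of _ 1])
 have c: "same k x z ==> (F x)\<^sup>2 = (F z)\<^sup>2" for x z using E_same[of k x z F] F(2) by simp
 have b2: "bcs (%x. (F x)\<^sup>2)" by (rule bcs_power2[OF F(1)])
 have I: "(LBINT x. d y x*(F x)\<^sup>2) <= abs y*2 powr of_int k*(N2 F)\<^sup>2" for y
  unfolding d_def N2_power2 by (rule cross_cell[OF b2 _ c]) auto
 have b1: "bcs (%x. F (x - y))" by (rule bcs_shift[OF F(1)])
 have Fb: "bcs (%x. F (x - y) - F x)" by (rule bcs_diff[OF b1 F(1)])
 have i1: "bcs (%x. d y x*(F (x - y))\<^sup>2)" by (rule bcs_mult'[OF bcs_power2[OF b1] dm db])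
 have i2: "bcs (%x. d y x*(F x)\<^sup>2)" by (rule bcs_mult'[OF b2 dm db])
 have "(N2 (%x. F (x - y) - F x))\<^sup>2 = (LBINT x. (F (x - y) - F x)\<^sup>2)" by (rule N2_power2)
 also have "... <= (LBINT x. 2*(d y x*(F (x - y))\<^sup>2) + 2*(d y x*(F x)\<^sup>2))"
 proof (rule integral_mono[OF bcs_integrable[OF bcs_power2[OF Fb]] bcs_integrable[OF bcs_add[OF bcs_cmult[OF i1] bcs_cmult[OF i2]]]])
  fix x
  show "(F (x - y) - F x)\<^sup>2 <= 2*(d y x*(F (x - y))\<^sup>2) + 2*(d y x*(F x)\<^sup>2)"
  proof (cases "same k x (x - y)")
   case True
   then show ?thesis using E_same[of k x "x - y" F] F(2) by (simp add: d_def)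
  next
   case False
   have "0 <= (F (x - y) + F x)\<^sup>2" by simp
   then show ?thesis using False by (simp add: d_def power2_eq_square algebra_simps)
  qed
 qed
 also have "... = 2*(LBINT x. d y x*(F (x - y))\<^sup>2) + 2*(LBINT x. d y x*(F x)\<^sup>2)"
  using bcs_integrable[OF i1] bcs_integrable[OF i2] by simp
 also have "(LBINT x. d y x*(F (x - y))\<^sup>2) = (LBINT x. d (-y) x*(F x)\<^sup>2)"
 proof -
  have "(LBINT x. d (-y) x*(F x)\<^sup>2) = (LBINT x. d (-y) (x - y)*(F (x - y))\<^sup>2)"
   using integral_shift[of "%x. d (-y) x*(F x)\<^sup>2" y] by simp
  moreover have "d (-y) (x - y) = d y x" for x by (auto simp: d_def same_def)
  ultimately show ?thesis by simp
 qed
 also have "2*(LBINT x. d (-y) x*(F x)\<^sup>2) + 2*(LBINT x. d y x*(F x)\<^sup>2) <= 4*(abs y*2 powr of_int k*(N2 F)\<^sup>2)"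
  using I[of y] I[of "-y"] by simp
 also have "... = (2 * sqrt (abs y*2 powr of_int k)*N2 F)\<^sup>2" by (simp add: power_mult_distrib)
 finally show ?thesis by (rule power2_le_imp_le) simp
qed

text \<open>The deviation from the mean is an average of increments; the kernel is at most
  \<open>2 powr k\<close> on a window of length \<open>2*2 powr (- k)\<close>, which is the factor
  2.\<close>

lemma sub_E:
 assumes \<psi>: "bcs \<psi>" and B: "\<And>y. abs y <= 2 powr (- of_int k) ==> N2 (%x. \<psi> (x - y) - \<psi> x) <= B"
 shows "N2 (%x. \<psi> x - E k \<psi> x) <= 2*B"
proof -
 have [measurable]: "\<psi> \<in> borel_measurable borel" by (rule bcs_measurable[OF \<psi>])
 define h where "h = (2::real) powr (- of_int k)"
 have h0: "0 < h" by (simp add: h_def)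
 have B0: "0 <= B" using B[of 0] N2_nonneg_le by (auto simp: h_def)
 obtain M R where MR: "0 <= M" "0 <= R" "\<And>x. abs (\<psi> x) <= M" "\<And>x. \<psi> x ~= 0 ==> norm x <= R" using bcs_ex[OF \<psi>] by blast
 define \<Phi> where "\<Phi> x y = ker k x (x - y)*(\<psi> x - \<psi> (x - y))" for x y
 have m: "(%(x, y). \<Phi> x y) \<in> borel_measurable (borel \<Otimes>\<^sub>M borel)" unfolding \<Phi>_def by measurable
 have b: "bcs (%(x, y). \<Phi> x y)"
 proof (rule bcs2I[OF m, where M = "2 powr of_int k*(M + M)" and R = "R + h"])
  fix x y
  have "abs (\<Phi> x y) <= 2 powr of_int k*(M + M)" unfolding \<Phi>_def abs_mult
   using ker_bound[of k x "x - y"] MR(3)[of x] MR(3)[of "x - y"] by (intro mult_mono) auto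
  then show "abs (case (x, y) of (x, y) => \<Phi> x y) <= 2 powr of_int k*(M + M)" by simp
  assume "(case (x, y) of (x, y) => \<Phi> x y) ~= 0"
  then have "abs y <= h" "\<psi> x ~= 0 \<or> \<psi> (x - y) ~= 0" using ker_support[of k x "x - y"] by (auto simp: \<Phi>_def h_def)
  then show "abs x <= R + h & abs y <= R + h" using MR(4)[of x] MR(4)[of "x - y"] MR(2) h0 by auto
 qed
 have e: "\<psi> x - E k \<psi> x = (LBINT y. \<Phi> x y)" for x
 proof -
  have "\<psi> x - E k \<psi> x = (LBINT z. ker k x z*\<psi> x) - (LBINT z. ker k x z*\<psi> z)"
   using ker_integral[of k x] by (simp add: E_def)
  also have "... = (LBINT z. ker k x z*\<psi> x - ker k x z*\<psi> z)"
   by (intro Bochner_Integration.integral_diff[symmetric] E_int[OF \<psi>] bcs_integrable bcs_multc ker_bcs)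
  also have "... = (LBINT z. ker k x z*(\<psi> x - \<psi> z))" by (simp add: right_diff_distrib)
  also have "... = (LBINT y. \<Phi> x y)" unfolding \<Phi>_def by (rule integral_sub_reflect)
  finally show ?thesis .
 qed
 have "N2 (%x. LBINT y. (case (x, y) of (x, y) => \<Phi> x y)) <= (LBINT y. (2 powr of_int k*B)*indicator {-h..h} y)"
 proof (rule N2_integral_le[OF b])
  show "bcs (%y. (2 powr of_int k*B)*indicat_real {-h..h} y)" by (intro bcs_cmult bcs_indicator) auto
  fix y
  show "N2 (%x. case (x, y) of (x, y) => \<Phi> x y) <= (2 powr of_int k*B)*indicator {-h..h} y"
  proof (cases "y \<in> {-h..h}")
   case True
   have sb: "bcs (%x. \<psi> (x - y) - \<psi> x)" by (intro bcs_diff bcs_shift \<psi>)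
   have pb: "bcs (%x. \<Phi> x y)" using bcs_slice(2)[OF b, of y] by simp
   have "N2 (%x. \<Phi> x y) <= N2 (%x. 2 powr of_int k*(\<psi> (x - y) - \<psi> x))"
   proof (rule N2_mono[OF pb bcs_cmult[OF sb]])
    show "abs (\<Phi> x y) <= abs (2 powr of_int k*(\<psi> (x - y) - \<psi> x))" for x
     using mult_right_mono[OF ker_bound[of k x "x - y"], of "abs (\<psi> x - \<psi> (x - y))"]
     by (simp add: \<Phi>_def abs_mult abs_minus_commute)
   qed
   also have "... = 2 powr of_int k*N2 (%x. \<psi> (x - y) - \<psi> x)" by (simp add: N2_cmult)
   also have "... <= 2 powr of_int k*B" using True by (intro mult_left_mono B) (auto simp: h_def)
   finally show ?thesis using True by simp
  next
   case False
   then have "ker k x (x - y) = 0" for x using ker_support[of k x "x - y"] by (force simp: h_def abs_le_iff)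
   then have z: "\<Phi> x y = 0" for x by (simp add: \<Phi>_def)
   show ?thesis using False z by simp
  qed
 qed
 also have "... = 2*B" using h0 by (simp add: h_def powr_minus)
 finally show ?thesis by (simp add: e)
qed

section \<open>Averages of one function along a power\<close>

lemma wgt_bounds: "0 <= wgt b s" "wgt b s <= indicator {1..b} s" "abs (wgt b s) <= 1" "wgt b s ~= 0 ==> s \<in> {1..b}"
 by (auto simp: wgt_def indicator_def)

lemma wgt_measurable [measurable]: "wgt b \<in> borel_measurable borel"
 unfolding wgt_def[abs_def] by measurable

lemma wgt_bcs: "bcs (wgt b)"
 by (rule bcsI[where M = 1 and R = "abs b"]) (auto simp: wgt_def indicator_def split: if_splits)

lemma wgt_integral: assumes "b > 1" shows "(LBINT s. wgt b s) <= b"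
proof -
 have "(LBINT s. wgt b s) <= (LBINT s. indicat_real {1..b} s)"
  by (intro integral_mono bcs_integrable wgt_bcs bcs_indicator wgt_bounds) auto
 then show ?thesis using assms by simp
qed

text \<open>Inside \<open>{1..b}\<close> the weight has Lipschitz constant 1, which gives
  \<open>(b - 1)*abs de\<close>; each of the two jumps contributes an interval of length
  \<open>2*abs de\<close>.\<close>

lemma wgt_shift:
 assumes "b > 1"
 shows "(LBINT s. abs (wgt b (s - de) - wgt b s)) <= (b + 3)*abs de"
proof -
 let ?B = "%s. abs de*indicat_real {1..b} s + (indicat_real {1-abs de..1+abs de} s + indicat_real {b-abs de..b+abs de} s)"
 have pt: "abs (wgt b (s - de) - wgt b s) <= ?B s" for s
 proof (cases "s \<in> {1..b}")
  case s: True
  show ?thesis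
  proof (cases "s - de \<in> {1..b}")
   case True
   have "abs (1/(s - de) - 1/s) = abs de/(s*(s - de))"
    using s True by (simp add: field_simps abs_divide abs_mult)
   also have "... <= abs de/1" using s True mult_mono[of 1 s 1 "s - de"] by (intro divide_left_mono) auto
   finally have "abs (wgt b (s - de) - wgt b s) <= abs de" using s True by (simp add: wgt_def)
   then show ?thesis using s by (auto simp: indicator_def)
  next
   case False
   then have "s \<in> {1-abs de..1+abs de} \<or> s \<in> {b-abs de..b+abs de}" using s by auto
   moreover have "abs (wgt b (s - de) - wgt b s) <= 1" using False wgt_bounds(3)[of b s] by (simp add: wgt_def)
   ultimately show ?thesis by (auto simp: indicator_def)
  qed
 next
  case s: False
  show ?thesis
  proof (cases "s - de \<in> {1..b}")
   case True
   then have "s \<in> {1-abs de..1+abs de} \<or> s \<in> {b-abs de..b+abs de}" using s by auto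
   moreover have "abs (wgt b (s - de) - wgt b s) <= 1" using s wgt_bounds(3)[of b "s - de"] by (simp add: wgt_def)
   ultimately show ?thesis by (auto simp: indicator_def)
  next
   case False
   then show ?thesis using s by (simp add: wgt_def)
  qed
 qed
 have Bb: "bcs ?B" by (intro bcs_add bcs_cmult bcs_indicator) auto
 have "(LBINT s. abs (wgt b (s - de) - wgt b s)) <= (LBINT s. ?B s)"
  by (intro integral_mono bcs_integrable bcs_abs bcs_diff bcs_shift wgt_bcs Bb pt)
 also have "... = abs de*(b - 1) + (2*abs de + 2*abs de)" using assms by simp
 also have "... <= (b + 3)*abs de" by (simp add: algebra_simps)
 finally show ?thesis .
qed

lemma conv_bcs:
 fixes \<omega> F ph :: "real => real"
 assumes \<omega>: "bcs \<omega>" and F: "bcs F" and ph [measurable]: "ph \<in> borel_measurable borel" and B: "\<And>s. \<omega> s ~= 0 ==> abs (ph s) <= B"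
 shows "bcs (%(x, s). \<omega> s*F (x - ph s))"
proof -
 have [measurable]: "\<omega> \<in> borel_measurable borel" "F \<in> borel_measurable borel" using assms bcs_measurable by auto
 obtain M R where MR: "0 <= M" "0 <= R" "\<And>x. abs (\<omega> x) <= M" "\<And>x. \<omega> x ~= 0 ==> norm x <= R" using bcs_ex[OF \<omega>] by blast
 obtain M' R' where MR': "0 <= M'" "0 <= R'" "\<And>x. abs (F x) <= M'" "\<And>x. F x ~= 0 ==> norm x <= R'" using bcs_ex[OF F] by blast
 have m: "(%(x, s). \<omega> s*F (x - ph s)) \<in> borel_measurable (borel \<Otimes>\<^sub>M borel)" by measurable
 show ?thesis
 proof (rule bcs2I[OF m, where M = "M*M'" and R = "R + R' + abs B"])
  fix x s
  show "abs (case (x, s) of (x, s) => \<omega> s*F (x - ph s)) <= M*M'"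
   using mult_mono[OF MR(3)[of s] MR'(3)[of "x - ph s"]] MR(1) by (simp add: abs_mult)
  assume "(case (x, s) of (x, s) => \<omega> s*F (x - ph s)) ~= 0"
  then have "abs s <= R" "abs (ph s) <= B" "abs (x - ph s) <= R'" using MR(4)[of s] B[of s] MR'(4)[of "x - ph s"] by auto
  then show "abs x <= R + R' + abs B & abs s <= R + R' + abs B" using MR(2) MR'(2) by linarith
 qed
qed

lemma wgt_pow_bound: "b > 1 ==> kp > 0 ==> wgt b s ~= 0 ==> abs (l * s powr kp) <= abs l*b powr kp"
 using wgt_bounds(4)[of b s] by (auto simp: abs_mult intro!: mult_left_mono powr_mono2)

definition Aop :: "real => real => real => (real => real) => real => real" where
 "Aop b kp l G x = (LBINT s. wgt b s*G (x - l * s powr kp))"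

lemma Aop_kernel_bcs:
 assumes "b > 1" "kp > 0" "bcs G" shows "bcs (%(x, s). wgt b s*G (x - l * s powr kp))"
 by (rule conv_bcs[OF wgt_bcs assms(3) _ wgt_pow_bound[OF assms(1,2)]]) measurable

lemma Aop_bcs: "b > 1 ==> kp > 0 ==> bcs G ==> bcs (Aop b kp l G)"
 using bcs_integral_snd[OF Aop_kernel_bcs] by (simp add: Aop_def[abs_def])

lemma Aop_int: "b > 1 ==> kp > 0 ==> bcs G ==> integrable lborel (%s. wgt b s*G (x - l * s powr kp))"
 using bcs_integrable[OF bcs_slice(1)[OF Aop_kernel_bcs]] by simp

lemma Aop_add: "b > 1 ==> kp > 0 ==> bcs F ==> bcs G ==> Aop b kp l (%x. F x + G x) x = Aop b kp l F x + Aop b kp l G x"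
 unfolding Aop_def distrib_left by (intro Bochner_Integration.integral_add Aop_int)

lemma Aop_N2:
 assumes "b > 1" "kp > 0" "bcs G" shows "N2 (Aop b kp l G) <= b*N2 G"
proof -
 have "N2 (%x. LBINT s. (case (x, s) of (x, s) => wgt b s*G (x - l * s powr kp))) <= (LBINT s. wgt b s*N2 G)"
  by (rule N2_integral_le[OF Aop_kernel_bcs[OF assms] bcs_multc[OF wgt_bcs]])
   (use wgt_bounds(1) in \<open>simp add: N2_cmult N2_shift\<close>)
 also have "... <= b*N2 G" using wgt_integral[OF assms(1)] by (simp add: mult_right_mono)
 finally show ?thesis by (simp add: Aop_def[abs_def])
qed

lemma Aop_adj:
 assumes "b > 1" "kp > 0" "bcs F" "bcs h"
 shows "(LBINT x. Aop b kp l F x*h x) = (LBINT x. F x*Aop b kp (-l) h x)"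
proof -
 have ext: "bcs (%(x, s). wgt b s*u (x - l * s powr kp) * v x)" if u: "bcs u" and v: "bcs v" for u v l
 proof -
  have [measurable]: "v \<in> borel_measurable borel" by (rule bcs_measurable[OF v])
  have m: "(%z::real\<times>real. v (fst z)) \<in> borel_measurable borel"
  proof -
   have "(%z::real\<times>real. v (fst z)) \<in> borel_measurable (borel \<Otimes>\<^sub>M borel)" by measurable
   then show ?thesis by (simp add: borel_prod)
  qed
  have "bcs (%z. (case z of (x, s) => wgt b s*u (x - l * s powr kp)) * v (fst z))"
   by (rule bcs_mult[OF Aop_kernel_bcs[OF assms(1,2) u] m]) (use bcs_bounded[OF v] in \<open>auto simp: bounded_iff\<close>)
  then show ?thesis by (simp add: case_prod_unfold)
 qed
 have "(LBINT x. Aop b kp l F x*h x) = (LBINT x. LBINT s. wgt b s*F (x - l * s powr kp)*h x)"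
  by (simp add: Aop_def)
 also have "... = (LBINT s. LBINT x. wgt b s*F (x - l * s powr kp)*h x)" using bcs_Fubini[OF ext[OF assms(3,4)]] by simp
 also have "... = (LBINT s. LBINT x. wgt b s*h (x - (-l) * s powr kp)*F x)"
 proof (rule Bochner_Integration.integral_cong[OF refl])
  fix s
  show "(LBINT x. wgt b s*F (x - l * s powr kp)*h x) = (LBINT x. wgt b s*h (x - (-l) * s powr kp)*F x)"
   using integral_shift[of "%x. wgt b s*h (x - (-l) * s powr kp)*F x" "l * s powr kp"] by (simp add: mult_ac)
 qed
 also have "... = (LBINT x. LBINT s. wgt b s*h (x - (-l) * s powr kp)*F x)"
  using bcs_Fubini[OF ext[OF assms(4,3), of "-l"]] by simp
 also have "... = (LBINT x. F x*Aop b kp (-l) h x)" by (simp add: Aop_def mult.commute)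
 finally show ?thesis .
qed

text \<open>The measure \<open>ds/s\<close> is multiplied by a constant under powers, so the shape
  of the weight survives with \<open>b\<close> replaced by \<open>b powr kp\<close>. This reduces
  \<open>Aop\<close> to exponent 1 and later exchanges the roles of the two functions.\<close>

lemma wgt_subst:
 assumes "b > 1" "kp > 0" "bcs (%r. wgt (b powr kp) r*h r)"
 shows "(LBINT s. wgt b s*h (s powr kp)) = (1/kp)*(LBINT r. wgt (b powr kp) r*h r)"
proof -
 define f where "f r = h r/r" for r
 have "(LBINT r. f r*indicator {1 powr kp..b powr kp} r) = (LBINT s. f (s powr kp)*(kp * s powr (kp - 1))*indicator {1..b} s)"
 proof (rule integral_substitution(2))
  have "(%s. wgt (b powr kp) s*h s) = (%s. indicat_real {1 powr kp..b powr kp} s *\<^sub>R f s)" by (auto simp: wgt_def f_def indicator_def)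
  with bcs_integrable[OF assms(3)] show "set_integrable lborel {1 powr kp..b powr kp} f" by (simp add: set_integrable_def)
  show "((%s. s powr kp) has_real_derivative kp * s powr (kp - 1)) (at s)" if "s \<in> {1..b}" for s
   using that by (intro derivative_eq_intros | simp)+
  show "continuous_on {1..b} (%s. kp * s powr (kp - 1))" by (intro continuous_intros) auto
 qed (use assms in auto)
 moreover have "(LBINT r. f r*indicator {1 powr kp..b powr kp} r) = (LBINT r. wgt (b powr kp) r*h r)"
  unfolding f_def wgt_def by (intro Bochner_Integration.integral_cong) (auto simp: indicator_def)
 moreover have "(LBINT s. f (s powr kp)*(kp * s powr (kp - 1))*indicator {1..b} s) = (LBINT s. kp*(wgt b s*h (s powr kp)))"
 proof (rule Bochner_Integration.integral_cong[OF refl])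
  fix s
  show "f (s powr kp)*(kp * s powr (kp - 1))*indicator {1..b} s = kp*(wgt b s*h (s powr kp))"
   by (cases "s \<in> {1..b}") (auto simp: f_def wgt_def powr_diff)
 qed
 ultimately show ?thesis using assms(2) by (simp add: field_simps)
qed

lemma Aop_subst:
 assumes "b > 1" "kp > 0" "bcs G"
 shows "Aop b kp l G x = (1/kp)*Aop (b powr kp) 1 l G x"
proof -
 have "1 < b powr kp" using assms by (simp add: gr_one_powr)
 from bcs_slice(1)[OF Aop_kernel_bcs[OF this zero_less_one assms(3)], of l x]
 have "bcs (%s. wgt (b powr kp) s*G (x - l * s powr 1))" by simp
 from wgt_subst[OF assms(1,2) this] show ?thesis by (simp add: Aop_def)
qed

text \<open>For exponent 1 a translation by \<open>y\<close> in \<open>x\<close> is a translation by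
  \<open>y/l\<close> in \<open>s\<close>; it falls on the weight, so no regularity of
  \<open>\<psi>\<close> is required.\<close>

lemma Aop_shift1:
 assumes "b > 1" "bcs \<psi>" "l ~= 0"
 shows "N2 (%x. Aop b 1 l \<psi> (x - y) - Aop b 1 l \<psi> x) <= (b + 3)*(abs y/abs l)*N2 \<psi>"
proof -
 define de where "de = y/l"
 define \<omega> where "\<omega> s = wgt b (s - de) - wgt b s" for s
 have \<omega>: "bcs \<omega>" unfolding \<omega>_def[abs_def] by (intro bcs_diff bcs_shift wgt_bcs)
 have k: "bcs (%(x, s). \<omega> s*\<psi> (x - l * s))"
 proof -
  obtain R where R: "\<And>s. \<omega> s ~= 0 ==> abs s <= R" using bcs_ex[OF \<omega>] by auto
  show ?thesis
   by (rule conv_bcs[OF \<omega> assms(2), where B = "abs l*R"]) (use R in \<open>auto simp: abs_mult intro!: mult_left_mono\<close>)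
 qed
 have k1: "bcs (%(x, s). wgt b s*\<psi> (x - l * s powr 1))" by (rule Aop_kernel_bcs[OF assms(1) _ assms(2)]) simp
 have A: "Aop b 1 l \<psi> x = (LBINT s. wgt b s*\<psi> (x - l * s))" for x
  unfolding Aop_def by (intro Bochner_Integration.integral_cong) (auto simp: wgt_def indicator_def)
 have i: "bcs (%s. wgt b s*\<psi> (x - l * s))" for x
 proof -
  have "bcs (%s. wgt b s*\<psi> (x - l * s powr 1))" using bcs_slice(1)[OF k1] by simp
  moreover have "(%s. wgt b s*\<psi> (x - l * s powr 1)) = (%s. wgt b s*\<psi> (x - l * s))" by (auto simp: wgt_def indicator_def)
  ultimately show ?thesis by simp
 qed
 have e: "Aop b 1 l \<psi> (x - y) - Aop b 1 l \<psi> x = (LBINT s. \<omega> s*\<psi> (x - l * s))" for x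
 proof -
  have yl: "l*(s - de) = l * s - y" for s using assms(3) by (simp add: de_def right_diff_distrib)
  have "Aop b 1 l \<psi> (x - y) = (LBINT s. wgt b (s - de)*\<psi> (x - y - l*(s - de)))"
   unfolding A using integral_shift[of "%s. wgt b s*\<psi> (x - y - l * s)" de] by simp
  also have "... = (LBINT s. wgt b (s - de)*\<psi> (x - l * s))" by (simp add: yl)
  finally have e1: "Aop b 1 l \<psi> (x - y) = (LBINT s. wgt b (s - de)*\<psi> (x - l * s))" .
  have i': "bcs (%s. wgt b (s - de)*\<psi> (x - l * s))"
   using bcs_shift[OF i[of "x - y"], of de] by (simp add: yl)
  show ?thesis unfolding e1 unfolding A[of x] \<omega>_def left_diff_distrib
   by (intro Bochner_Integration.integral_diff[symmetric] bcs_integrable i i')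
 qed
 have "N2 (%x. LBINT s. (case (x, s) of (x, s) => \<omega> s*\<psi> (x - l * s))) <= (LBINT s. abs (\<omega> s)*N2 \<psi>)"
  by (rule N2_integral_le[OF k bcs_multc[OF bcs_abs[OF \<omega>]]]) (simp add: N2_cmult N2_shift)
 also have "... = (LBINT s. abs (\<omega> s))*N2 \<psi>" by simp
 also have "... <= ((b + 3)*abs de)*N2 \<psi>" unfolding \<omega>_def by (intro mult_right_mono wgt_shift assms) simp
 finally show ?thesis by (simp add: e de_def abs_divide)
qed

lemma Aop_shift:
 assumes "b > 1" "kp > 0" "bcs \<psi>" "l ~= 0"
 shows "N2 (%x. Aop b kp l \<psi> (x - y) - Aop b kp l \<psi> x) <= (1/kp)*(b powr kp + 3)*(abs y/abs l)*N2 \<psi>"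
proof -
 have bk: "1 < b powr kp" using assms by (simp add: gr_one_powr)
 have "(%x. Aop b kp l \<psi> (x - y) - Aop b kp l \<psi> x) = (%x. (1/kp)*(Aop (b powr kp) 1 l \<psi> (x - y) - Aop (b powr kp) 1 l \<psi> x))"
  using Aop_subst[OF assms(1-3)] by (simp add: right_diff_distrib diff_divide_distrib)
 then have "N2 (%x. Aop b kp l \<psi> (x - y) - Aop b kp l \<psi> x) = (1/kp)*N2 (%x. Aop (b powr kp) 1 l \<psi> (x - y) - Aop (b powr kp) 1 l \<psi> x)"
  using assms(2) by (simp add: N2_cmult flip: times_divide_eq_left)
 also have "... <= (1/kp)*((b powr kp + 3)*(abs y/abs l)*N2 \<psi>)"
  using assms(2) by (intro mult_left_mono Aop_shift1 bk assms) auto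
 finally show ?thesis by (simp add: mult.assoc)
qed

lemma Aop_sub_E:
 assumes "b > 1" "kp > 0" "bcs \<psi>" "l ~= 0"
 shows "N2 (%x. Aop b kp l \<psi> x - E k (Aop b kp l \<psi>) x) <= 2*((1/kp)*(b powr kp + 3))*(2 powr (- of_int k)/abs l)*N2 \<psi>"
proof -
 have "N2 (%x. Aop b kp l \<psi> x - E k (Aop b kp l \<psi>) x) <= 2*((1/kp)*(b powr kp + 3)*(2 powr (- of_int k)/abs l)*N2 \<psi>)"
 proof (rule sub_E[OF Aop_bcs[OF assms(1-3)]])
  fix y :: real assume y: "abs y <= 2 powr (- of_int k)"
  have "(1/kp)*(b powr kp + 3)*(abs y/abs l)*N2 \<psi> <= (1/kp)*(b powr kp + 3)*(2 powr (- of_int k)/abs l)*N2 \<psi>"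
   using y assms(2) by (intro mult_right_mono mult_left_mono divide_right_mono) auto
  then show "N2 (%x. Aop b kp l \<psi> (x - y) - Aop b kp l \<psi> x) <= (1/kp)*(b powr kp + 3)*(2 powr (- of_int k)/abs l)*N2 \<psi>"
   using Aop_shift[OF assms, of y] by linarith
 qed
 then show ?thesis by (simp only: mult.assoc)
qed

text \<open>By duality: the adjoint is the average with \<open>- l\<close>, its output is smooth at
  scale \<open>abs l\<close> by \<open>Aop_sub_E\<close>, and pairing with \<open>F\<close>
  annihilates the dyadic means of that output.\<close>

lemma Aop_E_zero:
 assumes "b > 1" "kp > 0" "bcs F" "l ~= 0" "\<And>x. E k F x = 0"
 shows "N2 (Aop b kp l F) <= 2*((1/kp)*(b powr kp + 3))*(2 powr (- of_int k)/abs l)*N2 F"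
proof (rule N2_dual[OF Aop_bcs[OF assms(1-3)]])
 fix h :: "real => real" assume h: "bcs h"
 note Ah = Aop_bcs[OF assms(1,2) h, of "-l"]
 have z: "(LBINT x. F x*E k (Aop b kp (-l) h) x) = 0"
  using E_selfadj[OF assms(3) Ah, of k] assms(5) by simp
 have "(LBINT x. Aop b kp l F x*h x) = (LBINT x. F x*Aop b kp (-l) h x) - (LBINT x. F x*E k (Aop b kp (-l) h) x)"
  using Aop_adj[OF assms(1-3) h] z by simp
 also have "... = (LBINT x. F x*(Aop b kp (-l) h x - E k (Aop b kp (-l) h) x))"
  unfolding right_diff_distrib by (intro Bochner_Integration.integral_diff[symmetric] bcs_integrable bcs_times assms Ah E_bcs)
 also have "... <= N2 F*N2 (%x. Aop b kp (-l) h x - E k (Aop b kp (-l) h) x)"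
  by (intro bcs_Cauchy_Schwarz bcs_diff assms Ah E_bcs)
 also have "... <= N2 F*(2*((1/kp)*(b powr kp + 3))*(2 powr (- of_int k)/abs (-l))*N2 h)"
  using assms(4) by (intro mult_left_mono Aop_sub_E assms h) auto
 finally show "(LBINT x. Aop b kp l F x*h x) <= 2*((1/kp)*(b powr kp + 3))*(2 powr (- of_int k)/abs l)*N2 F*N2 h"
  by (simp add: mult_ac)
qed (use assms(2) in auto)

section \<open>The bilinear average when F has high frequency\<close>

text \<open>The pointwise form of \<open>sub_E\<close>. In \<open>Sop_coarse_high\<close> the
  averaged function depends on an outer variable \<open>x\<close>, and its increments are only
  controlled after integrating in \<open>x\<close> as well.\<close>

lemma sub_E_pointwise:
 assumes \<psi>: "bcs \<psi>"
 shows "abs (\<psi> x - E k \<psi> x) <= (LBINT y. (2 powr of_int k*indicator {- (2 powr (- of_int k))..2 powr (- of_int k)} y)*abs (\<psi> x - \<psi> (x - y)))"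
proof -
 have [measurable]: "\<psi> \<in> borel_measurable borel" by (rule bcs_measurable[OF \<psi>])
 obtain M where M: "\<And>x. abs (\<psi> x) <= M" using bcs_ex[OF \<psi>] by blast
 have bd: "bounded (range (%y. \<psi> x - \<psi> (x - y)))"
 proof -
  have "abs (\<psi> x - \<psi> (x - y)) <= M + M" for y using M[of x] M[of "x - y"] by linarith
  then show ?thesis by (auto simp: bounded_iff)
 qed
 have kb: "bcs (%y. ker k x (x - y)*(\<psi> x - \<psi> (x - y)))"
 proof (rule bcs_mult[OF _ _ bd])
  have "bcs (%y. ker k x (- 1*(y - x)))"
   by (rule bcs_shift[of "%y. ker k x (- 1*y)"]) (rule bcs_scale[OF ker_bcs], simp)
  then show "bcs (%y. ker k x (x - y))" by simp
 qed measurable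
 have rb: "bcs (%y. (2 powr of_int k*indicator {- (2 powr (- of_int k))..2 powr (- of_int k)} y)*abs (\<psi> x - \<psi> (x - y)))"
 proof -
  have ib: "bcs (%y::real. 2 powr of_int k*indicat_real {- (2 powr (- of_int k))..2 powr (- of_int k)} y)"
   by (intro bcs_cmult bcs_indicator) auto
  show ?thesis by (rule bcs_mult[OF ib]) (use bd in \<open>auto simp: bounded_iff\<close>)
 qed
 have "\<psi> x - E k \<psi> x = (LBINT z. ker k x z*\<psi> x) - (LBINT z. ker k x z*\<psi> z)"
  using ker_integral[of k x] by (simp add: E_def)
 also have "... = (LBINT z. ker k x z*\<psi> x - ker k x z*\<psi> z)"
  by (intro Bochner_Integration.integral_diff[symmetric] E_int[OF \<psi>] bcs_integrable bcs_multc ker_bcs)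
 also have "... = (LBINT z. ker k x z*(\<psi> x - \<psi> z))" by (simp add: right_diff_distrib)
 also have "... = (LBINT y. ker k x (x - y)*(\<psi> x - \<psi> (x - y)))" by (rule integral_sub_reflect)
 finally have "abs (\<psi> x - E k \<psi> x) <= (LBINT y. abs (ker k x (x - y)*(\<psi> x - \<psi> (x - y))))"
  by (simp only: integral_abs_bound)
 also have "... <= (LBINT y. (2 powr of_int k*indicator {- (2 powr (- of_int k))..2 powr (- of_int k)} y)*abs (\<psi> x - \<psi> (x - y)))"
 proof (rule integral_mono[OF bcs_integrable[OF bcs_abs[OF kb]] bcs_integrable[OF rb]])
  fix y
  have "abs (ker k x (x - y)) <= 2 powr of_int k*indicator {- (2 powr (- of_int k))..2 powr (- of_int k)} y"
  proof (cases "ker k x (x - y) = 0")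
   case False
   then have "abs y <= 2 powr (- of_int k)" using ker_support[of k x "x - y"] by simp
   then show ?thesis using ker_bound[of k x "x - y"] by (auto simp: indicator_def)
  qed simp
  then show "abs (ker k x (x - y)*(\<psi> x - \<psi> (x - y))) <= (2 powr of_int k*indicator {- (2 powr (- of_int k))..2 powr (- of_int k)} y)*abs (\<psi> x - \<psi> (x - y))"
   unfolding abs_mult by (rule mult_right_mono) simp
 qed
 finally show ?thesis .
qed

lemma Sop_kernel_bcs:
 assumes "b > 1" "kp > 0" "bcs F" "bcs G"
 shows "bcs (%(x, s). wgt b s*(F (x - L * s)*G (x - l * s powr kp)))"
proof -
 have [measurable]: "F \<in> borel_measurable borel" by (rule bcs_measurable[OF assms(3)])
 have m: "(%z::real\<times>real. F (fst z - L * snd z)) \<in> borel_measurable borel"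
 proof -
  have "(%z::real\<times>real. F (fst z - L * snd z)) \<in> borel_measurable (borel \<Otimes>\<^sub>M borel)" by measurable
  then show ?thesis by (simp add: borel_prod)
 qed
 have "bcs (%z. (case z of (x, s) => wgt b s*G (x - l * s powr kp))*F (fst z - L * snd z))"
  by (rule bcs_mult[OF Aop_kernel_bcs[OF assms(1,2,4)] m]) (use bcs_bounded[OF assms(3)] in \<open>auto simp: bounded_iff\<close>)
 then show ?thesis by (simp add: case_prod_unfold mult_ac)
qed

lemma Sop_bcs: "b > 1 ==> kp > 0 ==> bcs F ==> bcs G ==> bcs (Sop b kp L l F G)"
 using bcs_integral_snd[OF Sop_kernel_bcs] by (simp add: Sop_def[abs_def])

text \<open>If both parameters lie in \<open>{1..b}\<close>, the increment is split between the
  weight and \<open>G\<close>, the latter being a translation of a step function. Otherwise one of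
  the two terms vanishes and the weight increment alone accounts for the other.\<close>

lemma wgt_G_increment:
 assumes b: "b > 1" and G: "bcs G" "E m G = G" and C1: "\<And>s t. s \<in> {1..b} ==> t \<in> {1..b} ==> abs (s powr kp - t powr kp) <= C1*abs (s - t)"
 shows "N2 (%x. wgt b s*G (x - l * s powr kp) - wgt b t*G (x - l*t powr kp))
  <= (abs (wgt b t - wgt b s) + indicator {1..b} s*(2 * sqrt (abs l*(C1*abs (s - t))*2 powr of_int m)))*N2 G"
proof (cases "s \<in> {1..b} & t \<in> {1..b}")
 case False
 have C0: "0 <= indicator {1..b} s*(2 * sqrt (abs l*(C1*abs (s - t))*2 powr of_int m))"
 proof -
  have "0 <= C1*abs (b - 1)" using C1[of b 1] b by (auto intro: order_trans[OF abs_ge_zero])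
  then have "0 <= C1" using b by (simp add: zero_le_mult_iff)
  then show ?thesis by simp
 qed
 have "wgt b s = 0 \<or> wgt b t = 0" using False by (auto simp: wgt_def)
 then have "N2 (%x. wgt b s*G (x - l * s powr kp) - wgt b t*G (x - l*t powr kp)) = abs (wgt b t - wgt b s)*N2 G"
  using N2_cmult[of "wgt b s" "%x. G (x - l * s powr kp)"] N2_cmult[of "- wgt b t" "%x. G (x - l*t powr kp)"]
   N2_shift[of G "l * s powr kp"] N2_shift[of G "l*t powr kp"] by auto
 then show ?thesis using C0 by (simp add: distrib_right)
next
 case True
 define c where "c = l * s powr kp"
 define c' where "c' = l*t powr kp"
 have "N2 (%x. G (x - c) - G (x - c')) = N2 (%x. G (x - (c - c')) - G x)"
  using N2_shift[of "%x. G (x - (c - c')) - G x" c'] by simp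
 also have "... <= 2 * sqrt (abs (c - c')*2 powr of_int m)*N2 G" by (rule shift_step[OF G])
 also have "... <= 2 * sqrt (abs l*(C1*abs (s - t))*2 powr of_int m)*N2 G"
 proof (intro mult_right_mono mult_left_mono real_sqrt_le_mono)
  have "abs (c - c') = abs l*abs (s powr kp - t powr kp)" unfolding c_def c'_def by (simp add: abs_mult flip: right_diff_distrib)
  also have "... <= abs l*(C1*abs (s - t))" using True by (intro mult_left_mono C1) auto
  finally show "abs (c - c') <= abs l*(C1*abs (s - t))" .
 qed auto
 finally have 1: "N2 (%x. G (x - c) - G (x - c')) <= 2 * sqrt (abs l*(C1*abs (s - t))*2 powr of_int m)*N2 G" .
 have b1: "bcs (%x. G (x - c))" "bcs (%x. G (x - c'))" by (rule bcs_shift[OF G(1)])+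
 have "(%x. wgt b s*G (x - c) - wgt b t*G (x - c')) = (%x. (wgt b s - wgt b t)*G (x - c) + wgt b t*(G (x - c) - G (x - c')))"
  by (simp add: algebra_simps)
 then have "N2 (%x. wgt b s*G (x - c) - wgt b t*G (x - c')) <= N2 (%x. (wgt b s - wgt b t)*G (x - c)) + N2 (%x. wgt b t*(G (x - c) - G (x - c')))"
  using N2_triangle[OF bcs_cmult[OF b1(1)] bcs_cmult[OF bcs_diff[OF b1]]] by simp
 also have "... = abs (wgt b t - wgt b s)*N2 G + wgt b t*N2 (%x. G (x - c) - G (x - c'))"
  using wgt_bounds(1)[of b t] by (simp add: N2_cmult N2_shift abs_minus_commute)
 also have "... <= abs (wgt b t - wgt b s)*N2 G + 1*(2 * sqrt (abs l*(C1*abs (s - t))*2 powr of_int m)*N2 G)"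
  using 1 wgt_bounds(1,3)[of b t] by (intro add_left_mono mult_mono) auto
 finally show ?thesis using True by (simp add: c_def c'_def distrib_right)
qed

text \<open>In the variable \<open>u = x - L*s\<close> the average is an integral of
  \<open>F\<close> against \<open>W x\<close>, from which the dyadic mean at level \<open>k\<close>
  may be subtracted. An increment of \<open>u\<close> of size \<open>2 powr (- k)\<close> is an
  increment \<open>z\<close> of \<open>s\<close>, and \<open>wgt_G_increment\<close> bounds its
  effect: the weight costs \<open>z\<close>, the step function \<open>G\<close> costs a square root,
  which is large if \<open>G\<close> oscillates faster than \<open>F\<close>.\<close>

lemma Sop_coarse_high:
 assumes b: "b > 1" and kp: "kp > 0" and F: "bcs F" "\<And>x. E k F x = 0" and G: "bcs G" "E m G = G" and L: "L ~= 0"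
  and C1: "\<And>s t. s \<in> {1..b} ==> t \<in> {1..b} ==> abs (s powr kp - t powr kp) <= C1*abs (s - t)" "0 <= C1"
  and z: "z = 2 powr (- of_int k)/abs L"
 shows "(LBINT x. abs (Sop b kp L l F G x)) <= 2*((b + 3)*z + 2*b * sqrt (abs l*(C1*z)*2 powr of_int m))*N2 F*N2 G"
proof -
 have [measurable]: "F \<in> borel_measurable borel" "G \<in> borel_measurable borel" using F G bcs_measurable by auto
 define h where "h = (2::real) powr (- of_int k)"
 have h0: "0 < h" by (simp add: h_def)
 have z0: "0 <= z" by (simp add: z)
 define Wh where "Wh x s = wgt b s*G (x - l * s powr kp)" for x s
 define W where "W x u = Wh x ((x - u)/L)" for x u
 obtain MF RF where MF: "0 <= MF" "0 <= RF" "\<And>x. abs (F x) <= MF" "\<And>x. F x ~= 0 ==> norm x <= RF" using bcs_ex[OF F(1)] by blast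
 obtain M R where MR: "0 <= M" "0 <= R" "\<And>x. abs (G x) <= M" "\<And>x. G x ~= 0 ==> norm x <= R" using bcs_ex[OF G(1)] by blast
 have WhM: "abs (Wh x s) <= M" for x s
  using mult_mono[OF wgt_bounds(3)[of b s] MR(3)[of "x - l * s powr kp"]] by (simp add: Wh_def abs_mult)
 define R1 where "R1 = R + abs l*b powr kp"
 have R10: "0 <= R1" using MR by (simp add: R1_def)
 have WhR: "abs x <= R1 & s \<in> {1..b}" if "Wh x s ~= 0" for x s
 proof -
  have "wgt b s ~= 0" "G (x - l * s powr kp) ~= 0" using that by (auto simp: Wh_def)
  then have "abs (x - l * s powr kp) <= R" "abs (l * s powr kp) <= abs l*b powr kp" "s \<in> {1..b}"
   using MR(4)[of "x - l * s powr kp"] wgt_pow_bound[OF b kp, of s l] wgt_bounds(4)[of b s] by auto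
  then show ?thesis unfolding R1_def by linarith
 qed
 have WR: "abs x <= R1 & abs u <= R1 + abs L*b" if "W x u ~= 0" for x u
 proof -
  have 1: "abs x <= R1" "(x - u)/L \<in> {1..b}" using WhR[of x "(x - u)/L"] that by (auto simp: W_def)
  then have "abs ((x - u)/L) <= b" by auto
  then have "abs (x - u) <= abs L*b" using L by (simp add: abs_divide field_simps)
  then show ?thesis using 1 by linarith
 qed
 have Wb: "bcs (W x)" for x
 proof (rule bcsI[where M = M and R = "R1 + abs L*b"])
  show "W x \<in> borel_measurable borel" unfolding W_def[abs_def] Wh_def by measurable
 qed (use WhM WR in \<open>auto simp: W_def\<close>)
 have Se: "Sop b kp L l F G x = (1/abs L)*(LBINT u. F u*W x u)" for x
 proof -
  have "Sop b kp L l F G x = (LBINT s. F (x - L * s)*Wh x s)"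
   unfolding Sop_def Wh_def by (simp add: mult_ac)
  also have "... = (1/abs L)*(LBINT u. F u*W x u)"
  proof -
   have a: "x - L*(x/L + (- 1/L)*u) = u" for u using L by (simp add: field_simps)
   have c: "x/L + (- 1/L)*u = (x - u)/L" for u using L by (simp add: field_simps)
   show ?thesis using lborel_integral_real_affine[of "- 1/L" "%s. F (x - L * s)*Wh x s" "x/L"] L
    unfolding a c W_def by (simp add: abs_divide)
  qed
  finally show ?thesis .
 qed
 have Fo: "(LBINT u. F u*W x u) = (LBINT u. F u*(W x u - E k (W x) u))" for x
 proof -
  have "(LBINT u. F u*E k (W x) u) = 0" using E_selfadj[OF F(1) Wb, of k x] F(2) by simp
  moreover have "(LBINT u. F u*(W x u - E k (W x) u)) = (LBINT u. F u*W x u) - (LBINT u. F u*E k (W x) u)"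
   unfolding right_diff_distrib by (intro Bochner_Integration.integral_diff bcs_integrable bcs_times F Wb E_bcs)
  ultimately show ?thesis by simp
 qed
 define T where "T x u y = abs (F u)*((2 powr of_int k*indicator {-h..h} y)*abs (W x u - W x (u - y)))" for x u y
 have Tm: "(%(x, u, y). T x u y) \<in> borel_measurable (borel \<Otimes>\<^sub>M (borel \<Otimes>\<^sub>M borel))"
  unfolding T_def W_def Wh_def by measurable
 have Tb: "bcs (%(x, u, y). T x u y)"
 proof (rule bcs3I[OF Tm, where M = "MF*((2 powr of_int k*1)*(M + M))" and R = "RF + R1 + h"])
  fix x u y
  have "abs (W x u - W x (u - y)) <= M + M" using WhM[of x "(x - u)/L"] WhM[of x "(x - (u - y))/L"] unfolding W_def by linarith
  then have "abs (T x u y) <= MF*((2 powr of_int k*1)*(M + M))"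
   unfolding T_def abs_mult abs_abs using MF(1,3) MR(1) by (intro mult_mono) (auto simp: indicator_def)
  then show "abs (case (x, u, y) of (x, u, y) => T x u y) <= MF*((2 powr of_int k*1)*(M + M))" by simp
  assume "(case (x, u, y) of (x, u, y) => T x u y) ~= 0"
  then have "F u ~= 0" "y \<in> {-h..h}" "W x u ~= 0 \<or> W x (u - y) ~= 0" by (auto simp: T_def indicator_def split: if_splits)
  then have "abs u <= RF" "abs y <= h" "abs x <= R1" using MF(4)[of u] WR[of x u] WR[of x "u - y"] by auto
  then show "abs x <= RF + R1 + h & abs u <= RF + R1 + h & abs y <= RF + R1 + h" using MF(2) R10 h0 by linarith
 qed
 have T1: "bcs (%(x, u). LBINT y. T x u y)" using bcs_integral_third[OF Tb] by simp
 have T2: "bcs (%x. LBINT u. LBINT y. T x u y)" using bcs_integral_snd[OF T1] by simp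
 have pt: "abs (Sop b kp L l F G x) <= (1/abs L)*(LBINT u. LBINT y. T x u y)" for x
 proof -
  have Eb: "bcs (%u. F u*(W x u - E k (W x) u))" by (intro bcs_times bcs_diff F Wb E_bcs)
  have T3: "bcs (%u. LBINT y. T x u y)" using bcs_slice(1)[OF T1, of x] by simp
  have "abs (LBINT u. F u*(W x u - E k (W x) u)) <= (LBINT u. abs (F u*(W x u - E k (W x) u)))" by (rule integral_abs_bound)
  also have "... <= (LBINT u. LBINT y. T x u y)"
  proof (rule integral_mono[OF bcs_integrable[OF bcs_abs[OF Eb]] bcs_integrable[OF T3]])
   fix u
   have "abs (F u)*abs (W x u - E k (W x) u) <= abs (F u)*(LBINT y. (2 powr of_int k*indicator {-h..h} y)*abs (W x u - W x (u - y)))"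
    unfolding h_def by (intro mult_left_mono sub_E_pointwise Wb) simp
   then show "abs (F u*(W x u - E k (W x) u)) <= (LBINT y. T x u y)" unfolding T_def abs_mult by simp
  qed
  finally have "abs (LBINT u. F u*W x u) <= (LBINT u. LBINT y. T x u y)" unfolding Fo .
  then show ?thesis unfolding Se abs_mult by (simp add: divide_right_mono)
 qed
 define B where "B = ((b + 3)*z + 2*b * sqrt (abs l*(C1*z)*2 powr of_int m))*N2 G"
 have B0: "0 <= B" using b z0 C1(2) by (simp add: B_def)
 have inner: "(LBINT x. LBINT u. T x u y) <= (2 powr of_int k*abs L*N2 F*B)*indicator {-h..h} y" for y
 proof (cases "y \<in> {-h..h}")
  case False
  then have "(LBINT x. LBINT u. T x u y) = 0" by (simp add: T_def)
  then show ?thesis using False by simp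
 next
  case True
  define de where "de = y/L"
  have dz: "abs de <= z" using True by (simp add: de_def z h_def abs_divide divide_right_mono abs_le_iff)
  define P where "P x s = abs (F (x - L * s))*abs (Wh x s - Wh x (s + de))" for x s
  have Pm: "(%(x, s). P x s) \<in> borel_measurable (borel \<Otimes>\<^sub>M borel)" unfolding P_def Wh_def by measurable
  have Pb: "bcs (%(x, s). P x s)"
  proof (rule bcs2I[OF Pm, where M = "MF*(M + M)" and R = "R1 + b + abs de"])
   fix x s
   have "abs (Wh x s - Wh x (s + de)) <= M + M" using WhM[of x s] WhM[of x "s + de"] by linarith
   then have "abs (P x s) <= MF*(M + M)" unfolding P_def abs_mult abs_abs using MF(1,3) by (intro mult_mono) auto
   then show "abs (case (x, s) of (x, s) => P x s) <= MF*(M + M)" by simp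
   assume "(case (x, s) of (x, s) => P x s) ~= 0"
   then have "Wh x s ~= 0 \<or> Wh x (s + de) ~= 0" by (auto simp: P_def)
   then show "abs x <= R1 + b + abs de & abs s <= R1 + b + abs de" using WhR[of x s] WhR[of x "s + de"] R10 b by auto
  qed
  define \<omega> where "\<omega> s = N2 F*((abs (wgt b (s - (-de)) - wgt b s) + indicat_real {1..b} s*(2 * sqrt (abs l*(C1*abs de)*2 powr of_int m)))*N2 G)" for s
  have \<omega>b: "bcs \<omega>" unfolding \<omega>_def[abs_def]
   by (intro bcs_cmult bcs_multc bcs_add bcs_abs bcs_diff bcs_shift wgt_bcs bcs_indicator) auto
  have xu: "(LBINT u. T x u y) = (2 powr of_int k*abs L)*(LBINT s. P x s)" for x
  proof -
   have a: "(x - (x + - L * s))/L = s" for s using L by simp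
   have c: "(x - (x + - L * s - y))/L = s + de" for s using L by (simp add: de_def field_simps)
   have "(LBINT u. abs (F u)*abs (W x u - W x (u - y))) = abs L*(LBINT s. P x s)"
    using lborel_integral_real_affine[of "- L" "%u. abs (F u)*abs (W x u - W x (u - y))" x] L
    unfolding W_def a c P_def by simp
   moreover have "(LBINT u. T x u y) = (LBINT u. 2 powr of_int k*(abs (F u)*abs (W x u - W x (u - y))))"
    unfolding T_def using True by (intro Bochner_Integration.integral_cong) auto
   ultimately show ?thesis by simp
  qed
  have "(LBINT x. LBINT u. T x u y) = (2 powr of_int k*abs L)*(LBINT x. LBINT s. P x s)"
   unfolding xu by simp
  also have "(LBINT x. LBINT s. P x s) = (LBINT s. LBINT x. P x s)" using bcs_Fubini[OF Pb] by simp
  also have "(2 powr of_int k*abs L)*(LBINT s. LBINT x. P x s) <= (2 powr of_int k*abs L)*(LBINT s. \<omega> s)"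
  proof (intro mult_left_mono integral_mono)
   show "integrable lborel (%s. LBINT x. P x s)" using bcs_integrable[OF bcs_integral_fst[OF Pb]] by simp
   show "integrable lborel \<omega>" by (rule bcs_integrable[OF \<omega>b])
   fix s
   have Whs: "bcs (%x. Wh x s)" for s unfolding Wh_def by (intro bcs_cmult bcs_shift G)
   have "(LBINT x. P x s) = (LBINT x. abs (F (x - L * s)*(Wh x s - Wh x (s + de))))" by (simp add: P_def abs_mult)
   also have "... <= N2 (%x. F (x - L * s))*N2 (%x. Wh x s - Wh x (s + de))"
    by (intro bcs_Cauchy_Schwarz_abs bcs_shift F bcs_diff Whs)
   also have "... <= N2 F*((abs (wgt b (s + de) - wgt b s) + indicator {1..b} s*(2 * sqrt (abs l*(C1*abs (s - (s + de)))*2 powr of_int m)))*N2 G)"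
    unfolding N2_shift Wh_def by (intro mult_left_mono wgt_G_increment b G C1(1)) auto
   finally show "(LBINT x. P x s) <= \<omega> s" by (simp add: \<omega>_def)
  qed simp
  also have "... <= (2 powr of_int k*abs L)*(N2 F*B)"
  proof (rule mult_left_mono)
  have "(LBINT s. \<omega> s) = N2 F*(((LBINT s. abs (wgt b (s - (-de)) - wgt b s)) + (b - 1)*(2 * sqrt (abs l*(C1*abs de)*2 powr of_int m)))*N2 G)"
  proof -
   have "integrable lborel (%s. abs (wgt b (s - (-de)) - wgt b s))" by (intro bcs_integrable bcs_abs bcs_diff bcs_shift wgt_bcs)
   moreover have "integrable lborel (%s. indicat_real {1..b} s*(2 * sqrt (abs l*(C1*abs de)*2 powr of_int m)))"
    by (intro bcs_integrable bcs_multc bcs_indicator) auto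
   ultimately have "(LBINT s. abs (wgt b (s - (-de)) - wgt b s) + indicat_real {1..b} s*(2 * sqrt (abs l*(C1*abs de)*2 powr of_int m)))
    = (LBINT s. abs (wgt b (s - (-de)) - wgt b s)) + (LBINT s. indicat_real {1..b} s*(2 * sqrt (abs l*(C1*abs de)*2 powr of_int m)))"
    by (rule Bochner_Integration.integral_add)
   then show ?thesis unfolding \<omega>_def Bochner_Integration.integral_mult_right_zero Bochner_Integration.integral_mult_left_zero using b by simp
  qed
  also have "... <= N2 F*(((b + 3)*z + b*(2 * sqrt (abs l*(C1*z)*2 powr of_int m)))*N2 G)"
  proof (intro mult_left_mono mult_right_mono add_mono mult_mono real_sqrt_le_mono)
   show "(LBINT s. abs (wgt b (s - (-de)) - wgt b s)) <= (b + 3)*z"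
    by (rule order_trans[OF wgt_shift[OF b]]) (use dz b in \<open>auto intro!: mult_left_mono\<close>)
  qed (use b dz C1(2) z0 in auto)
  also have "... = N2 F*B" by (simp add: B_def mult_ac)
  finally show "(LBINT s. \<omega> s) <= N2 F*B" .
  qed simp
  finally show ?thesis using True by (simp add: mult_ac)
 qed
 have "(LBINT x. abs (Sop b kp L l F G x)) <= (LBINT x. (1/abs L)*(LBINT u. LBINT y. T x u y))"
  by (intro integral_mono bcs_integrable bcs_abs Sop_bcs b kp F G bcs_cmult[OF T2] pt)
 also have "... = (1/abs L)*(LBINT y. LBINT x. LBINT u. T x u y)"
  using bcs_rot3[OF Tb] by simp
 also have "... <= (1/abs L)*(LBINT y. (2 powr of_int k*abs L*N2 F*B)*indicator {-h..h} y)"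
 proof (intro mult_left_mono integral_mono inner)
  have "bcs (%((x, u), y). T x u y)" using bcs_assoc[OF Tb] by (simp add: case_prod_unfold)
  from bcs_integral_fst[OF this] have "bcs (%y. LBINT z. T (fst z) (snd z) y)" by (simp add: case_prod_unfold)
  moreover have "(LBINT z. T (fst z) (snd z) y) = (LBINT x. LBINT u. T x u y)" for y
  proof -
   have "bcs (%z. T (fst z) (snd z) y)" using bcs_slice(2)[OF \<open>bcs (%((x, u), y). T x u y)\<close>, of y] by (simp add: case_prod_unfold)
   from bcs_prod_integral[OF this] show ?thesis by simp
  qed
  ultimately have "bcs (%y. LBINT x. LBINT u. T x u y)" by simp
  then show "integrable lborel (%y. LBINT x. LBINT u. T x u y)" by (rule bcs_integrable)
  show "integrable lborel (%y. (2 powr of_int k*abs L*N2 F*B)*indicator {-h..h} y)"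
   by (rule bcs_integrable[OF bcs_cmult[OF bcs_indicator]]) auto
 qed simp
 also have "... = 2*N2 F*B" using L h0 by (simp add: h_def powr_minus field_simps)
 finally show ?thesis by (simp add: B_def mult_ac)
qed

section \<open>The error term\<close>

definition Err :: "real => real => real => real => int => int => (real => real) => (real => real) => real => real" where
 "Err b kp L l p q F G x = (LBINT s. wgt b s*((F (x - L * s) - E p F x)*(G (x - l * s powr kp) - E q G x)))"

lemma bcs_fst: 
 fixes f :: "real \<times> real => real"
 assumes "bcs (u :: real => real)" "bcs f" shows "bcs (%z. f z*u (fst z))"
proof -
 have [measurable]: "u \<in> borel_measurable borel" by (rule bcs_measurable[OF assms(1)])
 have "(%z::real\<times>real. u (fst z)) \<in> borel_measurable (borel \<Otimes>\<^sub>M borel)" by measurable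
 then have m: "(%z::real\<times>real. u (fst z)) \<in> borel_measurable borel" by (simp add: borel_prod)
 show ?thesis by (rule bcs_mult[OF assms(2) m]) (use bcs_bounded[OF assms(1)] in \<open>auto simp: bounded_iff\<close>)
qed

lemma wgt_powr1: "wgt b s*F (x - L * s powr 1) = wgt b s*F (x - L * s)"
 by (auto simp: wgt_def indicator_def)

lemma wgt_fst_bcs: assumes "bcs (u :: real => real)" shows "bcs (%(x, s). wgt b s*u x)"
proof -
 have "bcs (%(x, s). wgt b s*u (x - 0))" by (rule conv_bcs[OF wgt_bcs assms, where B = 0]) auto
 then show ?thesis by simp
qed

text \<open>The expansion into four products. The last one carries only the total mass of the weight
  and depends on neither \<open>L\<close> nor \<open>l\<close>, so it drops out when two averages
  with the same levels \<open>p\<close>, \<open>q\<close> are subtracted; the two middle ones become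
  paraproducts.\<close>

lemma Err_kernel:
 assumes "b > 1" "kp > 0" "bcs F" "bcs G"
 shows "bcs (%(x, s). wgt b s*((F (x - L * s) - E p F x)*(G (x - l * s powr kp) - E q G x)))"
  "Err b kp L l p q F G x = Sop b kp L l F G x - E p F x*Aop b kp l G x - Aop b 1 L F x*E q G x + (LBINT s. wgt b s)*(E p F x*E q G x)"
proof -
 note EF = E_bcs[OF assms(3), of p] and EG = E_bcs[OF assms(4), of q]
 have k1: "bcs (%(x, s). wgt b s*(F (x - L * s)*G (x - l * s powr kp)))" by (rule Sop_kernel_bcs[OF assms])
 have k2: "bcs (%(x, s). (wgt b s*G (x - l * s powr kp))*E p F x)"
  using bcs_fst[OF EF Aop_kernel_bcs[OF assms(1,2,4)]] by (simp add: case_prod_unfold)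
 have k3: "bcs (%(x, s). (wgt b s*F (x - L * s))*E q G x)"
  using bcs_fst[OF EG Aop_kernel_bcs[OF assms(1) zero_less_one assms(3), of L]] unfolding wgt_powr1 by (simp add: case_prod_unfold)
 have k4: "bcs (%(x, s). wgt b s*(E p F x*E q G x))" by (rule wgt_fst_bcs[OF bcs_times[OF EF EG]])
 have e: "wgt b s*((F (x - L * s) - E p F x)*(G (x - l * s powr kp) - E q G x)) =
   wgt b s*(F (x - L * s)*G (x - l * s powr kp)) - (wgt b s*G (x - l * s powr kp))*E p F x
   - (wgt b s*F (x - L * s))*E q G x + wgt b s*(E p F x*E q G x)" for x s
  by (simp add: algebra_simps)
 show "bcs (%(x, s). wgt b s*((F (x - L * s) - E p F x)*(G (x - l * s powr kp) - E q G x)))"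
  unfolding e using bcs_add[OF bcs_diff[OF bcs_diff[OF k1 k2] k3] k4] by (simp add: case_prod_unfold)
 have i: "integrable lborel (%s. wgt b s*(F (x - L * s)*G (x - l * s powr kp)))"
  "integrable lborel (%s. (wgt b s*G (x - l * s powr kp))*E p F x)"
  "integrable lborel (%s. (wgt b s*F (x - L * s))*E q G x)"
  "integrable lborel (%s. wgt b s*(E p F x*E q G x))" for x
  using bcs_integrable[OF bcs_slice(1)[OF k1, of x]] bcs_integrable[OF bcs_slice(1)[OF k2, of x]]
   bcs_integrable[OF bcs_slice(1)[OF k3, of x]] bcs_integrable[OF bcs_slice(1)[OF k4, of x]] by simp_all
 have "Err b kp L l p q F G x = (LBINT s. wgt b s*(F (x - L * s)*G (x - l * s powr kp)))
  - (LBINT s. (wgt b s*G (x - l * s powr kp))*E p F x) - (LBINT s. (wgt b s*F (x - L * s))*E q G x)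
  + (LBINT s. wgt b s*(E p F x*E q G x))"
  unfolding Err_def e
  by (subst Bochner_Integration.integral_add Bochner_Integration.integral_diff;
    (intro Bochner_Integration.integrable_diff i)?)+ simp
 then show "Err b kp L l p q F G x = Sop b kp L l F G x - E p F x*Aop b kp l G x - Aop b 1 L F x*E q G x + (LBINT s. wgt b s)*(E p F x*E q G x)"
  by (simp add: Sop_def Aop_def wgt_powr1 mult.commute[of _ "E p F x"] del: powr_one_gt_zero_iff powr_one' )
qed

lemma Err_bcs: "b > 1 ==> kp > 0 ==> bcs F ==> bcs G ==> bcs (Err b kp L l p q F G)"
 using bcs_integral_snd[OF Err_kernel(1)] by (simp add: Err_def[abs_def])

lemma Err_basic:
 assumes "b > 1" "kp > 0" "bcs F" "bcs G"
  and alf: "\<And>s. s \<in> {1..b} ==> N2 (%x. F (x - L * s) - E p F x) <= alf"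
  and bt: "\<And>s. s \<in> {1..b} ==> N2 (%x. G (x - l * s powr kp) - E q G x) <= bt"
 shows "(LBINT x. abs (Err b kp L l p q F G x)) <= b*(alf*bt)"
proof -
 have nn: "0 <= alf" "0 <= bt" using alf[of 1] bt[of 1] assms(1) N2_nonneg_le by auto
 have "(LBINT x. abs (LBINT s. (case (x, s) of (x, s) => wgt b s*((F (x - L * s) - E p F x)*(G (x - l * s powr kp) - E q G x)))))
  <= (LBINT s. wgt b s*(alf*bt))"
 proof (rule L1_integral_le[OF Err_kernel(1)[OF assms(1-4)] bcs_multc[OF wgt_bcs]])
  fix s
  show "(LBINT x. abs (case (x, s) of (x, s) => wgt b s*((F (x - L * s) - E p F x)*(G (x - l * s powr kp) - E q G x)))) <= wgt b s*(alf*bt)"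
  proof (cases "s \<in> {1..b}")
   case True
   have "(LBINT x. abs ((F (x - L * s) - E p F x)*(G (x - l * s powr kp) - E q G x)))
     <= N2 (%x. F (x - L * s) - E p F x)*N2 (%x. G (x - l * s powr kp) - E q G x)"
    by (intro bcs_Cauchy_Schwarz_abs bcs_diff bcs_shift E_bcs assms)
   also have "... <= alf*bt" by (intro mult_mono alf bt True nn N2_nonneg)
   finally show ?thesis using wgt_bounds(1)[of b s] by (simp add: abs_mult[of "wgt b s"] mult_left_mono)
  qed (simp add: wgt_def)
 qed
 also have "... = (LBINT s. wgt b s)*(alf*bt)" by simp
 also have "... <= b*(alf*bt)" by (intro mult_right_mono wgt_integral assms mult_nonneg_nonneg nn)
 finally show ?thesis by (simp add: Err_def)
qed

lemma Err_trivial: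
 assumes "b > 1" "kp > 0" "bcs F" "bcs G"
 shows "(LBINT x. abs (Err b kp L l p q F G x)) <= 4*b*N2 F*N2 G"
proof -
 have *: "N2 (%x. H (x - c) - E p H x) <= 2*N2 H" if "bcs H" for H c p
  using N2_triangle_diff[OF bcs_shift[OF that] E_bcs[OF that], of c p] N2_shift[of H c] N2_E[OF that, of p] by simp
 have "(LBINT x. abs (Err b kp L l p q F G x)) <= b*((2*N2 F)*(2*N2 G))"
  by (intro Err_basic assms * )
 then show ?thesis by (simp add: mult_ac)
qed

text \<open>For \<open>k < p\<close> the function is constant on cells much longer than the
  displacement and \<open>shift_step\<close> gives a gain. For \<open>k >= p\<close> its mean at
  level \<open>p\<close> is zero and there is no gain, hence the \<open>min\<close> with 0.\<close>

lemma low_gain: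
 assumes F: "bcs F" "E (k + 1) F = F" "\<And>x. E k F x = 0" and y: "abs y <= B*2 powr (- of_int p)" "B >= 1"
 shows "N2 (%x. F (x - y) - E p F x) <= 3*B*2 powr (min 0 (of_int (k - p)/2))*N2 F"
proof (cases "k < p")
 case True
 have "E p F = F" using E_E_fine[of "k + 1" p F] True F(2) by simp
 then have "N2 (%x. F (x - y) - E p F x) <= 2 * sqrt (abs y*2 powr of_int (k + 1))*N2 F"
  using shift_step[OF F(1,2), of y] by simp
 also have "... <= 3*B*2 powr (of_int (k - p)/2)*N2 F"
 proof (rule mult_right_mono)
  have "abs y*2 powr of_int (k + 1) <= (B*2 powr (- of_int p))*2 powr of_int (k + 1)"
   by (intro mult_right_mono y) simp
  also have "... = 2*B*2 powr of_int (k - p)" by (simp add: powr_add powr_diff powr_minus field_simps)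
  finally have "2 * sqrt (abs y*2 powr of_int (k + 1)) <= 2 * sqrt (2*B*2 powr of_int (k - p))" by simp
  also have "... = 2 * sqrt (2*B)*2 powr (of_int (k - p)/2)"
   by (simp add: real_sqrt_mult powr_half_sqrt_powr)
  also have "... <= (3*B)*2 powr (of_int (k - p)/2)"
  proof (rule mult_right_mono)
   have "2*B*1 <= 2*B*B" using y(2) by (intro mult_left_mono) auto
   then have "2*B <= (3/2*B)\<^sup>2" using y(2) by (simp add: power2_eq_square)
   then have "sqrt (2*B) <= 3/2*B" using y(2) by (intro real_le_lsqrt) auto
   then show "2 * sqrt (2*B) <= 3*B" by simp
  qed simp
  finally show "2 * sqrt (abs y*2 powr of_int (k + 1)) <= 3*B*2 powr (of_int (k - p)/2)" .
 qed simp
 finally show ?thesis using True by (simp add: min_def)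
next
 case False
 have "E p F = E p (E k F)" using E_E_coarse[OF F(1), of p k] False by simp
 moreover have "E k F = (%x. 0)" using F(3) by auto
 ultimately have "E p F x = 0" for x by simp
 then have "N2 (%x. F (x - y) - E p F x) = N2 F" by (simp add: N2_shift)
 also have "... <= 3*B*1*N2 F" using y(2) mult_right_mono[of 1 "3*B" "N2 F"] by simp
 finally show ?thesis using False by (simp add: min_def)
qed

text \<open>Two bounds are combined, with \<open>u = abs (k - p)\<close> and
  \<open>v = abs (j - q)\<close>: one decays in \<open>v\<close> alone, the other is
  \<open>2 powr ((v - u)/2)\<close> and helps only when \<open>u\<close> dominates. For
  \<open>j >= q\<close> or \<open>k >= p\<close> one of the dyadic means vanishes, which removes two
  of the four terms of \<open>Err_kernel\<close>.\<close>

theorem Err_decay: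
 fixes kp b :: real
 assumes kp: "kp > 0" "kp ~= 1" and b: "b > 1"
 shows "\<exists>C>0. \<exists>c0::int. \<forall>p q k j L l F G. abs L = 2 powr (- of_int p) --> abs l = 2 powr (- of_int q) --> q - p >= c0 -->
   bcs F --> bcs G --> E (k + 1) F = F --> (\<forall>x. E k F x = 0) --> E (j + 1) G = G --> (\<forall>x. E j G x = 0) -->
   (LBINT x. abs (Err b kp L l p q F G x)) <= C*2 powr (- of_int (abs (k - p) + abs (j - q))/200)*N2 F*N2 G"
proof -
 obtain Cs c where Cs: "Cs > 0" "c > 0" and sm: "\<And>L l et ep F G. L ~= 0 ==> l ~= 0 ==> abs l <= c*abs L ==> 0 < ep ==> ep <= 1 ==>
   0 < et ==> et <= abs l*ep^28 ==> bcs F ==> bcs G ==> meanzero et G ==>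
   (LBINT x. abs (Sop b kp L l F G x)) <= Cs * sqrt ep*N2 F*N2 G"
  using smoothing_general[OF kp b] by blast
 \<comment> \<open>A level gap of \<open>c0\<close> is exactly what makes
   \<open>abs l <= c*abs L\<close>, the smallness condition of the smoothing estimate.\<close>
 define c0 where "c0 = \<lceil>- log 2 c\<rceil>"
 obtain C1 where C1: "C1 > 0" "\<And>s t. s \<in> {1..b} ==> t \<in> {1..b} ==> abs (s powr kp - t powr kp) <= C1*abs (s - t)"
  using powr_diff_bounds[of 1 b kp] b by auto
 have bk: "1 < b powr kp" using b kp by (simp add: gr_one_powr)
 define C9 where "C9 = b*(9*b*b powr kp)"
 define CA where "CA = 2*((1/kp)*(b powr kp + 3))"
 define CB where "CB = 2*((1/1)*(b powr 1 + 3))"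
 define CF where "CF = 2*((b + 3) + 2*b * sqrt (2*C1))"
 define C where "C = C9 + (Cs + CA) + (CF + CB)"
 have pos: "0 < C9" "0 < CA" "0 < CB" "0 < CF" using b kp C1(1) bk by (auto simp: C9_def CA_def CB_def CF_def intro!: add_pos_pos divide_pos_pos mult_pos_pos)
 have C0: "0 < C" using pos Cs by (simp add: C_def)
 have main: "(LBINT x. abs (Err b kp L l p q F G x)) <= C*2 powr (- of_int (abs (k - p) + abs (j - q))/200)*N2 F*N2 G"
  if L: "abs L = 2 powr (- of_int p)" and l: "abs l = 2 powr (- of_int q)" and pq: "q - p >= c0" and F: "bcs F" and G: "bcs G"
   and F1: "E (k + 1) F = F" and F0: "\<And>x. E k F x = 0" and G1: "E (j + 1) G = G" and G0: "\<And>x. E j G x = 0"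
  for p q k j L l F G
 proof -
  define u v where "u = real_of_int (abs (k - p))" and "v = real_of_int (abs (j - q))"
  have uv: "0 <= u" "0 <= v" by (auto simp: u_def v_def)
  have L0: "L ~= 0" "l ~= 0" using L l by auto
  define X where "X = (LBINT x. abs (Err b kp L l p q F G x))"
  define NN where "NN = N2 F*N2 G"
  have NN0: "0 <= NN" by (simp add: NN_def)
  have basic: "X <= C9*2 powr (min 0 (of_int (k - p)/2))*2 powr (min 0 (of_int (j - q)/2))*NN"
  proof -
   have "X <= b*((3*b*2 powr (min 0 (of_int (k - p)/2))*N2 F)*(3*b powr kp*2 powr (min 0 (of_int (j - q)/2))*N2 G))"
    unfolding X_def
   proof (rule Err_basic[OF b kp(1) F G])
    fix s assume s: "s \<in> {1..b}"
    have "abs (L * s) <= b*2 powr (- of_int p)" using s unfolding abs_mult L by (simp add: mult.commute mult_left_mono)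
    then show "N2 (%x. F (x - L * s) - E p F x) <= 3*b*2 powr (min 0 (of_int (k - p)/2))*N2 F"
     using b by (intro low_gain F F1 F0) auto
    have "s powr kp <= b powr kp" using s kp by (intro powr_mono2) auto
    then have "abs (l * s powr kp) <= b powr kp*2 powr (- of_int q)" unfolding abs_mult l by (simp add: mult.commute mult_left_mono)
    then show "N2 (%x. G (x - l * s powr kp) - E q G x) <= 3*b powr kp*2 powr (min 0 (of_int (j - q)/2))*N2 G"
     using bk by (intro low_gain G G1 G0) auto
   qed
   also have "... = C9*2 powr (min 0 (of_int (k - p)/2))*2 powr (min 0 (of_int (j - q)/2))*NN" by (simp add: C9_def NN_def mult_ac)
   finally show ?thesis .
  qed
  have X1: "X <= C*2 powr (- v/56)*NN"
  proof (cases "j < q")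
   case True
   have "C9*2 powr (min 0 (of_int (k - p)/2))*2 powr (min 0 (of_int (j - q)/2)) <= C*1*2 powr (- v/56)"
   proof (intro mult_mono)
    show "C9 <= C" using pos Cs by (simp add: C_def)
    show "2 powr (min 0 (of_int (k - p)/2)) <= (1::real)" using powr_mono[of "min 0 (of_int (k - p)/2)" 0 2] by simp
    show "2 powr (min 0 (of_int (j - q)/2)) <= (2::real) powr (- v/56)"
     using True by (intro powr_mono) (auto simp: v_def min_def)
   qed (use C0 in auto)
   then show ?thesis using basic mult_right_mono[OF _ NN0] by fastforce
  next
   case False
   then have v: "v = of_int (j - q)" by (simp add: v_def)
   have Eq: "E q G = (%x. 0)"
   proof -
    have "E q G = E q (E j G)" using E_E_coarse[OF G, of q j] False by simp
    moreover have "E j G = (%x. 0)" using G0 by auto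
    ultimately show ?thesis by auto
   qed
   have e: "Err b kp L l p q F G = (%x. Sop b kp L l F G x - E p F x*Aop b kp l G x)"
    by (rule ext) (simp add: Err_kernel(2)[OF b kp(1) F G] Eq)
   \<comment> \<open>Here \<open>ep = 2 powr (- v/28)\<close>, so that \<open>abs l*ep^28\<close>
     equals \<open>2 powr (- j)\<close>, the length on which \<open>G\<close> has mean zero;
     \<open>sqrt ep\<close> then yields the rate 1/56.\<close>
   have s1: "(LBINT x. abs (Sop b kp L l F G x)) <= Cs * sqrt (2 powr (- v/28))*N2 F*N2 G"
   proof (rule sm[OF L0 _ _ _ _ _ F G meanzero_E[OF G G0]])
    have "- log 2 c <= of_int (q - p)" using pq unfolding c0_def by linarith
    then have "2 powr (- of_int (q - p)) <= 2 powr (log 2 c)" by (intro powr_mono) auto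
    then have "2 powr (- of_int (q - p)) <= c" using Cs by simp
    then have "2 powr (- of_int (q - p))*2 powr (- of_int p) <= c*2 powr (- of_int p)" by (rule mult_right_mono) simp
    then show "abs l <= c*abs L" unfolding L l by (simp add: powr_add[symmetric])
    show "2 powr (- of_int j) <= abs l*(2 powr (- v/28))^28"
     unfolding l v by (simp add: powr_realpow[symmetric] powr_powr powr_add[symmetric] field_simps)
    show "2 powr (- v/28) <= (1::real)" using uv powr_mono[of "- v/28" 0 2] by simp
   qed auto
   have sq: "sqrt (2 powr (- v/28)) = 2 powr (- v/56)"
   proof -
    have "2 powr (- v/28) = (2 powr (- v/56))\<^sup>2" by (simp add: powr_powr powr_realpow[symmetric] power2_eq_square powr_add[symmetric])
    then show ?thesis by simp
   qed
   have s2: "(LBINT x. abs (E p F x*Aop b kp l G x)) <= CA*2 powr (- v/56)*NN"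
   proof -
    have "(LBINT x. abs (E p F x*Aop b kp l G x)) <= N2 (E p F)*N2 (Aop b kp l G)"
     by (intro bcs_Cauchy_Schwarz_abs E_bcs Aop_bcs b kp F G)
    also have "... <= N2 F*(CA*(2 powr (- of_int j)/abs l)*N2 G)"
     unfolding CA_def using L0 by (intro mult_mono N2_E F Aop_E_zero b kp G G0) auto
    also have "2 powr (- of_int j)/abs l = 2 powr (- v)" unfolding l v by (simp add: powr_diff[symmetric])
    also have "N2 F*(CA*2 powr (- v)*N2 G) <= N2 F*(CA*2 powr (- v/56)*N2 G)"
     using pos uv by (intro mult_left_mono mult_right_mono powr_mono) auto
    finally show ?thesis by (simp add: NN_def mult_ac)
   qed
   have "X <= (LBINT x. abs (Sop b kp L l F G x)) + (LBINT x. abs (E p F x*Aop b kp l G x))"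
    unfolding X_def e using L1_triangle[of "Sop b kp L l F G" "%x. - (E p F x*Aop b kp l G x)"]
    by (simp add: Sop_bcs b kp F G bcs_uminus bcs_times E_bcs Aop_bcs)
   also have "... <= (Cs + CA)*2 powr (- v/56)*NN" using s1 s2 unfolding sq NN_def by (simp add: algebra_simps)
   also have "... <= C*2 powr (- v/56)*NN" using pos NN0 by (intro mult_right_mono) (auto simp: C_def)
   finally show ?thesis .
  qed
  have X2: "X <= C*2 powr ((v - u)/2)*NN"
  proof (cases "k < p")
   case True
   have "C9*2 powr (min 0 (of_int (k - p)/2))*2 powr (min 0 (of_int (j - q)/2)) <= C*2 powr ((v - u)/2)*1"
   proof (intro mult_mono)
    show "C9 <= C" using pos Cs by (simp add: C_def)
    show "2 powr (min 0 (of_int (j - q)/2)) <= (1::real)" using powr_mono[of "min 0 (of_int (j - q)/2)" 0 2] by simp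
    show "2 powr (min 0 (of_int (k - p)/2)) <= (2::real) powr ((v - u)/2)"
     using True uv by (intro powr_mono) (auto simp: u_def min_def)
   qed (use C0 in auto)
   then show ?thesis using basic mult_right_mono[OF _ NN0] by fastforce
  next
   case False
   then have u: "u = of_int (k - p)" by (simp add: u_def)
   have Ep: "E p F = (%x. 0)"
   proof -
    have "E p F = E p (E k F)" using E_E_coarse[OF F, of p k] False by simp
    moreover have "E k F = (%x. 0)" using F0 by auto
    ultimately show ?thesis by auto
   qed
   have e: "Err b kp L l p q F G = (%x. Sop b kp L l F G x - Aop b 1 L F x*E q G x)"
    by (rule ext) (simp add: Err_kernel(2)[OF b kp(1) F G] Ep)
   have z: "2 powr (- of_int k)/abs L = 2 powr (- u)" unfolding L u by (simp add: powr_diff[symmetric])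
   have zle: "2 powr (- u) <= (2::real) powr ((v - u)/2)" using uv by (intro powr_mono) auto
   have s1: "(LBINT x. abs (Sop b kp L l F G x)) <= CF*2 powr ((v - u)/2)*NN"
   proof -
    have "(LBINT x. abs (Sop b kp L l F G x)) <= 2*((b + 3)*2 powr (- u) + 2*b * sqrt (abs l*(C1*2 powr (- u))*2 powr of_int (j + 1)))*N2 F*N2 G"
     by (rule Sop_coarse_high[OF b kp(1) F F0 G G1 L0(1) C1(2) _ z[symmetric]]) (use C1(1) in auto)
    also have "... <= 2*((b + 3)*2 powr ((v - u)/2) + 2*b*(sqrt (2*C1)*2 powr ((v - u)/2)))*N2 F*N2 G"
    proof (intro mult_right_mono mult_left_mono add_mono zle)
     have "abs l*(C1*2 powr (- u))*2 powr of_int (j + 1) = 2*C1*2 powr (of_int (j - q) - u)"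
      unfolding l by (simp add: powr_add powr_diff powr_minus field_simps)
     also have "... <= 2*C1*2 powr (v - u)" using C1(1) by (intro mult_left_mono powr_mono) (auto simp: v_def)
     finally have "sqrt (abs l*(C1*2 powr (- u))*2 powr of_int (j + 1)) <= sqrt (2*C1*2 powr (v - u))" by simp
     also have "... = sqrt (2*C1)*2 powr ((v - u)/2)" by (simp add: real_sqrt_mult powr_half_sqrt_powr)
     finally show "sqrt (abs l*(C1*2 powr (- u))*2 powr of_int (j + 1)) <= sqrt (2*C1)*2 powr ((v - u)/2)" .
    qed (use b in auto)
    also have "... = CF*2 powr ((v - u)/2)*NN" by (simp add: CF_def NN_def algebra_simps)
    finally show ?thesis .
   qed
   have s2: "(LBINT x. abs (Aop b 1 L F x*E q G x)) <= CB*2 powr ((v - u)/2)*NN"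
   proof -
    have "(LBINT x. abs (Aop b 1 L F x*E q G x)) <= N2 (Aop b 1 L F)*N2 (E q G)"
     by (intro bcs_Cauchy_Schwarz_abs E_bcs Aop_bcs b F G) simp
    also have "... <= (CB*(2 powr (- of_int k)/abs L)*N2 F)*N2 G"
     unfolding CB_def by (intro mult_mono N2_E G Aop_E_zero b F F0 L0(1)) (use b in auto)
    also have "... = (CB*2 powr (- u))*(N2 F*N2 G)" unfolding z by simp
    also have "... <= (CB*2 powr ((v - u)/2))*(N2 F*N2 G)" using pos by (intro mult_right_mono mult_left_mono zle) auto
    finally show ?thesis by (simp add: NN_def)
   qed
   have "X <= (LBINT x. abs (Sop b kp L l F G x)) + (LBINT x. abs (Aop b 1 L F x*E q G x))"
    unfolding X_def e using L1_triangle[of "Sop b kp L l F G" "%x. - (Aop b 1 L F x*E q G x)"]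
    by (simp add: Sop_bcs b kp F G bcs_uminus bcs_times E_bcs Aop_bcs)
   also have "... <= (CF + CB)*2 powr ((v - u)/2)*NN" using s1 s2 by (simp add: algebra_simps)
   also have "... <= C*2 powr ((v - u)/2)*NN" using pos NN0 Cs by (intro mult_right_mono) (auto simp: C_def)
   finally show ?thesis .
  qed
  \<comment> \<open>If \<open>v/56\<close> reaches \<open>(u + v)/200\<close>, the first bound
    suffices. Otherwise \<open>u\<close> exceeds \<open>v\<close> by a fixed factor greater than 2,
    and \<open>(v - u)/2\<close> is negative enough.\<close>
  have "X <= C*2 powr (- (u + v)/200)*NN"
  proof (cases "(u + v)/200 <= v/56")
   case True
   have "C*2 powr (- v/56)*NN <= C*2 powr (- (u + v)/200)*NN"
    using C0 NN0 True by (intro mult_right_mono mult_left_mono powr_mono) auto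
   then show ?thesis using X1 by linarith
  next
   case False
   have "C*2 powr ((v - u)/2)*NN <= C*2 powr (- (u + v)/200)*NN"
   proof (intro mult_right_mono mult_left_mono powr_mono)
    show "(v - u)/2 <= - (u + v)/200" using False uv by (simp add: field_simps)
   qed (use C0 NN0 in auto)
   then show ?thesis using X2 by linarith
  qed
  then show ?thesis by (simp add: X_def NN_def u_def v_def)
 qed
 show ?thesis using C0 main by blast
qed

section \<open>Almost orthogonality\<close>

definition Wc :: "real => real" where "Wc de = 2/(1 - 2 powr (- de))"

lemma Wc_pos: "de > 0 ==> 0 < Wc de"
 using powr_less_mono[of "- de" 0 2] by (simp add: Wc_def)

lemma Wc_sum:
 fixes S :: "int set"
 assumes "de > 0" "finite S" shows "(\<Sum>k\<in>S. 2 powr (- de * of_int (abs (k - m)))) <= Wc de"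
proof -
 define r where "r = (2::real) powr (- de)"
 have r: "0 < r" "r < 1" using powr_less_mono[of "- de" 0 2] assms(1) by (auto simp: r_def)
 have geo: "(\<Sum>n\<in>A. r^n) <= 1/(1 - r)" if "finite A" for A
  using sum_le_suminf[OF summable_geometric[of r] that] r by (simp add: suminf_geometric)
 have e: "2 powr (- de * of_int (abs (k - m))) = r^nat (abs (k - m))" for k
  using r(1) by (simp add: r_def powr_powr powr_realpow[symmetric])
 have part: "(\<Sum>k\<in>A. r^nat (abs (k - m))) <= 1/(1 - r)" if "finite A" "inj_on (%k. nat (abs (k - m))) A" for A
  using geo[of "(%k. nat (abs (k - m))) ` A"] that by (simp add: sum.reindex)
 have "(\<Sum>k\<in>S. r^nat (abs (k - m))) = (\<Sum>k\<in>S \<inter> {m..}. r^nat (abs (k - m))) + (\<Sum>k\<in>S - {m..}. r^nat (abs (k - m)))"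
  by (rule sum.Int_Diff[OF assms(2)])
 also have "... <= 1/(1 - r) + 1/(1 - r)"
  using assms(2) by (intro add_mono part) (auto simp: inj_on_def)
 finally show ?thesis by (simp only: e Wc_def r_def[symmetric])
qed

lemma Wc_sum_inj:
 assumes "de > 0" "finite I" "inj_on p I" shows "(\<Sum>i\<in>I. 2 powr (- de * of_int (abs (k - p i)))) <= Wc de"
 using Wc_sum[OF assms(1), of "p ` I" k] assms by (simp add: sum.reindex abs_minus_commute)

text \<open>Schur's test: Cauchy-Schwarz with the weight split into two square roots, row sums over
  \<open>k\<close> and column sums over \<open>i\<close> both bounded by \<open>Wc\<close>.
  Injectivity of \<open>p\<close> is what bounds the column sums.\<close>

lemma schur:
 fixes S :: "int set"
 assumes de: "de > 0" and fin: "finite I" "finite S" and p: "inj_on p I"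
 shows "(\<Sum>i\<in>I. (\<Sum>k\<in>S. 2 powr (- de * of_int (abs (k - p i)))*a k)\<^sup>2) <= (Wc de)\<^sup>2*(\<Sum>k\<in>S. (a k)\<^sup>2)"
proof -
 define w where "w i k = 2 powr (- de * of_int (abs (k - p i)))" for i k
 have w0: "0 <= w i k" for i k by (simp add: w_def)
 have W0: "0 <= Wc de" using Wc_pos[OF de] by simp
 have "(\<Sum>k\<in>S. w i k*a k)\<^sup>2 <= Wc de*(\<Sum>k\<in>S. w i k*(a k)\<^sup>2)" for i
 proof -
  have "(\<Sum>k\<in>S. sqrt (w i k)*(sqrt (w i k)*a k))\<^sup>2 <= (\<Sum>k\<in>S. (sqrt (w i k))\<^sup>2)*(\<Sum>k\<in>S. (sqrt (w i k)*a k)\<^sup>2)"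
   by (rule Cauchy_Schwarz_ineq_sum)
  also have "... = (\<Sum>k\<in>S. w i k)*(\<Sum>k\<in>S. w i k*(a k)\<^sup>2)" by (simp add: w0 power_mult_distrib)
  also have "... <= Wc de*(\<Sum>k\<in>S. w i k*(a k)\<^sup>2)"
   unfolding w_def by (intro mult_right_mono Wc_sum de fin sum_nonneg) auto
  finally show ?thesis by (simp add: w0 mult.assoc[symmetric])
 qed
 then have "(\<Sum>i\<in>I. (\<Sum>k\<in>S. w i k*a k)\<^sup>2) <= (\<Sum>i\<in>I. Wc de*(\<Sum>k\<in>S. w i k*(a k)\<^sup>2))" by (intro sum_mono)
 also have "... = Wc de*(\<Sum>k\<in>S. (\<Sum>i\<in>I. w i k)*(a k)\<^sup>2)"
  by (simp add: sum_distrib_left sum_distrib_right) (rule sum.swap)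
 also have "... <= Wc de*(\<Sum>k\<in>S. Wc de*(a k)\<^sup>2)"
  unfolding w_def by (intro mult_left_mono sum_mono mult_right_mono Wc_sum_inj de fin p W0) auto
 also have "... = (Wc de)\<^sup>2*(\<Sum>k\<in>S. (a k)\<^sup>2)" by (simp add: sum_distrib_left power2_eq_square mult.assoc)
 finally show ?thesis by (simp add: w_def)
qed

lemma sum_CS: "(\<Sum>i\<in>I. a i*b i) <= sqrt (\<Sum>i\<in>I. (a i)\<^sup>2) * sqrt (\<Sum>i\<in>I. (b i :: real)\<^sup>2)"
 using Cauchy_Schwarz_ineq_sum[of a b I] by (simp add: real_le_rsqrt real_sqrt_mult[symmetric])

definition DE :: "int => (real => real) => real => real" where
 "DE k F x = E (k + 1) F x - E k F x"

text \<open>The functions that look like one martingale difference: constant on cells of level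
  \<open>k + 1\<close> and with mean zero on cells of level \<open>k\<close>.\<close>

definition cls :: "int => (real => real) => bool" where
 "cls k F \<longleftrightarrow> bcs F & E (k + 1) F = F & (\<forall>x. E k F x = 0)"

lemma cls_DE: assumes "bcs F" shows "cls k (DE k F)"
proof -
 note b = E_bcs[OF assms, of "k + 1"] E_bcs[OF assms, of k]
 show ?thesis unfolding cls_def DE_def[abs_def]
  using bcs_diff[OF b] E_diff[OF b] E_idem[of "k + 1" F] E_idem[of k F] E_E_fine[of k "k + 1" F] E_E_coarse[OF assms, of k "k + 1"]
  by (auto simp: fun_eq_iff)
qed

lemma DE_bcs: "bcs F ==> bcs (DE k F)" using cls_DE[of F k] by (simp add: cls_def)

lemma DE_decomp: "E (a + int m) F x = E a F x + (\<Sum>k\<in>{a..<a + int m}. DE k F x)"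
proof (induction m)
 case (Suc m)
 have "{a..<a + int (Suc m)} = insert (a + int m) {a..<a + int m}" by auto
 with Suc show ?case by (simp add: DE_def algebra_simps)
qed simp

lemma DE_square_sum: assumes "bcs F" shows "(\<Sum>k\<in>{a..<a + int m}. (N2 (DE k F))\<^sup>2) <= (N2 F)\<^sup>2"
proof -
 have "(\<Sum>k\<in>{a..<a + int m}. (N2 (DE k F))\<^sup>2) = (N2 (E (a + int m) F))\<^sup>2 - (N2 (E a F))\<^sup>2"
 proof (induction m)
  case (Suc m)
  have "{a..<a + int (Suc m)} = insert (a + int m) {a..<a + int m}" by auto
  with Suc pythagoras[OF assms, of "a + int m" "a + int m + 1"] show ?case by (simp add: DE_def[abs_def] algebra_simps)
 qed simp
 also have "... <= (N2 (E (a + int m) F))\<^sup>2" by simp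
 also have "... <= (N2 F)\<^sup>2" by (intro power_mono N2_E assms) simp
 finally show ?thesis .
qed

lemma E_coarse_tendsto: assumes "bcs F" shows "(%m. N2 (E (- int m) F)) \<longlonglongrightarrow> 0"
proof -
 define J where "J = (LBINT x. abs (F x))"
 have up: "(%m. sqrt ((1/2)^m)*J) \<longlonglongrightarrow> 0"
  using tendsto_mult[OF tendsto_real_sqrt[OF LIMSEQ_realpow_zero[of "1/2"]] tendsto_const[of J]] by simp
 have "N2 (E (- int m) F) <= sqrt ((1/2)^m)*J" for m
 proof -
  have "(N2 (E (- int m) F))\<^sup>2 <= (sqrt ((1/2)^m)*J)\<^sup>2"
   using N2_E_small[OF assms, of "- int m"] by (simp add: J_def power_mult_distrib powr_minus powr_realpow power_one_over field_simps)
  then show ?thesis by (rule power2_le_imp_le) (simp add: J_def)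
 qed
 then show ?thesis by (intro tendsto_sandwich[OF _ _ tendsto_const up]) auto
qed

lemma sub_sum:
 assumes sub: "\<And>f g. bcs f ==> bcs g ==> X (%x. f x + g x) <= X f + X g" and z: "X (%x. 0) <= (0::real)"
  and "finite S" "\<And>k. bcs (f k)"
 shows "X (%x. \<Sum>k\<in>S. f k x) <= (\<Sum>k\<in>S. X (f k))"
 using assms(3)
proof (induction S)
 case (insert k S)
 have "X (%x. f k x + (\<Sum>k\<in>S. f k x)) <= X (f k) + X (%x. \<Sum>k\<in>S. f k x)"
  by (intro sub bcs_sum assms)
 with insert show ?case by simp
qed (use z in simp)

text \<open>Both functions are expanded in martingale differences, finitely many because they are
  step functions at level \<open>K\<close> and are cut off at the coarse level \<open>- m\<close>.
  The decay separates, so Cauchy-Schwarz in \<open>i\<close> and \<open>schur\<close> for each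
  factor finish the main part. The coarse remainder is estimated crudely with \<open>B\<close>, but
  its norm tends to 0 with \<open>m\<close>; this is why \<open>B\<close> and \<open>K\<close> do
  not show up in the conclusion.\<close>

lemma bilinear_expansion:
 fixes X :: "nat => (real => real) => (real => real) => real"
 assumes de: "de > 0" and I: "finite I" "inj_on p I" "inj_on q I" and C: "C >= 0" and B: "B >= 0"
  and s1: "\<And>i f g h. i \<in> I ==> bcs f ==> bcs g ==> bcs h ==> X i (%x. f x + g x) h <= X i f h + X i g h"
  and s2: "\<And>i f g h. i \<in> I ==> bcs f ==> bcs g ==> bcs h ==> X i h (%x. f x + g x) <= X i h f + X i h g"
  and triv: "\<And>i f g. i \<in> I ==> bcs f ==> bcs g ==> X i f g <= B*N2 f*N2 g"
  and dec: "\<And>i k j f g. i \<in> I ==> cls k f ==> cls j g ==> X i f g <= C*2 powr (- de * of_int (abs (k - p i)))*2 powr (- de * of_int (abs (j - q i)))*N2 f*N2 g"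
  and F: "bcs F" "E K F = F" and G: "bcs G" "E K G = G"
 shows "(\<Sum>i\<in>I. X i F G) <= C*(Wc de)\<^sup>2*N2 F*N2 G"
proof -
 define err where "err m = real (card I)*(B*N2 (E (- int m) F)*N2 G + B*(2*N2 F)*N2 (E (- int m) G))" for m
 have "err \<longlonglongrightarrow> real (card I)*(B*0*N2 G + B*(2*N2 F)*0)"
  unfolding err_def by (intro tendsto_intros E_coarse_tendsto F G)
 then have lim: "(%m. err m + C*(Wc de)\<^sup>2*N2 F*N2 G) \<longlonglongrightarrow> 0 + C*(Wc de)\<^sup>2*N2 F*N2 G"
  by (intro tendsto_add tendsto_const) simp
 have bound: "(\<Sum>i\<in>I. X i F G) <= err m + C*(Wc de)\<^sup>2*N2 F*N2 G" if m: "m >= nat (abs K)" for m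
 proof -
  define a where "a = - int m"
  define M where "M = nat (K - a)"
  have aM: "a + int M = K" using m by (simp add: a_def M_def)
  define S where "S = {a..<K}"
  define F' G' where "F' x = (\<Sum>k\<in>S. DE k F x)" and "G' x = (\<Sum>k\<in>S. DE k G x)" for x
  have bc: "bcs F'" "bcs G'" "bcs (E a F)" "bcs (E a G)"
   unfolding F'_def[abs_def] G'_def[abs_def] by (intro bcs_sum DE_bcs E_bcs F G)+
  have Feq: "F = (%x. E a F x + F' x)" "G = (%x. E a G x + G' x)"
   using DE_decomp[of a M F] DE_decomp[of a M G] by (auto simp: aM F G F'_def G'_def S_def)
  have F'eq: "F' = (%x. F x - E a F x)" using Feq(1) by (simp add: fun_eq_iff)
  have NF': "N2 F' <= 2*N2 F" unfolding F'eq using N2_triangle_diff[OF F(1) bc(3)] N2_E[OF F(1), of a] by simp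
  define A1 A2 where "A1 i = (\<Sum>k\<in>S. 2 powr (- de * of_int (abs (k - p i)))*N2 (DE k F))"
   and "A2 i = (\<Sum>k\<in>S. 2 powr (- de * of_int (abs (k - q i)))*N2 (DE k G))" for i
  have each: "X i F G <= (B*N2 (E a F)*N2 G + B*(2*N2 F)*N2 (E a G)) + C*(A1 i*A2 i)" if i: "i \<in> I" for i
  proof -
   have "X i F G <= X i (E a F) G + X i F' G" using s1[OF i bc(3,1) G(1)] Feq(1) by simp
   also have "X i F' G <= X i F' (E a G) + X i F' G'" using s2[OF i bc(4,2,1)] Feq(2) by simp
   also have "X i (E a F) G <= B*N2 (E a F)*N2 G" by (intro triv i bc G)
   also have "X i F' (E a G) <= B*N2 F'*N2 (E a G)" by (intro triv i bc G)
   also have "... <= B*(2*N2 F)*N2 (E a G)" using NF' B by (intro mult_right_mono mult_left_mono) auto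
   also have "X i F' G' <= C*(A1 i*A2 i)"
   proof -
    have "X i F' G' <= (\<Sum>k\<in>S. X i (DE k F) G')"
     unfolding F'_def[abs_def] by (rule sub_sum[where X = "%f. X i f G'"])
      (use s1[OF i] triv[OF i, of "%x. 0"] bc DE_bcs F in \<open>auto simp: S_def\<close>)
    also have "... <= (\<Sum>k\<in>S. \<Sum>j\<in>S. X i (DE k F) (DE j G))"
    proof (rule sum_mono)
     fix k
     have b: "bcs (DE k F)" by (rule DE_bcs[OF F(1)])
     show "X i (DE k F) G' <= (\<Sum>j\<in>S. X i (DE k F) (DE j G))"
      unfolding G'_def[abs_def] by (rule sub_sum)
       (use s2[OF i] triv[OF i b, of "%x. 0"] b DE_bcs G in \<open>auto simp: S_def\<close>)
    qed
    also have "... <= (\<Sum>k\<in>S. \<Sum>j\<in>S. C*2 powr (- de * of_int (abs (k - p i)))*2 powr (- de * of_int (abs (j - q i)))*N2 (DE k F)*N2 (DE j G))"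
     by (intro sum_mono dec i cls_DE F G)
    also have "... = C*(A1 i*A2 i)" unfolding A1_def A2_def sum_product by (simp add: sum_distrib_left mult_ac)
    finally show ?thesis .
   qed
   finally show ?thesis by simp
  qed
  have sq: "sqrt (\<Sum>i\<in>I. (A1 i)\<^sup>2) <= Wc de*N2 F" "sqrt (\<Sum>i\<in>I. (A2 i)\<^sup>2) <= Wc de*N2 G"
  proof -
   have *: "sqrt (\<Sum>i\<in>I. (\<Sum>k\<in>S. 2 powr (- de * of_int (abs (k - r i)))*N2 (DE k H))\<^sup>2) <= Wc de*N2 H" if "inj_on r I" "bcs H" for r H
   proof (rule real_le_lsqrt)
    have "(\<Sum>i\<in>I. (\<Sum>k\<in>S. 2 powr (- de * of_int (abs (k - r i)))*N2 (DE k H))\<^sup>2) <= (Wc de)\<^sup>2*(\<Sum>k\<in>S. (N2 (DE k H))\<^sup>2)"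
     by (rule schur) (use de I that in \<open>auto simp: S_def\<close>)
    also have "... <= (Wc de)\<^sup>2*(N2 H)\<^sup>2"
     using DE_square_sum[OF that(2), of a M] by (intro mult_left_mono) (auto simp: S_def aM)
    finally show "(\<Sum>i\<in>I. (\<Sum>k\<in>S. 2 powr (- de * of_int (abs (k - r i)))*N2 (DE k H))\<^sup>2) <= (Wc de*N2 H)\<^sup>2" by (simp add: power_mult_distrib)
   qed (use Wc_pos[OF de] in auto)
   show "sqrt (\<Sum>i\<in>I. (A1 i)\<^sup>2) <= Wc de*N2 F" "sqrt (\<Sum>i\<in>I. (A2 i)\<^sup>2) <= Wc de*N2 G"
    unfolding A1_def A2_def by (intro * I F G)+
  qed
  have "(\<Sum>i\<in>I. X i F G) <= (\<Sum>i\<in>I. (B*N2 (E a F)*N2 G + B*(2*N2 F)*N2 (E a G)) + C*(A1 i*A2 i))"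
   by (rule sum_mono) (rule each)
  also have "... = err m + C*(\<Sum>i\<in>I. A1 i*A2 i)" by (simp add: sum.distrib sum_distrib_left err_def a_def)
  also have "C*(\<Sum>i\<in>I. A1 i*A2 i) <= C*((Wc de*N2 F)*(Wc de*N2 G))"
   by (rule mult_left_mono[OF order_trans[OF sum_CS mult_mono] C]) (use sq Wc_pos[OF de] in \<open>auto intro!: sum_nonneg\<close>)
  finally show ?thesis by (simp add: power2_eq_square mult_ac)
 qed
 have "(\<Sum>i\<in>I. X i F G) <= 0 + C*(Wc de)\<^sup>2*N2 F*N2 G"
  by (rule LIMSEQ_le_const[OF lim]) (use bound in blast)
 then show ?thesis by simp
qed

section \<open>Maximal function and paraproducts\<close>

text \<open>The dyadic maximal function over the first \<open>m + 1\<close> levels of a sequence, as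
  a running maximum so that its growth can be followed one level at a time.\<close>

fun mx :: "(nat => int) => (real => real) => nat => real => real" where
 "mx r h 0 x = E (r 0) h x"
| "mx r h (Suc m) x = max (mx r h m x) (E (r (Suc m)) h x)"

lemma mx_bcs: "bcs h ==> bcs (mx r h m)"
proof (induction m)
 case 0 then show ?case using E_bcs[of h "r 0"] by (simp add: bcs_def)
next
 case (Suc m)
 have "mx r h (Suc m) = (%x. max (mx r h m x) (E (r (Suc m)) h x))" by auto
 then show ?case using bcs_max[OF Suc.IH[OF Suc.prems] E_bcs[OF Suc.prems]] by metis
qed

lemma mx_ge: "E (r m) h x <= mx r h m x" by (cases m) auto

lemma mx_nonneg: "(\<And>x. 0 <= h x) ==> 0 <= mx r h m x" using E_nonneg[of h "r m" x] mx_ge[of r m h x] by simp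

lemma mx_same:
 assumes "\<And>i. i <= m ==> r i <= k" "same k x y" shows "mx r h m x = mx r h m y"
 using assms(1)
proof (induction m)
 case (Suc m)
 then show ?case using E_same[OF same_coarser[OF assms(2), of "r (Suc m)"]] by simp
qed (use E_same[OF same_coarser[OF assms(2), of "r 0"]] in simp)

text \<open>By induction on the number of levels, the square integral of the maximal function is at
  most twice its pairing with \<open>h\<close>; Cauchy-Schwarz then cancels one factor of the norm.
  When the maximum increases it becomes \<open>f\<close>, and the bound for its square is just
  \<open>(f - mx r h m x)\<^sup>2 >= 0\<close>.\<close>

theorem doob:
 assumes h: "bcs h" "\<And>x. 0 <= h x" and r: "mono r"
 shows "N2 (mx r h m) <= 2*N2 h"
proof -
 note mb = mx_bcs[OF h(1), of r]
 note int = bcs_integrable bcs_power2 bcs_times bcs_add bcs_diff mb h(1) E_bcs bcs_cmult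
 have main: "(LBINT x. (mx r h m x)\<^sup>2) <= 2*(LBINT x. h x*mx r h m x)"
 proof (induction m)
  case 0
  have "0 <= (LBINT x. h x*E (r 0) h x)" using h E_nonneg by (intro integral_nonneg_AE AE_I2 mult_nonneg_nonneg) auto
  then show ?case using N2_E_sq[OF h(1), of "r 0"] by (simp add: N2_power2)
 next
  case (Suc m)
  define f d where "f = E (r (Suc m)) h" and "d x = mx r h (Suc m) x - mx r h m x" for x
  have db: "bcs d" unfolding d_def[abs_def] by (intro bcs_diff mb)
  \<comment> \<open>The increment \<open>d\<close> is constant on cells of the newest level, so in
    its pairing with \<open>f\<close>, the average of \<open>h\<close> at that level, the average
    can be removed.\<close>
  have dc: "E (r (Suc m)) d = d"
  proof (rule E_of_const)
   fix x y assume xy: "same (r (Suc m)) x y"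
   show "d x = d y" using mx_same[OF _ xy, of "Suc m"] mx_same[OF _ xy, of m] r by (simp add: d_def mono_def)
  qed
  have "(mx r h (Suc m) x)\<^sup>2 <= (mx r h m x)\<^sup>2 + 2*(f x*d x)" for x
  proof (cases "f x <= mx r h m x")
   case False
   have "0 <= (f x - mx r h m x)\<^sup>2" by simp
   then show ?thesis using False by (simp add: d_def f_def[symmetric] max_def power2_eq_square algebra_simps)
  qed (simp add: d_def f_def[symmetric] max_def)
  then have "(LBINT x. (mx r h (Suc m) x)\<^sup>2) <= (LBINT x. (mx r h m x)\<^sup>2 + 2*(f x*d x))"
   unfolding f_def by (intro integral_mono int db)
  also have "... = (LBINT x. (mx r h m x)\<^sup>2) + 2*(LBINT x. f x*d x)"
   unfolding f_def by (subst Bochner_Integration.integral_add) (auto intro!: int db)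
  also have "(LBINT x. f x*d x) = (LBINT x. h x*d x)"
   using E_selfadj[OF h(1) db, of "r (Suc m)"] by (simp add: dc f_def)
  also have "... = (LBINT x. h x*mx r h (Suc m) x - h x*mx r h m x)" by (simp only: d_def right_diff_distrib)
  also have "... = (LBINT x. h x*mx r h (Suc m) x) - (LBINT x. h x*mx r h m x)"
   by (intro Bochner_Integration.integral_diff int)
  finally show ?case using Suc by simp
 qed
 then have "(N2 (mx r h m))\<^sup>2 <= 2*(N2 h*N2 (mx r h m))"
  using bcs_Cauchy_Schwarz[OF h(1) mb, of m] by (simp add: N2_power2)
 then have "N2 (mx r h m)*N2 (mx r h m) <= 2*N2 h*N2 (mx r h m)" by (simp add: power2_eq_square)
 then show ?thesis using N2_nonneg[of "mx r h m"] N2_nonneg[of h] by (metis mult_le_cancel_right mult_nonneg_nonneg order_less_le zero_le_numeral)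
qed

text \<open>A weight constant on the coarser cells passes through both projections, so this is the
  Pythagorean identity for \<open>w*h\<close>.\<close>

lemma E_weighted:
 assumes h: "bcs h" and w: "bcs w" "\<And>x y. same k x y ==> w x = w y" and kj: "k <= j"
 shows "(LBINT x. (w x)\<^sup>2*(E j h x - E k h x)\<^sup>2) = (LBINT x. (w x)\<^sup>2*(E j h x)\<^sup>2) - (LBINT x. (w x)\<^sup>2*(E k h x)\<^sup>2)"
proof -
 have e: "E i (%x. w x*h x) x = w x*E i h x" if "k <= i" for i x
  by (rule E_mult_const) (use w(2) same_coarser that in blast)
 have "(N2 (%x. E j (%x. w x*h x) x - E k (%x. w x*h x) x))\<^sup>2 = (N2 (E j (%x. w x*h x)))\<^sup>2 - (N2 (E k (%x. w x*h x)))\<^sup>2"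
  by (rule pythagoras[OF bcs_times[OF w(1) h] kj])
 moreover have "(%x. w x*E j h x - w x*E k h x) = (%x. w x*(E j h x - E k h x))" by (simp add: algebra_simps)
 ultimately show ?thesis using kj by (simp add: N2_power2 e power_mult_distrib)
qed

text \<open>Pair with \<open>h\<close> bounded by 1. The factor \<open>E (r i) F\<close> is constant
  on the cells of level \<open>q i\<close>, so the difference operator moves onto \<open>h\<close>.
  Cauchy-Schwarz separates the square function of \<open>R\<close> from a sum with weights
  \<open>g i\<close>, where \<open>g i\<close> is the running maximal function of \<open>F\<close>;
  that sum is the Carleson embedding for the bounded function \<open>h\<close>.\<close>

theorem martingale_paraproduct:
 assumes F: "bcs F" and R: "bcs R" and r: "mono r" and q: "mono q" and rq: "\<And>i. i < n ==> r i <= q i"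
 shows "(LBINT x. abs (\<Sum>i<n. E (r i) F x*(E (q (Suc i)) R x - E (q i) R x))) <= 2*N2 F*N2 R"
proof -
 define D where "D i H x = E (q (Suc i)) H x - E (q i) H x" for i H and x :: real
 have Db: "bcs (D i H)" if "bcs H" for i H unfolding D_def[abs_def] by (intro bcs_diff E_bcs that)
 have qs: "q i <= q (Suc i)" for i using q by (simp add: mono_def)
 define f where "f = (%i. E (r i) F)"
 have fb: "bcs (f i)" for i unfolding f_def by (rule E_bcs[OF F])
 define g where "g = mx r (%x. abs (F x))"
 have Fa: "bcs (%x. abs (F x))" by (rule bcs_abs[OF F])
 have gb: "bcs (g i)" for i unfolding g_def by (rule mx_bcs[OF Fa])
 have fg: "abs (f i x) <= g i x" for i x unfolding f_def g_def using E_abs[of "r i" F x] mx_ge[of r i "%x. abs (F x)" x] by linarith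
 have gN: "N2 (g i) <= 2*N2 F" for i unfolding g_def using doob[OF Fa _ r, of i] by (simp add: N2_abs)
 have gsame: "same (q i) x y ==> g i x = g i y" if "i < n" for i x y
  unfolding g_def by (rule mx_same) (use r rq[OF that] in \<open>auto simp: mono_def intro: order_trans\<close>)
 have fsame: "same (q i) x y ==> f i x = f i y" if "i < n" for i x y
  unfolding f_def using E_same same_coarser rq[OF that] by blast
 show ?thesis
 proof (rule L1_dual)
  show "bcs (%x. \<Sum>i<n. E (r i) F x*(E (q (Suc i)) R x - E (q i) R x))"
   by (intro bcs_sum bcs_times bcs_diff E_bcs F R)
  fix h :: "real => real" assume h: "bcs h" and h1: "\<And>x. abs (h x) <= 1"
  have D1: "(LBINT x. (f i x*D i R x)*h x) = (LBINT x. D i R x*(f i x*D i h x))" if i: "i < n" for i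
  proof -
   define u where "u x = f i x*D i R x" for x
   have ub: "bcs u" unfolding u_def[abs_def] by (intro bcs_times fb Db R)
   have Du: "D i u x = u x" for x
   proof -
    have "E (q (Suc i)) u x = f i x*E (q (Suc i)) (D i R) x" "E (q i) u x = f i x*E (q i) (D i R) x"
     unfolding u_def[abs_def] by (rule E_mult_const, use fsame[OF i] same_coarser[OF _ qs] in blast)+
    moreover have "E (q (Suc i)) (D i R) x = D i R x" "E (q i) (D i R) x = 0" unfolding D_def[abs_def]
     using E_diff[OF E_bcs[OF R] E_bcs[OF R]] E_idem E_E_fine[OF qs] E_E_coarse[OF R qs] by simp_all
    ultimately show ?thesis by (simp add: D_def[of i u] u_def)
   qed
   have Dadj: "(LBINT x. D i u x*h x) = (LBINT x. u x*D i h x)"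
    unfolding D_def left_diff_distrib right_diff_distrib
    by (simp add: E_selfadj[OF ub h] bcs_integrable bcs_times E_bcs ub h)
   show ?thesis using Dadj unfolding Du by (simp add: u_def mult_ac)
  qed
  \<comment> \<open>The Carleson embedding by telescoping: \<open>E_weighted\<close> makes each term
    a difference, and since the weights \<open>g i\<close> increase, replacing
    \<open>g (m - 1)\<close> by \<open>g m\<close> before the next step only enlarges the bound. For
    \<open>m = 0\<close> the truncated index is harmless because the sum is empty.\<close>
  have carl: "(\<Sum>i<m. LBINT x. (g i x)\<^sup>2*(D i h x)\<^sup>2) <= (LBINT x. (g (m - 1) x)\<^sup>2*(E (q m) h x)\<^sup>2)" if "m <= n" for m
   using that
  proof (induction m)
   case 0 show ?case by simp
  next
   case (Suc m)
   have "(LBINT x. (g (m - 1) x)\<^sup>2*(E (q m) h x)\<^sup>2) <= (LBINT x. (g m x)\<^sup>2*(E (q m) h x)\<^sup>2)"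
   proof (rule integral_mono)
    fix x
    have "0 <= g (m - 1) x" unfolding g_def by (rule mx_nonneg) simp
    moreover have "g (m - 1) x <= g m x" by (cases m) (auto simp: g_def)
    ultimately show "(g (m - 1) x)\<^sup>2*(E (q m) h x)\<^sup>2 <= (g m x)\<^sup>2*(E (q m) h x)\<^sup>2"
     by (intro mult_right_mono power_mono) auto
   qed (intro bcs_integrable bcs_times bcs_power2 gb E_bcs h)+
   moreover have "(LBINT x. (g m x)\<^sup>2*(D m h x)\<^sup>2) = (LBINT x. (g m x)\<^sup>2*(E (q (Suc m)) h x)\<^sup>2) - (LBINT x. (g m x)\<^sup>2*(E (q m) h x)\<^sup>2)"
    unfolding D_def by (rule E_weighted[OF h gb gsame qs]) (use Suc.prems in auto)
   ultimately show ?case using Suc by simp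
  qed
  have "(LBINT x. (\<Sum>i<n. f i x*D i R x)*h x) = (\<Sum>i<n. LBINT x. (f i x*D i R x)*h x)"
   unfolding sum_distrib_right by (intro Bochner_Integration.integral_sum bcs_integrable bcs_times fb Db R h)
  also have "... <= (\<Sum>i<n. N2 (D i R)*N2 (%x. g i x*D i h x))"
  proof (rule sum_mono)
   fix i assume "i \<in> {..<n}"
   then have "(LBINT x. (f i x*D i R x)*h x) <= N2 (D i R)*N2 (%x. f i x*D i h x)"
    using bcs_Cauchy_Schwarz[OF Db[OF R] bcs_times[OF fb Db[OF h]]] D1 by auto
   also have "N2 (%x. f i x*D i h x) <= N2 (%x. g i x*D i h x)"
   proof (rule N2_mono)
    show "abs (f i x*D i h x) <= abs (g i x*D i h x)" for x
     using fg[of i x] by (simp add: abs_mult mult_right_mono order_trans[OF _ abs_ge_self])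
   qed (intro bcs_times fb gb Db h)+
   finally show "(LBINT x. (f i x*D i R x)*h x) <= N2 (D i R)*N2 (%x. g i x*D i h x)"
    by (simp add: mult_left_mono)
  qed
  also have "... <= sqrt (\<Sum>i<n. (N2 (D i R))\<^sup>2) * sqrt (\<Sum>i<n. (N2 (%x. g i x*D i h x))\<^sup>2)" by (rule sum_CS)
  also have "... <= N2 R*(2*N2 F)"
  proof (rule mult_mono)
   have a1: "(\<Sum>i<m. (N2 (D i R))\<^sup>2) = (N2 (E (q m) R))\<^sup>2 - (N2 (E (q 0) R))\<^sup>2" for m
    by (induction m) (auto simp: D_def[abs_def] pythagoras[OF R qs])
   have "(N2 (E (q n) R))\<^sup>2 <= (N2 R)\<^sup>2" by (intro power_mono N2_E R) simp
   then have "(\<Sum>i<n. (N2 (D i R))\<^sup>2) <= (N2 R)\<^sup>2" using a1[of n] zero_le_power2[of "N2 (E (q 0) R)"] by linarith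
   then show "sqrt (\<Sum>i<n. (N2 (D i R))\<^sup>2) <= N2 R" by (intro real_le_lsqrt) auto
   have "(\<Sum>i<n. (N2 (%x. g i x*D i h x))\<^sup>2) <= (LBINT x. (g (n - 1) x)\<^sup>2*(E (q n) h x)\<^sup>2)"
    using carl[of n] by (simp add: N2_power2 power_mult_distrib)
   also have "... <= (LBINT x. (g (n - 1) x)\<^sup>2)"
   proof (rule integral_mono)
    fix x
    have "abs (E (q n) h x) <= 1" by (rule E_bounded[OF h h1])
    then have "(E (q n) h x)\<^sup>2 <= 1" by (simp add: abs_square_le_1)
    then show "(g (n - 1) x)\<^sup>2*(E (q n) h x)\<^sup>2 <= (g (n - 1) x)\<^sup>2" by (simp add: mult_left_le)
   qed (intro bcs_integrable bcs_times bcs_power2 gb E_bcs h)+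
   also have "... <= (2*N2 F)\<^sup>2" unfolding N2_power2[symmetric] by (intro power_mono gN) simp
   finally show "sqrt (\<Sum>i<n. (N2 (%x. g i x*D i h x))\<^sup>2) <= 2*N2 F" by (intro real_le_lsqrt) auto
  qed (auto intro!: sum_nonneg)
  finally show "(LBINT x. (\<Sum>i<n. E (r i) F x*(E (q (Suc i)) R x - E (q i) R x))*h x) <= 2*N2 F*N2 R"
   by (simp add: f_def D_def mult_ac)
 qed
qed

section \<open>Paraproducts for families that are almost martingale differences\<close>

lemma geo_mean_bound:
 fixes A :: real
 assumes "X <= A*2 powr (- u)" "X <= A*2 powr (- v)" "0 <= A" shows "X <= A*2 powr (- (u + v)/2)"
proof (cases "u >= v")
 case True
 then have "A*2 powr (- u) <= A*2 powr (- (u + v)/2)" using assms(3) by (intro mult_left_mono powr_mono) auto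
 then show ?thesis using assms by linarith
next
 case False
 then have "A*2 powr (- v) <= A*2 powr (- (u + v)/2)" using assms(3) by (intro mult_left_mono powr_mono) auto
 then show ?thesis using assms by linarith
qed

lemma abel_sum:
 fixes a e :: "nat => real"
 shows "(\<Sum>i<n. a i*(e (Suc i) - e i)) = a n*e n - a 0*e 0 - (\<Sum>i<n. e (Suc i)*(a (Suc i) - a i))"
 by (induction n) (auto simp: algebra_simps)

text \<open>What differences of averages at scale \<open>2 powr (- q i)\<close> have in common with
  martingale differences at level \<open>q i\<close>. \<open>Q2\<close> says that smooth input is
  nearly annihilated, \<open>Q3\<close> that rapidly oscillating input is; \<open>Q4\<close> says
  that the output is smooth at finer scales and \<open>Q5\<close> that it has nearly no coarse
  component. The rate 1/2 is that of translating step functions, the rate 1 that of the smooth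
  weight.\<close>

locale Qfam =
 fixes Q :: "nat => (real => real) => real => real" and q :: "nat => int" and C :: real
 assumes C: "0 <= C" and q: "strict_mono q"
  and Qb: "bcs F ==> bcs (Q i F)"
  and Qadd: "bcs F ==> bcs G ==> Q i (%x. F x + G x) x = Q i F x + Q i G x"
  and Q1: "bcs F ==> N2 (Q i F) <= C*N2 F"
  and Q2: "bcs F ==> E k F = F ==> N2 (Q i F) <= C*2 powr (of_int (k - q i)/2)*N2 F"
  and Q3: "bcs F ==> (\<And>x. E k F x = 0) ==> N2 (Q i F) <= C*2 powr (of_int (q i - k))*N2 F"
  and Q4: "bcs F ==> N2 (%x. Q i F x - E k (Q i F) x) <= C*2 powr (of_int (q i - k))*N2 F"
  and Q5: "bcs F ==> N2 (E k (Q i F)) <= C*2 powr (of_int (k - q i)/2)*N2 F"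
begin

lemma decay_step: assumes "N >= (0::real)"
 shows "k < q i ==> C*2 powr (of_int (k + 1 - q i)/2)*N <= 2*C*N*2 powr (- (of_int (abs (k - q i))/2))"
  and "\<not> k < q i ==> C*2 powr (of_int (q i - k))*N <= 2*C*N*2 powr (- (of_int (abs (k - q i))/2))"
proof -
 have "2 powr (of_int (k + 1 - q i)/2) <= (2::real) powr (1 + - (of_int (abs (k - q i))/2))" if "k < q i"
  using that by (intro powr_mono) (auto simp: field_simps)
 then have "2 powr (of_int (k + 1 - q i)/2) <= 2*2 powr (- (real_of_int (abs (k - q i))/2))" if "k < q i"
  using that by (simp add: powr_add powr_diff powr_minus_divide)
 then show "k < q i ==> C*2 powr (of_int (k + 1 - q i)/2)*N <= 2*C*N*2 powr (- (of_int (abs (k - q i))/2))"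
  using mult_left_mono[of _ _ "C*N"] C assms by (force simp: mult_ac)
 have "2 powr (of_int (q i - k)) <= (2::real) powr (1 + - (of_int (abs (k - q i))/2))" if "\<not> k < q i"
  using that by (intro powr_mono) (auto simp: field_simps)
 then have "2 powr (of_int (q i - k)) <= 2*2 powr (- (real_of_int (abs (k - q i))/2))" if "\<not> k < q i"
  using that by (simp add: powr_add powr_diff powr_minus_divide)
 then show "\<not> k < q i ==> C*2 powr (of_int (q i - k))*N <= 2*C*N*2 powr (- (of_int (abs (k - q i))/2))"
  using mult_left_mono[of _ _ "C*N"] C assms by (force simp: mult_ac)
qed

lemma Q_cls: assumes "cls k F" shows "N2 (Q i F) <= 2*C*N2 F*2 powr (- (of_int (abs (k - q i))/2))"
proof (cases "k < q i")
 case True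
 then show ?thesis using Q2[of F "k + 1" i] decay_step(1)[OF N2_nonneg True, of F] assms by (simp add: cls_def)
next
 case False
 then show ?thesis using Q3[of F k i] decay_step(2)[OF N2_nonneg False, of F] assms by (simp add: cls_def)
qed

lemma Q_cls_dual:
 assumes F: "bcs F" and h: "cls k h"
 shows "abs (LBINT x. Q i F x*h x) <= 2*C*(N2 F*N2 h)*2 powr (- (of_int (abs (k - q i))/2))"
proof -
 have hb: "bcs h" "E (k + 1) h = h" "\<And>x. E k h x = 0" using h by (auto simp: cls_def)
 note QF = Qb[OF F, of i]
 show ?thesis
 proof (cases "k < q i")
  case True
  have "(LBINT x. Q i F x*h x) = (LBINT x. E (k + 1) (Q i F) x*h x)" using E_selfadj[OF QF hb(1)] by (simp add: hb(2))
  then have "abs (LBINT x. Q i F x*h x) <= N2 (E (k + 1) (Q i F))*N2 h" using bcs_CS_abs[OF E_bcs[OF QF] hb(1)] by simp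
  also have "... <= C*2 powr (of_int (k + 1 - q i)/2)*N2 F*N2 h" by (intro mult_right_mono Q5 F) simp
  finally show ?thesis using decay_step(1)[of "N2 F*N2 h", OF _ True] by (simp add: mult.assoc)
 next
  case False
  have "(LBINT x. E k (Q i F) x*h x) = 0" using E_selfadj[OF QF hb(1)] hb(3) by simp
  then have "(LBINT x. Q i F x*h x) = (LBINT x. (Q i F x - E k (Q i F) x)*h x)"
   by (simp add: left_diff_distrib bcs_integrable bcs_times QF hb(1) E_bcs)
  then have "abs (LBINT x. Q i F x*h x) <= N2 (%x. Q i F x - E k (Q i F) x)*N2 h"
   using bcs_CS_abs[OF bcs_diff[OF QF E_bcs[OF QF]] hb(1)] by simp
  also have "... <= C*2 powr (of_int (q i - k))*N2 F*N2 h" by (intro mult_right_mono Q4 F) simp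
  finally show ?thesis using decay_step(2)[of "N2 F*N2 h", OF _ False] by (simp add: mult.assoc)
 qed
qed

definition R :: "nat => (real => real) => real => real" where "R n F x = (\<Sum>i<n. Q i F x)"

lemma R_bcs: "bcs F ==> bcs (R n F)" unfolding R_def[abs_def] by (intro bcs_sum Qb)

text \<open>Cotlar-type orthogonality in bilinear form. The decay of \<open>Q i f\<close> in the
  level of \<open>f\<close> comes from \<open>Q_cls\<close>, that in the level of the test function
  from \<open>Q_cls_dual\<close>; their geometric mean decays in both. A general \<open>h\<close> is
  first replaced by its average at level \<open>m\<close>, the error being controlled by smoothness
  of the output and vanishing in the limit.\<close>

lemma R_bound:
 assumes G: "bcs G" "E K G = G" shows "N2 (R n G) <= 2*C*(Wc (1/4))\<^sup>2*N2 G"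
proof (rule N2_dual[OF R_bcs[OF G(1)]])
 fix h :: "real => real" assume h: "bcs h"
 define err where "err m = (\<Sum>i<n. C*(2 powr of_int (q i)*(1/2)^m)*N2 G*N2 h)" for m :: nat
 have "err \<longlonglongrightarrow> (\<Sum>i<n. C*(2 powr of_int (q i)*0)*N2 G*N2 h)"
  unfolding err_def by (intro tendsto_intros LIMSEQ_realpow_zero) auto
 then have lim: "(%m. err m + 2*C*(Wc (1/4))\<^sup>2*N2 G*N2 h) \<longlonglongrightarrow> 0 + 2*C*(Wc (1/4))\<^sup>2*N2 G*N2 h"
  by (intro tendsto_add tendsto_const) simp
 have bound: "(LBINT x. R n G x*h x) <= err m + 2*C*(Wc (1/4))\<^sup>2*N2 G*N2 h" for m
 proof -
  define g where "g = E (int m) h"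
  have g: "bcs g" unfolding g_def by (rule E_bcs[OF h])
  have each: "(LBINT x. Q i G x*h x) <= C*(2 powr of_int (q i)*(1/2)^m)*N2 G*N2 h + abs (LBINT x. Q i G x*g x)" for i
  proof -
   note QG = Qb[OF G(1), of i]
   have "(LBINT x. Q i G x*h x) = (LBINT x. (Q i G x - E (int m) (Q i G) x)*h x) + (LBINT x. Q i G x*g x)"
    unfolding g_def E_selfadj[OF QG h, symmetric] left_diff_distrib by (simp add: bcs_integrable bcs_times QG h E_bcs)
   moreover have "(LBINT x. (Q i G x - E (int m) (Q i G) x)*h x) <= N2 (%x. Q i G x - E (int m) (Q i G) x)*N2 h"
    by (intro bcs_Cauchy_Schwarz bcs_diff QG E_bcs h)
   moreover have "N2 (%x. Q i G x - E (int m) (Q i G) x)*N2 h <= C*2 powr (of_int (q i - int m))*N2 G*N2 h"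
    by (intro mult_right_mono Q4 G) simp
   moreover have "2 powr (of_int (q i - int m)) = 2 powr of_int (q i)*(1/2::real)^m"
    by (simp add: powr_diff powr_realpow power_one_over field_simps)
   ultimately show ?thesis using abs_ge_self[of "LBINT x. Q i G x*g x"] by simp
  qed
  have qi: "inj_on q {..<n}" using strict_mono_imp_inj_on[OF q] inj_on_subset by blast
  have exp: "(\<Sum>i<n. abs (LBINT x. Q i G x*g x)) <= 2*C*(Wc (1/4))\<^sup>2*N2 G*N2 g"
  \<comment> \<open>The expansion asks for one common level at which both functions are step
    functions; \<open>G\<close> has level \<open>K\<close>, the averaged test function has level
    \<open>m\<close>.\<close>
  proof (rule bilinear_expansion[where p = q and q = q and K = "max K (int m)" and B = C])
   show "E (max K (int m)) G = G" using E_E_fine[of K "max K (int m)" G] G by simp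
   show "E (max K (int m)) g = g" unfolding g_def by (rule E_E_fine) simp
   fix i and f g h :: "real => real" assume b: "bcs f" "bcs g"
   show "abs (LBINT x. Q i f x*g x) <= C*N2 f*N2 g"
    using bcs_CS_abs[OF Qb[OF b(1)] b(2), of i] mult_right_mono[OF Q1[OF b(1), of i] N2_nonneg[of g]] by simp
   assume h: "bcs h"
   have "(LBINT x. Q i (%x. f x + g x) x*h x) = (LBINT x. Q i f x*h x) + (LBINT x. Q i g x*h x)"
    by (simp add: Qadd b distrib_right bcs_integrable bcs_times Qb h)
   then show "abs (LBINT x. Q i (%x. f x + g x) x*h x) <= abs (LBINT x. Q i f x*h x) + abs (LBINT x. Q i g x*h x)" by simp
   have "(LBINT x. Q i h x*(f x + g x)) = (LBINT x. Q i h x*f x) + (LBINT x. Q i h x*g x)"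
    by (simp add: b distrib_left bcs_integrable bcs_times Qb h)
   then show "abs (LBINT x. Q i h x*(f x + g x)) <= abs (LBINT x. Q i h x*f x) + abs (LBINT x. Q i h x*g x)" by simp
  next
   fix i k j f g assume c: "cls k f" "cls j g"
   then have b: "bcs f" "bcs g" by (auto simp: cls_def)
   have "abs (LBINT x. Q i f x*g x) <= 2*C*(N2 f*N2 g)*2 powr (- (of_int (abs (k - q i))/2 + of_int (abs (j - q i))/2)/2)"
   proof (rule geo_mean_bound)
    show "abs (LBINT x. Q i f x*g x) <= 2*C*(N2 f*N2 g)*2 powr (- (of_int (abs (k - q i))/2))"
     using bcs_CS_abs[OF Qb[OF b(1)] b(2), of i] mult_right_mono[OF Q_cls[OF c(1), of i] N2_nonneg[of g]] by (simp add: mult_ac)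
   qed (use Q_cls_dual[OF b(1) c(2)] C in auto)
   moreover have "2 powr (- (of_int (abs (k - q i))/2 + of_int (abs (j - q i))/2)/2) = 2 powr (- (1/4) * of_int (abs (k - q i)))*(2::real) powr (- (1/4) * of_int (abs (j - q i)))"
    unfolding powr_add[symmetric] by (rule arg_cong[where f = "%x. 2 powr x"]) (simp add: add_divide_distrib diff_divide_distrib)
   ultimately show "abs (LBINT x. Q i f x*g x) <= 2*C*2 powr (- (1/4) * of_int (abs (k - q i)))*2 powr (- (1/4) * of_int (abs (j - q i)))*N2 f*N2 g"
    by (simp only: mult_ac)
  qed (use C G g qi in auto)
  have "(LBINT x. R n G x*h x) = (\<Sum>i<n. LBINT x. Q i G x*h x)"
   unfolding R_def sum_distrib_right by (intro Bochner_Integration.integral_sum bcs_integrable bcs_times Qb G h)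
  also have "... <= err m + (\<Sum>i<n. abs (LBINT x. Q i G x*g x))"
   unfolding err_def sum.distrib[symmetric] by (rule sum_mono) (rule each)
  also have "... <= err m + 2*C*(Wc (1/4))\<^sup>2*N2 G*N2 g" using exp by simp
  also have "... <= err m + 2*C*(Wc (1/4))\<^sup>2*N2 G*N2 h"
   using N2_E[OF h, of "int m"] C by (simp add: g_def mult_left_mono)
  finally show ?thesis .
 qed
 have "(LBINT x. R n G x*h x) <= 0 + 2*C*(Wc (1/4))\<^sup>2*N2 G*N2 h" by (rule LIMSEQ_le_const[OF lim]) (use bound in blast)
 then show "(LBINT x. R n G x*h x) <= 2*C*(Wc (1/4))\<^sup>2*N2 G*N2 h" by simp
qed (use C in simp)

text \<open>The partial sum up to \<open>i\<close> is compared with the martingale of the full sum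
  stopped at level \<open>q i\<close>. In the decomposition into \<open>tm\<close>, a term with
  \<open>j < i\<close> is what \<open>Q j F\<close> loses by averaging, small by \<open>Q4\<close>;
  one with \<open>j >= i\<close> is what survives of it, small by \<open>Q5\<close>.\<close>

definition er :: "nat => nat => (real => real) => real => real" where
 "er n i F x = R i F x - E (q i) (R n F) x"

definition tm :: "nat => nat => (real => real) => real => real" where
 "tm i j F x = (if j < i then Q j F x else 0) - E (q i) (Q j F) x"

lemma tm_bcs: "bcs F ==> bcs (tm i j F)"
 unfolding tm_def[abs_def] by (cases "j < i") (auto intro!: bcs_diff bcs_uminus Qb E_bcs)

lemma er_bcs: "bcs F ==> bcs (er n i F)" unfolding er_def[abs_def] by (intro bcs_diff R_bcs E_bcs)

lemma er_tm: assumes "bcs F" "i <= n" shows "er n i F = (%x. \<Sum>j<n. tm i j F x)"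
proof
 fix x
 have "{..<n} \<inter> {j. j < i} = {..<i}" using assms(2) by auto
 then have "(\<Sum>j<n. if j < i then Q j F x else 0) = R i F x" by (simp add: sum.If_cases R_def)
 moreover have "E (q i) (R n F) x = (\<Sum>j<n. E (q i) (Q j F) x)" unfolding R_def[abs_def] by (intro E_sum Qb assms)
 ultimately show "er n i F x = (\<Sum>j<n. tm i j F x)" by (simp add: er_def tm_def sum_subtractf)
qed

lemma tm_triv: assumes "bcs F" shows "N2 (tm i j F) <= 2*N2 (Q j F)"
proof (cases "j < i")
 case True
 then show ?thesis unfolding tm_def[abs_def] using N2_triangle_diff[OF Qb[OF assms] E_bcs[OF Qb[OF assms]], of j "q i" j] N2_E[OF Qb[OF assms], of "q i" j] by simp
next
 case False
 have "N2 (%x. - E (q i) (Q j F) x) = N2 (E (q i) (Q j F))" using N2_cmult[of "-1" "E (q i) (Q j F)"] by simp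
 then show ?thesis unfolding tm_def[abs_def] using False N2_E[OF Qb[OF assms], of "q i" j] N2_nonneg[of "Q j F"] by (simp del: N2_nonneg)
qed

lemma tm_far: assumes "bcs F" shows "N2 (tm i j F) <= C*N2 F*2 powr (- (of_int (abs (q i - q j))/2))"
proof (cases "j < i")
 case True
 then have "q j < q i" using q by (simp add: strict_mono_def)
 then have "C*2 powr (of_int (q j - q i))*N2 F <= C*2 powr (- (of_int (abs (q i - q j))/2))*N2 F"
  using C by (intro mult_right_mono mult_left_mono powr_mono) (auto simp: field_simps)
 then show ?thesis unfolding tm_def[abs_def] using True Q4[OF assms, of j "q i"] by (simp add: mult_ac)
next
 case False
 then have "q i <= q j" using strict_mono_less_eq[OF q] by simp
 then have e: "real_of_int (q i - q j)/2 = - (of_int (abs (q i - q j))/2)" by (simp add: field_simps)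
 have "N2 (%x. - E (q i) (Q j F) x) = N2 (E (q i) (Q j F))" using N2_cmult[of "-1" "E (q i) (Q j F)"] by simp
 then show ?thesis unfolding tm_def[abs_def] using False Q5[OF assms, of "q i" j] unfolding e by (simp add: mult_ac)
qed

text \<open>Each term has one bound in \<open>abs (k - q j)\<close> and one in
  \<open>abs (q i - q j)\<close>. In their geometric mean the triangle inequality trades part of the
  decay for decay in \<open>abs (k - q i)\<close>, with enough left to sum over
  \<open>j\<close>.\<close>

lemma er_cls:
 assumes F: "cls k F" and i: "i <= n"
 shows "N2 (er n i F) <= 4*C*Wc (1/8)*2 powr (- (1/8) * of_int (abs (k - q i)))*N2 F"
proof -
 have b: "bcs F" using F by (simp add: cls_def)
 have each: "N2 (tm i j F) <= 4*C*N2 F*2 powr (- (1/8) * of_int (abs (k - q i)))*2 powr (- (1/8) * of_int (abs (q i - q j)))" for j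
 proof -
  have "N2 (tm i j F) <= 4*C*N2 F*2 powr (- (of_int (abs (k - q j))/2 + of_int (abs (q i - q j))/2)/2)"
  proof (rule geo_mean_bound)
   show "N2 (tm i j F) <= 4*C*N2 F*2 powr (- (of_int (abs (k - q j))/2))" using tm_triv[OF b, of i j] Q_cls[OF F, of j] by simp
   have "C*N2 F*2 powr (- (of_int (abs (q i - q j))/2)) <= 4*C*N2 F*2 powr (- (of_int (abs (q i - q j))/2))"
    using C by (intro mult_right_mono) auto
   then show "N2 (tm i j F) <= 4*C*N2 F*2 powr (- (of_int (abs (q i - q j))/2))" using tm_far[OF b, of i j] by linarith
  qed (use C in auto)
  also have "... <= 4*C*N2 F*2 powr (- (1/8) * of_int (abs (k - q i)) + - (1/8) * of_int (abs (q i - q j)))"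
  proof (intro mult_left_mono powr_mono)
   have aux: "- (a/2 + b/2)/2 <= - (1/8)*c + - (1/8)*b" if "c <= a + b" "0 <= a" for a b c :: real
    using that by (simp add: field_simps)
   have "real_of_int (abs (k - q i)) <= of_int (abs (k - q j)) + of_int (abs (q i - q j))" by linarith
   then show "- (real_of_int (abs (k - q j))/2 + of_int (abs (q i - q j))/2)/2 <= - (1/8) * of_int (abs (k - q i)) + - (1/8) * of_int (abs (q i - q j))"
    by (rule aux) simp
  qed (use C in auto)
  finally show ?thesis by (simp only: powr_add mult.assoc)
 qed
 have "N2 (er n i F) <= (\<Sum>j<n. N2 (tm i j F))" unfolding er_tm[OF b i] by (intro N2_sum tm_bcs b)
 also have "... <= (\<Sum>j<n. 4*C*N2 F*2 powr (- (1/8) * of_int (abs (k - q i)))*2 powr (- (1/8) * of_int (abs (q i - q j))))"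
  by (intro sum_mono each)
 also have "... = 4*C*N2 F*2 powr (- (1/8) * of_int (abs (k - q i)))*(\<Sum>j<n. 2 powr (- (1/8) * of_int (abs (q i - q j))))"
  by (simp add: sum_distrib_left)
 also have "... <= 4*C*N2 F*2 powr (- (1/8) * of_int (abs (k - q i)))*Wc (1/8)"
  using C strict_mono_imp_inj_on[OF q] inj_on_subset by (intro mult_left_mono Wc_sum_inj) auto
 finally show ?thesis by (simp add: mult_ac)
qed

lemma er_triv: assumes "bcs F" "i <= n" shows "N2 (er n i F) <= (2*real n*C)*N2 F"
proof -
 have "N2 (er n i F) <= (\<Sum>j<n. N2 (tm i j F))" unfolding er_tm[OF assms] by (intro N2_sum tm_bcs assms)
 also have "... <= (\<Sum>j<n. 2*(C*N2 F))"
 proof (rule sum_mono)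
  fix j show "N2 (tm i j F) <= 2*(C*N2 F)" using tm_triv[OF assms(1), of i j] Q1[OF assms(1), of j] by simp
 qed
 finally show ?thesis by (simp add: mult_ac)
qed

definition Ce :: real where "Ce = 4*C*(Wc (1/8))\<^sup>2"

lemma Ce_nonneg: "0 <= Ce" using C by (simp add: Ce_def)

text \<open>Although quadratic, the sum is treated as the bilinear functional
  \<open>N2 (er n i f)*N2 (er n i g)\<close> with both arguments equal to \<open>G\<close>, so that
  \<open>bilinear_expansion\<close> gives the square function estimate.\<close>

lemma er_square:
 assumes G: "bcs G" "E K G = G" shows "(\<Sum>i\<le>n. (N2 (er n i G))\<^sup>2) <= (Ce*N2 G)\<^sup>2"
proof -
 have W0: "0 <= Wc (1/8)" using Wc_pos[of "1/8"] by simp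
 have add: "N2 (er n i (%x. f x + g x)) <= N2 (er n i f) + N2 (er n i g)" if "bcs f" "bcs g" for i f g
 proof -
  have Ra: "R m (%x. f x + g x) = (%x. R m f x + R m g x)" for m by (simp add: fun_eq_iff R_def Qadd that sum.distrib)
  have "er n i (%x. f x + g x) = (%x. er n i f x + er n i g x)"
   by (simp add: fun_eq_iff er_def Ra E_add R_bcs that)
  then show ?thesis using N2_triangle[OF er_bcs[OF that(1)] er_bcs[OF that(2)]] by simp
 qed
 have "(\<Sum>i\<in>{..n}. N2 (er n i G)*N2 (er n i G)) <= (4*C*Wc (1/8))\<^sup>2*(Wc (1/8))\<^sup>2*N2 G*N2 G"
 proof (rule bilinear_expansion[where X = "%i f g. N2 (er n i f)*N2 (er n i g)" and p = q and q = q and B = "(2*real n*C)\<^sup>2"])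
  fix i and f g h :: "real => real" assume i: "i \<in> {..n}" and b: "bcs f" "bcs g"
  have "N2 (er n i f)*N2 (er n i g) <= ((2*real n*C)*N2 f)*((2*real n*C)*N2 g)"
   using C i by (intro mult_mono er_triv b) auto
  then show "N2 (er n i f)*N2 (er n i g) <= (2*real n*C)\<^sup>2*N2 f*N2 g" by (simp add: power2_eq_square mult_ac)
  show "N2 (er n i (%x. f x + g x))*N2 (er n i h) <= N2 (er n i f)*N2 (er n i h) + N2 (er n i g)*N2 (er n i h)"
   using mult_right_mono[OF add[OF b] N2_nonneg] by (simp add: distrib_right)
  show "N2 (er n i h)*N2 (er n i (%x. f x + g x)) <= N2 (er n i h)*N2 (er n i f) + N2 (er n i h)*N2 (er n i g)"
   using mult_left_mono[OF add[OF b] N2_nonneg] by (simp add: distrib_left)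
 next
  fix i k j f g assume i: "i \<in> {..n}" and c: "cls k f" "cls j g"
  have "N2 (er n i f)*N2 (er n i g) <= (4*C*Wc (1/8)*2 powr (- (1/8) * of_int (abs (k - q i)))*N2 f)*(4*C*Wc (1/8)*2 powr (- (1/8) * of_int (abs (j - q i)))*N2 g)"
   using i C W0 by (intro mult_mono er_cls c) auto
  then show "N2 (er n i f)*N2 (er n i g) <= (4*C*Wc (1/8))\<^sup>2*2 powr (- (1/8) * of_int (abs (k - q i)))*2 powr (- (1/8) * of_int (abs (j - q i)))*N2 f*N2 g"
   by (simp only: power2_eq_square mult_ac)
 qed (use G inj_on_subset[OF strict_mono_imp_inj_on[OF q]] in auto)
 then show ?thesis by (simp add: Ce_def power2_eq_square mult_ac)
qed

lemma er_single: assumes "bcs G" "E K G = G" "i <= n" shows "N2 (er n i G) <= Ce*N2 G"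
proof -
 have "(N2 (er n i G))\<^sup>2 <= (\<Sum>i\<le>n. (N2 (er n i G))\<^sup>2)" using assms(3) by (intro member_le_sum) auto
 then have "(N2 (er n i G))\<^sup>2 <= (Ce*N2 G)\<^sup>2" using er_square[OF assms(1,2), of n] by linarith
 then show ?thesis by (rule power2_le_imp_le) (use Ce_nonneg in simp)
qed

lemma boundary_L1:
 assumes "bcs a" "bcs b" "bcs c" "bcs d" "bcs s"
  and "N2 a <= A" "N2 c <= A" "N2 b <= B" "N2 d <= B" "(LBINT x. abs (s x)) <= S"
 shows "(LBINT x. abs (a x*b x - c x*d x - s x)) <= 2*(A*B) + S"
proof -
 have "(LBINT x. abs (a x*b x - c x*d x - s x)) <= (LBINT x. abs (a x*b x) + abs (c x*d x) + abs (s x))"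
  by (intro integral_mono bcs_integrable bcs_abs bcs_diff bcs_add bcs_times assms) linarith
 also have "... = (LBINT x. abs (a x*b x)) + (LBINT x. abs (c x*d x)) + (LBINT x. abs (s x))"
  by (simp add: bcs_integrable bcs_abs bcs_times assms)
 also have "... <= N2 a*N2 b + N2 c*N2 d + S"
  by (intro add_mono bcs_Cauchy_Schwarz_abs assms)
 also have "... <= A*B + A*B + S"
  using N2_nonneg_le[OF assms(6)] by (intro add_mono mult_mono assms) auto
 finally show ?thesis by simp
qed

text \<open>Summation by parts moves the differences onto the martingale of \<open>F\<close>, where
  they are square summable by \<open>pythagoras\<close>, while the errors are square summable by
  \<open>er_square\<close>. The constant 3 is this sum plus two boundary terms.\<close>

lemma error_part:
 assumes F: "bcs F" and G: "bcs G" "E K G = G" and r: "mono r"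
 shows "(LBINT x. abs (\<Sum>i<n. E (r i) F x*(er n (Suc i) G x - er n i G x))) <= 3*Ce*N2 F*N2 G"
proof -
 have rs: "r i <= r (Suc i)" for i using r by (simp add: mono_def)
 define D where "D i x = E (r (Suc i)) F x - E (r i) F x" for i x
 have Db: "bcs (D i)" for i unfolding D_def[abs_def] by (intro bcs_diff E_bcs F)
 have a1: "(\<Sum>i<m. (N2 (D i))\<^sup>2) = (N2 (E (r m) F))\<^sup>2 - (N2 (E (r 0) F))\<^sup>2" for m
  by (induction m) (auto simp: D_def[abs_def] pythagoras[OF F rs])
 have "(N2 (E (r n) F))\<^sup>2 <= (N2 F)\<^sup>2" by (intro power_mono N2_E F) simp
 then have sF: "(\<Sum>i<n. (N2 (D i))\<^sup>2) <= (N2 F)\<^sup>2" using a1[of n] zero_le_power2[of "N2 (E (r 0) F)"] by linarith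
 have sG: "(\<Sum>i<n. (N2 (er n (Suc i) G))\<^sup>2) <= (Ce*N2 G)\<^sup>2"
 proof -
  have "(\<Sum>i<n. (N2 (er n (Suc i) G))\<^sup>2) = (\<Sum>i\<in>Suc ` {..<n}. (N2 (er n i G))\<^sup>2)" by (simp add: sum.reindex)
  also have "... <= (\<Sum>i\<le>n. (N2 (er n i G))\<^sup>2)" by (rule sum_mono2) auto
  finally show ?thesis using er_square[OF G, of n] by linarith
 qed
 have "(LBINT x. abs (\<Sum>i<n. er n (Suc i) G x*D i x)) <= (\<Sum>i<n. LBINT x. abs (er n (Suc i) G x*D i x))"
  by (intro L1_sum bcs_times er_bcs G Db)
 also have "... <= (\<Sum>i<n. N2 (er n (Suc i) G)*N2 (D i))" by (intro sum_mono bcs_Cauchy_Schwarz_abs er_bcs G Db)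
 also have "... <= sqrt (\<Sum>i<n. (N2 (er n (Suc i) G))\<^sup>2) * sqrt (\<Sum>i<n. (N2 (D i))\<^sup>2)" by (rule sum_CS)
 also have "... <= (Ce*N2 G)*N2 F"
  using sF sG Ce_nonneg by (intro mult_mono real_le_lsqrt) (auto intro!: sum_nonneg)
 finally have S: "(LBINT x. abs (\<Sum>i<n. er n (Suc i) G x*D i x)) <= (Ce*N2 G)*N2 F" .
 have "(LBINT x. abs (E (r n) F x*er n n G x - E (r 0) F x*er n 0 G x - (\<Sum>i<n. er n (Suc i) G x*D i x))) <= 2*(N2 F*(Ce*N2 G)) + (Ce*N2 G)*N2 F"
  by (rule boundary_L1[OF _ _ _ _ _ _ _ _ _ S]) (auto intro!: E_bcs er_bcs F G bcs_sum bcs_times Db N2_E er_single)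
 then show ?thesis using abel_sum[of "%i. E (r i) F x" "%i. er n i G x" n for x] by (simp add: D_def mult_ac)
qed

definition CQ :: real where "CQ = 8*C*(Wc (1/4))\<^sup>2 + 3*Ce"

text \<open>Consecutive partial sums \<open>R i G\<close> differ by \<open>Q i G\<close>; writing
  each as the stopped martingale of \<open>R n G\<close> plus its error splits \<open>Q i G\<close>
  into a true martingale difference and a difference of errors.\<close>

lemma Q_split: "Q i G x = (E (q (Suc i)) (R n G) x - E (q i) (R n G) x) + (er n (Suc i) G x - er n i G x)"
 by (simp add: er_def R_def)

text \<open>The martingale part is left as a hypothesis because the two orderings of levels treat it
  differently; the constant 4 accommodates both. In \<open>CQ\<close> the first term is 4 times the
  constant of \<open>R_bound\<close>, the second comes from \<open>error_part\<close>.\<close>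

lemma paraproduct:
 assumes F: "bcs F" and G: "bcs G" "E K G = G" and r: "mono r"
  and main: "(LBINT x. abs (\<Sum>i<n. E (r i) F x*(E (q (Suc i)) (R n G) x - E (q i) (R n G) x))) <= 4*N2 F*N2 (R n G)"
 shows "(LBINT x. abs (\<Sum>i<n. E (r i) F x*Q i G x)) <= CQ*N2 F*N2 G"
proof -
 have "(LBINT x. abs ((\<Sum>i<n. E (r i) F x*(E (q (Suc i)) (R n G) x - E (q i) (R n G) x)) + (\<Sum>i<n. E (r i) F x*(er n (Suc i) G x - er n i G x))))
  <= (LBINT x. abs (\<Sum>i<n. E (r i) F x*(E (q (Suc i)) (R n G) x - E (q i) (R n G) x))) + (LBINT x. abs (\<Sum>i<n. E (r i) F x*(er n (Suc i) G x - er n i G x)))"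
  by (intro L1_triangle bcs_sum bcs_times bcs_diff E_bcs er_bcs R_bcs F G)
 also have "... <= 4*N2 F*(2*C*(Wc (1/4))\<^sup>2*N2 G) + 3*Ce*N2 F*N2 G"
  using error_part[OF F G r, of n] main mult_left_mono[OF R_bound[OF G, of n], of "4*N2 F"] N2_nonneg[of F] by linarith
 also have "... = CQ*N2 F*N2 G" by (simp add: CQ_def algebra_simps)
 finally show ?thesis unfolding sum.distrib[symmetric] distrib_left[symmetric] by (simp only: Q_split[of _ G _ n, symmetric])
qed

lemma q_mono: "mono q" using q by (rule strict_mono_mono)

lemma paraproduct_low:
 assumes F: "bcs F" and G: "bcs G" "E K G = G" and r: "mono r" "\<And>i. i < n ==> r i <= q i"
 shows "(LBINT x. abs (\<Sum>i<n. E (r i) F x*Q i G x)) <= CQ*N2 F*N2 G"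
proof (rule paraproduct[OF F G r(1)])
 have "2*N2 F*N2 (R n G) <= 4*N2 F*N2 (R n G)" by (intro mult_right_mono) auto
 then show "(LBINT x. abs (\<Sum>i<n. E (r i) F x*(E (q (Suc i)) (R n G) x - E (q i) (R n G) x))) <= 4*N2 F*N2 (R n G)"
  using martingale_paraproduct[OF F R_bcs[OF G(1), of n] r(1) q_mono r(2), of n] by linarith
qed

text \<open>When the averages of \<open>F\<close> are finer than the scale of \<open>Q i\<close>,
  summation by parts exchanges the roles: now \<open>R n G\<close> is averaged at the coarse levels
  \<open>q (Suc i)\<close> and \<open>F\<close> supplies the differences, which is again the
  situation of \<open>martingale_paraproduct\<close>.\<close>

lemma paraproduct_high:
 assumes F: "bcs F" and G: "bcs G" "E K G = G" and r: "mono r" "\<And>i. i < n ==> q (Suc i) <= r i"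
 shows "(LBINT x. abs (\<Sum>i<n. E (r i) F x*Q i G x)) <= CQ*N2 F*N2 G"
proof (rule paraproduct[OF F G r(1)])
 note Rb = R_bcs[OF G(1), of n]
 have "mono (%i. q (Suc i))" using q_mono by (simp add: mono_def)
 then have S: "(LBINT x. abs (\<Sum>i<n. E (q (Suc i)) (R n G) x*(E (r (Suc i)) F x - E (r i) F x))) <= 2*N2 (R n G)*N2 F"
  by (rule martingale_paraproduct[OF Rb F _ r(1)]) (use r(2) in auto)
 have "(LBINT x. abs (E (r n) F x*E (q n) (R n G) x - E (r 0) F x*E (q 0) (R n G) x - (\<Sum>i<n. E (q (Suc i)) (R n G) x*(E (r (Suc i)) F x - E (r i) F x))))
  <= 2*(N2 F*N2 (R n G)) + 2*N2 (R n G)*N2 F"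
  by (rule boundary_L1[OF _ _ _ _ _ _ _ _ _ S]) (auto intro!: E_bcs Rb F bcs_sum bcs_times bcs_diff N2_E)
 then show "(LBINT x. abs (\<Sum>i<n. E (r i) F x*(E (q (Suc i)) (R n G) x - E (q i) (R n G) x))) <= 4*N2 F*N2 (R n G)"
  using abel_sum[of "%i. E (r i) F x" "%i. E (q i) (R n G) x" n for x] by (simp add: mult_ac)
qed

end

section \<open>Summation over scales\<close>

definition Qop :: "real => real => real => real => (real => real) => real => real" where
 "Qop b kp l l' F x = Aop b kp l F x - Aop b kp l' F x"

lemma Qop_bcs: "b > 1 ==> kp > 0 ==> bcs F ==> bcs (Qop b kp l l' F)"
 unfolding Qop_def[abs_def] by (intro bcs_diff Aop_bcs)

text \<open>The two averages have equal total weight, so for each \<open>s\<close> only the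
  difference of two translates of \<open>F\<close> matters, by displacements of size comparable to
  \<open>2 powr (- q)\<close>; \<open>shift_step\<close> and Minkowski's inequality do the
  rest.\<close>

lemma Qop_step:
 assumes b: "b > 1" and kp: "kp > 0" and F: "bcs F" "E k F = F" and l: "abs l = 2 powr (- of_int q)" "abs l' = 2 powr (- of_int q)"
 shows "N2 (Qop b kp l l' F) <= 2*b * sqrt (2*b powr kp)*2 powr (of_int (k - q)/2)*N2 F"
proof -
 define B where "B = 2*(sqrt (2*b powr kp)*2 powr (of_int (k - q)/2))*N2 F"
 have B0: "0 <= B" by (simp add: B_def)
 have bcsk: "bcs (%(x, s). wgt b s*F (x - l * s powr kp) - wgt b s*F (x - l' * s powr kp))"
  using bcs_diff[OF Aop_kernel_bcs[OF b kp F(1)] Aop_kernel_bcs[OF b kp F(1)], of l l'] by (simp add: case_prod_unfold)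
 have "N2 (%x. LBINT s. (case (x, s) of (x, s) => wgt b s*F (x - l * s powr kp) - wgt b s*F (x - l' * s powr kp))) <= (LBINT s. wgt b s*B)"
 proof (rule N2_integral_le[OF bcsk bcs_multc[OF wgt_bcs]])
  fix s
  show "N2 (%x. case (x, s) of (x, s) => wgt b s*F (x - l * s powr kp) - wgt b s*F (x - l' * s powr kp)) <= wgt b s*B"
  proof (cases "wgt b s = 0")
   case False
   then have s: "s \<in> {1..b}" using wgt_bounds(4) by blast
   define y where "y = (l - l') * s powr kp"
   have "abs y <= (2*2 powr (- of_int q))*b powr kp"
    unfolding y_def abs_mult using s kp abs_triangle_ineq4[of l l'] l by (intro mult_mono) (auto intro: powr_mono2)
   then have "abs y*2 powr of_int k <= (2*b powr kp)*2 powr of_int (k - q)"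
    using mult_right_mono[of "abs y" _ "2 powr of_int k"] by (fastforce simp: powr_diff powr_minus_divide mult_ac)
   then have "sqrt (abs y*2 powr of_int k) <= sqrt (2*b powr kp)*2 powr (of_int (k - q)/2)"
    using real_sqrt_le_mono by (fastforce simp: real_sqrt_mult[symmetric] powr_half_sqrt_powr)
   then have "2 * sqrt (abs y*2 powr of_int k)*N2 F <= B" unfolding B_def by (intro mult_right_mono mult_left_mono) auto
   moreover have "N2 (%x. F (x - l * s powr kp) - F (x - l' * s powr kp)) = N2 (%x. F (x - y) - F x)"
    using N2_shift[of "%x. F (x - y) - F x" "l' * s powr kp"] by (simp add: y_def algebra_simps)
   ultimately have "N2 (%x. F (x - l * s powr kp) - F (x - l' * s powr kp)) <= B" using shift_step[OF F, of y] by simp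
   then show ?thesis using wgt_bounds(1)[of b s] N2_cmult[of "wgt b s" "%x. F (x - l * s powr kp) - F (x - l' * s powr kp)"]
    by (simp add: right_diff_distrib mult_left_mono)
  qed simp
 qed
 also have "... <= b*B" using wgt_integral[OF b] B0 by (simp add: mult_right_mono)
 finally show ?thesis unfolding Qop_def[abs_def] Aop_def B_def by (simp add: Aop_int b kp F mult_ac)
qed

lemma Qop_fam:
 assumes b: "b > 1" and kp: "kp > 0"
 shows "\<exists>C\<ge>0. \<forall>q l l'. strict_mono q --> (\<forall>i. abs (l i) = 2 powr (- of_int (q i)) & abs (l' i) = 2 powr (- of_int (q i))) -->
  Qfam (%i. Qop b kp (l i) (l' i)) q C"
proof -
 define c where "c = 2*((1/kp)*(b powr kp + 3))"
 define C2 where "C2 = 2*b * sqrt (2*b powr kp)"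
 define C where "C = 2*b + 2*c + C2"
 have pos: "0 <= c" "0 <= C2" using b kp by (auto simp: c_def C2_def)
 have C0: "0 <= C" "2*b <= C" "2*c <= C" "C2 <= C" using pos b by (auto simp: C_def)
 have "Qfam (%i. Qop b kp (l i) (l' i)) q C"
  if q: "strict_mono q" and l: "\<And>i. abs (l i) = 2 powr (- of_int (q i))" "\<And>i. abs (l' i) = 2 powr (- of_int (q i))" for q l l'
 proof
  note A = Aop_bcs[OF b kp] and Q = Qop_bcs[OF b kp]
  have l0: "l i ~= 0" "l' i ~= 0" for i using l[of i] by auto
  have rat: "2 powr (- of_int k)/abs (l i) = 2 powr of_int (q i - k)" "2 powr (- of_int k)/abs (l' i) = 2 powr of_int (q i - k)" for k i
   unfolding l by (simp_all add: powr_diff[symmetric])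
  show "0 <= C" "strict_mono q" by (fact C0 q)+
  fix F :: "real => real" and i assume F: "bcs F"
  show "bcs (Qop b kp (l i) (l' i) F)" by (rule Q[OF F])
  show "Qop b kp (l i) (l' i) (%x. F x + G x) x = Qop b kp (l i) (l' i) F x + Qop b kp (l i) (l' i) G x" if "bcs G" for G x
   by (simp add: Qop_def Aop_add b kp F that)
  have tri: "N2 (Qop b kp (l i) (l' i) F) <= N2 (Aop b kp (l i) F) + N2 (Aop b kp (l' i) F)"
   unfolding Qop_def[abs_def] by (intro N2_triangle_diff A F)
  have "2*b*N2 F <= C*N2 F" using C0 by (intro mult_right_mono) auto
  then show "N2 (Qop b kp (l i) (l' i) F) <= C*N2 F"
   using tri Aop_N2[OF b kp F, of "l i"] Aop_N2[OF b kp F, of "l' i"] by simp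
  fix k
  have m: "C2*2 powr (of_int (k - q i)/2)*N2 H <= C*2 powr (of_int (k - q i)/2)*N2 H" for H :: "real => real"
   using C0 by (intro mult_right_mono) auto
  show "N2 (Qop b kp (l i) (l' i) F) <= C*2 powr (of_int (k - q i)/2)*N2 F" if "E k F = F"
   using Qop_step[OF b kp F that l(1,2)[of i]] m[of F] unfolding C2_def by linarith
  have m3: "2*c*2 powr of_int (q i - k)*N2 F <= C*2 powr of_int (q i - k)*N2 F" using C0 by (intro mult_right_mono) auto
  show "N2 (Qop b kp (l i) (l' i) F) <= C*2 powr of_int (q i - k)*N2 F" if "\<And>x. E k F x = 0"
   using tri Aop_E_zero[OF b kp F l0(1) that, of i] Aop_E_zero[OF b kp F l0(2) that, of i] m3
   unfolding rat c_def[symmetric] by linarith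
  have "N2 (%x. (Aop b kp (l i) F x - E k (Aop b kp (l i) F) x) - (Aop b kp (l' i) F x - E k (Aop b kp (l' i) F) x))
   <= N2 (%x. Aop b kp (l i) F x - E k (Aop b kp (l i) F) x) + N2 (%x. Aop b kp (l' i) F x - E k (Aop b kp (l' i) F) x)"
   by (intro N2_triangle_diff bcs_diff A E_bcs F)
  then have "N2 (%x. Qop b kp (l i) (l' i) F x - E k (Qop b kp (l i) (l' i) F) x) <=
   N2 (%x. Aop b kp (l i) F x - E k (Aop b kp (l i) F) x) + N2 (%x. Aop b kp (l' i) F x - E k (Aop b kp (l' i) F) x)"
   unfolding Qop_def[abs_def] by (simp add: E_diff A F algebra_simps)
  then show "N2 (%x. Qop b kp (l i) (l' i) F x - E k (Qop b kp (l i) (l' i) F) x) <= C*2 powr of_int (q i - k)*N2 F"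
   using Aop_sub_E[OF b kp F l0(1), of i k] Aop_sub_E[OF b kp F l0(2), of i k] m3 unfolding rat c_def[symmetric] by linarith
  \<comment> \<open>By duality from \<open>Qop_step\<close>: the adjoint is the same operator with
    \<open>- l i\<close> and \<open>- l' i\<close>, and it acts on the step function
    \<open>E k h\<close>.\<close>
  show "N2 (E k (Qop b kp (l i) (l' i) F)) <= C*2 powr (of_int (k - q i)/2)*N2 F"
  proof (rule N2_dual[OF E_bcs[OF Q[OF F]]])
   fix h :: "real => real" assume h: "bcs h"
   have Eh: "bcs (E k h)" by (rule E_bcs[OF h])
   have "(LBINT x. E k (Qop b kp (l i) (l' i) F) x*h x) = (LBINT x. Qop b kp (l i) (l' i) F x*E k h x)" by (rule E_selfadj[OF Q[OF F] h])
   also have "... = (LBINT x. F x*Qop b kp (- l i) (- l' i) (E k h) x)"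
    unfolding Qop_def left_diff_distrib right_diff_distrib
    by (simp add: bcs_integrable bcs_times A F Eh Aop_adj[OF b kp F Eh])
   also have "... <= N2 F*N2 (Qop b kp (- l i) (- l' i) (E k h))" by (intro bcs_Cauchy_Schwarz F Q Eh)
   also have "... <= N2 F*(C*2 powr (of_int (k - q i)/2)*N2 (E k h))"
    by (intro mult_left_mono order_trans[OF Qop_step[OF b kp Eh E_idem] m[of "E k h", unfolded C2_def]]) (use l in auto)
   also have "... <= N2 F*(C*2 powr (of_int (k - q i)/2)*N2 h)"
    using C0 N2_E[OF h] by (intro mult_left_mono) auto
   finally show "(LBINT x. E k (Qop b kp (l i) (l' i) F) x*h x) <= C*2 powr (of_int (k - q i)/2)*N2 F*N2 h" by (simp add: mult_ac)
  qed (use C0 in auto)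
 qed
 then show ?thesis using C0(1) by blast
qed

lemma Err_add:
 assumes "b > 1" "kp > 0" "bcs F" "bcs F'" "bcs G"
 shows "Err b kp L l p q (%x. F x + F' x) G x = Err b kp L l p q F G x + Err b kp L l p q F' G x"
  "Err b kp L l p q G (%x. F x + F' x) x = Err b kp L l p q G F x + Err b kp L l p q G F' x"
proof -
 have int: "integrable lborel (%s. wgt b s*((H (x - L * s) - E p H x)*(K (x - l * s powr kp) - E q K x)))" if "bcs H" "bcs K" for H K
  using bcs_integrable[OF bcs_slice(1)[OF Err_kernel(1)[OF assms(1,2) that]]] by simp
 show "Err b kp L l p q (%x. F x + F' x) G x = Err b kp L l p q F G x + Err b kp L l p q F' G x"
  unfolding Err_def E_add[OF assms(3,4)]
  by (subst Bochner_Integration.integral_add[symmetric, OF int[OF assms(3,5)] int[OF assms(4,5)]]) (simp add: algebra_simps)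
 show "Err b kp L l p q G (%x. F x + F' x) x = Err b kp L l p q G F x + Err b kp L l p q G F' x"
  unfolding Err_def E_add[OF assms(3,4)]
  by (subst Bochner_Integration.integral_add[symmetric, OF int[OF assms(5,3)] int[OF assms(5,4)]]) (simp add: algebra_simps)
qed

lemma Err_sum:
 fixes kp b :: real
 assumes kp: "kp > 0" "kp ~= 1" and b: "b > 1"
 shows "\<exists>C>0. \<exists>c0::int. \<forall>(n::nat) p q L l F G K. strict_mono p --> strict_mono q -->
   (\<forall>i<n. abs (L i) = 2 powr (- of_int (p i)) & abs (l i) = 2 powr (- of_int (q i)) & q i - p i >= c0) -->
   bcs F --> bcs G --> E K F = F --> E K G = G -->
   (\<Sum>i<n. LBINT x. abs (Err b kp (L i) (l i) (p i) (q i) F G x)) <= C*N2 F*N2 G"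
proof -
 obtain C c0 where C: "C > 0" and dec: "\<And>p q k j L l F G. abs L = 2 powr (- of_int p) ==> abs l = 2 powr (- of_int q) ==> q - p >= c0 ==>
   bcs F ==> bcs G ==> E (k + 1) F = F ==> (\<forall>x. E k F x = 0) ==> E (j + 1) G = G ==> (\<forall>x. E j G x = 0) ==>
   (LBINT x. abs (Err b kp L l p q F G x)) <= C*2 powr (- of_int (abs (k - p) + abs (j - q))/200)*N2 F*N2 G"
  using Err_decay[OF kp b] by blast
 have main: "(\<Sum>i<n. LBINT x. abs (Err b kp (L i) (l i) (p i) (q i) F G x)) <= C*(Wc (1/200))\<^sup>2*N2 F*N2 G"
  if p: "strict_mono p" and q: "strict_mono q" and
   H: "\<And>i. i < n ==> abs (L i) = 2 powr (- of_int (p i)) & abs (l i) = 2 powr (- of_int (q i)) & q i - p i >= c0"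
   and F: "bcs F" "E K F = F" and G: "bcs G" "E K G = G" for n :: nat and p q L l F G K
 proof (rule bilinear_expansion[where p = p and q = q and K = K and B = "4*b"])
  show "inj_on p {..<n}" "inj_on q {..<n}" using strict_mono_imp_inj_on[OF p] strict_mono_imp_inj_on[OF q] inj_on_subset by blast+
  fix i and f g h :: "real => real" assume bb: "bcs f" "bcs g"
  show "(LBINT x. abs (Err b kp (L i) (l i) (p i) (q i) f g x)) <= 4*b*N2 f*N2 g" by (rule Err_trivial[OF b kp(1) bb])
  assume h: "bcs h"
  show "(LBINT x. abs (Err b kp (L i) (l i) (p i) (q i) (%x. f x + g x) h x)) <= (LBINT x. abs (Err b kp (L i) (l i) (p i) (q i) f h x)) + (LBINT x. abs (Err b kp (L i) (l i) (p i) (q i) g h x))"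
   unfolding Err_add[OF b kp(1) bb h] by (intro L1_triangle Err_bcs b kp bb h)
  show "(LBINT x. abs (Err b kp (L i) (l i) (p i) (q i) h (%x. f x + g x) x)) <= (LBINT x. abs (Err b kp (L i) (l i) (p i) (q i) h f x)) + (LBINT x. abs (Err b kp (L i) (l i) (p i) (q i) h g x))"
   unfolding Err_add[OF b kp(1) bb h] by (intro L1_triangle Err_bcs b kp bb h)
 next
  fix i k j f g assume i: "i \<in> {..<n}" and c: "cls k f" "cls j g"
  have e: "2 powr (- of_int (abs (k - p i) + abs (j - q i))/200) = 2 powr (- (1/200) * of_int (abs (k - p i)))*(2::real) powr (- (1/200) * of_int (abs (j - q i)))"
   unfolding powr_add[symmetric] by (rule arg_cong[where f = "%x. 2 powr x"]) (simp add: add_divide_distrib diff_divide_distrib)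
  have "(LBINT x. abs (Err b kp (L i) (l i) (p i) (q i) f g x)) <= C*2 powr (- of_int (abs (k - p i) + abs (j - q i))/200)*N2 f*N2 g"
   by (rule dec) (use H[of i] i c in \<open>auto simp: cls_def\<close>)
  then show "(LBINT x. abs (Err b kp (L i) (l i) (p i) (q i) f g x)) <= C*2 powr (- (1/200) * of_int (abs (k - p i)))*2 powr (- (1/200) * of_int (abs (j - q i)))*N2 f*N2 g"
   unfolding e by (simp only: mult.assoc)
 qed (use C b F G in auto)
 have "0 < C*(Wc (1/200))\<^sup>2" using C Wc_pos[of "1/200"] by simp
 then show ?thesis using main by blast
qed

text \<open>The primed displacements stand for the half with \<open>t < 0\<close>; only their sizes
  are prescribed, so signs such as \<open>(-1)^d\<close> need no separate treatment. The level
  \<open>K\<close> is arbitrary and does not affect \<open>C\<close>. The condition on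
  \<open>p (Suc i)\<close> is what \<open>paraproduct_high\<close> requires.\<close>

definition Sop_bounded :: "real => real => real => int => bool" where
 "Sop_bounded b kp C c0 \<longleftrightarrow> (\<forall>(n::nat) p q L L' l l' F G K. strict_mono p --> strict_mono q -->
   (\<forall>i. abs (L i) = 2 powr (- of_int (p i)) & abs (L' i) = 2 powr (- of_int (p i)) & abs (l i) = 2 powr (- of_int (q i)) & abs (l' i) = 2 powr (- of_int (q i))) -->
   (\<forall>i<n. q i - p i >= c0 & p i <= q i & p (Suc i) <= q i) -->
   bcs F --> bcs G --> E K F = F --> E K G = G -->
   (LBINT x. abs (\<Sum>i<n. Sop b kp (L i) (l i) F G x - Sop b kp (L' i) (l' i) F G x)) <= C*N2 F*N2 G)"

theorem Sop_sum:
 fixes kp b :: real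
 assumes kp: "kp > 0" "kp ~= 1" and b: "b > 1"
 shows "\<exists>C>0. \<exists>c0::int. Sop_bounded b kp C c0"
proof -
 obtain C c0 where C: "C > 0" and err: "\<And>(n::nat) p q L l F G K. strict_mono p ==> strict_mono q ==>
   (\<forall>i<n. abs (L i) = 2 powr (- of_int (p i)) & abs (l i) = 2 powr (- of_int (q i)) & q i - p i >= c0) ==>
   bcs F ==> bcs G ==> E K F = F ==> E K G = G ==>
   (\<Sum>i<n. LBINT x. abs (Err b kp (L i) (l i) (p i) (q i) F G x)) <= C*N2 F*N2 G"
  using Err_sum[OF kp b] by blast
 obtain C1 where C1: "C1 >= 0" "\<And>q l l'. strict_mono q ==> (\<forall>i. abs (l i) = 2 powr (- of_int (q i)) & abs (l' i) = 2 powr (- of_int (q i))) ==>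
  Qfam (%i. Qop b kp (l i) (l' i)) q C1" using Qop_fam[OF b kp(1)] by blast
 obtain C2 where C2: "C2 >= 0" "\<And>q l l'. strict_mono q ==> (\<forall>i. abs (l i) = 2 powr (- of_int (q i)) & abs (l' i) = 2 powr (- of_int (q i))) ==>
  Qfam (%i. Qop b 1 (l i) (l' i)) q C2" using Qop_fam[OF b zero_less_one] by blast
 define D where "D = 2*C + abs (Qfam.CQ C1) + abs (Qfam.CQ C2)"
 have main: "(LBINT x. abs (\<Sum>i<n. Sop b kp (L i) (l i) F G x - Sop b kp (L' i) (l' i) F G x)) <= D*N2 F*N2 G"
  if p: "strict_mono p" and q: "strict_mono q" and
   LL: "\<And>i. abs (L i) = 2 powr (- of_int (p i)) & abs (L' i) = 2 powr (- of_int (p i)) & abs (l i) = 2 powr (- of_int (q i)) & abs (l' i) = 2 powr (- of_int (q i))"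
   and H: "\<And>i. i < n ==> q i - p i >= c0 & p i <= q i & p (Suc i) <= q i"
   and F: "bcs F" "E K F = F" and G: "bcs G" "E K G = G" for n p q L L' l l' F G K
 proof -
  interpret A: Qfam "%i. Qop b kp (l i) (l' i)" q C1 by (rule C1(2)[OF q]) (use LL in blast)
  interpret B: Qfam "%i. Qop b 1 (L i) (L' i)" p C2 by (rule C2(2)[OF p]) (use LL in blast)
  define e e' where "e i = Err b kp (L i) (l i) (p i) (q i) F G" and "e' i = Err b kp (L' i) (l' i) (p i) (q i) F G" for i
  define P1 P2 where "P1 x = (\<Sum>i<n. E (p i) F x*Qop b kp (l i) (l' i) G x)" and "P2 x = (\<Sum>i<n. E (q i) G x*Qop b 1 (L i) (L' i) F x)" for x
  have eb: "bcs (e i)" "bcs (e' i)" for i unfolding e_def e'_def by (intro Err_bcs b kp F G)+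
  have Pb: "bcs P1" "bcs P2" unfolding P1_def[abs_def] P2_def[abs_def] by (intro bcs_sum bcs_times E_bcs A.Qb B.Qb F G)+
  \<comment> \<open>Subtracting the two expansions from \<open>Err_kernel\<close> cancels the
    product of the two dyadic means and turns the one-function averages into
    \<open>Qop\<close>.\<close>
  have split: "(\<Sum>i<n. Sop b kp (L i) (l i) F G x - Sop b kp (L' i) (l' i) F G x) = ((\<Sum>i<n. e i x) + (\<Sum>i<n. - e' i x)) + (P1 x + P2 x)" for x
   unfolding P1_def P2_def sum.distrib[symmetric] e_def e'_def
   by (rule sum.cong) (auto simp: Err_kernel(2)[OF b kp(1) F(1) G(1)] Qop_def algebra_simps)
  have s1: "(LBINT x. abs (\<Sum>i<n. e i x)) <= C*N2 F*N2 G"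
   unfolding e_def by (rule order_trans[OF L1_sum err[OF p q]]) (use LL H F G b kp in \<open>auto intro!: Err_bcs\<close>)
  have "(LBINT x. abs (\<Sum>i<n. e' i x)) <= C*N2 F*N2 G"
   unfolding e'_def by (rule order_trans[OF L1_sum err[OF p q]]) (use LL H F G b kp in \<open>auto intro!: Err_bcs\<close>)
  then have s2: "(LBINT x. abs (\<Sum>i<n. - e' i x)) <= C*N2 F*N2 G" by (simp add: sum_negf)
  have s3: "(LBINT x. abs (P1 x)) <= A.CQ*N2 F*N2 G"
   unfolding P1_def by (rule A.paraproduct_low[OF F(1) G B.q_mono]) (use H in blast)
  have s4: "(LBINT x. abs (P2 x)) <= B.CQ*N2 G*N2 F"
   unfolding P2_def by (rule B.paraproduct_high[OF G(1) F A.q_mono]) (use H in blast)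
  have "(LBINT x. abs (\<Sum>i<n. Sop b kp (L i) (l i) F G x - Sop b kp (L' i) (l' i) F G x)) <=
   ((LBINT x. abs (\<Sum>i<n. e i x)) + (LBINT x. abs (\<Sum>i<n. - e' i x))) + ((LBINT x. abs (P1 x)) + (LBINT x. abs (P2 x)))"
   unfolding split by (intro order_trans[OF L1_triangle add_mono] L1_triangle bcs_add bcs_sum bcs_uminus eb Pb)
  also have "... <= C*N2 F*N2 G + C*N2 F*N2 G + (abs (A.CQ)*N2 F*N2 G + abs (B.CQ)*N2 G*N2 F)"
   by (intro add_mono s1 s2 order_trans[OF s3] order_trans[OF s4] mult_right_mono) auto
  also have "... = D*N2 F*N2 G" by (simp add: D_def algebra_simps)
  finally show ?thesis .
 qed
 have "0 < D" using C by (simp add: D_def)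
 then show ?thesis using main unfolding Sop_bounded_def by blast
qed

lemma Sop_int: "b > 1 ==> kp > 0 ==> bcs F ==> bcs G ==> bcs (%s. wgt b s*(F (x - L * s)*G (x - l * s powr kp)))"
 using bcs_slice(1)[OF Sop_kernel_bcs] by simp

text \<open>By invariance of \<open>ds/s\<close> under powers the parameter can be chosen so that
  \<open>G\<close> moves linearly. This is how large \<open>t\<close>, where the displacement of
  \<open>G\<close> is the larger one, is brought to the standard form.\<close>

lemma Sop_swap:
 assumes b: "b > 1" and kp: "kp > 0" and F: "bcs F" and G: "bcs G"
 shows "Sop b kp L l F G x = (1/kp)*Sop (b powr kp) (1/kp) l L G F x"
proof -
 define h where "h r = G (x - l*r)*F (x - L*r powr (1/kp))" for r
 have "1 < b powr kp" using b kp by (simp add: gr_one_powr)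
 then have "bcs (%r. wgt (b powr kp) r*h r)" unfolding h_def using Sop_int[OF _ _ G F] kp by simp
 note w = wgt_subst[OF b kp this]
 have "wgt b s*h (s powr kp) = wgt b s*(F (x - L * s)*G (x - l * s powr kp))" for s
  using kp by (cases "s \<in> {1..b}") (auto simp: h_def wgt_def powr_powr)
 then have "Sop b kp L l F G x = (LBINT s. wgt b s*h (s powr kp))" by (simp only: Sop_def)
 with w show ?thesis by (simp only: Sop_def h_def)
qed

lemma Sop_trivial:
 assumes b: "b > 1" and kp: "kp > 0" and F: "bcs F" and G: "bcs G"
 shows "(LBINT x. abs (Sop b kp L l F G x)) <= b*(N2 F*N2 G)"
proof -
 have "(LBINT x. abs (LBINT s. (case (x, s) of (x, s) => wgt b s*(F (x - L * s)*G (x - l * s powr kp))))) <= (LBINT s. wgt b s*(N2 F*N2 G))"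
 proof (rule L1_integral_le[OF Sop_kernel_bcs[OF assms] bcs_multc[OF wgt_bcs]])
  fix s
  have "(LBINT x. abs (F (x - L * s)*G (x - l * s powr kp))) <= N2 F*N2 G"
   using bcs_Cauchy_Schwarz_abs[OF bcs_shift[OF F] bcs_shift[OF G], of "L * s" "l * s powr kp"] by (simp add: N2_shift)
  then show "(LBINT x. abs (case (x, s) of (x, s) => wgt b s*(F (x - L * s)*G (x - l * s powr kp)))) <= wgt b s*(N2 F*N2 G)"
   using wgt_bounds(1)[of b s] by (simp add: abs_mult[of "wgt b s"] mult_left_mono)
 qed
 also have "... <= b*(N2 F*N2 G)" using wgt_integral[OF b] by (simp add: mult_right_mono)
 finally show ?thesis by (simp add: Sop_def)
qed

lemma Sop_diff:
 assumes "b > 1" "kp > 0" "bcs F" "bcs F'" "bcs G"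
 shows "Sop b kp L l (%x. F x - F' x) G x = Sop b kp L l F G x - Sop b kp L l F' G x"
  "Sop b kp L l G (%x. F x - F' x) x = Sop b kp L l G F x - Sop b kp L l G F' x"
 unfolding Sop_def left_diff_distrib right_diff_distrib
 by (intro Bochner_Integration.integral_diff bcs_integrable Sop_int assms)+

section \<open>Dyadic shells\<close>

text \<open>The part of the integral with \<open>t\<close> of size \<open>2 powr (- j)\<close>,
  after putting \<open>t = s*2 powr (- j)\<close> on the positive side and
  \<open>t = - s*2 powr (- j)\<close> on the negative one. The minus sign is that of
  \<open>1/t\<close>; the factor \<open>(-1)^d\<close> comes from \<open>t^d\<close>.\<close>

definition shell :: "nat => int => (real => real) => (real => real) => real => real" where
 "shell d j f g x = Sop 2 (real d) (2 powr (- of_int j)) (2 powr (- of_int (j*int d))) f g x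
   - Sop 2 (real d) (- (2 powr (- of_int j))) ((-1)^d*2 powr (- of_int (j*int d))) f g x"

definition Hr :: "nat => nat => (real => real) => (real => real) => real => real" where
 "Hr d m f g x = (\<Sum>j\<in>{- int m<..int m}. shell d j f g x)"

lemma shell_bcs: "d > 0 ==> bcs f ==> bcs g ==> bcs (shell d j f g)"
 unfolding shell_def[abs_def] by (intro bcs_diff Sop_bcs) auto

lemma shell_trivial:
 assumes "d > 0" "bcs f" "bcs g" shows "(LBINT x. abs (shell d j f g x)) <= 4*(N2 f*N2 g)"
proof -
 have S: "bcs (Sop 2 (real d) L l f g)" "(LBINT x. abs (Sop 2 (real d) L l f g x)) <= 2*(N2 f*N2 g)" for L l
  using Sop_bcs[of 2 "real d" f g] Sop_trivial[of 2 "real d" f g] assms by auto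
 show ?thesis unfolding shell_def diff_conv_add_uminus
  by (rule order_trans[OF L1_triangle[OF S(1) bcs_uminus[OF S(1)]]])
   (use S(2)[of "2 powr (- of_int j)" "2 powr (- of_int (j*int d))"] S(2)[of "- (2 powr (- of_int j))" "(-1)^d*2 powr (- of_int (j*int d))"] in simp)
qed

lemma Hr_bcs: "d > 0 ==> bcs f ==> bcs g ==> bcs (Hr d m f g)"
 unfolding Hr_def[abs_def] by (intro bcs_sum shell_bcs)

lemma shell_sum_trivial:
 assumes "d > 0" "bcs f" "bcs g"
 shows "(LBINT x. abs (\<Sum>j\<in>S. shell d j f g x)) <= real (card S)*(4*(N2 f*N2 g))"
proof -
 have "(LBINT x. abs (\<Sum>j\<in>S. shell d j f g x)) <= (\<Sum>j\<in>S. LBINT x. abs (shell d j f g x))" by (intro L1_sum shell_bcs assms)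
 also have "... <= (\<Sum>j\<in>S. 4*(N2 f*N2 g))" by (intro sum_mono shell_trivial assms)
 finally show ?thesis by simp
qed

lemma Hr_diff:
 assumes "d > 0" "bcs f" "bcs f'" "bcs g"
 shows "Hr d m (%x. f x - f' x) g x = Hr d m f g x - Hr d m f' g x" "Hr d m g (%x. f x - f' x) x = Hr d m g f x - Hr d m g f' x"
 using assms unfolding Hr_def shell_def by (simp_all add: Sop_diff sum_subtractf)

text \<open>Shells with \<open>j >= j0\<close> satisfy the hypotheses of \<open>Sop_bounded\<close>
  directly, those with \<open>j <= - j0\<close> after \<open>Sop_swap\<close>, and the bounded
  number in between is estimated trivially.\<close>

theorem Hr_step:
 assumes d: "d >= 2"
 shows "\<exists>C>0. \<forall>m f g K. bcs f --> bcs g --> E K f = f --> E K g = g --> (LBINT x. abs (Hr d m f g x)) <= C*N2 f*N2 g"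
proof -
 define b where "b = 2 powr real d"
 have b1: "b > 1" using d by (simp add: b_def gr_one_powr)
 have d0: "real d > 0" "real d ~= 1" "1/real d > 0" "1/real d ~= 1" "d > 0" using d by auto
 obtain C1 c1 where C1: "C1 > 0" "Sop_bounded 2 (real d) C1 c1" using Sop_sum[OF d0(1,2), of 2] by auto
 obtain C2 c2 where C2: "C2 > 0" "Sop_bounded b (1/real d) C2 c2" using Sop_sum[OF d0(3,4) b1] by blast
 \<comment> \<open>The levels \<open>j\<close> and \<open>j*d\<close> then differ by at least
   \<open>c1\<close> and \<open>c2\<close>. The value 2 is needed for negative \<open>j\<close>,
   where \<open>(j + 1)*d <= j\<close> must hold; it fails at \<open>j = -1\<close>.\<close>
 define j0 where "j0 = max 2 (max c1 c2)"
 have j0: "j0 >= 2" "j0 >= c1" "j0 >= c2" by (auto simp: j0_def)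
 define dd where "dd = int d"
 have dd: "dd >= 2" using d by (simp add: dd_def)
 have gap: "j0 <= dd*t - t" if "t >= j0" for t
 proof -
  have "1*t <= (dd - 1)*t" using dd that j0 by (intro mult_right_mono) auto
  then show ?thesis using that by (simp add: algebra_simps)
 qed
 have abs1: "abs ((-1)^d*y) = abs y" for y :: real by (simp add: abs_mult power_abs)
 have main: "(LBINT x. abs (Hr d m f g x)) <= (C1 + C2 + 8*real_of_int j0)*N2 f*N2 g"
  if f: "bcs f" "E K f = f" and g: "bcs g" "E K g = g" for m f g K
 proof -
  define S where "S = {- int m<..int m}"
  define A1 A2 A3 where "A1 = S \<inter> {j0..}" and "A2 = S \<inter> {..- j0}" and "A3 = S \<inter> {- j0<..<j0}"
  have fin: "finite A1" "finite A2" "finite A3" by (auto simp: A1_def A2_def A3_def S_def)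
  have S: "S = A1 \<union> (A2 \<union> A3)" by (auto simp: A1_def A2_def A3_def)
  have dis: "A1 \<inter> (A2 \<union> A3) = {}" "A2 \<inter> A3 = {}" using j0 by (auto simp: A1_def A2_def A3_def)
  note sb = shell_bcs[OF d0(5) f(1) g(1)]
  have s1: "(LBINT x. abs (\<Sum>j\<in>A1. shell d j f g x)) <= C1*N2 f*N2 g"
  proof -
   define n where "n = nat (int m - j0 + 1)"
   have "A1 = (%i. j0 + int i) ` {..<n}"
   proof (intro equalityI subsetI)
    fix j assume "j \<in> A1" then show "j \<in> (%i. j0 + int i) ` {..<n}"
     by (intro image_eqI[of _ _ "nat (j - j0)"]) (auto simp: A1_def S_def n_def)
   qed (use j0 in \<open>auto simp: A1_def S_def n_def\<close>)
   then have e: "(\<Sum>j\<in>A1. shell d j f g x) = (\<Sum>i<n. shell d (j0 + int i) f g x)" for x by (simp add: sum.reindex inj_on_def)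
   show ?thesis unfolding e unfolding shell_def
   proof (rule C1(2)[unfolded Sop_bounded_def, rule_format, where p = "%i. j0 + int i" and q = "%i. (j0 + int i)*int d"])
    show "strict_mono (%i. j0 + int i)" by (simp add: strict_mono_def)
    show "strict_mono (%i. (j0 + int i)*int d)" using d by (simp add: strict_mono_def)
    fix i show "(j0 + int i)*int d - (j0 + int i) >= c1 & j0 + int i <= (j0 + int i)*int d & j0 + int (Suc i) <= (j0 + int i)*int d"
     using gap[of "j0 + int i"] j0 d by (simp add: dd_def mult.commute)
   qed (use f g in \<open>auto simp: abs1\<close>)
  qed
  have s2: "(LBINT x. abs (\<Sum>j\<in>A2. shell d j f g x)) <= C2*N2 f*N2 g"
  proof -
   define n where "n = nat (int m - j0)"
   \<comment> \<open>The negative shells are enumerated from the most negative upwards, because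
     \<open>Sop_bounded\<close> wants increasing levels.\<close>
   define J where "J i = - (j0 + int n - 1 - int i)" for i
   have "A2 = J ` {..<n}"
   proof (intro equalityI subsetI)
    fix j assume "j \<in> A2" then show "j \<in> J ` {..<n}"
     by (intro image_eqI[of _ _ "nat (j + (j0 + int n - 1))"]) (auto simp: A2_def S_def n_def J_def)
   qed (use j0 in \<open>auto simp: A2_def S_def n_def J_def\<close>)
   then have e: "(\<Sum>j\<in>A2. shell d j f g x) = (\<Sum>i<n. shell d (J i) f g x)" for x by (simp add: sum.reindex inj_on_def J_def)
   define D where "D i x = Sop b (1/real d) (2 powr (- of_int (J i*int d))) (2 powr (- of_int (J i))) g f x
    - Sop b (1/real d) ((-1)^d*2 powr (- of_int (J i*int d))) (- (2 powr (- of_int (J i)))) g f x" for i x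
   have sh: "shell d (J i) f g x = (1/real d)*D i x" for i x
    unfolding shell_def D_def b_def by (simp add: Sop_swap[of 2 "real d"] f g d0 right_diff_distrib del: of_int_mult)
   have "(LBINT x. abs (\<Sum>i<n. D i x)) <= C2*N2 g*N2 f" unfolding D_def
   proof (rule C2(2)[unfolded Sop_bounded_def, rule_format, where p = "%i. J i*int d" and q = J])
    show "strict_mono J" by (simp add: strict_mono_def J_def)
    show "strict_mono (%i. J i*int d)" using d by (simp add: strict_mono_def J_def)
    fix i assume "i < n"
     then have t: "- J i >= j0" "J (Suc i) = J i + 1" by (auto simp: J_def)
     have "1*1 <= (dd - 1)*(- J i - 1)" using dd t j0 by (intro mult_mono) auto
     then have "dd <= dd*(- J i) + J i" by (simp add: algebra_simps)
     then show "J i - J i*int d >= c2 & J i*int d <= J i & J (Suc i)*int d <= J i"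
      using gap[OF t(1)] j0 t d by (simp add: dd_def algebra_simps)
   qed (use f g in \<open>auto simp: abs1\<close>)
   moreover have "(LBINT x. abs (\<Sum>j\<in>A2. shell d j f g x)) = (1/real d)*(LBINT x. abs (\<Sum>i<n. D i x))"
    unfolding e sh sum_distrib_left[symmetric] by (simp add: abs_mult)
   moreover have "(1/real d)*(LBINT x. abs (\<Sum>i<n. D i x)) <= 1*(LBINT x. abs (\<Sum>i<n. D i x))"
    using d by (intro mult_right_mono) auto
   ultimately show ?thesis by (simp add: mult_ac)
  qed
  have s3: "(LBINT x. abs (\<Sum>j\<in>A3. shell d j f g x)) <= 8*real_of_int j0*N2 f*N2 g"
  proof -
   have "card A3 <= card {- j0<..<j0}" by (rule card_mono) (auto simp: A3_def)
   also have "... = nat (2*j0 - 1)" by simp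
   finally have "real (card A3) <= 2*real_of_int j0" using j0 by linarith
   then have "real (card A3)*(4*(N2 f*N2 g)) <= 2*real_of_int j0*(4*(N2 f*N2 g))" by (intro mult_right_mono) auto
   then show ?thesis using shell_sum_trivial[OF d0(5) f(1) g(1), of A3] by (simp only: mult.assoc)
  qed
  have e: "Hr d m f g x = (\<Sum>j\<in>A1. shell d j f g x) + ((\<Sum>j\<in>A2. shell d j f g x) + (\<Sum>j\<in>A3. shell d j f g x))" for x
   unfolding Hr_def S_def[symmetric] S by (simp add: sum.union_disjoint fin dis)
  have "(LBINT x. abs (Hr d m f g x)) <= (LBINT x. abs (\<Sum>j\<in>A1. shell d j f g x)) + ((LBINT x. abs (\<Sum>j\<in>A2. shell d j f g x)) + (LBINT x. abs (\<Sum>j\<in>A3. shell d j f g x)))"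
   unfolding e by (intro order_trans[OF L1_triangle add_left_mono[OF L1_triangle]] bcs_add bcs_sum sb)
  then show ?thesis using s1 s2 s3 by (simp add: algebra_simps)
 qed
 have "C1 + C2 + 8*real_of_int j0 > 0" using C1 C2 j0 by simp
 then show ?thesis using main by blast
qed

section \<open>From step functions to Lipschitz functions\<close>

lemma lipschitz_E_limit:
 assumes \<psi>: "bcs \<psi>" and lip: "\<And>x y. abs (\<psi> x - \<psi> y) <= \<Lambda>*abs (x - y)"
 shows "(%k. N2 (%x. \<psi> x - E (int k) \<psi> x)) \<longlonglongrightarrow> 0"
proof -
 obtain R where R: "0 <= R" "\<And>x. \<psi> x ~= 0 ==> norm x <= R" using bcs_ex[OF \<psi>] by blast
 have \<Lambda>0: "0 <= \<Lambda>" using lip[of 1 0] by simp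
 define B where "B = N2 (indicat_real {-(R + 1)..R + 1})"
 have bd: "N2 (%x. \<psi> x - E (int k) \<psi> x) <= 2*(\<Lambda>*(1/2)^k*B)" for k
 proof (rule sub_E[OF \<psi>])
  fix y :: real assume "abs y <= 2 powr (- of_int (int k))"
  then have y: "abs y <= (1/2)^k" by (simp add: powr_minus powr_realpow power_one_over inverse_eq_divide)
  also have "... <= 1" by (simp add: power_le_one)
  finally have y1: "abs y <= 1" .
  have "N2 (%x. \<psi> (x - y) - \<psi> x) <= N2 (%x. (\<Lambda>*(1/2)^k)*indicat_real {-(R + 1)..R + 1} x)"
  proof (rule N2_mono)
   fix x
   have "abs (\<psi> (x - y) - \<psi> x) <= \<Lambda>*abs y" using lip[of "x - y" x] by simp
   also have "... <= \<Lambda>*(1/2)^k" by (rule mult_left_mono[OF y \<Lambda>0])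
   finally have "abs (\<psi> (x - y) - \<psi> x) <= \<Lambda>*(1/2)^k" .
   moreover have "x \<in> {-(R + 1)..R + 1}" if "abs (x - y) <= R \<or> abs x <= R" using that y1 by (auto simp: abs_le_iff)
   then have "\<psi> (x - y) = 0" "\<psi> x = 0" if "x \<notin> {-(R + 1)..R + 1}" using R(2)[of x] R(2)[of "x - y"] that by auto
   ultimately show "abs (\<psi> (x - y) - \<psi> x) <= abs ((\<Lambda>*(1/2)^k)*indicat_real {-(R + 1)..R + 1} x)"
    using \<Lambda>0 by (cases "x \<in> {-(R + 1)..R + 1}") auto
  qed (intro bcs_diff bcs_shift \<psi> bcs_cmult bcs_indicator; simp)+
  then show "N2 (%x. \<psi> (x - y) - \<psi> x) <= \<Lambda>*(1/2)^k*B" using \<Lambda>0 unfolding N2_cmult B_def by simp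
 qed
 have "(%k. 2*(\<Lambda>*(1/2)^k*B)) \<longlonglongrightarrow> 2*(\<Lambda>*0*B)"
  by (intro tendsto_intros LIMSEQ_realpow_zero) auto
 then have lim: "(%k. 2*(\<Lambda>*(1/2)^k*B)) \<longlonglongrightarrow> 0" by simp
 show ?thesis by (rule tendsto_sandwich[OF _ _ tendsto_const lim]; intro always_eventually allI; rule N2_nonneg bd)
qed

text \<open>For fixed \<open>m\<close> the crude bound on \<open>Hr\<close> grows with the number of
  shells, but it multiplies the norm of \<open>f - E k f\<close> or \<open>g - E k g\<close>, which
  tends to 0; the uniform constant from the step functions is all that survives.\<close>

theorem Hr_lipschitz:
 assumes d: "d >= 2"
 shows "\<exists>C>0. \<forall>m f g. bcs f --> bcs g --> (\<exists>\<Lambda>. \<forall>x y. abs (f x - f y) <= \<Lambda>*abs (x - y)) --> (\<exists>\<Lambda>. \<forall>x y. abs (g x - g y) <= \<Lambda>*abs (x - y)) -->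
  (LBINT x. abs (Hr d m f g x)) <= C*N2 f*N2 g"
proof -
 obtain C where C: "C > 0" "\<And>m f g K. bcs f ==> bcs g ==> E K f = f ==> E K g = g ==> (LBINT x. abs (Hr d m f g x)) <= C*N2 f*N2 g"
  using Hr_step[OF d] by blast
 have d0: "d > 0" using d by simp
 have main: "(LBINT x. abs (Hr d m f g x)) <= C*N2 f*N2 g"
  if f: "bcs f" "(%k. N2 (%x. f x - E (int k) f x)) \<longlonglongrightarrow> 0" and g: "bcs g" "(%k. N2 (%x. g x - E (int k) g x)) \<longlonglongrightarrow> 0" for m f g
 proof -
  define M where "M = real (card {- int m<..int m})"
  have triv: "(LBINT x. abs (Hr d m u v x)) <= M*(4*(N2 u*N2 v))" if "bcs u" "bcs v" for u v
   unfolding Hr_def M_def by (rule shell_sum_trivial[OF d0 that])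
  define err where "err k = M*(4*(N2 (%x. f x - E (int k) f x)*N2 g)) + M*(4*(N2 f*N2 (%x. g x - E (int k) g x)))" for k
  have "err \<longlonglongrightarrow> M*(4*(0*N2 g)) + M*(4*(N2 f*0))" unfolding err_def by (intro tendsto_intros f g)
  then have lim: "(%k. err k + C*N2 f*N2 g) \<longlonglongrightarrow> 0 + C*N2 f*N2 g" by (intro tendsto_add tendsto_const) simp
  have "(LBINT x. abs (Hr d m f g x)) <= err k + C*N2 f*N2 g" for k
  proof -
   define u v where "u = E (int k) f" and "v = E (int k) g"
   have b: "bcs u" "bcs v" "bcs (%x. f x - u x)" "bcs (%x. g x - v x)" unfolding u_def v_def by (intro bcs_diff E_bcs f g)+
   have N: "N2 u <= N2 f" "N2 v <= N2 g" unfolding u_def v_def by (intro N2_E f g)+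
   have e: "Hr d m f g x = (Hr d m (%x. f x - u x) g x + Hr d m u (%x. g x - v x) x) + Hr d m u v x" for x
    by (simp add: Hr_diff d0 f g b)
   have "(LBINT x. abs (Hr d m f g x)) <= (LBINT x. abs (Hr d m (%x. f x - u x) g x)) + (LBINT x. abs (Hr d m u (%x. g x - v x) x)) + (LBINT x. abs (Hr d m u v x))"
    unfolding e by (intro order_trans[OF L1_triangle add_right_mono[OF L1_triangle]] bcs_add Hr_bcs d0 b f g)
   moreover have "(LBINT x. abs (Hr d m (%x. f x - u x) g x)) <= M*(4*(N2 (%x. f x - u x)*N2 g))" by (intro triv b g)
   moreover have "(LBINT x. abs (Hr d m u (%x. g x - v x) x)) <= M*(4*(N2 u*N2 (%x. g x - v x)))" by (intro triv b)
   moreover have "M*(4*(N2 u*N2 (%x. g x - v x))) <= M*(4*(N2 f*N2 (%x. g x - v x)))"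
    using N by (intro mult_left_mono mult_right_mono) (auto simp: M_def)
   moreover have "(LBINT x. abs (Hr d m u v x)) <= C*N2 u*N2 v"
    by (rule C(2)[of _ _ "int k"]) (use f g in \<open>auto simp: u_def v_def E_idem intro: E_bcs\<close>)
   moreover have "C*N2 u*N2 v <= C*N2 f*N2 g" using N C(1) by (intro mult_mono) auto
   ultimately show ?thesis by (simp add: err_def u_def v_def)
  qed
  then have "(LBINT x. abs (Hr d m f g x)) <= 0 + C*N2 f*N2 g" by (intro LIMSEQ_le_const[OF lim]) blast
  then show ?thesis by simp
 qed
 have L: "(%k. N2 (%x. \<psi> x - E (int k) \<psi> x)) \<longlonglongrightarrow> 0" if "bcs \<psi>" "\<exists>\<Lambda>. \<forall>x y. abs (\<psi> x - \<psi> y) <= \<Lambda>*abs (x - y)" for \<psi>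
  using lipschitz_E_limit that by blast
 show ?thesis using C(1) main L by blast
qed

section \<open>Dyadic shells as integrals over annuli\<close>

lemma curve_measurable:
 assumes "f \<in> borel_measurable borel" "g \<in> borel_measurable borel" "A \<in> sets borel"
 shows "(%t. indicat_real A t*(f (x - t)*g (x - t^d)/t)) \<in> borel_measurable borel"
proof -
 note [measurable] = assms
 show ?thesis by measurable
qed

lemma annulus_sets [measurable]: "{t::real. a <= abs t & abs t < b} \<in> sets borel" "{t::real. a <= abs t} \<in> sets borel"
 by measurable

lemma annulus_bcs:
 assumes f: "bcs f" and g: "bcs g" and a: "a > 0"
 shows "bcs (%t. indicat_real {t. a <= abs t & abs t < b} t*(f (x - t)*g (x - t^d)/t))"
proof -
 obtain M1 where M1: "0 <= M1" "\<And>x. abs (f x) <= M1" using bcs_ex[OF f] by blast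
 obtain M2 where M2: "0 <= M2" "\<And>x. abs (g x) <= M2" using bcs_ex[OF g] by blast
 show ?thesis
 proof (rule bcsI[OF curve_measurable[OF bcs_measurable[OF f] bcs_measurable[OF g] annulus_sets(1)], where M = "M1*M2/a" and R = b])
  fix t
  have "abs (f (x - t)*g (x - t^d)/t) <= M1*M2/a" if "a <= abs t"
   unfolding abs_divide abs_mult using that a M1 M2 by (intro frac_le mult_mono) auto
  then show "abs (indicat_real {t. a <= abs t & abs t < b} t*(f (x - t)*g (x - t^d)/t)) <= M1*M2/a"
   using M1(1) M2(1) a by (auto simp: indicator_def)
 qed (auto simp: indicator_def)
qed

lemma shell_integral:
 assumes d: "d > 0" and f: "bcs f" and g: "bcs g"
 shows "shell d j f g x = (LBINT t. indicat_real {t. 2 powr (- of_int j) <= abs t & abs t < 2 powr (- of_int (j - 1))} t*(f (x - t)*g (x - t^d)/t))"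
proof -
 define la where "la = (2::real) powr (- of_int j)"
 have l0: "0 < la" by (simp add: la_def)
 have l2: "2 powr (- of_int (j - 1)) = 2*la" by (simp add: la_def powr_diff powr_minus_divide)
 have ld: "2 powr (- of_int (j*int d)) = la^d" by (simp add: la_def powr_powr powr_realpow[symmetric])
 define H where "H t = indicat_real {t. la <= abs t & abs t < 2*la} t*(f (x - t)*g (x - t^d)/t)" for t
 have Hb: "bcs H" unfolding H_def[abs_def] by (rule annulus_bcs[OF f g l0])
 have half: "(LBINT t. indicat_real {t. 0 < si*t} t*H t) = si*Sop 2 (real d) (si*la) (si^d*la^d) f g x" if si: "abs si = 1" for si
 proof -
  have s2: "si * si = 1" using si by (metis abs_mult_self_eq mult_1)
  define P where "P t = indicat_real {t. 0 < si*t} t*H t" for t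
  have "(LBINT t. P t) = la*(LBINT s. P ((si*la) * s))"
   using integral_scale[of "si*la" P] si l0 by (auto simp: abs_mult)
  also have "... = (LBINT s. la*P ((si*la) * s))" by simp
  also have "... = (LBINT s. si*(wgt 2 s*(f (x - si*la * s)*g (x - si^d*la^d * s powr real d))))"
  proof (rule integral_cong_AE)
   have mb: "P \<in> borel_measurable borel" unfolding P_def[abs_def] using bcs_measurable[OF Hb] by measurable
   then show "(%s. la*P ((si*la) * s)) \<in> borel_measurable lborel" by measurable
   show "(%s. si*(wgt 2 s*(f (x - si*la * s)*g (x - si^d*la^d * s powr real d)))) \<in> borel_measurable lborel"
    using bcs_measurable[OF bcs_cmult[OF Sop_int[of 2 "real d" f g, OF _ _ f g]]] d by simp
   show "AE s in lborel. la*P ((si*la) * s) = si*(wgt 2 s*(f (x - si*la * s)*g (x - si^d*la^d * s powr real d)))"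
    \<comment> \<open>The weight lives on the closed interval \<open>{1..2}\<close>, the annulus is
      half open; the endpoint is a null set.\<close>
    using AE_lborel_singleton[of 2]
   proof eventually_elim
    fix s :: real assume "s ~= 2"
    show "la*P ((si*la) * s) = si*(wgt 2 s*(f (x - si*la * s)*g (x - si^d*la^d * s powr real d)))"
    proof (cases "s \<in> {1..2}")
     case True
     then have s: "1 <= s" "s < 2" "0 < s" using \<open>s ~= 2\<close> by auto
     have a: "abs (si*la * s) = la * s" using si l0 s by (simp add: abs_mult)
     have p: "si*(si*la * s) = la * s" using s2 by (simp add: mult.assoc[symmetric])
     have "P ((si*la) * s) = f (x - si*la * s)*g (x - si^d*la^d * s^d)/(si*la * s)"
      using s l0 by (simp add: P_def H_def a p power_mult_distrib)
     moreover from si have "si = 1 \<or> si = -1" by linarith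
     ultimately show ?thesis using s l0 by (auto simp: wgt_def powr_realpow)
    next
     case False
     have "P ((si*la) * s) = 0"
     proof (rule ccontr)
      assume "P ((si*la) * s) ~= 0"
      then have q: "0 < si*(si*la * s)" "la <= abs (si*la * s)" "abs (si*la * s) < 2*la" by (auto simp: P_def H_def indicator_def split: if_splits)
      have "si*(si*la * s) = la * s" using s2 by (simp add: mult.assoc[symmetric])
      with q(1) l0 have "0 < s" by (simp add: zero_less_mult_iff)
      moreover from this have "abs (si*la * s) = la * s" using si l0 by (simp add: abs_mult)
      ultimately show False using q False l0 by simp
     qed
     then show ?thesis using False by (simp add: wgt_def)
    qed
   qed
  qed
  finally show ?thesis by (simp add: Sop_def P_def)
 qed
 have Hs: "bcs (%t. indicat_real {t. 0 < si*t} t*H t)" for si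
  by (rule bcs_mult'[OF Hb]) (auto simp: bounded_iff indicator_def intro!: exI[of _ 1])
 have "H t = indicat_real {t. 0 < 1*t} t*H t + indicat_real {t. 0 < (-1)*t} t*H t" for t
  using l0 by (cases t "0::real" rule: linorder_cases) (auto simp: H_def)
 then have "(LBINT t. H t) = (LBINT t. indicat_real {t. 0 < 1*t} t*H t + indicat_real {t. 0 < (-1)*t} t*H t)" by (rule arg_cong[OF ext])
 also have "... = (LBINT t. indicat_real {t. 0 < 1*t} t*H t) + (LBINT t. indicat_real {t. 0 < (-1)*t} t*H t)"
  by (intro Bochner_Integration.integral_add bcs_integrable Hs)
 also have "... = shell d j f g x" using half[of 1] half[of "-1"] unfolding shell_def ld la_def[symmetric] by simp
 finally show ?thesis unfolding l2 la_def[symmetric] by (simp add: H_def)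
qed

text \<open>The indicator of a shell is a difference of two indicators of exteriors, so the sum over
  shells telescopes and only the innermost and outermost radii remain.\<close>

lemma Hr_integral:
 assumes d: "d > 0" and f: "bcs f" and g: "bcs g"
 shows "Hr d m f g x = (LBINT t. indicat_real {t. (1/2)^m <= abs t & abs t < 2^m} t*(f (x - t)*g (x - t^d)/t))"
proof -
 define S where "S j = {t::real. 2 powr (- of_int j) <= abs t & abs t < 2 powr (- of_int (j - 1))}" for j
 define c where "c j t = indicat_real {t. 2 powr (- of_int j) <= abs t} t" for j and t :: real
 have ic: "indicat_real (S j) t = c j t - c (j - 1) t" for j t
 proof -
  have "2 powr (- real_of_int j) <= abs t" if "2 powr (1 - real_of_int j) <= abs t" by (rule order_trans[OF powr_mono that]) auto
  then show ?thesis by (auto simp: S_def c_def indicator_def)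
 qed
 have "(\<Sum>j\<in>{- int m<..int m}. c j t - c (j - 1) t) = c (int m) t - c (- int m) t" for t
 proof (induction m)
  case (Suc m)
  have "{- int (Suc m)<..int (Suc m)} = insert (int m + 1) (insert (- int m) {- int m<..int m})" by auto
  then show ?case using Suc by (simp add: minus_diff_commute[of 1] add.commute)
 qed simp
 then have tel: "(\<Sum>j\<in>{- int m<..int m}. indicat_real (S j) t) = indicat_real {t. (1/2)^m <= abs t & abs t < 2^m} t" for t
 proof -
  have "(1/2::real)^m <= abs t" if "2^m <= abs t" by (rule order_trans[OF power_mono that]) auto
  moreover have "(2::real) powr (- real m) = (1/2)^m" by (simp add: powr_minus powr_realpow power_one_over inverse_eq_divide)
  ultimately show ?thesis using \<open>\<And>t. (\<Sum>j\<in>{- int m<..int m}. c j t - c (j - 1) t) = c (int m) t - c (- int m) t\<close>[of t]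
   unfolding ic by (auto simp: c_def indicator_def powr_realpow)
 qed
 have "Hr d m f g x = (\<Sum>j\<in>{- int m<..int m}. LBINT t. indicat_real (S j) t*(f (x - t)*g (x - t^d)/t))"
  unfolding Hr_def S_def by (intro sum.cong refl shell_integral d f g)
 also have "... = (LBINT t. \<Sum>j\<in>{- int m<..int m}. indicat_real (S j) t*(f (x - t)*g (x - t^d)/t))"
  unfolding S_def by (intro Bochner_Integration.integral_sum[symmetric] bcs_integrable annulus_bcs f g) simp
 finally show ?thesis unfolding sum_distrib_right[symmetric] tel .
qed

lemma integrable_inverse_1_plus: "integrable lborel (%x::real. 1/(1 + x\<^sup>2))"
proof -
 define h where "h x = 1/(1 + x\<^sup>2)" for x :: real
 have [measurable]: "h \<in> borel_measurable borel" unfolding h_def[abs_def] by measurable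
 have "(\<integral>\<^sup>+x. ennreal (h x)*indicator {0..} x \<partial>lborel) = ennreal (pi/2 - arctan 0)"
 proof (rule nn_integral_FTC_atLeast)
  show "DERIV arctan x :> h x" for x unfolding h_def using DERIV_arctan[of x] by (simp add: inverse_eq_divide)
 qed (auto simp: h_def intro!: tendsto_arctan_at_top)
 then have "(\<integral>\<^sup>+x. ennreal (h x*indicat_real {0..} x) \<partial>lborel) = ennreal (pi/2)"
  by (simp add: ennreal_mult'' ennreal_indicator)
 then have i: "integrable lborel (%x. h x*indicat_real {0..} x)" by (intro integrableI_nn_integral_finite) (auto simp: h_def)
 have "integrable lborel (%x. h x*indicat_real {0..} x + h (0 + -1*x)*indicat_real {0..} (0 + -1*x))"
  by (intro Bochner_Integration.integrable_add i lborel_integrable_real_affine[OF i]) simp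
 then show ?thesis unfolding h_def[symmetric]
  by (rule Bochner_Integration.integrable_bound) (auto simp: h_def indicator_def)
qed

section \<open>Passage to Schwartz functions\<close>

text \<open>What the argument uses of a Schwartz function: the Lipschitz bound gives the principal
  value, the decay gives integrability and convergence of the cutoffs.\<close>

definition nice :: "(real => real) => real => real => bool" where
 "nice ph \<Lambda> B \<longleftrightarrow> (\<forall>x y. abs (ph x - ph y) <= \<Lambda>*abs (x - y)) & (\<forall>x. abs (ph x) <= B/(1 + x\<^sup>2))"

lemma nice_facts:
 assumes "nice ph \<Lambda> B"
 shows "0 <= \<Lambda>" "0 <= B" "\<And>x. abs (ph x) <= B" "ph \<in> borel_measurable borel" "integrable lborel ph" "integrable lborel (%x. (ph x)\<^sup>2)"
proof -
 have L: "abs (ph x - ph y) <= \<Lambda>*abs (x - y)" and D: "abs (ph x) <= B/(1 + x\<^sup>2)" for x y using assms by (auto simp: nice_def)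
 show \<Lambda>: "0 <= \<Lambda>" using L[of 1 0] by simp
 show B: "0 <= B" using D[of 0] by simp
 have "B/(1 + x\<^sup>2) <= B/1" for x by (rule divide_left_mono) (use B in \<open>auto simp: add_pos_nonneg\<close>)
 then show bd: "abs (ph x) <= B" for x using D[of x] by (metis div_by_1 order_trans)
 have "\<Lambda>-lipschitz_on UNIV ph" using L \<Lambda> by (auto simp: lipschitz_on_def dist_real_def)
 then show m: "ph \<in> borel_measurable borel" using lipschitz_on_continuous_on borel_measurable_continuous_onI by blast
 have i: "integrable lborel (%x. B*(1/(1 + x\<^sup>2)))" by (intro integrable_mult_right integrable_inverse_1_plus)
 show "integrable lborel ph" by (rule Bochner_Integration.integrable_bound[OF i]) (use m D B in auto)
 have "abs (ph x)*abs (ph x) <= B*(B*(1/(1 + x\<^sup>2)))" for x using bd[of x] D[of x] B by (intro mult_mono) auto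
 then have "(ph x)\<^sup>2 <= B*(B*(1/(1 + x\<^sup>2)))" for x by (simp add: power2_eq_square)
 then show "integrable lborel (%x. (ph x)\<^sup>2)"
  by (intro Bochner_Integration.integrable_bound[OF integrable_mult_right[OF i, of B]]) (use m B in auto)
qed

text \<open>A trapezoidal cutoff with Lipschitz constant 1, so that multiplication by it preserves
  the Lipschitz property required in \<open>Hr_lipschitz\<close>.\<close>

definition cut :: "nat => real => real" where "cut m y = max 0 (min 1 (real m + 1 - abs y))"

lemma cut_facts: "0 <= cut m y" "cut m y <= 1" "abs y <= real m ==> cut m y = 1" "cut m y ~= 0 ==> abs y <= real m + 1" "abs (cut m y - cut m z) <= abs (y - z)"
proof -
 have "abs (max 0 (min 1 a) - max 0 (min 1 b)) <= abs (a - b)" for a b :: real by (auto simp: max_def min_def)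
 moreover have "abs ((real m + 1 - abs y) - (real m + 1 - abs z)) <= abs (y - z)" by linarith
 ultimately show "abs (cut m y - cut m z) <= abs (y - z)" unfolding cut_def using order_trans by blast
qed (auto simp: cut_def)

lemma nice_cut:
 assumes "nice ph \<Lambda> B" defines "\<psi> \<equiv> %m x. ph x*cut m x"
 shows "bcs (\<psi> m)" "\<exists>\<Lambda>. \<forall>x y. abs (\<psi> m x - \<psi> m y) <= \<Lambda>*abs (x - y)" "N2 (\<psi> m) <= N2 ph" "abs (\<psi> m x) <= abs (ph x)"
proof -
 note n = nice_facts[OF assms(1)]
 have [measurable]: "cut m \<in> borel_measurable borel" unfolding cut_def[abs_def] by measurable
 have le: "abs (\<psi> m x) <= abs (ph x)" for x unfolding \<psi>_def abs_mult using cut_facts(1,2)[of m x] by (simp add: mult_left_le)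
 then show "abs (\<psi> m x) <= abs (ph x)" .
 show b: "bcs (\<psi> m)"
  by (rule bcsI[where M = B and R = "real m + 1"]) (use n(4) cut_facts(4) order_trans[OF le n(3)] in \<open>auto simp: \<psi>_def\<close>)
 have "abs (\<psi> m x - \<psi> m y) <= (\<Lambda> + B)*abs (x - y)" for x y
 proof -
  have "\<psi> m x - \<psi> m y = (ph x - ph y)*cut m x + ph y*(cut m x - cut m y)" by (simp add: \<psi>_def algebra_simps)
  then have "abs (\<psi> m x - \<psi> m y) <= abs (ph x - ph y)*abs (cut m x) + abs (ph y)*abs (cut m x - cut m y)" by (metis abs_mult abs_triangle_ineq)
  also have "... <= (\<Lambda>*abs (x - y))*1 + B*abs (x - y)"
   using cut_facts[of m] assms(1) n by (intro add_mono mult_mono) (auto simp: nice_def)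
  finally show ?thesis by (simp add: algebra_simps)
 qed
 then show "\<exists>\<Lambda>. \<forall>x y. abs (\<psi> m x - \<psi> m y) <= \<Lambda>*abs (x - y)" by blast
 show "N2 (\<psi> m) <= N2 ph" unfolding N2_def
  by (intro real_sqrt_le_mono integral_mono bcs_integrable bcs_power2 b n) (use le in \<open>simp add: abs_le_square_iff\<close>)
qed

definition Ht :: "nat => (real => real) => (real => real) => real => real => real" where
 "Ht d ph \<psi> x ep = (LBINT t. indicat_real {t. ep <= abs t} t*(ph (x - t)*\<psi> (x - t^d)/t))"

text \<open>Away from 0 the factor \<open>\<psi>/t\<close> is bounded, and the first factor is
  integrable in \<open>t\<close> by itself.\<close>

lemma Ht_int:
 assumes "nice ph \<Lambda> B" "nice \<psi> \<Lambda>' B'" "ep > 0"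
 shows "integrable lborel (%t. indicat_real {t. ep <= abs t} t*(ph (x - t)*\<psi> (x - t^d)/t))"
proof -
 note n = nice_facts[OF assms(1)] and n' = nice_facts[OF assms(2)]
 have "integrable lborel (%t. (B'/ep)*ph (x + -1*t))"
  by (intro integrable_mult_right lborel_integrable_real_affine n) simp
 then show ?thesis
 proof (rule Bochner_Integration.integrable_bound[OF _ _ AE_I2])
  show "(%t. indicat_real {t. ep <= abs t} t*(ph (x - t)*\<psi> (x - t^d)/t)) \<in> borel_measurable lborel"
   using curve_measurable[OF n(4) n'(4) annulus_sets(2)] by simp
  fix t
  have "abs (\<psi> (x - t^d))/abs t <= B'/ep" if "ep <= abs t" using that assms(3) n' by (intro frac_le) auto
  from mult_left_mono[OF this abs_ge_zero[of "ph (x - t)"]]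
  show "norm (indicat_real {t. ep <= abs t} t*(ph (x - t)*\<psi> (x - t^d)/t)) <= norm ((B'/ep)*ph (x + -1*t))"
   using n'(2) assms(3) by (auto simp: indicator_def abs_mult mult_ac)
 qed
qed

text \<open>Pairing \<open>t\<close> with \<open>- t\<close> replaces the integrand by
  \<open>(G t - G (- t))/t\<close>, which is bounded on \<open>0 < t < 1\<close> because
  \<open>t^d <= t\<close> there and both functions are Lipschitz. The truncated integral therefore
  differs from the candidate limit by at most \<open>K*ep\<close>.\<close>

lemma Ht_limit:
 assumes ph: "nice ph \<Lambda> B" and \<psi>: "nice \<psi> \<Lambda>' B'" and d: "d > 0"
 shows "\<exists>h. (Ht d ph \<psi> x \<longlongrightarrow> h) (at_right 0)"
proof -
 note n = nice_facts[OF ph] and n' = nice_facts[OF \<psi>]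
 define G where "G t = ph (x - t)*\<psi> (x - t^d)" for t
 define K where "K = 2*\<Lambda>*B' + B*(2*\<Lambda>')"
 have odd: "abs (G t - G (- t)) <= K*t" if t: "0 < t" "t < 1" for t
 proof -
  have "abs (t^d - (- t)^d) <= abs (t^d) + abs ((- t)^d)" by (rule abs_triangle_ineq4)
  moreover have "t^d <= t^1" using t d by (intro power_decreasing) auto
  ultimately have td: "abs ((x - t^d) - (x - (- t)^d)) <= 2*t" using t by (simp add: power_abs abs_minus_commute)
  have "G t - G (- t) = (ph (x - t) - ph (x - - t))*\<psi> (x - t^d) + ph (x - - t)*(\<psi> (x - t^d) - \<psi> (x - (- t)^d))"
   by (simp add: G_def algebra_simps)
  then have "abs (G t - G (- t)) <= abs (ph (x - t) - ph (x - - t))*abs (\<psi> (x - t^d)) + abs (ph (x - - t))*abs (\<psi> (x - t^d) - \<psi> (x - (- t)^d))"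
   by (metis abs_mult abs_triangle_ineq)
  also have "... <= (\<Lambda>*(2*t))*B' + B*(\<Lambda>'*(2*t))"
  proof (intro add_mono mult_mono n n')
   have "abs (ph (x - t) - ph (x - - t)) <= \<Lambda>*abs ((x - t) - (x - - t))" using ph unfolding nice_def by blast
   then show "abs (ph (x - t) - ph (x - - t)) <= \<Lambda>*(2*t)" using t by simp
   have "abs (\<psi> (x - t^d) - \<psi> (x - (- t)^d)) <= \<Lambda>'*abs ((x - t^d) - (x - (- t)^d))" using \<psi> unfolding nice_def by blast
   also have "... <= \<Lambda>'*(2*t)" by (rule mult_left_mono[OF td n'(1)])
   finally show "abs (\<psi> (x - t^d) - \<psi> (x - (- t)^d)) <= \<Lambda>'*(2*t)" .
  qed (use n(1) t in auto)
  finally show ?thesis by (simp add: K_def algebra_simps)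
 qed
 have K0: "0 <= K" using n(1,2) n'(1,2) by (simp add: K_def)
 have Gm [measurable]: "G \<in> borel_measurable borel"
 proof -
  note [measurable] = n(4) n'(4)
  show ?thesis unfolding G_def[abs_def] by measurable
 qed
 define k where "k A t = indicat_real A t*((G t - G (- t))/t)" for A t
 have kb: "bcs (k A)" "abs (k A t) <= K*indicator A t" if A: "A \<in> sets borel" "A \<subseteq> {0<..<1}" for A t
 proof -
  have "abs ((G t - G (- t))/t) <= K" if "t \<in> A" for t using odd[of t] that A by (auto simp: field_simps)
  then show *: "abs (k A t) <= K*indicator A t" for t by (simp add: k_def indicator_def)
  have "k A \<in> borel_measurable borel" unfolding k_def[abs_def] using A(1) by measurable
  moreover have "abs (k A t) <= K" for t using *[of t] K0 by (cases "t \<in> A") auto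
  moreover have "norm t <= 1" if "k A t ~= 0" for t using that A(2) by (auto simp: k_def indicator_def split: if_splits)
  ultimately show "bcs (k A)" by (rule bcsI)
 qed
 define h where "h = Ht d ph \<psi> x 1 + (LBINT t. k {0<..<1} t)"
 have near: "abs (Ht d ph \<psi> x ep - h) <= K*ep" if ep: "0 < ep" "ep < 1" for ep
 proof -
  define A where "A = {ep..<1}"
  have Gb: "abs (G t) <= B*B'" for t unfolding G_def abs_mult using n n' by (intro mult_mono) auto
  have half: "bcs (%t. indicat_real A t*(G (c*t)/(c*t)))" if "abs c = 1" for c
  proof (rule bcsI[where M = "B*B'/ep" and R = 1])
   have [measurable]: "A \<in> sets borel" by (simp add: A_def)
   show "(%t. indicat_real A t*(G (c*t)/(c*t))) \<in> borel_measurable borel" by measurable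
   fix t
   have "abs (G (c*t)/(c*t)) <= B*B'/ep" if "t \<in> A"
    unfolding abs_divide using Gb that ep \<open>\<bar>c\<bar> = 1\<close> n(2) n'(2) by (intro frac_le) (auto simp: A_def abs_mult)
   then show "abs (indicat_real A t*(G (c*t)/(c*t))) <= B*B'/ep" using n(2) n'(2) ep by (auto simp: indicator_def)
   show "norm t <= 1" if "indicat_real A t*(G (c*t)/(c*t)) ~= 0" using that ep by (auto simp: A_def indicator_def split: if_splits)
  qed
  have h1: "integrable lborel (%t. indicat_real A t*(G t/t))" using bcs_integrable[OF half[of 1]] by simp
  have h2: "integrable lborel (%t. indicat_real A t*(G (- t)/(- t)))" using bcs_integrable[OF half[of "-1"]] by simp
  have h3: "integrable lborel (%t. indicat_real A (- t)*(G t/t))" using lborel_integrable_real_affine[OF h2, of "-1" 0] by simp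
  have "Ht d ph \<psi> x ep = (LBINT t. indicat_real {t. 1 <= abs t} t*(G t/t) + (indicat_real A t*(G t/t) + indicat_real A (- t)*(G t/t)))"
   unfolding Ht_def G_def using ep by (intro Bochner_Integration.integral_cong) (auto simp: A_def indicator_def)
  also have "... = Ht d ph \<psi> x 1 + ((LBINT t. indicat_real A t*(G t/t)) + (LBINT t. indicat_real A (- t)*(G t/t)))"
   using h1 h3 Ht_int[OF ph \<psi> zero_less_one, of x d] unfolding Ht_def G_def by simp
  also have "(LBINT t. indicat_real A (- t)*(G t/t)) = (LBINT t. indicat_real A t*(G (- t)/(- t)))"
   using integral_reflect[of "%t. indicat_real A (- t)*(G t/t)"] by simp
  also have "(LBINT t. indicat_real A t*(G t/t)) + (LBINT t. indicat_real A t*(G (- t)/(- t))) = (LBINT t. k A t)"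
   by (rule trans[OF Bochner_Integration.integral_add[symmetric, OF h1 h2] Bochner_Integration.integral_cong[OF refl]])
    (simp add: k_def diff_divide_distrib right_diff_distrib)
  finally have e: "Ht d ph \<psi> x ep = Ht d ph \<psi> x 1 + (LBINT t. k A t)" .
  have "(LBINT t. k {0<..<1} t) = (LBINT t. k A t + k {0<..<ep} t)"
   using ep by (intro Bochner_Integration.integral_cong) (auto simp: k_def A_def indicator_def)
  also have "... = (LBINT t. k A t) + (LBINT t. k {0<..<ep} t)"
   using ep by (intro Bochner_Integration.integral_add bcs_integrable kb) (auto simp: A_def)
  finally have "abs (Ht d ph \<psi> x ep - h) = abs (LBINT t. k {0<..<ep} t)" by (simp add: e h_def)
  also have "... <= (LBINT t. abs (k {0<..<ep} t))" by (rule integral_abs_bound)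
  also have "... <= (LBINT t. K*indicat_real {0<..<ep} t)"
   using ep by (intro integral_mono bcs_integrable bcs_abs kb bcs_cmult bcs_indicator) auto
  also have "... = K*ep" using ep by simp
  finally show ?thesis .
 qed
 have ev: "eventually (%ep. norm (Ht d ph \<psi> x ep - h) <= K*ep) (at_right 0)"
  unfolding eventually_at_right_field by (rule exI[of _ 1]) (use near in auto)
 have "((%ep. K*ep) \<longlongrightarrow> K*0) (at_right 0)" by (intro tendsto_intros)
 then have "((%ep. Ht d ph \<psi> x ep - h) \<longlongrightarrow> 0) (at_right 0)" by (intro Lim_null_comparison[OF ev]) simp
 then show ?thesis using LIM_zero_cancel by blast
qed

text \<open>Dominated convergence for the difference between the dyadic truncation of the cut
  functions and the plain truncation of the original ones. For \<open>abs t < 1\<close>, where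
  \<open>1/t\<close> admits no integrable majorant, the two integrands coincide once
  \<open>m\<close> is large; for \<open>abs t >= 1\<close> a multiple of \<open>ph (x - t)\<close>
  dominates.\<close>

lemma Hr_cut_limit:
 assumes ph: "nice ph \<Lambda> B" and \<psi>: "nice \<psi> \<Lambda>' B'" and d: "d > 0" and lim: "(Ht d ph \<psi> x \<longlongrightarrow> h) (at_right 0)"
 shows "(%m. Hr d m (%x. ph x*cut m x) (%x. \<psi> x*cut m x) x) \<longlonglongrightarrow> h"
proof -
 note n = nice_facts[OF ph] and n' = nice_facts[OF \<psi>]
 define e where "e m = (1/2::real)^m" for m
 have e0: "0 < e m" "e m <= 1" for m by (auto simp: e_def power_le_one)
 have "filterlim e (at_right 0) sequentially"
 proof -
  have "e \<longlonglongrightarrow> 0" unfolding e_def[abs_def] by (rule LIMSEQ_realpow_zero) auto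
  then show ?thesis unfolding filterlim_at using e0(1) by (auto simp: less_imp_neq[symmetric])
 qed
 from filterlim_compose[OF lim this] have L1: "(%m. Ht d ph \<psi> x (e m)) \<longlonglongrightarrow> h" .
 define a where "a m t = indicat_real {t. e m <= abs t & abs t < 2^m} t*((ph (x - t)*cut m (x - t))*(\<psi> (x - t^d)*cut m (x - t^d))/t)" for m t
 define b where "b m t = indicat_real {t. e m <= abs t} t*(ph (x - t)*\<psi> (x - t^d)/t)" for m t
 have ai: "integrable lborel (a m)" for m unfolding a_def[abs_def] by (intro bcs_integrable annulus_bcs nice_cut(1)[OF ph] nice_cut(1)[OF \<psi>] e0)
 have bi: "integrable lborel (b m)" for m unfolding b_def[abs_def] by (intro Ht_int[OF ph \<psi>] e0)
 \<comment> \<open>Beyond this index both cutoffs equal 1 for all \<open>abs t < 1\<close>; shifting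
   the sequence by \<open>N\<close> makes the majorant valid for every term.\<close>
 define N where "N = nat \<lceil>(abs x) + 1\<rceil>"
 have eq0: "a m t - b m t = 0" if "abs t < 2^m" "abs (x - t) <= real m" "abs (x - t^d) <= real m" for m t
  using that by (auto simp: a_def b_def cut_facts(3) indicator_def)
 have "(%m. LBINT t. a (m + N) t - b (m + N) t) \<longlonglongrightarrow> (LBINT t::real. 0)"
 proof (rule integral_dominated_convergence[where w = "%t. (2*B')*abs (ph (x + -1*t))"])
  show "integrable lborel (%t. (2*B')*abs (ph (x + -1*t)))"
   by (intro integrable_mult_right Bochner_Integration.integrable_abs lborel_integrable_real_affine n) simp
  show "(%t. a (m + N) t - b (m + N) t) \<in> borel_measurable lborel" for m using ai bi by auto
  show "AE t in lborel. (%m. a (m + N) t - b (m + N) t) \<longlonglongrightarrow> 0"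
  proof (rule AE_I2)
   fix t
   obtain M :: nat where M: "abs t + abs (x - t) + abs (x - t^d) <= real M" using real_arch_simple by blast
   have "a (m + N) t - b (m + N) t = 0" if m: "m >= M" for m
   proof (rule eq0)
    have "abs t <= real (m + N)" using M m by linarith
    also have "... < 2^(m + N)" by (rule of_nat_less_two_power)
    finally show "abs t < 2^(m + N)" .
   qed (use M m in linarith)+
   then show "(%m. a (m + N) t - b (m + N) t) \<longlonglongrightarrow> 0" by (intro tendsto_eventually) (auto simp: eventually_sequentially)
  qed
  fix m
  show "AE t in lborel. norm (a (m + N) t - b (m + N) t) <= (2*B')*abs (ph (x + -1*t))"
  proof (rule AE_I2)
   fix t :: real
   show "norm (a (m + N) t - b (m + N) t) <= (2*B')*abs (ph (x + -1*t))"
   proof (cases "abs t < 1")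
    case True
    have N: "abs x + 1 <= real (m + N)" unfolding N_def by linarith
    have td: "abs (t^d) <= 1" using True by (simp add: power_abs power_le_one)
    have "a (m + N) t - b (m + N) t = 0"
    proof (rule eq0)
     have "abs t < 1" by fact
     also have "(1::real) <= 2^(m + N)" by simp
     finally show "abs t < 2^(m + N)" .
     show "abs (x - t) <= real (m + N)" using abs_triangle_ineq4[of x t] True N by linarith
     show "abs (x - t^d) <= real (m + N)" using abs_triangle_ineq4[of x "t^d"] td N by linarith
    qed
    then show ?thesis using n'(2) by simp
   next
    case False
    define p where "p = ph (x - t)"
    have one: "abs (u * v/t) <= abs p*B'" if "abs u <= abs p" "abs v <= B'" for u v
    proof -
     have "abs (u * v)/abs t <= (abs p*B')/1" unfolding abs_mult using False that by (intro frac_le mult_mono) auto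
     then show ?thesis by (simp add: abs_divide)
    qed
    have "abs (b (m + N) t) <= abs p*B'" unfolding b_def p_def[symmetric] using one[of p "\<psi> (x - t^d)"] n'(2,3) by (auto simp: indicator_def)
    moreover have "abs (a (m + N) t) <= abs p*B'"
     unfolding a_def using one[of "ph (x - t)*cut (m + N) (x - t)" "\<psi> (x - t^d)*cut (m + N) (x - t^d)"] nice_cut(4)[OF ph, of "x - t" "m + N"]
      order_trans[OF nice_cut(4)[OF \<psi>, of "x - t^d" "m + N"] n'(3)] n'(2) by (auto simp: indicator_def p_def)
    ultimately show ?thesis using abs_triangle_ineq4[of "a (m + N) t" "b (m + N) t"] by (simp add: p_def mult_ac)
   qed
  qed
 qed simp
 then have "(%m. LBINT t. a m t - b m t) \<longlonglongrightarrow> 0" using LIMSEQ_offset[of "%m. LBINT t. a m t - b m t" N] by simp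
 then have "(%m. (LBINT t. a m t) - (LBINT t. b m t)) \<longlonglongrightarrow> 0" by (simp add: ai bi)
 from tendsto_add[OF this L1] have "(%m. LBINT t. a m t) \<longlonglongrightarrow> h" by (simp add: Ht_def b_def)
 moreover have "Hr d m (%x. ph x*cut m x) (%x. \<psi> x*cut m x) x = (LBINT t. a m t)" for m
  unfolding a_def e_def by (rule Hr_integral[OF d nice_cut(1)[OF ph] nice_cut(1)[OF \<psi>]])
 ultimately show ?thesis by simp
qed

text \<open>Fatou's lemma also supplies integrability of the limit, so the principal value lies in
  L1 without a separate decay estimate.\<close>

lemma fatou_L1:
 fixes F :: "nat => real => real"
 assumes lim: "\<And>x. (%m. F m x) \<longlonglongrightarrow> h x" and int: "\<And>m. integrable lborel (F m)" and bd: "\<And>m. (LBINT x. abs (F m x)) <= X"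
 shows "integrable lborel h" "(LBINT x. abs (h x)) <= X"
proof -
 have "0 <= (LBINT x. abs (F 0 x))" by (rule integral_nonneg_AE) simp
 then have X0: "0 <= X" using bd[of 0] by linarith
 have [measurable]: "F m \<in> borel_measurable borel" for m using int[of m] by auto
 have [measurable]: "h \<in> borel_measurable borel" by (rule borel_measurable_LIMSEQ_real[OF lim]) simp
 have "(\<integral>\<^sup>+x. ennreal (abs (h x)) \<partial>lborel) = (\<integral>\<^sup>+x. liminf (%m. ennreal (abs (F m x))) \<partial>lborel)"
 proof (rule nn_integral_cong)
  fix x
  have "(%m. ennreal (abs (F m x))) \<longlonglongrightarrow> ennreal (abs (h x))" by (intro tendsto_ennrealI tendsto_rabs lim)
  then show "ennreal (abs (h x)) = liminf (%m. ennreal (abs (F m x)))" by (rule lim_imp_Liminf[symmetric, rotated]) simp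
 qed
 also have "... <= liminf (%m. \<integral>\<^sup>+x. ennreal (abs (F m x)) \<partial>lborel)" by (rule nn_integral_liminf) simp
 also have "... <= liminf (%m::nat. ennreal X)"
 proof (intro Liminf_mono always_eventually allI)
  fix m
  have "(\<integral>\<^sup>+x. ennreal (abs (F m x)) \<partial>lborel) = ennreal (LBINT x. abs (F m x))" using int[of m] by (intro nn_integral_eq_integral) auto
  then show "(\<integral>\<^sup>+x. ennreal (abs (F m x)) \<partial>lborel) <= ennreal X" using bd[of m] by (simp add: ennreal_leI)
 qed
 also have "... = ennreal X" by (simp add: Liminf_const)
 finally have le: "(\<integral>\<^sup>+x. ennreal (abs (h x)) \<partial>lborel) <= ennreal X" .
 show i: "integrable lborel h" by (rule integrableI_bounded) (use le in \<open>auto intro: order_le_less_trans\<close>)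
 have "(\<integral>\<^sup>+x. ennreal (abs (h x)) \<partial>lborel) = ennreal (LBINT x. abs (h x))" using i by (intro nn_integral_eq_integral) auto
 then show "(LBINT x. abs (h x)) <= X" using le X0 by (simp add: ennreal_le_iff)
qed

theorem Ht_bounded:
 assumes d: "d >= 2"
 shows "\<exists>C>0. \<forall>ph \<psi> \<Lambda> B \<Lambda>' B'. nice ph \<Lambda> B --> nice \<psi> \<Lambda>' B' -->
  (\<exists>h. (\<forall>x. (Ht d ph \<psi> x \<longlongrightarrow> h x) (at_right 0)) & integrable lborel h & (LBINT x. abs (h x)) <= C*N2 ph*N2 \<psi>)"
proof -
 obtain C where C: "C > 0" "\<And>m f g. bcs f ==> bcs g ==> (\<exists>\<Lambda>. \<forall>x y. abs (f x - f y) <= \<Lambda>*abs (x - y)) ==> (\<exists>\<Lambda>. \<forall>x y. abs (g x - g y) <= \<Lambda>*abs (x - y)) ==>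
  (LBINT x. abs (Hr d m f g x)) <= C*N2 f*N2 g" using Hr_lipschitz[OF d] by blast
 have d0: "d > 0" using d by simp
 have "\<exists>h. (\<forall>x. (Ht d ph \<psi> x \<longlongrightarrow> h x) (at_right 0)) & integrable lborel h & (LBINT x. abs (h x)) <= C*N2 ph*N2 \<psi>"
  if ph: "nice ph \<Lambda> B" and \<psi>: "nice \<psi> \<Lambda>' B'" for ph \<psi> \<Lambda> B \<Lambda>' B'
 proof -
  obtain h where h: "\<And>x. (Ht d ph \<psi> x \<longlongrightarrow> h x) (at_right 0)" using Ht_limit[OF ph \<psi> d0] by metis
  note c = nice_cut[OF ph] and c' = nice_cut[OF \<psi>]
  define F where "F m = Hr d m (%x. ph x*cut m x) (%x. \<psi> x*cut m x)" for m
  have lim: "(%m. F m x) \<longlonglongrightarrow> h x" for x unfolding F_def by (rule Hr_cut_limit[OF ph \<psi> d0 h])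
  have int: "integrable lborel (F m)" for m unfolding F_def by (intro bcs_integrable Hr_bcs d0 c c')
  have bd: "(LBINT x. abs (F m x)) <= C*N2 ph*N2 \<psi>" for m
  proof -
   have "(LBINT x. abs (F m x)) <= C*N2 (%x. ph x*cut m x)*N2 (%x. \<psi> x*cut m x)" unfolding F_def by (intro C(2) c c')
   also have "... <= C*N2 ph*N2 \<psi>" using C(1) by (intro mult_mono c c') auto
   finally show ?thesis .
  qed
  show ?thesis using h fatou_L1[OF lim int bd] by blast
 qed
 then show ?thesis using C(1) by blast
qed

section \<open>Real and imaginary parts, and the theorem\<close>

text \<open>Boundedness of the first derivative gives the Lipschitz constant; boundedness of
  \<open>f\<close> and of \<open>x\<^sup>2\<close> times \<open>f\<close> together give the decay.
  One pair of constants serves both parts.\<close>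

lemma schwartz_nice:
 assumes "schwartz f"
 obtains \<Lambda> B where "nice (%x. Re (f x)) \<Lambda> B" "nice (%x. Im (f x)) \<Lambda> B"
proof -
 have diff: "f differentiable (at x)" for x using assms[unfolded schwartz_def, THEN conjunct1, rule_format, of 0 x] by simp
 have bd: "\<exists>c. \<forall>x. cmod (complex_of_real (x^m)*(dR ^^ k) f x) <= c" for k m
  using assms[unfolded schwartz_def, THEN conjunct2, rule_format, of m k] by (auto simp: bounded_iff)
 obtain b0 where b0: "\<And>x. cmod (f x) <= b0" using bd[of 0 0] by auto
 obtain b2 where b2: "\<And>x. x\<^sup>2*cmod (f x) <= b2" using bd[of 2 0] by (auto simp: norm_mult norm_power)
 obtain \<Lambda> where \<Lambda>: "\<And>x. cmod (vector_derivative f (at x)) <= \<Lambda>" using bd[of 0 1] by (auto simp: dR_def)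
 have "cmod (f x - f y) <= \<Lambda>*norm (x - y)" for x y
 proof (rule differentiable_bound[of UNIV f "%x t. t *\<^sub>R vector_derivative f (at x)"])
  show "(f has_derivative (%t. t *\<^sub>R vector_derivative f (at z))) (at z within UNIV)" for z
   using diff[of z] unfolding vector_derivative_works has_vector_derivative_def by simp
  show "onorm (%t. t *\<^sub>R vector_derivative f (at z)) <= \<Lambda>" for z
   by (rule onorm_bound) (use \<Lambda>[of z] order_trans[OF norm_ge_zero \<Lambda>] in \<open>auto simp: mult.commute[of \<Lambda>] intro: mult_left_mono\<close>)
 qed auto
 then have lip: "abs (Re (f x) - Re (f y)) <= \<Lambda>*abs (x - y)" "abs (Im (f x) - Im (f y)) <= \<Lambda>*abs (x - y)" for x y
  using abs_Re_le_cmod[of "f x - f y"] abs_Im_le_cmod[of "f x - f y"] by (auto intro: order_trans)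
 have "cmod (f x) <= (b0 + b2)/(1 + x\<^sup>2)" for x
  using b0[of x] b2[of x] by (simp add: pos_le_divide_eq add_pos_nonneg algebra_simps)
 then have dec: "abs (Re (f x)) <= (b0 + b2)/(1 + x\<^sup>2)" "abs (Im (f x)) <= (b0 + b2)/(1 + x\<^sup>2)" for x
  using abs_Re_le_cmod[of "f x"] abs_Im_le_cmod[of "f x"] order_trans by blast+
 show ?thesis by (rule that[of \<Lambda> "b0 + b2"]) (use lip dec in \<open>auto simp: nice_def\<close>)
qed

lemma N2_le_L2norm:
 assumes "nice (%x. Re (f x)) \<Lambda> B" "nice (%x. Im (f x)) \<Lambda> B"
 shows "N2 (%x. Re (f x)) <= L2norm f" "N2 (%x. Im (f x)) <= L2norm f"
 unfolding N2_def L2norm_def cmod_power2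
 by (intro real_sqrt_le_mono integral_mono Bochner_Integration.integrable_add nice_facts(6)[OF assms(1)] nice_facts(6)[OF assms(2)]; simp)+

lemma H_trunc_Ht:
 assumes f: "nice (%x. Re (f x)) \<Lambda> B" "nice (%x. Im (f x)) \<Lambda> B" and g: "nice (%x. Re (g x)) \<Lambda>' B'" "nice (%x. Im (g x)) \<Lambda>' B'" and ep: "ep > 0"
 shows "H_trunc d f g x ep = Complex (Ht d (%x. Re (f x)) (%x. Re (g x)) x ep - Ht d (%x. Im (f x)) (%x. Im (g x)) x ep)
  (Ht d (%x. Re (f x)) (%x. Im (g x)) x ep + Ht d (%x. Im (f x)) (%x. Re (g x)) x ep)"
proof -
 define a where "a u v t = indicat_real {t. ep <= abs t} t*(u (f (x - t)) * v (g (x - t^d))/t)" for u v t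
 have i: "integrable lborel (a Re Re)" "integrable lborel (a Im Im)" "integrable lborel (a Re Im)" "integrable lborel (a Im Re)"
  unfolding a_def[abs_def] by (rule Ht_int[OF f(1) g(1) ep] Ht_int[OF f(2) g(2) ep] Ht_int[OF f(1) g(2) ep] Ht_int[OF f(2) g(1) ep])+
 have "H_trunc d f g x ep = (LBINT t. complex_of_real (a Re Re t - a Im Im t) + \<i>*complex_of_real (a Re Im t + a Im Re t))"
  unfolding H_trunc_def set_lebesgue_integral_def
  by (intro Bochner_Integration.integral_cong refl) (auto simp: a_def indicator_def complex_eq_iff Re_divide_of_real Im_divide_of_real diff_divide_distrib add_divide_distrib)
 also have "... = complex_of_real (LBINT t. a Re Re t - a Im Im t) + \<i>*complex_of_real (LBINT t. a Re Im t + a Im Re t)"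
  using i by (simp del: of_real_add of_real_diff)
 also have "... = Complex ((LBINT t. a Re Re t) - (LBINT t. a Im Im t)) ((LBINT t. a Re Im t) + (LBINT t. a Im Re t))"
  using i by (simp add: complex_eq_iff)
 finally show ?thesis by (simp add: Ht_def a_def)
qed

theorem theorem1:
  fixes d :: nat
  assumes "d \<ge> 2"
  shows "\<exists>C::real. \<forall>f g. schwartz f \<longrightarrow> schwartz g \<longrightarrow>
           (\<forall>x. (H_trunc d f g x \<longlongrightarrow> H_Gamma d f g x) (at_right 0)) \<and>
           integrable lborel (H_Gamma d f g) \<and>
           L1norm (H_Gamma d f g) \<le> C * L2norm f * L2norm g"
proof -
 obtain C where C: "C > 0" and bd: "\<And>ph \<psi> \<Lambda> B \<Lambda>' B'. nice ph \<Lambda> B ==> nice \<psi> \<Lambda>' B' ==>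
  (\<exists>h. (\<forall>x. (Ht d ph \<psi> x \<longlongrightarrow> h x) (at_right 0)) & integrable lborel h & (LBINT x. abs (h x)) <= C*N2 ph*N2 \<psi>)"
  using Ht_bounded[OF assms] by blast
 \<comment> \<open>The factor 4 counts the four real bilinear pieces into which the complex integral
   splits.\<close>
 have "(\<forall>x. (H_trunc d f g x \<longlongrightarrow> H_Gamma d f g x) (at_right 0)) & integrable lborel (H_Gamma d f g) & L1norm (H_Gamma d f g) <= (4*C)*L2norm f*L2norm g"
  if sf: "schwartz f" and sg: "schwartz g" for f g
 proof -
  obtain \<Lambda> B where f: "nice (%x. Re (f x)) \<Lambda> B" "nice (%x. Im (f x)) \<Lambda> B" using schwartz_nice[OF sf] .
  obtain \<Lambda>' B' where g: "nice (%x. Re (g x)) \<Lambda>' B'" "nice (%x. Im (g x)) \<Lambda>' B'" using schwartz_nice[OF sg] .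
  note Nf = N2_le_L2norm[OF f] and Ng = N2_le_L2norm[OF g]
  have part: "\<exists>h. (\<forall>x. (Ht d ph \<psi> x \<longlongrightarrow> h x) (at_right 0)) & integrable lborel h & (LBINT x. abs (h x)) <= C*L2norm f*L2norm g"
   if p: "nice ph \<Lambda> B" "nice \<psi> \<Lambda>' B'" "N2 ph <= L2norm f" "N2 \<psi> <= L2norm g" for ph \<psi>
  proof -
   have "C*N2 ph*N2 \<psi> <= C*L2norm f*L2norm g" using C p N2_nonneg_le[OF p(3)] by (intro mult_mono) auto
   then show ?thesis using bd[OF p(1,2)] by (meson order_trans)
  qed
  obtain h1 where h1: "\<And>x. (Ht d (%x. Re (f x)) (%x. Re (g x)) x \<longlongrightarrow> h1 x) (at_right 0)" "integrable lborel h1" "(LBINT x. abs (h1 x)) <= C*L2norm f*L2norm g"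
   using part[OF f(1) g(1) Nf(1) Ng(1)] by blast
  obtain h2 where h2: "\<And>x. (Ht d (%x. Im (f x)) (%x. Im (g x)) x \<longlongrightarrow> h2 x) (at_right 0)" "integrable lborel h2" "(LBINT x. abs (h2 x)) <= C*L2norm f*L2norm g"
   using part[OF f(2) g(2) Nf(2) Ng(2)] by blast
  obtain h3 where h3: "\<And>x. (Ht d (%x. Re (f x)) (%x. Im (g x)) x \<longlongrightarrow> h3 x) (at_right 0)" "integrable lborel h3" "(LBINT x. abs (h3 x)) <= C*L2norm f*L2norm g"
   using part[OF f(1) g(2) Nf(1) Ng(2)] by blast
  obtain h4 where h4: "\<And>x. (Ht d (%x. Im (f x)) (%x. Re (g x)) x \<longlongrightarrow> h4 x) (at_right 0)" "integrable lborel h4" "(LBINT x. abs (h4 x)) <= C*L2norm f*L2norm g"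
   using part[OF f(2) g(1) Nf(2) Ng(1)] by blast
  define h where "h x = Complex (h1 x - h2 x) (h3 x + h4 x)" for x
  have lim: "(H_trunc d f g x \<longlongrightarrow> h x) (at_right 0)" for x
  proof (rule Lim_transform_eventually)
   show "((%ep. Complex (Ht d (%x. Re (f x)) (%x. Re (g x)) x ep - Ht d (%x. Im (f x)) (%x. Im (g x)) x ep)
    (Ht d (%x. Re (f x)) (%x. Im (g x)) x ep + Ht d (%x. Im (f x)) (%x. Re (g x)) x ep)) \<longlongrightarrow> h x) (at_right 0)"
    unfolding h_def by (intro tendsto_Complex tendsto_diff tendsto_add h1 h2 h3 h4)
  qed (use eventually_at_right_less[of "0::real"] in eventually_elim, simp add: H_trunc_Ht[OF f g])
  have H: "H_Gamma d f g = h"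
  proof
   show "H_Gamma d f g x = h x" for x unfolding H_Gamma_def by (rule tendsto_Lim[OF _ lim]) simp
  qed
  have hc: "h = (%x. complex_of_real (h1 x - h2 x) + \<i>*complex_of_real (h3 x + h4 x))" by (auto simp: h_def complex_eq_iff)
  have hi: "integrable lborel h" unfolding hc
   by (intro Bochner_Integration.integrable_add integrable_mult_right integrable_of_real Bochner_Integration.integrable_diff h1 h2 h3 h4)
  have "L1norm h <= (LBINT x. (abs (h1 x) + abs (h2 x)) + (abs (h3 x) + abs (h4 x)))" unfolding L1norm_def
  proof (rule integral_mono)
   show "cmod (h x) <= (abs (h1 x) + abs (h2 x)) + (abs (h3 x) + abs (h4 x))" for x
    using cmod_le[of "h x"] abs_triangle_ineq4[of "h1 x" "h2 x"] abs_triangle_ineq[of "h3 x" "h4 x"] by (simp add: h_def)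
  qed (use hi h1 h2 h3 h4 in auto)
  also have "... = (LBINT x. abs (h1 x)) + (LBINT x. abs (h2 x)) + ((LBINT x. abs (h3 x)) + (LBINT x. abs (h4 x)))" using h1 h2 h3 h4 by simp
  also have "... <= (4*C)*L2norm f*L2norm g" using h1(3) h2(3) h3(3) h4(3) by simp
  finally show ?thesis using lim hi by (simp add: H)
 qed
 then show ?thesis by blast
qed

end
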